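(* For $\beta=(\beta(n))_{n\in\mathbb{N}}$ in the Baire space $\mathscr{N}$ let $\mathsf{uhf}(\beta)$ be the associated UHF algebra, $\rho_\beta$ its unique faithful tracial state, $\gamma_\beta=(\gamma_\beta(n))_{n\in\mathbb{N}}$ the sequence $\gamma_\beta(n)=1/\dim(M_{\boxtimes\beta(n)}(\mathbb{C}))$, and $L^{\rho_\beta}_{\gamma_\beta}$ the associated Christensen--Ivan $L$-seminorm on $\mathsf{uhf}(\beta)$ (all defined in the context). Then the map $$\beta\in\mathscr{N}\longmapsto(\mathsf{uhf}(\beta),L^{\rho_\beta}_{\gamma_\beta})$$ is continuous from the metric space $(\mathscr{N},d_{\mathscr{N}})$ to the class of Leibniz compact quantum metric spaces with the quantum Gromov--Hausdorff propinquity $\mathsf{\Lambda}$; that is, if $(\beta^k)_{k\in\mathbb{N}}$ is a sequence in $\mathscr{N}$ converging to $\beta\in\mathscr{N}$ for $d_{\mathscr{N}}$, then $$\lim_{k\to\infty}\mathsf{\Lambda}\big((\mathsf{uhf}(\beta^k),L^{\rho_{\beta^k}}_{\gamma_{\beta^k}}),(\mathsf{uhf}(\beta),L^{\rho_\beta}_{\gamma_\beta})\big)=0.$$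
   Context: $\mathbb{N}=\{0,1,2,\dots\}$; $M_d(\mathbb{C})$ is the algebra of complex $d\times d$ matrices. **Leibniz compact quantum metric space.** A pair $(\mathcal{A},L)$, with $\mathcal{A}$ a unital C*-algebra and $L:\mathcal{A}\to[0,\infty]$ a seminorm (possibly taking the value $\infty$) such that $\mathrm{dom}(L)=\{a:L(a)<\infty\}$ is a dense *-subalgebra, $L(a)=L(a^* )$, $\{a:L(a)=0\}=\mathbb{C}1_\mathcal{A}$, $L(ab)\le\|a\|L(b)+\|b\|L(a)$, and such that the metric $mk_L(\phi,\psi)=\sup\{|\phi(a)-\psi(a)|:a\in\mathcal{A},L(a)\le1\}$ on the state space $S(\mathcal{A})$ metrizes the weak* topology. Then $L$ is called an $L$-seminorm. **Quantum Gromov--Hausdorff propinquity (Latrémolière).** It is defined on the class of pairs $(\mathcal{A},L)$ where $L$ is a lower semicontinuous seminorm on the self-adjoint part $\mathfrak{sa}(\mathcal{A})$ with values in $[0,\infty]$, finite on a dense subspace, with $L(a)=0$ iff $a\in\mathbb{R}1_\mathcal{A}$, with $mk_L$ (computed with self-adjoint elements) metrizing the weak* topology of $S(\mathcal{A})$, and with $L(\frac{ab+ba}{2})$ and $L(\frac{ab-ba}{2i})$ both at most $\|a\|L(b)+\|b\|L(a)$; an $L$-seminorm on $\mathcal{A}$ is regarded as such by restriction to $\mathfrak{sa}(\mathcal{A})$. A bridge from $\mathcal{A}$ to $\mathcal{B}$ is $\gamma=(\mathcal{D},\omega,\pi_\mathcal{A},\pi_\mathcal{B})$, where $\mathcal{D}$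 is a unital C*-algebra, $\pi_\mathcal{A}:\mathcal{A}\to\mathcal{D}$ and $\pi_\mathcal{B}:\mathcal{B}\to\mathcal{D}$ are unital *-monomorphisms, and $\omega\in\mathcal{D}$ is such that $S_1(\omega)=\{\phi\in S(\mathcal{D}):\phi((1-\omega)^*(1-\omega))=\phi((1-\omega)(1-\omega)^* )=0\}$ is nonempty. Given $(\mathcal{A},L_\mathcal{A})$ and $(\mathcal{B},L_\mathcal{B})$ in the class: - the reach of $\gamma$ is the Hausdorff distance in $(\mathcal{D},\|\cdot\|_\mathcal{D})$ between $\{\pi_\mathcal{A}(a)\omega:a\in\mathfrak{sa}(\mathcal{A}),L_\mathcal{A}(a)\le1\}$ and $\{\omega\pi_\mathcal{B}(b):b\in\mathfrak{sa}(\mathcal{B}),L_\mathcal{B}(b)\le1\}$; - the height of $\gamma$ is the maximum of the Hausdorff distance for $mk_{L_\mathcal{A}}$ between $S(\mathcal{A})$ and $\{\phi\circ\pi_\mathcal{A}:\phi\in S_1(\omega)\}$ and of the Hausdorff distance for $mk_{L_\mathcal{B}}$ between $S(\mathcal{B})$ and $\{\phi\circ\pi_\mathcal{B}:\phi\in S_1(\omega)\}$; - the length of $\gamma$ is the maximum of its reach and height. A trek from $(\mathcal{A},L_\mathcal{A})$ to $(\mathcal{B},L_\mathcal{B})$ is a finite chain of pairs in the class starting at $(\mathcal{A},L_\mathcal{A})$ and ending at $(\mathcal{B},L_\mathcal{B})$, with a bridge between each pair of consecutive terms; its length is the sum of the lengths of its bridges. $\mathsf{\Lambda}((\mathcal{A},L_\mathcal{A}),(\mathcal{B},L_\mathcal{B}))$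 is the infimum of the lengths of all treks from $(\mathcal{A},L_\mathcal{A})$ to $(\mathcal{B},L_\mathcal{B})$. **Christensen--Ivan $L$-seminorms.** Let $\mathcal{A}=\overline{\bigcup_{n\in\mathbb{N}}\mathcal{A}_n}$ be a unital AF algebra, with $(\mathcal{A}_n)$ an increasing sequence of finite-dimensional C*-subalgebras containing $1_\mathcal{A}$ and $\mathcal{A}_0=\mathbb{C}1_\mathcal{A}$, and let $\tau$ be a faithful tracial state on $\mathcal{A}$. Let $H_\tau$ be the GNS Hilbert space (completion of $\mathcal{A}$ for $\langle a,b\rangle_\tau=\tau(b^*a)$, norm $\|a\|_\tau=\sqrt{\tau(a^*a)}$), with $\mathcal{A}\subseteq H_\tau$, and let $\pi_\tau:\mathcal{A}\to B(H_\tau)$ be the GNS representation, $\pi_\tau(a)b=ab$. Let $P^\tau_n$ be the orthogonal projection of $H_\tau$ onto $\mathcal{A}_n$ and $Q^\tau_n=P^\tau_n-P^\tau_{n-1}$ for $n\ge1$. Let $c^\tau_n$ be the smallest constant with $\|a\|_\mathcal{A}\le c^\tau_n\|a\|_\tau$ for all $a\in\mathcal{A}_n$. For a summable sequence $\gamma=(\gamma(n))_{n\in\mathbb{N}}$ of positive reals, put $a^\tau_{\gamma,n}=c^\tau_n/\gamma(n)$ for $n\ge1$, and let $D^\tau_\gamma=\sum_{n\ge1}a^\tau_{\gamma,n}Q^\tau_n$, an unbounded self-adjoint operator on $H_\tau$ with domain $\{h:\sum_n(a^\tau_{\gamma,n})^2\|Q^\tau_nh\|_\tau^2<\infty\}$.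 For $a\in\mathcal{A}$ set $L^\tau_\gamma(a)=\|[D^\tau_\gamma,\pi_\tau(a)]\|_{B(H_\tau)}$ if $[D^\tau_\gamma,\pi_\tau(a)]$ extends to a bounded operator on $H_\tau$ (i.e. $\pi_\tau(a)$ maps $\mathrm{dom}(D^\tau_\gamma)$ into itself and the commutator is bounded there), and $L^\tau_\gamma(a)=\infty$ otherwise. By a theorem of Christensen and Ivan, $(\mathcal{A},L^\tau_\gamma)$ is a Leibniz compact quantum metric space. **Baire space.** $\mathscr{N}=(\mathbb{N}\setminus\{0\})^{\mathbb{N}}$ with the metric $d_{\mathscr{N}}(x,y)=0$ if $x=y$ and $d_{\mathscr{N}}(x,y)=2^{-\min\{n\in\mathbb{N}:x(n)\ne y(n)\}}$ otherwise. **UHF algebras.** For $\beta\in\mathscr{N}$ put $\boxtimes\beta(0)=1$ and $\boxtimes\beta(n)=\prod_{j=0}^{n-1}(\beta(j)+1)$ for $n\ge1$. Let $\mu_{\beta,n}:M_{\boxtimes\beta(n)}(\mathbb{C})\to M_{\boxtimes\beta(n+1)}(\mathbb{C})$, $a\mapsto\mathrm{diag}(a,\dots,a)$, with $\beta(n)+1$ copies of $a$. Then $\mathsf{uhf}(\beta)=\varinjlim(M_{\boxtimes\beta(n)}(\mathbb{C}),\mu_{\beta,n})$ is the C*-algebraic inductive limit, $\rho_\beta$ is its unique faithful tracial state, and $\gamma_\beta(n)=1/\dim(M_{\boxtimes\beta(n)}(\mathbb{C}))=(\boxtimes\beta(n))^{-2}$. $L^{\rho_\beta}_{\gamma_\beta}$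 is the Christensen--Ivan $L$-seminorm for $\mathcal{A}=\mathsf{uhf}(\beta)$, $\mathcal{A}_n$ the canonical image of $M_{\boxtimes\beta(n)}(\mathbb{C})$ in $\mathsf{uhf}(\beta)$, $\tau=\rho_\beta$, $\gamma=\gamma_\beta$. *)

theory Defs
  imports
    "HOL-Analysis.Analysis"
    "Jordan_Normal_Form.VS_Connect"
    "Jordan_Normal_Form.Schur_Decomposition"
begin

section \<open>Unital C*-algebras and their states\<close>

text \<open>
  The algebras below depend on elements of the Baire space, so they are carrier-based records
  over the complex numbers; addition, multiplication and scalar multiplication are those of the
  HOL-Algebra record of modules.
\<close>

record 'a cstar_algebra = "(complex, 'a) module" +
  star :: "'a \<Rightarrow> 'a"
  nrm :: "'a \<Rightarrow> real"

locale unital_cstar_algebra = ring A + Module.module "class_ring :: complex ring" A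
  for A :: "'a cstar_algebra" (structure) +
  assumes smult_mult_left: "\<lbrakk>x \<in> carrier A; y \<in> carrier A\<rbrakk> \<Longrightarrow>
      (c \<odot>\<^bsub>A\<^esub> x) \<otimes>\<^bsub>A\<^esub> y = c \<odot>\<^bsub>A\<^esub> (x \<otimes>\<^bsub>A\<^esub> y)"
    and smult_mult_right: "\<lbrakk>x \<in> carrier A; y \<in> carrier A\<rbrakk> \<Longrightarrow>
      x \<otimes>\<^bsub>A\<^esub> (c \<odot>\<^bsub>A\<^esub> y) = c \<odot>\<^bsub>A\<^esub> (x \<otimes>\<^bsub>A\<^esub> y)"
    and star_closed: "x \<in> carrier A \<Longrightarrow> star A x \<in> carrier A"
    and star_star: "x \<in> carrier A \<Longrightarrow> star A (star A x) = x"
    and star_add: "\<lbrakk>x \<in> carrier A; y \<in> carrier A\<rbrakk> \<Longrightarrow>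
      star A (x \<oplus>\<^bsub>A\<^esub> y) = star A x \<oplus>\<^bsub>A\<^esub> star A y"
    and star_smult: "x \<in> carrier A \<Longrightarrow> star A (c \<odot>\<^bsub>A\<^esub> x) = cnj c \<odot>\<^bsub>A\<^esub> star A x"
    and star_mult: "\<lbrakk>x \<in> carrier A; y \<in> carrier A\<rbrakk> \<Longrightarrow>
      star A (x \<otimes>\<^bsub>A\<^esub> y) = star A y \<otimes>\<^bsub>A\<^esub> star A x"
    and nrm_nonneg: "x \<in> carrier A \<Longrightarrow> 0 \<le> nrm A x"
    and nrm_eq_0: "x \<in> carrier A \<Longrightarrow> nrm A x = 0 \<longleftrightarrow> x = \<zero>\<^bsub>A\<^esub>"
    and nrm_triangle: "\<lbrakk>x \<in> carrier A; y \<in> carrier A\<rbrakk> \<Longrightarrow>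
      nrm A (x \<oplus>\<^bsub>A\<^esub> y) \<le> nrm A x + nrm A y"
    and nrm_smult: "x \<in> carrier A \<Longrightarrow> nrm A (c \<odot>\<^bsub>A\<^esub> x) = cmod c * nrm A x"
    and nrm_mult: "\<lbrakk>x \<in> carrier A; y \<in> carrier A\<rbrakk> \<Longrightarrow>
      nrm A (x \<otimes>\<^bsub>A\<^esub> y) \<le> nrm A x * nrm A y"
    and cstar_identity: "x \<in> carrier A \<Longrightarrow> nrm A (star A x \<otimes>\<^bsub>A\<^esub> x) = (nrm A x)\<^sup>2"
    and complete: "\<lbrakk>\<And>n. s n \<in> carrier A;
        \<And>e. e > 0 \<Longrightarrow> \<exists>N. \<forall>m\<ge>N. \<forall>n\<ge>N. nrm A (s m \<ominus>\<^bsub>A\<^esub> s n) < e\<rbrakk> \<Longrightarrow>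
      \<exists>l\<in>carrier A. (\<lambda>n. nrm A (s n \<ominus>\<^bsub>A\<^esub> l)) \<longlonglongrightarrow> 0"

definition sa :: "'a cstar_algebra \<Rightarrow> 'a set" where
  "sa A = {a \<in> carrier A. star A a = a}"

text \<open>
  Functionals are extensional (undefined outside the carrier), so that equality of states is
  equality on the algebra.
\<close>

definition states :: "'a cstar_algebra \<Rightarrow> ('a \<Rightarrow> complex) set" where
  "states A = {\<phi> \<in> extensional (carrier A).
     (\<forall>a\<in>carrier A. \<forall>b\<in>carrier A. \<phi> (a \<oplus>\<^bsub>A\<^esub> b) = \<phi> a + \<phi> b) \<and>
     (\<forall>c. \<forall>a\<in>carrier A. \<phi> (c \<odot>\<^bsub>A\<^esub> a) = c * \<phi> a) \<and>
     (\<forall>a\<in>carrier A. \<phi> (star A a \<otimes>\<^bsub>A\<^esub> a) \<in> \<real>\<^sub>\<ge>\<^sub>0) \<and>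
     \<phi> \<one>\<^bsub>A\<^esub> = 1}"

definition faithful_tracial_state :: "'a cstar_algebra \<Rightarrow> ('a \<Rightarrow> complex) \<Rightarrow> bool" where
  "faithful_tracial_state A \<tau> \<longleftrightarrow> \<tau> \<in> states A \<and>
     (\<forall>a\<in>carrier A. \<forall>b\<in>carrier A. \<tau> (a \<otimes>\<^bsub>A\<^esub> b) = \<tau> (b \<otimes>\<^bsub>A\<^esub> a)) \<and>
     (\<forall>a\<in>carrier A. \<tau> (star A a \<otimes>\<^bsub>A\<^esub> a) = 0 \<longrightarrow> a = \<zero>\<^bsub>A\<^esub>)"

definition weak_star_topology :: "'a cstar_algebra \<Rightarrow> ('a \<Rightarrow> complex) topology" where
  "weak_star_topology A =
     subtopology (product_topology (\<lambda>_. euclidean) (carrier A)) (states A)"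

definition unital_star_mono :: "'a cstar_algebra \<Rightarrow> 'a cstar_algebra \<Rightarrow> ('a \<Rightarrow> 'a) \<Rightarrow> bool" where
  "unital_star_mono A B \<pi> \<longleftrightarrow> \<pi> \<in> Ring.ring_hom A B \<and>
     (\<forall>c. \<forall>a\<in>carrier A. \<pi> (c \<odot>\<^bsub>A\<^esub> a) = c \<odot>\<^bsub>B\<^esub> \<pi> a) \<and>
     (\<forall>a\<in>carrier A. \<pi> (star A a) = star B (\<pi> a)) \<and>
     inj_on \<pi> (carrier A)"

section \<open>Compact quantum metric spaces\<close>

text \<open>
  Seminorms with values in \<open>[0,\<infinity>]\<close> are functions into \<^typ>\<open>ennreal\<close>, with the convention
  \<open>0 \<cdot> \<infinity> = 0\<close>.  In \<open>mk T\<close>, \<open>T\<close> is the Lipschitz ball, taken either in the whole algebra or in its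
  self-adjoint part.
\<close>

definition mk :: "'a set \<Rightarrow> ('a \<Rightarrow> complex) \<Rightarrow> ('a \<Rightarrow> complex) \<Rightarrow> ennreal" where
  "mk T \<phi> \<psi> = (SUP a\<in>T. ennreal (cmod (\<phi> a - \<psi> a)))"

definition metrizes_weak_star ::
    "'a cstar_algebra \<Rightarrow> (('a \<Rightarrow> complex) \<Rightarrow> ('a \<Rightarrow> complex) \<Rightarrow> ennreal) \<Rightarrow> bool" where
  "metrizes_weak_star A d \<longleftrightarrow>
     (\<forall>\<phi>\<in>states A. \<forall>\<psi>\<in>states A. d \<phi> \<psi> < \<infinity>) \<and>
     Metric_space (states A) (\<lambda>\<phi> \<psi>. enn2real (d \<phi> \<psi>)) \<and>
     Metric_space.mtopology (states A) (\<lambda>\<phi> \<psi>. enn2real (d \<phi> \<psi>)) = weak_star_topology A"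

definition seminorm_dom :: "'a cstar_algebra \<Rightarrow> ('a \<Rightarrow> ennreal) \<Rightarrow> 'a set" where
  "seminorm_dom A L = {a \<in> carrier A. L a < \<infinity>}"

definition leibniz_cqms :: "'a cstar_algebra \<Rightarrow> ('a \<Rightarrow> ennreal) \<Rightarrow> bool" where
  "leibniz_cqms A L \<longleftrightarrow>
     unital_cstar_algebra A \<and>
     (\<forall>a\<in>carrier A. \<forall>b\<in>carrier A. L (a \<oplus>\<^bsub>A\<^esub> b) \<le> L a + L b) \<and>
     (\<forall>c. \<forall>a\<in>carrier A. L (c \<odot>\<^bsub>A\<^esub> a) = ennreal (cmod c) * L a) \<and>
     (\<forall>a\<in>seminorm_dom A L. \<forall>b\<in>seminorm_dom A L.
        a \<oplus>\<^bsub>A\<^esub> b \<in> seminorm_dom A L \<and> a \<otimes>\<^bsub>A\<^esub> b \<in> seminorm_dom A L) \<and>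
     (\<forall>c. \<forall>a\<in>seminorm_dom A L. c \<odot>\<^bsub>A\<^esub> a \<in> seminorm_dom A L) \<and>
     (\<forall>a\<in>seminorm_dom A L. star A a \<in> seminorm_dom A L) \<and>
     (\<forall>a\<in>carrier A. \<forall>e>0. \<exists>b\<in>seminorm_dom A L. nrm A (a \<ominus>\<^bsub>A\<^esub> b) < e) \<and>
     (\<forall>a\<in>carrier A. L (star A a) = L a) \<and>
     {a \<in> carrier A. L a = 0} = {c \<odot>\<^bsub>A\<^esub> \<one>\<^bsub>A\<^esub> | c. True} \<and>
     (\<forall>a\<in>carrier A. \<forall>b\<in>carrier A.
        L (a \<otimes>\<^bsub>A\<^esub> b) \<le> ennreal (nrm A a) * L b + ennreal (nrm A b) * L a) \<and>
     metrizes_weak_star A (mk {a \<in> carrier A. L a \<le> 1})"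

section \<open>The quantum Gromov--Hausdorff propinquity\<close>

text \<open>
  The class on which the propinquity is defined.  Only the values of \<open>L\<close> on the self-adjoint
  part enter this predicate and the propinquity, so an L-seminorm on the whole algebra is
  implicitly restricted to that part.
\<close>

definition lipschitz_ball :: "'a cstar_algebra \<Rightarrow> ('a \<Rightarrow> ennreal) \<Rightarrow> 'a set" where
  "lipschitz_ball A L = {a \<in> sa A. L a \<le> 1}"

definition propinquity_class :: "'a cstar_algebra \<Rightarrow> ('a \<Rightarrow> ennreal) \<Rightarrow> bool" where
  "propinquity_class A L \<longleftrightarrow>
     unital_cstar_algebra A \<and>
     (\<forall>a\<in>sa A. \<forall>b\<in>sa A. L (a \<oplus>\<^bsub>A\<^esub> b) \<le> L a + L b) \<and>
     (\<forall>r::real. \<forall>a\<in>sa A. L (of_real r \<odot>\<^bsub>A\<^esub> a) = ennreal \<bar>r\<bar> * L a) \<and>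
     (\<forall>a\<in>sa A. \<forall>y<L a. \<exists>e>0. \<forall>b\<in>sa A. nrm A (b \<ominus>\<^bsub>A\<^esub> a) < e \<longrightarrow> y < L b) \<and>
     (\<forall>a\<in>sa A. \<forall>e>0. \<exists>b\<in>sa A. L b < \<infinity> \<and> nrm A (a \<ominus>\<^bsub>A\<^esub> b) < e) \<and>
     {a \<in> sa A. L a = 0} = {of_real r \<odot>\<^bsub>A\<^esub> \<one>\<^bsub>A\<^esub> | r::real. True} \<and>
     metrizes_weak_star A (mk (lipschitz_ball A L)) \<and>
     (\<forall>a\<in>sa A. \<forall>b\<in>sa A.
        L ((1 / 2) \<odot>\<^bsub>A\<^esub> (a \<otimes>\<^bsub>A\<^esub> b \<oplus>\<^bsub>A\<^esub> b \<otimes>\<^bsub>A\<^esub> a))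
          \<le> ennreal (nrm A a) * L b + ennreal (nrm A b) * L a \<and>
        L ((1 / (2 * \<i>)) \<odot>\<^bsub>A\<^esub> (a \<otimes>\<^bsub>A\<^esub> b \<ominus>\<^bsub>A\<^esub> b \<otimes>\<^bsub>A\<^esub> a))
          \<le> ennreal (nrm A a) * L b + ennreal (nrm A b) * L a)"

definition hausdorff_distance :: "('b \<Rightarrow> 'b \<Rightarrow> ennreal) \<Rightarrow> 'b set \<Rightarrow> 'b set \<Rightarrow> ennreal" where
  "hausdorff_distance d X Y = max (SUP x\<in>X. INF y\<in>Y. d x y) (SUP y\<in>Y. INF x\<in>X. d x y)"

record 'a bridge =
  bridge_algebra :: "'a cstar_algebra"
  pivot :: 'a
  left_embedding :: "'a \<Rightarrow> 'a"
  right_embedding :: "'a \<Rightarrow> 'a"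

definition one_level :: "'a cstar_algebra \<Rightarrow> 'a \<Rightarrow> ('a \<Rightarrow> complex) set" where
  "one_level D \<omega> = {\<phi> \<in> states D.
     \<phi> (star D (\<one>\<^bsub>D\<^esub> \<ominus>\<^bsub>D\<^esub> \<omega>) \<otimes>\<^bsub>D\<^esub> (\<one>\<^bsub>D\<^esub> \<ominus>\<^bsub>D\<^esub> \<omega>)) = 0 \<and>
     \<phi> ((\<one>\<^bsub>D\<^esub> \<ominus>\<^bsub>D\<^esub> \<omega>) \<otimes>\<^bsub>D\<^esub> star D (\<one>\<^bsub>D\<^esub> \<ominus>\<^bsub>D\<^esub> \<omega>)) = 0}"

definition is_bridge :: "'a cstar_algebra \<Rightarrow> 'a cstar_algebra \<Rightarrow> 'a bridge \<Rightarrow> bool" where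
  "is_bridge A B g \<longleftrightarrow>
     unital_cstar_algebra (bridge_algebra g) \<and>
     pivot g \<in> carrier (bridge_algebra g) \<and>
     unital_star_mono A (bridge_algebra g) (left_embedding g) \<and>
     unital_star_mono B (bridge_algebra g) (right_embedding g) \<and>
     one_level (bridge_algebra g) (pivot g) \<noteq> {}"

text \<open>A compact quantum metric space is passed as a pair \<open>(A, L)\<close>.\<close>

definition bridge_reach ::
    "'a cstar_algebra \<times> ('a \<Rightarrow> ennreal) \<Rightarrow> 'a cstar_algebra \<times> ('a \<Rightarrow> ennreal) \<Rightarrow> 'a bridge \<Rightarrow> ennreal" where
  "bridge_reach X Y g = (let D = bridge_algebra g in
     hausdorff_distance (\<lambda>x y. ennreal (nrm D (x \<ominus>\<^bsub>D\<^esub> y)))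
       ((\<lambda>a. left_embedding g a \<otimes>\<^bsub>D\<^esub> pivot g) ` lipschitz_ball (fst X) (snd X))
       ((\<lambda>b. pivot g \<otimes>\<^bsub>D\<^esub> right_embedding g b) ` lipschitz_ball (fst Y) (snd Y)))"

definition bridge_height ::
    "'a cstar_algebra \<times> ('a \<Rightarrow> ennreal) \<Rightarrow> 'a cstar_algebra \<times> ('a \<Rightarrow> ennreal) \<Rightarrow> 'a bridge \<Rightarrow> ennreal" where
  "bridge_height X Y g = (let S1 = one_level (bridge_algebra g) (pivot g) in
     max (hausdorff_distance (mk (lipschitz_ball (fst X) (snd X))) (states (fst X))
            ((\<lambda>\<phi>. restrict (\<phi> \<circ> left_embedding g) (carrier (fst X))) ` S1))
         (hausdorff_distance (mk (lipschitz_ball (fst Y) (snd Y))) (states (fst Y))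
            ((\<lambda>\<phi>. restrict (\<phi> \<circ> right_embedding g) (carrier (fst Y))) ` S1)))"

definition bridge_length ::
    "'a cstar_algebra \<times> ('a \<Rightarrow> ennreal) \<Rightarrow> 'a cstar_algebra \<times> ('a \<Rightarrow> ennreal) \<Rightarrow> 'a bridge \<Rightarrow> ennreal" where
  "bridge_length X Y g = max (bridge_reach X Y g) (bridge_height X Y g)"

definition is_trek ::
    "'a cstar_algebra \<times> ('a \<Rightarrow> ennreal) \<Rightarrow> 'a cstar_algebra \<times> ('a \<Rightarrow> ennreal) \<Rightarrow>
     nat \<Rightarrow> (nat \<Rightarrow> 'a cstar_algebra \<times> ('a \<Rightarrow> ennreal)) \<Rightarrow> (nat \<Rightarrow> 'a bridge) \<Rightarrow> bool" where
  "is_trek X Y n Z G \<longleftrightarrow> Z 0 = X \<and> Z n = Y \<and>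
     (\<forall>i\<le>n. propinquity_class (fst (Z i)) (snd (Z i))) \<and>
     (\<forall>i<n. is_bridge (fst (Z i)) (fst (Z (Suc i))) (G i))"

text \<open>
  HOL cannot quantify over types inside a term, so the intermediate spaces and the bridge
  algebras range over all algebras carried by subsets of the type \<open>'a\<close>.  Enlarging \<open>'a\<close> only adds
  treks and so can only decrease the value.  If \<open>'a\<close> has at least the cardinality of the continuum
  (as in the type used below for UHF algebras) nothing is lost: the weak* topology being
  metrizable, all spaces in the class are separable, and a bridge algebra may be cut down to the
  separable subalgebra generated by the two embedded algebras and the pivot without changing
  reach or height.
\<close>

definition propinquity ::
    "'a cstar_algebra \<times> ('a \<Rightarrow> ennreal) \<Rightarrow> 'a cstar_algebra \<times> ('a \<Rightarrow> ennreal) \<Rightarrow> ennreal" where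
  "propinquity X Y =
     Inf {\<Sum>i<n. bridge_length (Z i) (Z (Suc i)) (G i) | n Z G. is_trek X Y n Z G}"

section \<open>The GNS Hilbert space of a faithful tracial state\<close>

record 'h inner_product_space = "(complex, 'h) module" +
  inner_prod :: "'h \<Rightarrow> 'h \<Rightarrow> complex"

definition vnorm :: "'h inner_product_space \<Rightarrow> 'h \<Rightarrow> real" where
  "vnorm H h = sqrt (Re (inner_prod H h h))"

definition orth_proj :: "'h inner_product_space \<Rightarrow> 'h set \<Rightarrow> 'h \<Rightarrow> 'h" where
  "orth_proj H V h = (THE p. p \<in> V \<and> (\<forall>v\<in>V. inner_prod H (h \<ominus>\<^bsub>H\<^esub> p) v = 0))"

definition trace_norm :: "'a cstar_algebra \<Rightarrow> ('a \<Rightarrow> complex) \<Rightarrow> 'a \<Rightarrow> real" where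
  "trace_norm A \<tau> a = sqrt (Re (\<tau> (star A a \<otimes>\<^bsub>A\<^esub> a)))"

text \<open>
  The completion of \<open>A\<close> for \<^const>\<open>trace_norm\<close>: Cauchy sequences modulo null sequences.
\<close>

definition gns_seqs :: "'a cstar_algebra \<Rightarrow> ('a \<Rightarrow> complex) \<Rightarrow> (nat \<Rightarrow> 'a) set" where
  "gns_seqs A \<tau> = {x. (\<forall>n. x n \<in> carrier A) \<and>
     (\<forall>e>0. \<exists>N. \<forall>m\<ge>N. \<forall>n\<ge>N. trace_norm A \<tau> (x m \<ominus>\<^bsub>A\<^esub> x n) < e)}"

definition gns_rel :: "'a cstar_algebra \<Rightarrow> ('a \<Rightarrow> complex) \<Rightarrow> ((nat \<Rightarrow> 'a) \<times> (nat \<Rightarrow> 'a)) set" where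
  "gns_rel A \<tau> = {(x, y). x \<in> gns_seqs A \<tau> \<and> y \<in> gns_seqs A \<tau> \<and>
     (\<lambda>n. trace_norm A \<tau> (x n \<ominus>\<^bsub>A\<^esub> y n)) \<longlonglongrightarrow> 0}"

definition gns_class :: "'a cstar_algebra \<Rightarrow> ('a \<Rightarrow> complex) \<Rightarrow> (nat \<Rightarrow> 'a) \<Rightarrow> (nat \<Rightarrow> 'a) set" where
  "gns_class A \<tau> x = gns_rel A \<tau> `` {x}"

definition gns_space ::
    "'a cstar_algebra \<Rightarrow> ('a \<Rightarrow> complex) \<Rightarrow> (nat \<Rightarrow> 'a) set inner_product_space" where
  "gns_space A \<tau> = \<lparr>
     carrier = gns_seqs A \<tau> // gns_rel A \<tau>,
     mult = undefined,
     one = undefined,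
     zero = gns_class A \<tau> (\<lambda>_. \<zero>\<^bsub>A\<^esub>),
     add = (\<lambda>X Y. \<Union>x\<in>X. \<Union>y\<in>Y. gns_class A \<tau> (\<lambda>n. x n \<oplus>\<^bsub>A\<^esub> y n)),
     smult = (\<lambda>c X. \<Union>x\<in>X. gns_class A \<tau> (\<lambda>n. c \<odot>\<^bsub>A\<^esub> x n)),
     inner_prod = (\<lambda>X Y. THE z. \<forall>x\<in>X. \<forall>y\<in>Y. (\<lambda>n. \<tau> (star A (y n) \<otimes>\<^bsub>A\<^esub> x n)) \<longlonglongrightarrow> z)\<rparr>"

definition gns_embed :: "'a cstar_algebra \<Rightarrow> ('a \<Rightarrow> complex) \<Rightarrow> 'a \<Rightarrow> (nat \<Rightarrow> 'a) set" where
  "gns_embed A \<tau> a = gns_class A \<tau> (\<lambda>_. a)"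

text \<open>Left multiplication, extended by continuity from the algebra to the completion.\<close>

definition gns_rep ::
    "'a cstar_algebra \<Rightarrow> ('a \<Rightarrow> complex) \<Rightarrow> 'a \<Rightarrow> (nat \<Rightarrow> 'a) set \<Rightarrow> (nat \<Rightarrow> 'a) set" where
  "gns_rep A \<tau> a X = (\<Union>x\<in>X. gns_class A \<tau> (\<lambda>n. a \<otimes>\<^bsub>A\<^esub> x n))"

section \<open>Christensen--Ivan seminorms\<close>

text \<open>
  \<open>F n\<close> is the \<open>n\<close>-th finite-dimensional subalgebra of the AF filtration, with
  \<open>F 0\<close> the scalars; \<open>\<gamma>\<close> is a summable sequence of positive reals.
\<close>

definition ci_const :: "'a cstar_algebra \<Rightarrow> (nat \<Rightarrow> 'a set) \<Rightarrow> ('a \<Rightarrow> complex) \<Rightarrow> nat \<Rightarrow> real" where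
  "ci_const A F \<tau> n = (LEAST c. \<forall>a\<in>F n. nrm A a \<le> c * trace_norm A \<tau> a)"

definition ci_coeff ::
    "'a cstar_algebra \<Rightarrow> (nat \<Rightarrow> 'a set) \<Rightarrow> ('a \<Rightarrow> complex) \<Rightarrow> (nat \<Rightarrow> real) \<Rightarrow> nat \<Rightarrow> real" where
  "ci_coeff A F \<tau> \<gamma> n = ci_const A F \<tau> n / \<gamma> n"

definition ci_P ::
    "'a cstar_algebra \<Rightarrow> (nat \<Rightarrow> 'a set) \<Rightarrow> ('a \<Rightarrow> complex) \<Rightarrow> nat \<Rightarrow> (nat \<Rightarrow> 'a) set \<Rightarrow> (nat \<Rightarrow> 'a) set" where
  "ci_P A F \<tau> n = orth_proj (gns_space A \<tau>) (gns_embed A \<tau> ` F n)"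

text \<open>Only used for \<open>n \<ge> 1\<close>.\<close>

definition ci_Q ::
    "'a cstar_algebra \<Rightarrow> (nat \<Rightarrow> 'a set) \<Rightarrow> ('a \<Rightarrow> complex) \<Rightarrow> nat \<Rightarrow> (nat \<Rightarrow> 'a) set \<Rightarrow> (nat \<Rightarrow> 'a) set" where
  "ci_Q A F \<tau> n h = ci_P A F \<tau> n h \<ominus>\<^bsub>gns_space A \<tau>\<^esub> ci_P A F \<tau> (n - 1) h"

definition ci_dom ::
    "'a cstar_algebra \<Rightarrow> (nat \<Rightarrow> 'a set) \<Rightarrow> ('a \<Rightarrow> complex) \<Rightarrow> (nat \<Rightarrow> real) \<Rightarrow> (nat \<Rightarrow> 'a) set set" where
  "ci_dom A F \<tau> \<gamma> = {h \<in> carrier (gns_space A \<tau>).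
     summable (\<lambda>n. (ci_coeff A F \<tau> \<gamma> (Suc n))\<^sup>2 * (vnorm (gns_space A \<tau>) (ci_Q A F \<tau> (Suc n) h))\<^sup>2)}"

text \<open>The sum of the norm-convergent series, for \<open>h\<close> in \<^const>\<open>ci_dom\<close>.\<close>

definition ci_D ::
    "'a cstar_algebra \<Rightarrow> (nat \<Rightarrow> 'a set) \<Rightarrow> ('a \<Rightarrow> complex) \<Rightarrow> (nat \<Rightarrow> real) \<Rightarrow>
     (nat \<Rightarrow> 'a) set \<Rightarrow> (nat \<Rightarrow> 'a) set" where
  "ci_D A F \<tau> \<gamma> h = (let H = gns_space A \<tau> in
     THE k. k \<in> carrier H \<and>
       (\<lambda>N. vnorm H (finsum H (\<lambda>n. of_real (ci_coeff A F \<tau> \<gamma> n) \<odot>\<^bsub>H\<^esub> ci_Q A F \<tau> n h) {1..N}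
                     \<ominus>\<^bsub>H\<^esub> k)) \<longlonglongrightarrow> 0)"

text \<open>
  The norm of the bounded extension of the commutator is the supremum over the unit ball of the
  dense domain, and this supremum is \<open>\<infinity>\<close> if the commutator is not bounded there.
\<close>

definition ci_seminorm ::
    "'a cstar_algebra \<Rightarrow> (nat \<Rightarrow> 'a set) \<Rightarrow> ('a \<Rightarrow> complex) \<Rightarrow> (nat \<Rightarrow> real) \<Rightarrow> 'a \<Rightarrow> ennreal" where
  "ci_seminorm A F \<tau> \<gamma> a = (let H = gns_space A \<tau>; D = ci_D A F \<tau> \<gamma>; \<pi> = gns_rep A \<tau> in
     if \<forall>h\<in>ci_dom A F \<tau> \<gamma>. \<pi> a h \<in> ci_dom A F \<tau> \<gamma>
     then (SUP h\<in>{h \<in> ci_dom A F \<tau> \<gamma>. vnorm H h \<le> 1}.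
             ennreal (vnorm H (D (\<pi> a h) \<ominus>\<^bsub>H\<^esub> \<pi> a (D h))))
     else \<infinity>)"

section \<open>Inductive limits of sequences of unital C*-algebras\<close>

text \<open>\<open>connecting \<mu> m k\<close> is the composition \<open>\<mu> (m + k - 1) \<circ> \<dots> \<circ> \<mu> m\<close> from level \<open>m\<close> to level \<open>m + k\<close>.\<close>

primrec connecting :: "(nat \<Rightarrow> 'a \<Rightarrow> 'a) \<Rightarrow> nat \<Rightarrow> nat \<Rightarrow> 'a \<Rightarrow> 'a" where
  "connecting \<mu> m 0 a = a"
| "connecting \<mu> m (Suc k) a = \<mu> (m + k) (connecting \<mu> m k a)"

text \<open>
  The inductive limit is realized in the usual way inside the quotient of the bounded product of
  the \<open>B n\<close> by the ideal of null sequences, as the closure of the union of the images of the \<open>B n\<close>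
  (the connecting maps being injective unital *-homomorphisms, hence isometric).
  A sequence represents an element of this closure iff it is, up to arbitrarily small errors,
  eventually coherent for the connecting maps.
\<close>

definition limit_seqs :: "(nat \<Rightarrow> 'a cstar_algebra) \<Rightarrow> (nat \<Rightarrow> 'a \<Rightarrow> 'a) \<Rightarrow> (nat \<Rightarrow> 'a) set" where
  "limit_seqs B \<mu> = {x. (\<forall>n. x n \<in> carrier (B n)) \<and>
     (\<forall>e>0. \<exists>N. \<forall>k. nrm (B (N + k)) (x (N + k) \<ominus>\<^bsub>B (N + k)\<^esub> connecting \<mu> N k (x N)) < e)}"

definition limit_rel ::
    "(nat \<Rightarrow> 'a cstar_algebra) \<Rightarrow> (nat \<Rightarrow> 'a \<Rightarrow> 'a) \<Rightarrow> ((nat \<Rightarrow> 'a) \<times> (nat \<Rightarrow> 'a)) set" where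
  "limit_rel B \<mu> = {(x, y). x \<in> limit_seqs B \<mu> \<and> y \<in> limit_seqs B \<mu> \<and>
     (\<lambda>n. nrm (B n) (x n \<ominus>\<^bsub>B n\<^esub> y n)) \<longlonglongrightarrow> 0}"

definition limit_class ::
    "(nat \<Rightarrow> 'a cstar_algebra) \<Rightarrow> (nat \<Rightarrow> 'a \<Rightarrow> 'a) \<Rightarrow> (nat \<Rightarrow> 'a) \<Rightarrow> (nat \<Rightarrow> 'a) set" where
  "limit_class B \<mu> x = limit_rel B \<mu> `` {x}"

definition inductive_limit ::
    "(nat \<Rightarrow> 'a cstar_algebra) \<Rightarrow> (nat \<Rightarrow> 'a \<Rightarrow> 'a) \<Rightarrow> (nat \<Rightarrow> 'a) set cstar_algebra" where
  "inductive_limit B \<mu> = \<lparr>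
     carrier = limit_seqs B \<mu> // limit_rel B \<mu>,
     mult = (\<lambda>X Y. \<Union>x\<in>X. \<Union>y\<in>Y. limit_class B \<mu> (\<lambda>n. x n \<otimes>\<^bsub>B n\<^esub> y n)),
     one = limit_class B \<mu> (\<lambda>n. \<one>\<^bsub>B n\<^esub>),
     zero = limit_class B \<mu> (\<lambda>n. \<zero>\<^bsub>B n\<^esub>),
     add = (\<lambda>X Y. \<Union>x\<in>X. \<Union>y\<in>Y. limit_class B \<mu> (\<lambda>n. x n \<oplus>\<^bsub>B n\<^esub> y n)),
     smult = (\<lambda>c X. \<Union>x\<in>X. limit_class B \<mu> (\<lambda>n. c \<odot>\<^bsub>B n\<^esub> x n)),
     star = (\<lambda>X. \<Union>x\<in>X. limit_class B \<mu> (\<lambda>n. star (B n) (x n))),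
     nrm = (\<lambda>X. THE r. \<forall>x\<in>X. (\<lambda>n. nrm (B n) (x n)) \<longlonglongrightarrow> r)\<rparr>"

definition limit_map ::
    "(nat \<Rightarrow> 'a cstar_algebra) \<Rightarrow> (nat \<Rightarrow> 'a \<Rightarrow> 'a) \<Rightarrow> nat \<Rightarrow> 'a \<Rightarrow> (nat \<Rightarrow> 'a) set" where
  "limit_map B \<mu> n a =
     limit_class B \<mu> (\<lambda>k. if k < n then \<zero>\<^bsub>B k\<^esub> else connecting \<mu> n (k - n) a)"

section \<open>Baire space and UHF algebras\<close>

definition baire_space :: "(nat \<Rightarrow> nat) set" where
  "baire_space = {\<beta>. \<forall>n. \<beta> n \<noteq> 0}"

definition baire_dist :: "(nat \<Rightarrow> nat) \<Rightarrow> (nat \<Rightarrow> nat) \<Rightarrow> real" where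
  "baire_dist x y = (if x = y then 0 else 1 / 2 ^ (LEAST n. x n \<noteq> y n))"

definition mat_op_norm :: "complex mat \<Rightarrow> real" where
  "mat_op_norm a = (SUP v\<in>{v \<in> carrier_vec (dim_col a). Re (v \<bullet>c v) \<le> 1}.
     sqrt (Re ((a *\<^sub>v v) \<bullet>c (a *\<^sub>v v))))"

definition mat_algebra :: "nat \<Rightarrow> complex mat cstar_algebra" where
  "mat_algebra d = ring_mat TYPE(complex) d
     \<lparr>smult = (\<cdot>\<^sub>m), star = mat_adjoint, nrm = mat_op_norm\<rparr>"

definition uhf_dim :: "(nat \<Rightarrow> nat) \<Rightarrow> nat \<Rightarrow> nat" where
  "uhf_dim \<beta> n = (\<Prod>j<n. \<beta> j + 1)"

definition uhf_mu :: "(nat \<Rightarrow> nat) \<Rightarrow> nat \<Rightarrow> complex mat \<Rightarrow> complex mat" where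
  "uhf_mu \<beta> n a = diag_block_mat (replicate (\<beta> n + 1) a)"

definition uhf :: "(nat \<Rightarrow> nat) \<Rightarrow> (nat \<Rightarrow> complex mat) set cstar_algebra" where
  "uhf \<beta> = inductive_limit (\<lambda>n. mat_algebra (uhf_dim \<beta> n)) (uhf_mu \<beta>)"

definition uhf_level :: "(nat \<Rightarrow> nat) \<Rightarrow> nat \<Rightarrow> (nat \<Rightarrow> complex mat) set set" where
  "uhf_level \<beta> n = limit_map (\<lambda>n. mat_algebra (uhf_dim \<beta> n)) (uhf_mu \<beta>) n
     ` carrier (mat_algebra (uhf_dim \<beta> n))"

definition uhf_trace :: "(nat \<Rightarrow> nat) \<Rightarrow> (nat \<Rightarrow> complex mat) set \<Rightarrow> complex" where
  "uhf_trace \<beta> = (THE \<tau>. faithful_tracial_state (uhf \<beta>) \<tau>)"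

text \<open>The matrix algebra of size \<open>d\<close> has dimension \<open>d\<^sup>2\<close> over the complex numbers.\<close>

definition uhf_gamma :: "(nat \<Rightarrow> nat) \<Rightarrow> nat \<Rightarrow> real" where
  "uhf_gamma \<beta> n = 1 / (real (uhf_dim \<beta> n))\<^sup>2"

definition uhf_seminorm :: "(nat \<Rightarrow> nat) \<Rightarrow> (nat \<Rightarrow> complex mat) set \<Rightarrow> ennreal" where
  "uhf_seminorm \<beta> = ci_seminorm (uhf \<beta>) (uhf_level \<beta>) (uhf_trace \<beta>) (uhf_gamma \<beta>)"

end

theory Submission
  imports Defs
begin

text \<open>
  Testing the commutator \<open>[D, a]\<close> on the vector \<open>1\<close> bounds the trace norm of \<open>E\<^sub>n a - E\<^sub>n\<^sub>-\<^sub>1 a\<close> by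
  \<open>L(a) / \<alpha>\<^sub>n\<close>, where \<open>E\<^sub>n\<close> is the conditional expectation onto \<open>\<A>\<^sub>n\<close>; hence its norm is at most
  \<open>\<gamma>(n) L(a)\<close> and \<open>a\<close> is within \<open>L(a) \<cdot> \<Sum>\<^sub>n\<^sub>>\<^sub>N \<gamma>(n)\<close> of \<open>E\<^sub>N a\<close>.  This gives Rieffel's total
  boundedness criterion, and it bounds the reach of the bridge from \<open>\<A>\<^sub>N\<close> to \<open>\<A>\<close> with pivot \<open>1\<close>; the
  height of that bridge is \<open>0\<close> because states of \<open>\<A>\<^sub>N\<close> extend through \<open>E\<^sub>N\<close>.

  For \<open>a \<in> \<A>\<^sub>N\<close> the norm of \<open>[D, a]\<close> is attained on \<open>\<A>\<^sub>N\<close>, so for UHF algebras \<open>L\<close> on \<open>\<A>\<^sub>N\<close> depends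
  only on \<open>\<beta>(0), \<dots>, \<beta>(N - 1)\<close>.  If \<open>\<beta>\<close> and \<open>\<beta>'\<close> agree there, the trek through the common algebra
  \<open>\<A>\<^sub>N\<close> has length at most \<open>2 \<cdot> 4\<^sup>-\<^sup>N\<close>.

  Unbounded operators are avoided by replacing the commutator by the sesquilinear form
  \<open>\<langle>a h, D k\<rangle> - \<langle>a D h, k\<rangle>\<close> on \<open>\<Union>\<^sub>n \<A>\<^sub>n\<close>; since \<open>D\<close> is closed and self-adjoint, its norm is the
  Christensen--Ivan seminorm.
\<close>

section \<open>C*-algebras and states\<close>

text \<open>The facts on C*-algebras come from the axioms alone: an iteration gives a self-adjoint
  square root of \<open>1 - x\<close> for self-adjoint \<open>x\<close> with
  \<open>||x|| < 1\<close>, and with it boundedness of states and of left multiplication in the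
  trace norm. On a level the C*-norm is the norm of left multiplication on trace-norm vectors, which
  replaces spectral arguments: positivity of \<open>E N (a* a)\<close> is used as the bound
  \<open>||1 - E N (a* a) / s|| <= 1\<close>, and norm estimates are tested vector by vector because
  \<open>E M a\<close> is at first known to tend to \<open>a\<close> only in trace norm.
  \<open>E n\<close> is just the orthogonal projection for \<tau>; its module property is due to
  traciality.

  The weight \<open>c n / \<gamma> n\<close> has two tasks: \<open>c n\<close> pays for the return
  from trace norm to norm, \<open>\<gamma> n\<close> makes the result summable. For matrices of size
  d the constant is \<open>sqrt d\<close>. Entries of a point of Baire space are at least 1, so the
  size doubles at least at each level, \<open>\<gamma> n <= 4^-n\<close>, and the tail after N is at
  most \<open>4^-N / 3\<close>; each of the two bridges is charged \<open>4^-N\<close>.\<close>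

context unital_cstar_algebra
begin

section \<open>Arithmetic and norm inequalities in a C*-algebra\<close>

lemma is_ring: "ring A"
  using unital_cstar_algebra_axioms by (rule unital_cstar_algebra.axioms(1))

lemmas is_abelian_group = ring.is_abelian_group[OF is_ring]
lemmas is_abelian_monoid = abelian_group.axioms(1)[OF is_abelian_group]

lemmas add_assoc = abelian_monoid.a_assoc[OF is_abelian_monoid]
lemmas add_comm = abelian_monoid.a_comm[OF is_abelian_monoid]
lemmas add_minus_self = abelian_group.r_neg[OF is_abelian_group]
lemmas minus_add_self = abelian_group.l_neg[OF is_abelian_group]
lemmas add_uminus_cancel = abelian_group.r_neg1[OF is_abelian_group]
lemmas uminus_add = abelian_group.minus_add[OF is_abelian_group]
lemmas uminus_unique = abelian_group.minus_equality[OF is_abelian_group]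
lemma is_semiring: "semiring A" by unfold_locales
lemmas mult_add_left = semiring.l_distr[OF is_semiring]
lemmas mult_add_right = semiring.r_distr[OF is_semiring]
lemmas mult_uminus_left = ring.l_minus[OF is_ring]
lemmas mult_uminus_right = ring.r_minus[OF is_ring]

lemma smult_carrier [simp, intro]: "x \<in> carrier A \<Longrightarrow> c \<odot> x \<in> carrier A"
  using smult_closed by simp

lemma smult_add_left: "x \<in> carrier A \<Longrightarrow> (a + b) \<odot> x = a \<odot> x \<oplus> b \<odot> x"
  using smult_l_distr by simp

lemma smult_add_right:
  "x \<in> carrier A \<Longrightarrow> y \<in> carrier A \<Longrightarrow> c \<odot> (x \<oplus> y) = c \<odot> x \<oplus> c \<odot> y"
  using smult_r_distr by simp

lemma smult_smult: "x \<in> carrier A \<Longrightarrow> a \<odot> (b \<odot> x) = (a * b) \<odot> x"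
  using smult_assoc1 by simp

lemma smult_1 [simp]: "x \<in> carrier A \<Longrightarrow> 1 \<odot> x = x"
  using smult_one by simp

lemma smult_0 [simp]: "x \<in> carrier A \<Longrightarrow> 0 \<odot> x = \<zero>"
  using smult_l_null by simp

lemma smult_zero [simp]: "c \<odot> \<zero> = \<zero>"
  using smult_r_null by simp

lemma smult_minus_1: "x \<in> carrier A \<Longrightarrow> (- 1) \<odot> x = \<ominus> x"
proof -
  assume x: "x \<in> carrier A"
  have "(- 1) \<odot> x \<oplus> x = ((- 1) + 1) \<odot> x"
    using x by (simp only: smult_add_left smult_1)
  then have "(- 1) \<odot> x \<oplus> x = \<zero>" using x by simp
  from uminus_unique[OF this] show ?thesis using x by simp
qed

lemma minus_smult: "x \<in> carrier A \<Longrightarrow> y \<in> carrier A \<Longrightarrow> x \<ominus> y = x \<oplus> (- 1) \<odot> y"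
  by (simp add: smult_minus_1 a_minus_def)

lemma smult_minus_right:
  "x \<in> carrier A \<Longrightarrow> y \<in> carrier A \<Longrightarrow> c \<odot> (x \<ominus> y) = c \<odot> x \<ominus> c \<odot> y"
  by (simp add: minus_smult smult_add_right smult_smult)

lemma add_minus_add:
  assumes [simp]: "x \<in> carrier A" "a \<in> carrier A" "b \<in> carrier A"
  shows "(x \<oplus> a) \<ominus> (x \<oplus> b) = a \<ominus> b"
proof -
  have "x \<oplus> a = (a \<ominus> b) \<oplus> (x \<oplus> b)"
    by (simp add: a_minus_def add_assoc add_comm[of x] add_uminus_cancel)
  then show ?thesis by (simp add: a_minus_def add_assoc add_minus_self)
qed

declare star_closed [simp, intro]

lemma star_star' [simp]: "x \<in> carrier A \<Longrightarrow> star A (star A x) = x"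
  by (rule star_star)

lemma star_zero [simp]: "star A \<zero> = \<zero>"
  using star_smult[of \<zero> 0] by simp

lemma star_one [simp]: "star A \<one> = \<one>"
proof -
  have "star A (star A \<one> \<otimes> \<one>) = star A \<one> \<otimes> star A (star A \<one>)"
    by (rule star_mult) auto
  then show ?thesis by simp
qed

lemma star_minus: "x \<in> carrier A \<Longrightarrow> y \<in> carrier A \<Longrightarrow> star A (x \<ominus> y) = star A x \<ominus> star A y"
  by (simp add: minus_smult star_add star_smult)

lemma nrm_zero [simp]: "nrm A \<zero> = 0"
  using nrm_eq_0[of \<zero>] by simp

lemma nrm_minus_commute:
  assumes "x \<in> carrier A" "y \<in> carrier A" shows "nrm A (x \<ominus> y) = nrm A (y \<ominus> x)"
proof -
  have "x \<ominus> y = (- 1) \<odot> (y \<ominus> x)"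
    using assms by (simp add: minus_smult smult_add_right smult_smult add_comm[of x])
  then show ?thesis using assms by (simp add: nrm_smult)
qed

lemma nrm_triangle3:
  assumes "x \<in> carrier A" "y \<in> carrier A" "z \<in> carrier A"
  shows "nrm A (x \<ominus> z) \<le> nrm A (x \<ominus> y) + nrm A (y \<ominus> z)"
proof -
  have "x \<ominus> z = (x \<ominus> y) \<oplus> (y \<ominus> z)" using assms by algebra
  then show ?thesis using assms by (simp add: nrm_triangle)
qed

lemma nrm_le_add_minus:
  assumes "x \<in> carrier A" "y \<in> carrier A" shows "nrm A x \<le> nrm A y + nrm A (x \<ominus> y)"
proof -
  have "x = y \<oplus> (x \<ominus> y)" using assms by algebra
  then show ?thesis using assms nrm_triangle[of y "x \<ominus> y"] by simp
qed

lemma nrm_diff_le: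
  assumes "x \<in> carrier A" "y \<in> carrier A" shows "\<bar>nrm A x - nrm A y\<bar> \<le> nrm A (x \<ominus> y)"
  using nrm_le_add_minus[OF assms] nrm_le_add_minus[OF assms(2,1)] nrm_minus_commute[OF assms]
  by linarith

text \<open>The C*-identity gives \<open>||y||^2 = ||y* y|| <= ||y*|| ||y||\<close>. Cancelling
  \<open>||y||\<close> and using the result for \<open>y\<close> and for \<open>y*\<close> yields
  both inequalities.\<close>

lemma nrm_star [simp]:
  assumes "x \<in> carrier A" shows "nrm A (star A x) = nrm A x"
proof -
  have *: "nrm A y \<le> nrm A (star A y)" if "y \<in> carrier A" for y
  proof (cases "nrm A y = 0")
    case False
    have "nrm A y * nrm A y \<le> nrm A (star A y) * nrm A y"
      using cstar_identity[OF that] nrm_mult[of "star A y" y] that by (simp add: power2_eq_square)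
    then show ?thesis using False nrm_nonneg[OF that] by simp
  qed (use that in \<open>simp add: nrm_nonneg\<close>)
  show ?thesis using *[OF assms] *[of "star A x"] assms by simp
qed

text \<open>The fixed point iteration \<open>y \<mapsto> (x + y\<^sup>2) / 2\<close> computes \<open>1 - sqrt (1 - x)\<close> without
  any power series or functional calculus.\<close>

lemma one_minus_sa_square:
  assumes x: "x \<in> sa A" and nx: "nrm A x < 1"
  obtains b where "b \<in> sa A" "\<one> \<ominus> x = b \<otimes> b"
proof -
  define r where "r = nrm A x"
  have xc [simp]: "x \<in> carrier A" and xs: "star A x = x" using x by (auto simp: sa_def)
  have r0: "0 \<le> r" and r1: "r < 1" using nx nrm_nonneg by (auto simp: r_def)
  \<comment> \<open>Starting at 0 keeps every iterate self-adjoint and inside the ball of radius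
    \<open>r = ||x|| < 1\<close>, on which the iteration contracts with factor r.\<close>
  define y where "y n = ((\<lambda>y. (1/2) \<odot> (x \<oplus> y \<otimes> y)) ^^ n) \<zero>" for n
  have y0: "y 0 = \<zero>" and ySuc: "y (Suc n) = (1/2) \<odot> (x \<oplus> y n \<otimes> y n)" for n
    by (simp_all add: y_def)
  have yc [simp]: "y n \<in> carrier A" for n by (induction n) (auto simp: y0 ySuc)
  have ys: "star A (y n) = y n" for n
    by (induction n) (auto simp: y0 ySuc star_smult star_add star_mult xs)
  have yn: "nrm A (y n) \<le> r" for n
  proof (induction n)
    case (Suc n)
    have "nrm A (y n \<otimes> y n) \<le> r * r"
      using nrm_mult[of "y n" "y n"] Suc nrm_nonneg[of "y n"] mult_mono[of "nrm A (y n)" r "nrm A (y n)" r] r0 by simp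
    also have "\<dots> \<le> r" using r0 r1 by (simp add: mult_left_le)
    finally have "nrm A (x \<oplus> y n \<otimes> y n) \<le> 2 * r"
      using nrm_triangle[of x "y n \<otimes> y n"] by (simp add: r_def)
    then show ?case by (simp add: ySuc nrm_smult norm_divide)
  qed (simp add: y0 r0)
  have contr: "nrm A (u \<otimes> u \<ominus> v \<otimes> v) \<le> 2 * r * nrm A (u \<ominus> v)"
    if [simp]: "u \<in> carrier A" "v \<in> carrier A" and "nrm A u \<le> r" "nrm A v \<le> r" for u v
  proof -
    \<comment> \<open>This factorisation of a difference of squares does not assume that u and v
      commute.\<close>
    have "u \<otimes> u \<ominus> v \<otimes> v = u \<otimes> (u \<ominus> v) \<oplus> (u \<ominus> v) \<otimes> v"
      using that(1,2) by algebra
    then have "nrm A (u \<otimes> u \<ominus> v \<otimes> v) \<le> nrm A (u \<otimes> (u \<ominus> v)) + nrm A ((u \<ominus> v) \<otimes> v)"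
      by (simp add: nrm_triangle)
    also have "\<dots> \<le> r * nrm A (u \<ominus> v) + nrm A (u \<ominus> v) * r"
      by (intro add_mono order_trans[OF nrm_mult] mult_mono) (use that r0 in \<open>auto simp: nrm_nonneg\<close>)
    finally show ?thesis by (simp add: algebra_simps)
  qed
  have step: "nrm A (y (Suc (Suc n)) \<ominus> y (Suc n)) \<le> r * nrm A (y (Suc n) \<ominus> y n)" for n
  proof -
    have "y (Suc (Suc n)) \<ominus> y (Suc n) = (1/2) \<odot> (y (Suc n) \<otimes> y (Suc n) \<ominus> y n \<otimes> y n)"
      by (subst (1 2) ySuc) (simp add: smult_minus_right[symmetric] add_minus_add)
    then show ?thesis using contr[of "y (Suc n)" "y n"] yn
      by (simp add: nrm_smult norm_divide)
  qed
  have geo: "nrm A (y (Suc n) \<ominus> y n) \<le> r ^ n" for n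
  proof (induction n)
    case 0 then show ?case using yn[of "Suc 0"] r1 by (simp add: y0 a_minus_def)
  next
    case (Suc n) then show ?case using step[of n] r0 mult_left_mono[OF Suc r0] by simp
  qed
  \<comment> \<open>Tail of the geometric series with ratio r; it makes the iterates a Cauchy
    sequence.\<close>
  have tele: "nrm A (y (m + k) \<ominus> y m) \<le> r ^ m * (1 / (1 - r))" for m k
  proof -
    have "nrm A (y (m + k) \<ominus> y m) \<le> (\<Sum>i<k. r ^ (m + i))"
    proof (induction k)
      case (Suc k)
      show ?case using nrm_triangle3[of "y (m + Suc k)" "y (m + k)" "y m"] geo[of "m + k"] Suc by simp
    qed (simp add: a_minus_def add_minus_self)
    also have "\<dots> = r ^ m * (\<Sum>i<k. r ^ i)" by (simp add: power_add sum_distrib_left)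
    also have "\<dots> \<le> r ^ m * (1 / (1 - r))"
      using r0 r1 by (intro mult_left_mono) (auto simp: sum_gp_strict divide_simps)
    finally show ?thesis .
  qed
  have lim0: "(\<lambda>m. r ^ m * (1 / (1 - r))) \<longlonglongrightarrow> 0"
    using r0 r1 by (auto intro!: tendsto_eq_intros LIMSEQ_power_zero)
  have "\<exists>l\<in>carrier A. (\<lambda>n. nrm A (y n \<ominus> l)) \<longlonglongrightarrow> 0"
  proof (rule complete)
    fix e :: real assume "e > 0"
    then obtain N where N: "\<And>m. m \<ge> N \<Longrightarrow> r ^ m * (1 / (1 - r)) < e"
      using order_tendstoD(2)[OF lim0] by (auto simp: eventually_sequentially)
    have "nrm A (y m \<ominus> y n) < e" if "m \<ge> N" "n \<ge> N" for m n
    proof (cases "m \<le> n")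
      case True
      then show ?thesis using tele[of m "n - m"] N[OF that(1)] nrm_minus_commute[of "y m" "y n"] by simp
    next
      case False
      then show ?thesis using tele[of n "m - n"] N[OF that(2)] by simp
    qed
    then show "\<exists>N. \<forall>m\<ge>N. \<forall>n\<ge>N. nrm A (y m \<ominus> y n) < e" by blast
  qed auto
  then obtain l where l [simp]: "l \<in> carrier A" and lim: "(\<lambda>n. nrm A (y n \<ominus> l)) \<longlonglongrightarrow> 0" by blast
  have nl: "nrm A l \<le> r"
  proof (rule LIMSEQ_le_const)
    show "(\<lambda>n. r + nrm A (y n \<ominus> l)) \<longlonglongrightarrow> r" using tendsto_add[OF tendsto_const lim, of r] by simp
    have "nrm A l \<le> r + nrm A (y n \<ominus> l)" for n
      using nrm_le_add_minus[of l "y n"] nrm_minus_commute[of l "y n"] yn[of n] by simp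
    then show "\<exists>N. \<forall>n\<ge>N. nrm A l \<le> r + nrm A (y n \<ominus> l)" by blast
  qed
  have ls: "star A l = l"
  proof -
    have "nrm A (star A l \<ominus> l) \<le> 0"
    proof (rule LIMSEQ_le_const)
      show "(\<lambda>n. 2 * nrm A (y n \<ominus> l)) \<longlonglongrightarrow> 0" using tendsto_mult_right_zero[OF lim, of 2] by simp
      have "nrm A (star A l \<ominus> l) \<le> 2 * nrm A (y n \<ominus> l)" for n
        using nrm_triangle3[of "star A l" "y n" l] nrm_star[of "l \<ominus> y n"] nrm_minus_commute[of l "y n"]
        by (simp add: star_minus ys)
      then show "\<exists>N. \<forall>n\<ge>N. nrm A (star A l \<ominus> l) \<le> 2 * nrm A (y n \<ominus> l)" by blast
    qed
    then have "star A l \<ominus> l = \<zero>"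
      using nrm_eq_0[of "star A l \<ominus> l"] nrm_nonneg[of "star A l \<ominus> l"] by simp
    then show ?thesis by simp
  qed
  \<comment> \<open>Both \<open>l\<close> and its image are compared with \<open>y (Suc n)\<close>,
    which is the image of \<open>y n\<close>.\<close>
  have fixp: "l = (1/2) \<odot> (x \<oplus> l \<otimes> l)"
  proof -
    let ?g = "(1/2) \<odot> (x \<oplus> l \<otimes> l)"
    have "nrm A (l \<ominus> ?g) \<le> 0"
    proof (rule LIMSEQ_le_const)
      show "(\<lambda>n. nrm A (y (Suc n) \<ominus> l) + nrm A (y n \<ominus> l)) \<longlonglongrightarrow> 0"
        using tendsto_add[OF LIMSEQ_Suc[OF lim] lim] by simp
      have "nrm A (l \<ominus> ?g) \<le> nrm A (y (Suc n) \<ominus> l) + nrm A (y n \<ominus> l)" for n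
      proof -
        have "y (Suc n) \<ominus> ?g = (1/2) \<odot> (y n \<otimes> y n \<ominus> l \<otimes> l)"
          by (simp add: ySuc smult_minus_right[symmetric] add_minus_add)
        then have "nrm A (y (Suc n) \<ominus> ?g) = nrm A (y n \<otimes> y n \<ominus> l \<otimes> l) / 2"
          by (simp add: nrm_smult norm_divide)
        also have "\<dots> \<le> r * nrm A (y n \<ominus> l)" using contr[of "y n" l] yn nl by simp
        also have "\<dots> \<le> nrm A (y n \<ominus> l)"
          using r0 r1 nrm_nonneg[of "y n \<ominus> l"] by (simp add: mult_left_le_one_le)
        finally show ?thesis
          using nrm_triangle3[of l "y (Suc n)" ?g] nrm_minus_commute[of l "y (Suc n)"] by simp
      qed
      then show "\<exists>N. \<forall>n\<ge>N. nrm A (l \<ominus> ?g) \<le> nrm A (y (Suc n) \<ominus> l) + nrm A (y n \<ominus> l)" by blast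
    qed
    then have "l \<ominus> ?g = \<zero>"
      using nrm_eq_0[of "l \<ominus> ?g"] nrm_nonneg[of "l \<ominus> ?g"] by simp
    then show ?thesis by simp
  qed
  \<comment> \<open>The fixed point equation in the form \<open>2 l = x + l^2\<close>: it turns
    \<open>(1 - l)^2 = 1 - 2 l + l^2\<close> into \<open>1 - x\<close>, so the root is
    \<open>1 - l\<close>.\<close>
  have two: "l \<oplus> l = x \<oplus> l \<otimes> l"
  proof -
    have "l \<oplus> l = 2 \<odot> l" using smult_add_left[OF l, of 1 1] by simp
    also have "\<dots> = 2 \<odot> ((1/2) \<odot> (x \<oplus> l \<otimes> l))" using fixp by simp
    also have "\<dots> = x \<oplus> l \<otimes> l" by (simp add: smult_smult)
    finally show ?thesis .
  qed
  show thesis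
  proof
    show "\<one> \<ominus> l \<in> sa A" by (simp add: sa_def star_minus ls)
    have "(\<one> \<ominus> l) \<otimes> (\<one> \<ominus> l) = \<one> \<ominus> (l \<oplus> l) \<oplus> l \<otimes> l"
      by (simp add: a_minus_def mult_add_left mult_add_right mult_uminus_left mult_uminus_right uminus_add add_assoc)
    also have "\<dots> = \<one> \<ominus> x" unfolding two by (simp add: a_minus_def add_assoc uminus_add minus_add_self)
    finally show "\<one> \<ominus> x = (\<one> \<ominus> l) \<otimes> (\<one> \<ominus> l)" by simp
  qed
qed

end

text \<open>The discriminant argument behind every Cauchy-Schwarz inequality below. Taking c
  proportional to the conjugate of z leaves a real quadratic in t, whose value at
  \<open>t = 1 / q\<close> is the claim. The signs of p and q are derived, so the lemma applies to
  forms whose positivity is only known through the quadratic.\<close>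

lemma complex_quadratic_nonneg_imp:
  fixes p q :: real and z :: complex
  assumes "\<And>c. 0 \<le> p + 2 * Re (c * z) + (cmod c)\<^sup>2 * q"
  shows "(cmod z)\<^sup>2 \<le> p * q"
proof -
  have *: "0 \<le> p - 2 * t * (cmod z)\<^sup>2 + t\<^sup>2 * (cmod z)\<^sup>2 * q" for t
  proof -
    have "Re (cnj z * z) = (cmod z)\<^sup>2" by (simp add: cmod_power2) (simp add: power2_eq_square)
    then show ?thesis using assms[of "- of_real t * cnj z"]
      by (simp add: norm_mult power_mult_distrib mult.assoc)
  qed
  have p: "0 \<le> p" using assms[of 0] by simp
  show ?thesis
  proof (cases "q = 0")
    case True
    \<comment> \<open>With \<open>q = 0\<close> the expression is affine in t; the value of t used
      here would make it equal to -1.\<close>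
    have "cmod z = 0"
    proof (rule ccontr)
      assume "cmod z \<noteq> 0"
      then show False using *[of "(p + 1) / (2 * (cmod z)\<^sup>2)"] True by (simp add: divide_simps)
    qed
    then show ?thesis using True by simp
  next
    case False
    have q: "0 < q"
    proof (rule ccontr)
      assume "\<not> 0 < q"
      then have "q < 0" using False by simp
      \<comment> \<open>Chosen so that \<open>t q = q - (p + 2 |z| + 1)\<close>, which outweighs
        \<open>p + 2 |z|\<close>; the final summand 1 ensures \<open>t >= 1\<close>, needed for
        \<open>p <= t p\<close>.\<close>
      define t where "t = (p + 2 * cmod z + 1) / (-q) + 1"
      have t: "t \<ge> 1" using p \<open>q < 0\<close> by (simp add: t_def divide_nonneg_neg field_simps)
      have "0 \<le> p + 2 * Re (of_real t * z) + t\<^sup>2 * q" using assms[of "of_real t"] by simp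
      also have "\<dots> \<le> t * p + 2 * t * cmod z + t\<^sup>2 * q"
      proof -
        have "p \<le> t * p" using p t by (simp add: mult_le_cancel_right1)
        moreover have "2 * Re (of_real t * z) \<le> 2 * t * cmod z" using t complex_Re_le_cmod[of z] by simp
        ultimately show ?thesis by linarith
      qed
      also have "\<dots> = t * (p + 2 * cmod z + t * q)" by (simp add: algebra_simps power2_eq_square)
      also have "t * q = - (p + 2 * cmod z + 1) + q" using \<open>q < 0\<close> by (simp add: t_def field_simps)
      finally have "0 \<le> t * (q - 1)" by (simp add: algebra_simps)
      then show False using t \<open>q < 0\<close> by (simp add: zero_le_mult_iff)
    qed
    show ?thesis using *[of "1 / q"] q by (simp add: field_simps power2_eq_square)
  qed
qed

section \<open>Positive functionals: Cauchy-Schwarz and boundedness\<close>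

context unital_cstar_algebra
begin

lemmas add_lcomm = abelian_monoid.a_lcomm[OF is_abelian_monoid]
lemmas mult_assoc = monoid.m_assoc[OF ring.is_monoid[OF is_ring]]

context
  fixes \<phi> assumes \<phi>: "\<phi> \<in> states A"
begin

lemma state_add: "a \<in> carrier A \<Longrightarrow> b \<in> carrier A \<Longrightarrow> \<phi> (a \<oplus> b) = \<phi> a + \<phi> b"
  using \<phi> by (simp add: states_def)

lemma state_smult: "a \<in> carrier A \<Longrightarrow> \<phi> (c \<odot> a) = c * \<phi> a"
  using \<phi> by (simp add: states_def)

lemma state_one: "\<phi> \<one> = 1"
  using \<phi> by (simp add: states_def)

lemma state_pos: "a \<in> carrier A \<Longrightarrow> \<phi> (star A a \<otimes> a) \<in> \<real>\<^sub>\<ge>\<^sub>0"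
  using \<phi> by (simp add: states_def)

lemma state_zero: "\<phi> \<zero> = 0"
  using state_smult[of \<zero> 0] by simp

lemma state_minus: "a \<in> carrier A \<Longrightarrow> b \<in> carrier A \<Longrightarrow> \<phi> (a \<ominus> b) = \<phi> a - \<phi> b"
  by (simp add: minus_smult state_add state_smult)

lemma state_expand:
  assumes [simp]: "a \<in> carrier A" "b \<in> carrier A"
  shows "\<phi> (star A (a \<oplus> c \<odot> b) \<otimes> (a \<oplus> c \<odot> b)) =
    \<phi> (star A a \<otimes> a) + c * \<phi> (star A a \<otimes> b) + cnj c * \<phi> (star A b \<otimes> a)
    + c * cnj c * \<phi> (star A b \<otimes> b)"
proof -
  have "star A (a \<oplus> c \<odot> b) \<otimes> (a \<oplus> c \<odot> b) =
    (star A a \<otimes> a \<oplus> c \<odot> (star A a \<otimes> b)) \<oplus>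
    (cnj c \<odot> (star A b \<otimes> a) \<oplus> (c * cnj c) \<odot> (star A b \<otimes> b))"
    by (simp add: star_add star_smult mult_add_left mult_add_right smult_mult_left
        smult_mult_right smult_smult smult_add_right add_assoc mult.commute)
      (rule add_lcomm; simp)
  then show ?thesis by (simp add: state_add state_smult)
qed

text \<open>Positivity makes all diagonal values real, so the two cross terms of
  \<open>state_expand\<close> have a real sum for every scalar c. The choices \<open>c = 1\<close>
  and \<open>c = \<i>\<close> give the imaginary and the real part of the identity.\<close>

lemma state_cnj_mult:
  assumes [simp]: "a \<in> carrier A" "b \<in> carrier A"
  shows "\<phi> (star A b \<otimes> a) = cnj (\<phi> (star A a \<otimes> b))"
proof -
  have im: "Im (\<phi> (star A x \<otimes> x)) = 0" if "x \<in> carrier A" for x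
    using state_pos[OF that] by (auto simp: nonneg_Reals_def complex_nonneg_Reals_iff)
  have "Im (c * \<phi> (star A a \<otimes> b) + cnj c * \<phi> (star A b \<otimes> a)) = 0" for c
  proof -
    have "Im (c * cnj c * \<phi> (star A b \<otimes> b)) = 0"
      using im[of b] by (simp add: complex_mult_cnj)
    then show ?thesis
      using im[of "a \<oplus> c \<odot> b"] im[of a] unfolding state_expand[OF assms] by auto
  qed
  from this[of 1] this[of \<i>] show ?thesis by (simp add: complex_eq_iff)
qed

lemma state_star: "a \<in> carrier A \<Longrightarrow> \<phi> (star A a) = cnj (\<phi> a)"
  using state_cnj_mult[of \<one> a] by simp

lemma state_self:
  assumes "a \<in> carrier A"
  shows "\<phi> (star A a \<otimes> a) = of_real (Re (\<phi> (star A a \<otimes> a)))" "0 \<le> Re (\<phi> (star A a \<otimes> a))"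
  using state_pos[OF assms] by (auto simp: complex_nonneg_Reals_iff complex_eq_iff)

lemma trace_norm_nonneg [simp]: "0 \<le> trace_norm A \<phi> a"
  if "a \<in> carrier A" using state_self(2)[OF that] by (simp add: trace_norm_def)

lemma trace_norm_power2: "a \<in> carrier A \<Longrightarrow> (trace_norm A \<phi> a)\<^sup>2 = Re (\<phi> (star A a \<otimes> a))"
  using state_self(2) by (simp add: trace_norm_def)

lemma state_self_eq: "a \<in> carrier A \<Longrightarrow> \<phi> (star A a \<otimes> a) = of_real ((trace_norm A \<phi> a)\<^sup>2)"
  using state_self(1) trace_norm_power2 by metis

lemma state_Cauchy_Schwarz:
  assumes [simp]: "a \<in> carrier A" "b \<in> carrier A"
  shows "cmod (\<phi> (star A b \<otimes> a)) \<le> trace_norm A \<phi> a * trace_norm A \<phi> b"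
proof -
  have "(cmod (\<phi> (star A a \<otimes> b)))\<^sup>2 \<le> (trace_norm A \<phi> a)\<^sup>2 * (trace_norm A \<phi> b)\<^sup>2"
  proof (rule complex_quadratic_nonneg_imp)
    fix c
    have "0 \<le> Re (\<phi> (star A (a \<oplus> c \<odot> b) \<otimes> (a \<oplus> c \<odot> b)))" by (rule state_self) simp
    also have "\<dots> = (trace_norm A \<phi> a)\<^sup>2 + 2 * Re (c * \<phi> (star A a \<otimes> b)) + (cmod c)\<^sup>2 * (trace_norm A \<phi> b)\<^sup>2"
      unfolding state_expand[OF assms] state_cnj_mult[OF assms] state_self_eq[OF assms(1)] state_self_eq[OF assms(2)]
      by (simp add: complex_mult_cnj cmod_power2 del: of_real_power)
    finally show "0 \<le> \<dots>" .
  qed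
  then have "cmod (\<phi> (star A a \<otimes> b)) \<le> trace_norm A \<phi> a * trace_norm A \<phi> b"
    unfolding power_mult_distrib[symmetric] by (rule power2_le_imp_le) simp
  then show ?thesis unfolding state_cnj_mult[OF assms] by simp
qed

text \<open>Boundedness is not part of the definition of a state; it follows from positivity. If y
  is self-adjoint with \<open>||y|| < 1\<close>, then \<open>1 - y\<close> is the square of a
  self-adjoint element, so \<phi> is nonnegative on it and \<open>\<phi> y <= 1\<close>. Scaling x
  by \<open>1 / (||x|| + e)\<close> with either sign and letting e tend to 0 gives the
  bound.\<close>

lemma state_sa_bound:
  assumes "x \<in> sa A" shows "cmod (\<phi> x) \<le> nrm A x"
proof -
  have xc [simp]: "x \<in> carrier A" and xs: "star A x = x" using assms by (auto simp: sa_def)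
  have real: "\<phi> x = of_real (Re (\<phi> x))" using state_star[of x] xs by (simp add: complex_eq_iff)
  have le: "Re (\<phi> y) \<le> 1" if y: "y \<in> sa A" "nrm A y < 1" for y
  proof -
    obtain b where b: "b \<in> sa A" "\<one> \<ominus> y = b \<otimes> b" using one_minus_sa_square[OF y] .
    then have "0 \<le> Re (\<phi> (\<one> \<ominus> y))" using state_self(2)[of b] by (simp add: sa_def)
    then show ?thesis using y by (simp add: state_minus state_one sa_def)
  qed
  have "s * Re (\<phi> x) \<le> nrm A x + e" if "e > 0" "\<bar>s\<bar> = 1" for e s :: real
  proof -
    define t where "t = s / (nrm A x + e)"
    have n0: "0 \<le> nrm A x" by (simp add: nrm_nonneg)
    have "of_real t \<odot> x \<in> sa A" by (simp add: sa_def star_smult xs)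
    moreover have "nrm A (of_real t \<odot> x) = \<bar>t\<bar> * nrm A x" by (simp add: nrm_smult)
    moreover have "\<bar>t\<bar> * nrm A x < 1" using that n0 by (simp add: t_def field_simps)
    ultimately have "Re (\<phi> (of_real t \<odot> x)) \<le> 1" using le by simp
    then have "t * Re (\<phi> x) \<le> 1" by (simp add: state_smult)
    then show ?thesis using that n0 by (simp add: t_def field_simps)
  qed
  from this[of _ 1] this[of _ "-1"] have "\<bar>Re (\<phi> x)\<bar> \<le> nrm A x + e" if "e > 0" for e
    using that by (auto simp: abs_le_iff)
  then have "\<bar>Re (\<phi> x)\<bar> \<le> nrm A x" by (rule field_le_epsilon)
  then show ?thesis using real by (metis norm_of_real)
qed

lemma trace_norm_le_nrm:
  assumes [simp]: "a \<in> carrier A" shows "trace_norm A \<phi> a \<le> nrm A a"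
proof -
  have "star A a \<otimes> a \<in> sa A" by (simp add: sa_def star_mult)
  from state_sa_bound[OF this] have "Re (\<phi> (star A a \<otimes> a)) \<le> (nrm A a)\<^sup>2"
    using complex_Re_le_cmod[of "\<phi> (star A a \<otimes> a)"] by (simp add: cstar_identity)
  then show ?thesis
    unfolding trace_norm_power2[OF assms, symmetric] by (rule power2_le_imp_le) (simp add: nrm_nonneg)
qed

lemma trace_norm_one [simp]: "trace_norm A \<phi> \<one> = 1"
  by (simp add: trace_norm_def state_one)

lemma state_bound:
  assumes [simp]: "a \<in> carrier A" shows "cmod (\<phi> a) \<le> nrm A a"
  using state_Cauchy_Schwarz[of a \<one>] trace_norm_le_nrm[of a] by simp

lemma trace_norm_smult: "a \<in> carrier A \<Longrightarrow> trace_norm A \<phi> (c \<odot> a) = cmod c * trace_norm A \<phi> a"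
proof -
  assume [simp]: "a \<in> carrier A"
  have "\<phi> (star A (c \<odot> a) \<otimes> (c \<odot> a)) = of_real ((cmod c)\<^sup>2) * \<phi> (star A a \<otimes> a)"
    by (simp add: star_smult smult_mult_left smult_mult_right smult_smult state_smult complex_norm_square mult.commute del: of_real_power)
  then show ?thesis by (simp add: trace_norm_def real_sqrt_mult)
qed

lemma trace_norm_zero [simp]: "trace_norm A \<phi> \<zero> = 0"
  by (simp add: trace_norm_def state_zero)

lemma trace_norm_triangle:
  assumes [simp]: "a \<in> carrier A" "b \<in> carrier A"
  shows "trace_norm A \<phi> (a \<oplus> b) \<le> trace_norm A \<phi> a + trace_norm A \<phi> b"
proof -
  have "(trace_norm A \<phi> (a \<oplus> b))\<^sup>2 =
    (trace_norm A \<phi> a)\<^sup>2 + 2 * Re (\<phi> (star A a \<otimes> b)) + (trace_norm A \<phi> b)\<^sup>2"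
    using state_expand[OF assms, of 1] state_cnj_mult[OF assms]
    by (simp add: trace_norm_power2)
  also have "\<dots> \<le> (trace_norm A \<phi> a)\<^sup>2 + 2 * (trace_norm A \<phi> a * trace_norm A \<phi> b) + (trace_norm A \<phi> b)\<^sup>2"
    using state_Cauchy_Schwarz[of b a] complex_Re_le_cmod[of "\<phi> (star A a \<otimes> b)"] by (simp add: mult.commute)
  also have "\<dots> = (trace_norm A \<phi> a + trace_norm A \<phi> b)\<^sup>2" by (simp add: power2_eq_square algebra_simps)
  finally show ?thesis by (rule power2_le_imp_le) simp
qed

lemma trace_norm_triangle_minus:
  "a \<in> carrier A \<Longrightarrow> b \<in> carrier A \<Longrightarrow> trace_norm A \<phi> (a \<ominus> b) \<le> trace_norm A \<phi> a + trace_norm A \<phi> b"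
  using trace_norm_triangle[of a "(- 1) \<odot> b"] by (simp add: minus_smult trace_norm_smult)

lemma trace_norm_minus_commute:
  assumes [simp]: "x \<in> carrier A" "y \<in> carrier A"
  shows "trace_norm A \<phi> (x \<ominus> y) = trace_norm A \<phi> (y \<ominus> x)"
proof -
  have "x \<ominus> y = (- 1) \<odot> (y \<ominus> x)"
    by (simp add: minus_smult smult_add_right smult_smult add_comm[of x])
  then show ?thesis by (simp add: trace_norm_smult)
qed

lemma trace_norm_triangle3:
  assumes "x \<in> carrier A" "y \<in> carrier A" "z \<in> carrier A"
  shows "trace_norm A \<phi> (x \<ominus> z) \<le> trace_norm A \<phi> (x \<ominus> y) + trace_norm A \<phi> (y \<ominus> z)"
proof -
  have "x \<ominus> z = (x \<ominus> y) \<oplus> (y \<ominus> z)" using assms by algebra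
  then show ?thesis using assms by (simp add: trace_norm_triangle)
qed

lemma trace_norm_diff_le:
  assumes [simp]: "x \<in> carrier A" "y \<in> carrier A"
  shows "\<bar>trace_norm A \<phi> x - trace_norm A \<phi> y\<bar> \<le> trace_norm A \<phi> (x \<ominus> y)"
  using trace_norm_triangle3[of x y \<zero>] trace_norm_triangle3[of y x \<zero>] trace_norm_minus_commute[of x y]
  by (simp add: minus_smult)

text \<open>With \<open>s = ||a||^2 + e\<close> the element \<open>1 - a* a / s\<close> is a square
  \<open>c c\<close> with c self-adjoint, and positivity of \<phi> at \<open>(c b)* (c b)\<close> is
  the inequality with \<open>||a||^2 + e\<close> in place of \<open>||a||^2\<close>. It says that
  the GNS operators are bounded by the norm.\<close>

lemma trace_norm_mult_le:
  assumes [simp]: "a \<in> carrier A" "b \<in> carrier A"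
  shows "trace_norm A \<phi> (a \<otimes> b) \<le> nrm A a * trace_norm A \<phi> b"
proof -
  have n0: "0 \<le> nrm A a" by (simp add: nrm_nonneg)
  have *: "(trace_norm A \<phi> (a \<otimes> b))\<^sup>2 \<le> ((nrm A a)\<^sup>2 + e) * (trace_norm A \<phi> b)\<^sup>2" if "e > 0" for e
  proof -
    define s where "s = (nrm A a)\<^sup>2 + e"
    have s: "s > 0" using that by (simp add: s_def add_nonneg_pos)
    define x where "x = of_real (1 / s) \<odot> (star A a \<otimes> a)"
    have x: "x \<in> sa A" by (simp add: x_def sa_def star_mult star_smult)
    have "nrm A x = (nrm A a)\<^sup>2 / s" using s by (simp add: x_def nrm_smult cstar_identity norm_divide)
    then have "nrm A x < 1" using s that by (simp add: s_def)
    with x obtain c where c: "c \<in> sa A" "\<one> \<ominus> x = c \<otimes> c" by (rule one_minus_sa_square)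
    have [simp]: "x \<in> carrier A" "c \<in> carrier A" and cs: "star A c = c" using x c by (auto simp: sa_def)
    have "star A (c \<otimes> b) \<otimes> (c \<otimes> b) = star A b \<otimes> ((\<one> \<ominus> x) \<otimes> b)"
      using c by (simp add: star_mult cs mult_assoc)
    also have "\<dots> = star A b \<otimes> b \<ominus> of_real (1 / s) \<odot> (star A (a \<otimes> b) \<otimes> (a \<otimes> b))"
      by (simp add: x_def minus_smult mult_add_left mult_add_right star_mult mult_assoc smult_mult_left smult_mult_right)
    finally have "Re (\<phi> (star A (c \<otimes> b) \<otimes> (c \<otimes> b))) = (trace_norm A \<phi> b)\<^sup>2 - (1 / s) * (trace_norm A \<phi> (a \<otimes> b))\<^sup>2"
      by (simp add: state_minus state_smult trace_norm_power2)
    moreover have cb: "c \<otimes> b \<in> carrier A" by simp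
    ultimately have "(1 / s) * (trace_norm A \<phi> (a \<otimes> b))\<^sup>2 \<le> (trace_norm A \<phi> b)\<^sup>2"
      using state_self(2)[OF cb] by linarith
    then show ?thesis using s by (simp add: field_simps s_def)
  qed
  have "(trace_norm A \<phi> (a \<otimes> b))\<^sup>2 \<le> (nrm A a)\<^sup>2 * (trace_norm A \<phi> b)\<^sup>2"
  proof (rule LIMSEQ_le_const)
    show "(\<lambda>n. ((nrm A a)\<^sup>2 + inverse (real (Suc n))) * (trace_norm A \<phi> b)\<^sup>2) \<longlonglongrightarrow> (nrm A a)\<^sup>2 * (trace_norm A \<phi> b)\<^sup>2"
      using tendsto_mult_right[OF tendsto_add[OF tendsto_const LIMSEQ_inverse_real_of_nat], of "(nrm A a)\<^sup>2" "(trace_norm A \<phi> b)\<^sup>2"]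
      by simp
    show "\<exists>N. \<forall>n\<ge>N. (trace_norm A \<phi> (a \<otimes> b))\<^sup>2 \<le> ((nrm A a)\<^sup>2 + inverse (real (Suc n))) * (trace_norm A \<phi> b)\<^sup>2"
      using * by (metis inverse_positive_iff_positive of_nat_0_less_iff zero_less_Suc)
  qed
  then show ?thesis unfolding power_mult_distrib[symmetric]
    by (rule power2_le_imp_le) (simp add: n0)
qed

end

section \<open>Closed unital star-subalgebras\<close>

definition subalg :: "'a set \<Rightarrow> 'a cstar_algebra" where "subalg S = A\<lparr>carrier := S\<rparr>"

lemma subalg_sel [simp]:
  "carrier (subalg S) = S" "mult (subalg S) = mult A" "one (subalg S) = \<one>"
  "add (subalg S) = add A" "zero (subalg S) = \<zero>" "smult (subalg S) = smult A"
  "star (subalg S) = star A" "nrm (subalg S) = nrm A"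
  by (simp_all add: subalg_def)

context
  fixes S
  assumes sub: "S \<subseteq> carrier A" and S_one: "\<one> \<in> S"
    and S_add: "\<And>x y. x \<in> S \<Longrightarrow> y \<in> S \<Longrightarrow> x \<oplus> y \<in> S"
    and S_mult: "\<And>x y. x \<in> S \<Longrightarrow> y \<in> S \<Longrightarrow> x \<otimes> y \<in> S"
    and S_smult: "\<And>c x. x \<in> S \<Longrightarrow> c \<odot> x \<in> S"
    and S_star: "\<And>x. x \<in> S \<Longrightarrow> star A x \<in> S"
    and S_limit: "\<And>s l. (\<And>n. s n \<in> S) \<Longrightarrow> l \<in> carrier A \<Longrightarrow> (\<lambda>n. nrm A (s n \<ominus> l)) \<longlonglongrightarrow> 0 \<Longrightarrow> l \<in> S"
begin

lemma S_zero: "\<zero> \<in> S" using S_smult[OF S_one, of 0] by simp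
lemma S_carrier: "x \<in> S \<Longrightarrow> x \<in> carrier A" using sub by auto

lemma subalg_abelian_group: "abelian_group (subalg S)"
proof (rule abelian_groupI)
  fix x assume "x \<in> carrier (subalg S)"
  then show "\<exists>y\<in>carrier (subalg S). y \<oplus>\<^bsub>subalg S\<^esub> x = \<zero>\<^bsub>subalg S\<^esub>"
    using S_smult[of x "-1"] S_carrier[of x]
    by (intro bexI[of _ "(- 1) \<odot> x"]) (simp_all add: smult_minus_1 minus_add_self)
qed (auto simp: S_add S_zero S_carrier add_assoc intro: add_comm)

text \<open>Addition is literally shared with A, but the additive inverse is a definite description
  over the carrier and may change with it. Uniqueness of inverses identifies the two
  subtractions.\<close>

lemma subalg_minus: "x \<in> S \<Longrightarrow> y \<in> S \<Longrightarrow> x \<ominus>\<^bsub>subalg S\<^esub> y = x \<ominus> y"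
proof -
  assume x: "x \<in> S" and y: "y \<in> S"
  have "\<ominus>\<^bsub>subalg S\<^esub> y = (- 1) \<odot> y"
    using y S_smult[OF y, of "-1"] S_carrier[OF y]
    by (intro abelian_group.minus_equality[OF subalg_abelian_group]) (simp_all add: smult_minus_1 minus_add_self)
  then show ?thesis using x y S_carrier by (simp add: a_minus_def smult_minus_1)
qed

lemma subalg_cstar: "unital_cstar_algebra (subalg S)"
proof -
  have "ring (subalg S)"
  proof (rule ringI)
    show "Group.monoid (subalg S)"
      by (rule monoidI) (auto simp: S_mult S_one S_carrier mult_assoc)
  qed (auto simp: subalg_abelian_group S_carrier mult_add_left mult_add_right)
  moreover have "Module.module (class_ring :: complex ring) (subalg S)"
    by (rule moduleI)
      (auto simp: subalg_abelian_group class_cring.cring_axioms S_smult S_carrier smult_add_left smult_add_right smult_smult)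
  moreover have "unital_cstar_algebra_axioms (subalg S)"
  proof
    fix s :: "nat \<Rightarrow> 'a"
    assume s: "\<And>n. s n \<in> carrier (subalg S)"
      and C: "\<And>e. e > 0 \<Longrightarrow> \<exists>N. \<forall>m\<ge>N. \<forall>n\<ge>N. nrm (subalg S) (s m \<ominus>\<^bsub>subalg S\<^esub> s n) < e"
    have s': "s n \<in> S" for n using s by simp
    have "\<exists>l\<in>carrier A. (\<lambda>n. nrm A (s n \<ominus> l)) \<longlonglongrightarrow> 0"
      by (rule complete) (use s' S_carrier C in \<open>auto simp: subalg_minus\<close>)
    then obtain l where l: "l \<in> carrier A" "(\<lambda>n. nrm A (s n \<ominus> l)) \<longlonglongrightarrow> 0" by blast
    then have "l \<in> S" using S_limit s' by blast
    then show "\<exists>l\<in>carrier (subalg S). (\<lambda>n. nrm (subalg S) (s n \<ominus>\<^bsub>subalg S\<^esub> l)) \<longlonglongrightarrow> 0"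
      using l s' by (intro bexI[of _ l]) (auto simp: subalg_minus)
  qed (auto simp: S_carrier S_star star_add star_smult star_mult nrm_nonneg nrm_eq_0 nrm_triangle
      nrm_smult nrm_mult cstar_identity smult_mult_left smult_mult_right)
  ultimately show ?thesis by (simp add: unital_cstar_algebra_def)
qed

end
end

context unital_cstar_algebra
begin

lemma minus_self: "x \<in> carrier A \<Longrightarrow> x \<ominus> x = \<zero>"
  by (simp add: a_minus_def add_minus_self)

lemma minus_add_minus:
  assumes [simp]: "a \<in> carrier A" "b \<in> carrier A" "x \<in> carrier A" "y \<in> carrier A"
  shows "(a \<oplus> b) \<ominus> (x \<oplus> y) = (a \<ominus> x) \<oplus> (b \<ominus> y)"
  by (simp add: a_minus_def uminus_add add_assoc add_lcomm[of b])

lemma mult_diff_right: "a \<in> carrier A \<Longrightarrow> x \<in> carrier A \<Longrightarrow> y \<in> carrier A \<Longrightarrow> a \<otimes> x \<ominus> a \<otimes> y = a \<otimes> (x \<ominus> y)"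
  by (simp add: minus_smult mult_add_right smult_mult_right)

lemma mult_diff_left: "a \<in> carrier A \<Longrightarrow> x \<in> carrier A \<Longrightarrow> y \<in> carrier A \<Longrightarrow> x \<otimes> a \<ominus> y \<otimes> a = (x \<ominus> y) \<otimes> a"
  by (simp add: minus_smult mult_add_left smult_mult_left)

lemma nrm_mult_diff:
  assumes [simp]: "a \<in> carrier A" "b \<in> carrier A" "x \<in> carrier A" "y \<in> carrier A"
  shows "nrm A (a \<otimes> b \<ominus> x \<otimes> y) \<le> nrm A (a \<ominus> x) * nrm A b + nrm A x * nrm A (b \<ominus> y)"
proof -
  have "nrm A (a \<otimes> b \<ominus> x \<otimes> y) \<le> nrm A (a \<otimes> b \<ominus> x \<otimes> b) + nrm A (x \<otimes> b \<ominus> x \<otimes> y)"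
    by (rule nrm_triangle3) auto
  also have "\<dots> \<le> nrm A (a \<ominus> x) * nrm A b + nrm A x * nrm A (b \<ominus> y)"
    unfolding mult_diff_left[OF assms(2,1,3)] mult_diff_right[OF assms(3,2,4)]
    by (intro add_mono nrm_mult) auto
  finally show ?thesis .
qed

lemma eqI_nrm: "x \<in> carrier A \<Longrightarrow> y \<in> carrier A \<Longrightarrow> nrm A (x \<ominus> y) = 0 \<Longrightarrow> x = y"
  using nrm_eq_0[of "x \<ominus> y"] by simp

end

text \<open>Operations on the quotients are encoded as unions over representatives; such a union
  collapses to one class once its members are shown to agree.\<close>

lemma UN_eqI: "x0 \<in> X \<Longrightarrow> (\<And>x. x \<in> X \<Longrightarrow> f x = S) \<Longrightarrow> (\<Union>x\<in>X. f x) = S"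
  by auto

lemma null_le_add:
  fixes f g h :: "nat \<Rightarrow> real"
  assumes "g \<longlonglongrightarrow> 0" "h \<longlonglongrightarrow> 0" "\<And>n. 0 \<le> f n" "\<And>n. f n \<le> g n + h n"
  shows "f \<longlonglongrightarrow> 0"
  by (rule Lim_null_comparison[OF _ tendsto_add_zero[OF assms(1,2)]]) (simp add: assms)

section \<open>The weak* topology of the state space\<close>

context unital_cstar_algebra
begin

lemma states_extensional: "\<phi> \<in> states A \<Longrightarrow> \<phi> \<in> extensional (carrier A)"
  by (simp add: states_def)

lemma topspace_weak_star: "topspace (weak_star_topology A) = states A"
  by (auto simp: weak_star_topology_def PiE_def states_extensional)

lemma continuous_map_weak_star_eval:
  "a \<in> carrier A \<Longrightarrow> continuous_map (weak_star_topology A) euclidean (\<lambda>\<psi>. \<psi> a)"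
  unfolding weak_star_topology_def
  by (intro continuous_map_from_subtopology continuous_map_product_projection)

lemma openin_weak_star_basic:
  assumes "finite S" "S \<subseteq> carrier A"
  shows "openin (weak_star_topology A) {\<psi> \<in> states A. \<forall>s\<in>S. dist (\<phi> s) (\<psi> s) < e}"
  using assms
proof (induction S)
  case empty
  then show ?case using openin_topspace[of "weak_star_topology A"] by (simp add: topspace_weak_star)
next
  case (insert a S)
  have "openin (weak_star_topology A) {\<psi> \<in> topspace (weak_star_topology A). \<psi> a \<in> ball (\<phi> a) e}"
    using insert.prems by (intro openin_continuous_map_preimage[OF continuous_map_weak_star_eval]) auto
  moreover have "{\<psi> \<in> states A. \<forall>s\<in>insert a S. dist (\<phi> s) (\<psi> s) < e} =
      {\<psi> \<in> topspace (weak_star_topology A). \<psi> a \<in> ball (\<phi> a) e}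
      \<inter> {\<psi> \<in> states A. \<forall>s\<in>S. dist (\<phi> s) (\<psi> s) < e}"
    by (auto simp: topspace_weak_star)
  ultimately show ?case using insert by (simp add: openin_Int)
qed

text \<open>Total boundedness of the Lipschitz ball modulo scalars is Rieffel's criterion.\<close>

lemma metrizes_weak_starI:
  assumes T: "T \<subseteq> carrier A"
    and dense: "\<And>a e. a \<in> carrier A \<Longrightarrow> e > 0 \<Longrightarrow>
      \<exists>s\<in>T. \<exists>t\<in>T. \<exists>c d. nrm A (a \<ominus> (c \<odot> s \<oplus> d \<odot> t)) < e"
    and tb: "\<And>e. e > 0 \<Longrightarrow>
      \<exists>S. finite S \<and> S \<subseteq> carrier A \<and> (\<forall>t\<in>T. \<exists>s\<in>S. \<exists>c. nrm A (t \<ominus> (s \<oplus> c \<odot> \<one>)) < e)"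
  shows "metrizes_weak_star A (mk T)"
proof -
  define d where "d \<phi> \<psi> = enn2real (mk T \<phi> \<psi>)" for \<phi> \<psi>
  \<comment> \<open>States agree on scalars, so the multiple of the unit drops out of
    \<open>\<phi> t - \<psi> t\<close>; this is why nets modulo scalars suffice.\<close>
  have approx: "cmod (\<phi> t - \<psi> t) \<le> cmod (\<phi> s - \<psi> s) + 2 * e"
    if "\<phi> \<in> states A" "\<psi> \<in> states A" and [simp]: "t \<in> carrier A" "s \<in> carrier A"
      and "nrm A (t \<ominus> (s \<oplus> c \<odot> \<one>)) < e" for \<phi> \<psi> t s c e
  proof -
    have 1: "cmod (\<xi> t - \<xi> s - c) \<le> e" if "\<xi> \<in> states A" for \<xi>
      using state_bound[OF that, of "t \<ominus> (s \<oplus> c \<odot> \<one>)"] \<open>nrm A _ < e\<close>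
      by (simp add: state_minus[OF that] state_add[OF that] state_smult[OF that] state_one[OF that] diff_diff_add)
    have "\<phi> t - \<psi> t = (\<phi> s - \<psi> s) + ((\<phi> t - \<phi> s - c) - (\<psi> t - \<psi> s - c))" by simp
    then have "cmod (\<phi> t - \<psi> t) \<le> cmod (\<phi> s - \<psi> s) + cmod ((\<phi> t - \<phi> s - c) - (\<psi> t - \<psi> s - c))"
      by (metis norm_triangle_ineq)
    also have "cmod ((\<phi> t - \<phi> s - c) - (\<psi> t - \<psi> s - c)) \<le> e + e"
      using 1[OF that(1)] 1[OF that(2)] norm_triangle_ineq4[of "\<phi> t - \<phi> s - c" "\<psi> t - \<psi> s - c"] by linarith
    finally show ?thesis by simp
  qed
  have mk_le: "mk T \<phi> \<psi> \<le> ennreal r" if "\<And>t. t \<in> T \<Longrightarrow> cmod (\<phi> t - \<psi> t) \<le> r" for \<phi> \<psi> r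
    unfolding mk_def using that by (intro SUP_least ennreal_leI)
  have fin: "mk T \<phi> \<psi> < \<infinity>" if \<phi>: "\<phi> \<in> states A" and \<psi>: "\<psi> \<in> states A" for \<phi> \<psi>
  proof -
    obtain S where S: "finite S" "S \<subseteq> carrier A" "\<forall>t\<in>T. \<exists>s\<in>S. \<exists>c. nrm A (t \<ominus> (s \<oplus> c \<odot> \<one>)) < 1"
      using tb[of 1] by auto
    have "mk T \<phi> \<psi> \<le> ennreal ((\<Sum>s\<in>S. cmod (\<phi> s - \<psi> s)) + 2)"
    proof (rule mk_le)
      fix t assume t: "t \<in> T"
      then obtain s c where s: "s \<in> S" "nrm A (t \<ominus> (s \<oplus> c \<odot> \<one>)) < 1" using S by blast
      have "cmod (\<phi> t - \<psi> t) \<le> cmod (\<phi> s - \<psi> s) + 2 * 1"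
        using approx[OF \<phi> \<psi> _ _ s(2)] t T S s by auto
      also have "cmod (\<phi> s - \<psi> s) \<le> (\<Sum>s\<in>S. cmod (\<phi> s - \<psi> s))"
        using S s by (intro member_le_sum) auto
      finally show "cmod (\<phi> t - \<psi> t) \<le> (\<Sum>s\<in>S. cmod (\<phi> s - \<psi> s)) + 2" by simp
    qed
    also have "\<dots> < \<infinity>" by simp
    finally show ?thesis .
  qed
  have le_d: "cmod (\<phi> t - \<psi> t) \<le> d \<phi> \<psi>" if "\<phi> \<in> states A" "\<psi> \<in> states A" "t \<in> T" for \<phi> \<psi> t
  proof -
    have "ennreal (cmod (\<phi> t - \<psi> t)) \<le> mk T \<phi> \<psi>" unfolding mk_def using that by (intro SUP_upper)
    then show ?thesis unfolding d_def using fin[OF that(1,2)]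
      by (metis enn2real_mono enn2real_ennreal infinity_ennreal_def norm_ge_zero)
  qed
  have d_le: "d \<phi> \<psi> \<le> r" if "\<And>t. t \<in> T \<Longrightarrow> cmod (\<phi> t - \<psi> t) \<le> r" "0 \<le> r" for \<phi> \<psi> r
    unfolding d_def using mk_le[OF that(1)] that(2) by (simp add: enn2real_leI)
  have d0: "0 \<le> d \<phi> \<psi>" for \<phi> \<psi> by (simp add: d_def)
  \<comment> \<open>Two elements of T span an approximation of a, one for the real and one for the
    imaginary part when T is self-adjoint. The estimate serves twice: \<open>d = 0\<close> separates
    states, and evaluations are continuous for d.\<close>
  have eval: "\<exists>K>0. \<forall>\<psi>\<in>states A. cmod (\<phi> a - \<psi> a) \<le> e + K * d \<phi> \<psi>"
    if \<phi>: "\<phi> \<in> states A" and a [simp]: "a \<in> carrier A" and e: "e > 0" for \<phi> a e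
  proof -
    obtain s t p q where st: "s \<in> T" "t \<in> T" and n: "nrm A (a \<ominus> (p \<odot> s \<oplus> q \<odot> t)) < e / 2"
      using dense[OF a, of "e / 2"] e by auto
    have [simp]: "s \<in> carrier A" "t \<in> carrier A" using st T by auto
    have "cmod (\<phi> a - \<psi> a) \<le> e + (1 + cmod p + cmod q) * d \<phi> \<psi>" if \<psi>: "\<psi> \<in> states A" for \<psi>
    proof -
      have 1: "cmod (\<xi> a - (p * \<xi> s + q * \<xi> t)) \<le> e / 2" if "\<xi> \<in> states A" for \<xi>
        using state_bound[OF that, of "a \<ominus> (p \<odot> s \<oplus> q \<odot> t)"] n
        by (simp add: state_minus[OF that] state_add[OF that] state_smult[OF that])
      have "\<phi> a - \<psi> a = (\<phi> a - (p * \<phi> s + q * \<phi> t)) - (\<psi> a - (p * \<psi> s + q * \<psi> t))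
         + (p * (\<phi> s - \<psi> s) + q * (\<phi> t - \<psi> t))" by (simp add: algebra_simps)
      then have "cmod (\<phi> a - \<psi> a) \<le> cmod (\<phi> a - (p * \<phi> s + q * \<phi> t)) + cmod (\<psi> a - (p * \<psi> s + q * \<psi> t))
         + (cmod (p * (\<phi> s - \<psi> s)) + cmod (q * (\<phi> t - \<psi> t)))"
        by (smt (verit) norm_triangle_ineq norm_triangle_ineq4)
      also have "\<dots> \<le> e / 2 + e / 2 + (cmod p * d \<phi> \<psi> + cmod q * d \<phi> \<psi>)"
        by (intro add_mono 1 \<phi> \<psi>) (auto simp: norm_mult intro!: mult_left_mono le_d \<phi> \<psi> st)
      finally show ?thesis using d0[of \<phi> \<psi>] by (simp add: algebra_simps)
    qed
    then show ?thesis by (intro exI[of _ "1 + cmod p + cmod q"]) (auto simp: add_pos_nonneg)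
  qed
  have comm: "d \<phi> \<psi> = d \<psi> \<phi>" for \<phi> \<psi> by (simp add: d_def mk_def norm_minus_commute)
  interpret M: Metric_space "states A" d
  proof
    show "d \<phi> \<psi> = 0 \<longleftrightarrow> \<phi> = \<psi>" if \<phi>: "\<phi> \<in> states A" and \<psi>: "\<psi> \<in> states A" for \<phi> \<psi>
    proof
      assume z: "d \<phi> \<psi> = 0"
      have "\<phi> a = \<psi> a" if "a \<in> carrier A" for a
      proof -
        have "cmod (\<phi> a - \<psi> a) \<le> 0 + e" if "e > 0" for e
          using eval[OF \<phi> \<open>a \<in> carrier A\<close> that] \<psi> z by auto
        then have "cmod (\<phi> a - \<psi> a) \<le> 0" by (rule field_le_epsilon)
        then show ?thesis by simp
      qed
      then show "\<phi> = \<psi>"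
        using states_extensional[OF \<phi>] states_extensional[OF \<psi>] by (metis extensionalityI)
    next
      assume "\<phi> = \<psi>" then show "d \<phi> \<psi> = 0" using d_le[of \<phi> \<psi> 0] d0[of \<phi> \<psi>] by simp
    qed
    show "d \<phi> \<xi> \<le> d \<phi> \<psi> + d \<psi> \<xi>" if "\<phi> \<in> states A" "\<psi> \<in> states A" "\<xi> \<in> states A" for \<phi> \<psi> \<xi>
    proof (rule d_le)
      fix t assume "t \<in> T"
      then show "cmod (\<phi> t - \<xi> t) \<le> d \<phi> \<psi> + d \<psi> \<xi>"
        using le_d[OF that(1,2)] le_d[OF that(2,3)] norm_triangle_ineq[of "\<phi> t - \<psi> t" "\<psi> t - \<xi> t"] by force
    qed (simp add: d0)
  qed (auto simp: d0 comm)
  have top: "openin M.mtopology U \<longleftrightarrow> openin (weak_star_topology A) U" for U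
  proof
    assume U: "openin M.mtopology U"
    show "openin (weak_star_topology A) U"
    proof (subst openin_subopen, rule ballI)
      fix \<phi> assume "\<phi> \<in> U"
      then obtain r where r: "r > 0" "M.mball \<phi> r \<subseteq> U" and \<phi>: "\<phi> \<in> states A"
        using U M.openin_mtopology by blast
      \<comment> \<open>The error on T is then at most \<open>r / 4\<close> from the finite set plus
        \<open>2 * (r / 8)\<close> from the net, hence \<open>r / 2 < r\<close>.\<close>
      obtain S where S: "finite S" "S \<subseteq> carrier A" "\<forall>t\<in>T. \<exists>s\<in>S. \<exists>c. nrm A (t \<ominus> (s \<oplus> c \<odot> \<one>)) < r / 8"
        using tb[of "r / 8"] r by auto
      define W where "W = {\<psi> \<in> states A. \<forall>s\<in>S. dist (\<phi> s) (\<psi> s) < r / 4}"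
      have "W \<subseteq> M.mball \<phi> r"
      proof
        fix \<psi> assume "\<psi> \<in> W"
        then have \<psi>: "\<psi> \<in> states A" and *: "\<And>s. s \<in> S \<Longrightarrow> cmod (\<phi> s - \<psi> s) < r / 4"
          by (auto simp: W_def dist_norm)
        have "d \<phi> \<psi> \<le> r / 2"
        proof (rule d_le)
          fix t assume t: "t \<in> T"
          then obtain s c where s: "s \<in> S" "nrm A (t \<ominus> (s \<oplus> c \<odot> \<one>)) < r / 8" using S by blast
          have "cmod (\<phi> t - \<psi> t) \<le> cmod (\<phi> s - \<psi> s) + 2 * (r / 8)"
            using approx[OF \<phi> \<psi> _ _ s(2)] t T S s by auto
          then show "cmod (\<phi> t - \<psi> t) \<le> r / 2" using *[OF s(1)] by simp
        qed (use r in simp)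
        then show "\<psi> \<in> M.mball \<phi> r" using \<phi> \<psi> r by (simp add: M.in_mball)
      qed
      moreover have "openin (weak_star_topology A) W" unfolding W_def by (rule openin_weak_star_basic) (use S in auto)
      moreover have "\<phi> \<in> W" using \<phi> r by (simp add: W_def)
      ultimately show "\<exists>W. openin (weak_star_topology A) W \<and> \<phi> \<in> W \<and> W \<subseteq> U" using r by blast
    qed
  next
    assume U: "openin (weak_star_topology A) U"
    have ev: "continuous_map M.mtopology euclidean (\<lambda>\<phi>. \<phi> a)" if a: "a \<in> carrier A" for a
      unfolding continuous_map_def
    proof (intro conjI allI impI)
      fix V :: "complex set" assume "openin euclidean V"
      then have V: "open V" by simp
      show "openin M.mtopology {\<phi> \<in> topspace M.mtopology. \<phi> a \<in> V}"
        unfolding M.openin_mtopology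
      proof (intro conjI allI impI)
        fix \<phi> assume "\<phi> \<in> {\<phi> \<in> topspace M.mtopology. \<phi> a \<in> V}"
        then have \<phi>: "\<phi> \<in> states A" and v: "\<phi> a \<in> V" by auto
        obtain e where e: "e > 0" "ball (\<phi> a) e \<subseteq> V" using V v openE by blast
        obtain K where K: "K > 0" "\<forall>\<psi>\<in>states A. cmod (\<phi> a - \<psi> a) \<le> e / 2 + K * d \<phi> \<psi>"
          using eval[OF \<phi> a, of "e / 2"] e by auto
        have "M.mball \<phi> (e / (2 * K)) \<subseteq> {\<phi> \<in> topspace M.mtopology. \<phi> a \<in> V}"
        proof
          fix \<psi> assume "\<psi> \<in> M.mball \<phi> (e / (2 * K))"
          then have \<psi>: "\<psi> \<in> states A" "d \<phi> \<psi> < e / (2 * K)" by (auto simp: M.in_mball)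
          have "K * d \<phi> \<psi> < e / 2" using K \<psi>(2) by (simp add: field_simps)
          then have "cmod (\<phi> a - \<psi> a) < e" using K(2) \<psi>(1) by fastforce
          then show "\<psi> \<in> {\<phi> \<in> topspace M.mtopology. \<phi> a \<in> V}" using e \<psi>(1) by (auto simp: dist_norm)
        qed
        moreover have "e / (2 * K) > 0" using e K by simp
        ultimately show "\<exists>r>0. M.mball \<phi> r \<subseteq> {\<phi> \<in> topspace M.mtopology. \<phi> a \<in> V}" by blast
      qed auto
    qed auto
    \<comment> \<open>The weak* topology is initial for the evaluations, so their continuity makes
      the identity map continuous.\<close>
    have "continuous_map M.mtopology (weak_star_topology A) (\<lambda>\<phi>. \<phi>)"
      unfolding weak_star_topology_def continuous_map_in_subtopology continuous_map_componentwise
      using ev states_extensional by auto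
    then have "openin M.mtopology {\<phi> \<in> topspace M.mtopology. \<phi> \<in> U}"
      using U by (rule openin_continuous_map_preimage)
    moreover have "{\<phi> \<in> topspace M.mtopology. \<phi> \<in> U} = U"
      using openin_subset[OF U] by (auto simp: topspace_weak_star)
    ultimately show "openin M.mtopology U" by simp
  qed
  have "M.mtopology = weak_star_topology A" using top by (simp add: topology_eq)
  then show ?thesis unfolding metrizes_weak_star_def
    using fin M.Metric_space_axioms by (auto simp: d_def[abs_def])
qed

end

section \<open>Filtered C*-algebras with a trace\<close>

text \<open>\<open>E n\<close> is the trace-orthogonal projection onto \<open>F n\<close>. Together
  with the bound on left multiplication, \<open>nrm_leI_F\<close> says that on \<open>F n\<close>
  the C*-norm is the norm of left multiplication on trace-norm vectors of \<open>F n\<close>; finite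
  nets of balls are the form in which finite dimension enters. The number \<open>c n\<close> is only
  an admissible constant, its minimality is brought in with \<open>ci_coeff_eq\<close>. Faithfulness
  of \<tau> is a consequence, see \<open>tn_eq_0\<close>.\<close>

locale ci_system = unital_cstar_algebra A for A :: "'a cstar_algebra" (structure) +
  fixes \<tau> :: "'a \<Rightarrow> complex" and F :: "nat \<Rightarrow> 'a set" and E :: "nat \<Rightarrow> 'a \<Rightarrow> 'a"
    and c \<gamma> :: "nat \<Rightarrow> real"
  assumes tau: "\<tau> \<in> states A"
    and tracial: "a \<in> carrier A \<Longrightarrow> b \<in> carrier A \<Longrightarrow> \<tau> (a \<otimes> b) = \<tau> (b \<otimes> a)"
    and F_carrier: "F n \<subseteq> carrier A"
    and F_0: "F 0 = {z \<odot> \<one> | z. True}"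
    and F_Suc: "F n \<subseteq> F (Suc n)"
    and F_add: "a \<in> F n \<Longrightarrow> b \<in> F n \<Longrightarrow> a \<oplus> b \<in> F n"
    and F_mult: "a \<in> F n \<Longrightarrow> b \<in> F n \<Longrightarrow> a \<otimes> b \<in> F n"
    and F_smult: "a \<in> F n \<Longrightarrow> z \<odot> a \<in> F n"
    and F_star: "a \<in> F n \<Longrightarrow> star A a \<in> F n"
    and F_dense: "a \<in> carrier A \<Longrightarrow> e > 0 \<Longrightarrow> \<exists>n. \<exists>b\<in>F n. nrm A (a \<ominus> b) < e"
    and E_in: "a \<in> carrier A \<Longrightarrow> E n a \<in> F n"
    and E_orth: "a \<in> carrier A \<Longrightarrow> v \<in> F n \<Longrightarrow> \<tau> (star A v \<otimes> (a \<ominus> E n a)) = 0"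
    and nrm_le_trace_norm: "a \<in> F n \<Longrightarrow> nrm A a \<le> c n * trace_norm A \<tau> a"
    and nrm_leI_F: "a \<in> F n \<Longrightarrow> 0 \<le> r \<Longrightarrow>
      (\<And>v. v \<in> F n \<Longrightarrow> trace_norm A \<tau> (a \<otimes> v) \<le> r * trace_norm A \<tau> v) \<Longrightarrow> nrm A a \<le> r"
    and F_totally_bounded: "e > 0 \<Longrightarrow>
      \<exists>S. finite S \<and> S \<subseteq> F n \<and> (\<forall>a\<in>F n. nrm A a \<le> r \<longrightarrow> (\<exists>s\<in>S. nrm A (a \<ominus> s) < e))"
    and gamma_pos: "\<gamma> n > 0"
    and gamma_summable: "summable \<gamma>"
begin

section \<open>The trace inner product and the conditional expectations\<close>

abbreviation tn where "tn \<equiv> trace_norm A \<tau>"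

definition ip where "ip a b = \<tau> (star A b \<otimes> a)"

lemmas tn_nonneg [simp] = trace_norm_nonneg[OF tau]
lemmas tn_one [simp] = trace_norm_one[OF tau]
lemmas tn_zero [simp] = trace_norm_zero[OF tau]
lemmas tn_smult = trace_norm_smult[OF tau]
lemmas tn_triangle = trace_norm_triangle[OF tau]
lemmas tn_triangle_minus = trace_norm_triangle_minus[OF tau]
lemmas tn_triangle3 = trace_norm_triangle3[OF tau]
lemmas tn_minus_commute = trace_norm_minus_commute[OF tau]
lemmas tn_le_nrm = trace_norm_le_nrm[OF tau]
lemmas tn_mult_le = trace_norm_mult_le[OF tau]
lemmas tn_diff_le = trace_norm_diff_le[OF tau]
lemmas tau_add = state_add[OF tau]
lemmas tau_smult = state_smult[OF tau]

lemma FC [simp]: "a \<in> F n \<Longrightarrow> a \<in> carrier A" using F_carrier by auto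

lemma F_mono: "m \<le> n \<Longrightarrow> a \<in> F m \<Longrightarrow> a \<in> F n"
  using lift_Suc_mono_le[of F, OF F_Suc] by blast

lemma F_one: "\<one> \<in> F n"
proof (rule F_mono)
  show "\<one> \<in> F 0" unfolding F_0 by (rule CollectI, rule exI[of _ 1]) simp
qed simp

lemma F_zero: "\<zero> \<in> F n" using F_smult[OF F_one, of 0] by simp

lemma F_minus: "a \<in> F n \<Longrightarrow> b \<in> F n \<Longrightarrow> a \<ominus> b \<in> F n"
  by (simp add: minus_smult F_add F_smult)

lemma ip_add_left: "a \<in> carrier A \<Longrightarrow> b \<in> carrier A \<Longrightarrow> v \<in> carrier A \<Longrightarrow> ip (a \<oplus> b) v = ip a v + ip b v"
  by (simp add: ip_def mult_add_right tau_add)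

lemma ip_smult_left: "a \<in> carrier A \<Longrightarrow> v \<in> carrier A \<Longrightarrow> ip (z \<odot> a) v = z * ip a v"
  by (simp add: ip_def smult_mult_right tau_smult)

lemma ip_cnj: "a \<in> carrier A \<Longrightarrow> b \<in> carrier A \<Longrightarrow> ip b a = cnj (ip a b)"
  unfolding ip_def using state_cnj_mult[OF tau] by blast

lemma ip_minus_left: "a \<in> carrier A \<Longrightarrow> b \<in> carrier A \<Longrightarrow> v \<in> carrier A \<Longrightarrow> ip (a \<ominus> b) v = ip a v - ip b v"
  by (simp add: minus_smult ip_add_left ip_smult_left)

lemma ip_add_right: "a \<in> carrier A \<Longrightarrow> b \<in> carrier A \<Longrightarrow> v \<in> carrier A \<Longrightarrow> ip v (a \<oplus> b) = ip v a + ip v b"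
  by (simp add: ip_def star_add mult_add_left tau_add)

lemma ip_smult_right: "a \<in> carrier A \<Longrightarrow> v \<in> carrier A \<Longrightarrow> ip v (z \<odot> a) = cnj z * ip v a"
  by (simp add: ip_def star_smult smult_mult_left tau_smult)

lemma ip_minus_right: "a \<in> carrier A \<Longrightarrow> b \<in> carrier A \<Longrightarrow> v \<in> carrier A \<Longrightarrow> ip v (a \<ominus> b) = ip v a - ip v b"
  by (simp add: minus_smult ip_add_right ip_smult_right)

lemma ip_zero [simp]: "v \<in> carrier A \<Longrightarrow> ip \<zero> v = 0" "v \<in> carrier A \<Longrightarrow> ip v \<zero> = 0"
  using ip_smult_left[of \<zero> v 0] ip_smult_right[of \<zero> v 0] by simp_all

lemma ip_self: "a \<in> carrier A \<Longrightarrow> ip a a = of_real ((tn a)\<^sup>2)"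
  unfolding ip_def by (rule state_self_eq[OF tau])

lemma ip_Cauchy_Schwarz: "a \<in> carrier A \<Longrightarrow> b \<in> carrier A \<Longrightarrow> cmod (ip a b) \<le> tn a * tn b"
  unfolding ip_def by (rule state_Cauchy_Schwarz[OF tau])

lemma ip_mult_left:
  "a \<in> carrier A \<Longrightarrow> h \<in> carrier A \<Longrightarrow> k \<in> carrier A \<Longrightarrow> ip (a \<otimes> h) k = ip h (star A a \<otimes> k)"
  by (simp add: ip_def star_mult mult_assoc)

text \<open>Traciality gives right multiplication an adjoint as well, from which the right module
  property of \<open>E n\<close> follows.\<close>

lemma ip_mult_right:
  "a \<in> carrier A \<Longrightarrow> h \<in> carrier A \<Longrightarrow> k \<in> carrier A \<Longrightarrow> ip (h \<otimes> a) k = ip h (k \<otimes> star A a)"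
  using tracial[of "star A k \<otimes> h" a] by (simp add: ip_def star_mult mult_assoc)

lemma ip_star:
  "a \<in> carrier A \<Longrightarrow> b \<in> carrier A \<Longrightarrow> ip (star A a) (star A b) = ip b a"
  using tracial[of b "star A a"] by (simp add: ip_def)

lemma tn_star [simp]: "a \<in> carrier A \<Longrightarrow> tn (star A a) = tn a"
  using ip_star[of a a] by (simp add: trace_norm_def ip_def)

text \<open>By traciality the star preserves the trace norm, so the bound for left multiplication
  applies to \<open>(a b)* = b* a*\<close>.\<close>

lemma tn_mult_le_right:
  assumes [simp]: "a \<in> carrier A" "b \<in> carrier A" shows "tn (a \<otimes> b) \<le> tn a * nrm A b"
  using tn_mult_le[of "star A b" "star A a"] tn_star[of "a \<otimes> b"]
  by (simp add: star_mult mult.commute del: tn_star) (simp add: mult.commute)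

text \<open>Replacing a by a nearby element b of some level costs \<open>e / 2\<close> in the
  hypothesis and \<open>e / 2\<close> in the conclusion, and at that level \<open>nrm_leI_F\<close>
  applies. The GNS representation is thereby isometric, as seen on level vectors.\<close>

lemma nrm_leI:
  assumes [simp]: "a \<in> carrier A" and r: "0 \<le> r"
    and le: "\<And>n v. v \<in> F n \<Longrightarrow> tn (a \<otimes> v) \<le> r * tn v"
  shows "nrm A a \<le> r"
proof (rule field_le_epsilon)
  fix e :: real assume "e > 0"
  then obtain n b where b: "b \<in> F n" "nrm A (a \<ominus> b) < e / 2" using F_dense[of a "e / 2"] by auto
  note [simp] = FC[OF b(1)]
  have "nrm A b \<le> r + e / 2"
  proof (rule nrm_leI_F[OF b(1)])
    fix v assume v: "v \<in> F n"
    note [simp] = FC[OF v]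
    have eq: "b \<otimes> v = a \<otimes> v \<ominus> (a \<ominus> b) \<otimes> v"
      by (simp add: minus_smult mult_add_left smult_mult_left smult_add_right smult_smult add_assoc[symmetric])
        (simp add: smult_minus_1 add_minus_self)
    have "tn (b \<otimes> v) \<le> tn (a \<otimes> v) + tn ((a \<ominus> b) \<otimes> v)"
      unfolding eq by (rule tn_triangle_minus) auto
    also have "\<dots> \<le> r * tn v + e / 2 * tn v"
      using le[OF v] order_trans[OF tn_mult_le[of "a \<ominus> b" v] mult_right_mono[of "nrm A (a \<ominus> b)" "e/2" "tn v"]] b(2)
      by (intro add_mono) auto
    finally show "tn (b \<otimes> v) \<le> (r + e / 2) * tn v" by (simp add: algebra_simps)
  qed (use r \<open>e > 0\<close> in simp)
  then show "nrm A a \<le> r + e" using nrm_le_add_minus[of a b] b(2) by simp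
qed

text \<open>If \<open>tn a = 0\<close>, the bound for right multiplication gives
  \<open>tn (a v) = 0\<close> for every v, so left multiplication by a vanishes and
  \<open>nrm_leI\<close> applies with bound 0. This is faithfulness of the trace.\<close>

lemma tn_eq_0:
  assumes [simp]: "a \<in> carrier A" and z: "tn a = 0" shows "a = \<zero>"
proof -
  have "nrm A a \<le> 0"
  proof (rule nrm_leI)
    fix n v assume "v \<in> F n"
    then show "tn (a \<otimes> v) \<le> 0 * tn v" using tn_mult_le_right[of a v] z by simp
  qed auto
  then show ?thesis using nrm_eq_0[of a] nrm_nonneg[of a] by simp
qed

lemma eqI_tn:
  assumes "a \<in> carrier A" "b \<in> carrier A" "tn (a \<ominus> b) = 0" shows "a = b"
  using tn_eq_0[of "a \<ominus> b"] assms by simp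

lemma E_carrier [simp]: "a \<in> carrier A \<Longrightarrow> E n a \<in> carrier A" using E_in FC by blast

text \<open>The difference of two candidates lies in \<open>F n\<close> and is orthogonal to itself.
  The algebraic properties of \<open>E n\<close> below are obtained by checking this
  orthogonality.\<close>

lemma E_unique:
  assumes [simp]: "a \<in> carrier A" and p: "p \<in> F n" and orth: "\<And>v. v \<in> F n \<Longrightarrow> ip (a \<ominus> p) v = 0"
  shows "E n a = p"
proof -
  note [simp] = FC[OF p]
  have d: "E n a \<ominus> p \<in> F n" using E_in p by (simp add: F_minus)
  have "ip (E n a \<ominus> p) (E n a \<ominus> p) = ip (a \<ominus> p) (E n a \<ominus> p) - ip (a \<ominus> E n a) (E n a \<ominus> p)"
    by (simp add: ip_minus_left)
  also have "\<dots> = 0" using orth[OF d] E_orth[of a, OF _ d] by (simp add: ip_def)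
  finally have "tn (E n a \<ominus> p) = 0" using ip_self[of "E n a \<ominus> p"] by simp
  then show ?thesis by (intro eqI_tn) auto
qed

lemma ip_E:
  assumes [simp]: "a \<in> carrier A" and v: "v \<in> F n"
  shows "ip (E n a) v = ip a v" "ip v (E n a) = ip v a"
proof -
  note [simp] = FC[OF v]
  show 1: "ip (E n a) v = ip a v" using E_orth[OF assms] ip_minus_left[of a "E n a" v] by (simp add: ip_def)
  show "ip v (E n a) = ip v a" using 1 ip_cnj[of a v] ip_cnj[of "E n a" v] by simp
qed

lemma ip_E_E:
  assumes [simp]: "a \<in> carrier A" "b \<in> carrier A" shows "ip (E n a) b = ip a (E n b)"
  using ip_E(1)[OF assms(1) E_in[of b n]] ip_E(2)[OF assms(2) E_in[of a n]] by simp

lemma E_id: "a \<in> F n \<Longrightarrow> E n a = a"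
  by (rule E_unique) (auto simp: ip_minus_left)

lemma E_add: "a \<in> carrier A \<Longrightarrow> b \<in> carrier A \<Longrightarrow> E n (a \<oplus> b) = E n a \<oplus> E n b"
  by (rule E_unique) (auto simp: F_add E_in ip_minus_left ip_add_left ip_E)

lemma E_smult: "a \<in> carrier A \<Longrightarrow> E n (z \<odot> a) = z \<odot> E n a"
  by (rule E_unique) (auto simp: F_smult E_in ip_minus_left ip_smult_left ip_E)

lemma E_minus: "a \<in> carrier A \<Longrightarrow> b \<in> carrier A \<Longrightarrow> E n (a \<ominus> b) = E n a \<ominus> E n b"
  by (simp add: minus_smult E_add E_smult)

lemma E_one [simp]: "E n \<one> = \<one>" by (rule E_id) (rule F_one)

lemma E_star:
  assumes [simp]: "a \<in> carrier A" shows "E n (star A a) = star A (E n a)"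
proof (rule E_unique)
  fix v assume v: "v \<in> F n"
  note [simp] = FC[OF v]
  have "ip (star A a \<ominus> star A (E n a)) v = ip (star A v) (a \<ominus> E n a)"
    using ip_star[of "a \<ominus> E n a" "star A v"] by (simp add: star_minus)
  also have "\<dots> = 0" using ip_E(2)[of a "star A v" n] F_star[OF v] by (simp add: ip_minus_right)
  finally show "ip (star A a \<ominus> star A (E n a)) v = 0" .
qed (auto simp: E_in F_star)

text \<open>\<open>F n\<close> is invariant under multiplication by \<open>b*\<close>, so b may be
  moved to the test vector and back. With the right-hand version this makes the projection
  \<open>E n\<close> a conditional expectation.\<close>

lemma E_mult_left:
  assumes [simp]: "a \<in> carrier A" and b: "b \<in> F n" shows "E n (b \<otimes> a) = b \<otimes> E n a"
proof (rule E_unique)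
  note [simp] = FC[OF b]
  fix v assume v: "v \<in> F n"
  note [simp] = FC[OF v]
  show "ip (b \<otimes> a \<ominus> b \<otimes> E n a) v = 0"
    using ip_E(1)[of a "star A b \<otimes> v" n] F_mult[OF F_star[OF b] v] by (simp add: ip_minus_left ip_mult_left)
qed (use b in \<open>auto simp: F_mult E_in\<close>)

lemma E_mult_right:
  assumes [simp]: "a \<in> carrier A" and b: "b \<in> F n" shows "E n (a \<otimes> b) = E n a \<otimes> b"
proof (rule E_unique)
  note [simp] = FC[OF b]
  fix v assume v: "v \<in> F n"
  note [simp] = FC[OF v]
  show "ip (a \<otimes> b \<ominus> E n a \<otimes> b) v = 0"
    using ip_E(1)[of a "v \<otimes> star A b" n] F_mult[OF v F_star[OF b]] by (simp add: ip_minus_left ip_mult_right)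
qed (use b in \<open>auto simp: F_mult E_in\<close>)

lemma E_E_le:
  assumes "m \<le> n" and [simp]: "a \<in> carrier A"
  shows "E m (E n a) = E m a" "E n (E m a) = E m a"
proof -
  show "E m (E n a) = E m a"
  proof (rule E_unique)
    fix v assume v: "v \<in> F m"
    note [simp] = FC[OF v]
    show "ip (E n a \<ominus> E m a) v = 0"
      using ip_E(1)[of a v m] ip_E(1)[of a v n] v F_mono[OF assms(1) v] by (simp add: ip_minus_left)
  qed (auto simp: E_in)
  show "E n (E m a) = E m a" using F_mono[OF assms(1) E_in[of a m]] by (intro E_id) simp
qed

lemma tn_E_Pythagoras:
  assumes [simp]: "a \<in> carrier A" shows "(tn a)\<^sup>2 = (tn (E n a))\<^sup>2 + (tn (a \<ominus> E n a))\<^sup>2"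
proof -
  have "ip (E n a) (E n a) = ip a (E n a)" "ip (E n a) (E n a) = ip (E n a) a"
    using E_in[of a n] by (auto intro: ip_E)
  then have "ip (a \<ominus> E n a) (a \<ominus> E n a) = ip a a - ip (E n a) (E n a)"
    by (simp add: ip_minus_left ip_minus_right)
  then have "(of_real ((tn (a \<ominus> E n a))\<^sup>2) :: complex) = of_real ((tn a)\<^sup>2 - (tn (E n a))\<^sup>2)"
    by (simp add: ip_self)
  then show ?thesis by (simp del: of_real_diff of_real_power)
qed

lemma tn_E_le: "a \<in> carrier A \<Longrightarrow> tn (E n a) \<le> tn a"
  by (rule power2_le_imp_le) (auto simp: tn_E_Pythagoras[of a n])

lemma tn_minus_E_le: "a \<in> carrier A \<Longrightarrow> tn (a \<ominus> E n a) \<le> tn a"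
  by (rule power2_le_imp_le) (auto simp: tn_E_Pythagoras[of a n])

text \<open>\<open>E n\<close> fixes b, so shifting a by b leaves the distance vector unchanged;
  contractivity then shows that \<open>E n a\<close> is the best approximation.\<close>

lemma minus_E_shift:
  assumes [simp]: "a \<in> carrier A" and b: "b \<in> F n"
  shows "a \<ominus> E n a = (a \<ominus> b) \<ominus> E n (a \<ominus> b)"
proof -
  note [simp] = FC[OF b]
  have eq: "b \<oplus> (a \<ominus> b) = a" "b \<oplus> (E n a \<ominus> b) = E n a"
    by (simp_all add: a_minus_def add_lcomm[of b] add_minus_self)
  have "(a \<ominus> b) \<ominus> (E n a \<ominus> b) = (b \<oplus> (a \<ominus> b)) \<ominus> (b \<oplus> (E n a \<ominus> b))"
    by (rule add_minus_add[symmetric]) auto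
  then show ?thesis using E_id[OF b] by (simp add: E_minus eq)
qed

lemma tn_E_best: "a \<in> carrier A \<Longrightarrow> b \<in> F n \<Longrightarrow> tn (a \<ominus> E n a) \<le> tn (a \<ominus> b)"
  using tn_minus_E_le[of "a \<ominus> b" n] minus_E_shift[of a b n] by simp

lemma E_tendsto:
  assumes [simp]: "a \<in> carrier A" shows "(\<lambda>n. tn (a \<ominus> E n a)) \<longlonglongrightarrow> 0"
proof (rule LIMSEQ_I)
  fix e :: real assume "e > 0"
  then obtain m b where b: "b \<in> F m" "nrm A (a \<ominus> b) < e" using F_dense[of a e] by auto
  have "tn (a \<ominus> E n a) < e" if "n \<ge> m" for n
    using tn_E_best[OF assms F_mono[OF that b(1)]] tn_le_nrm[of "a \<ominus> b"] b by simp
  then show "\<exists>m. \<forall>n\<ge>m. norm (tn (a \<ominus> E n a) - 0) < e" by (intro exI[of _ m]) simp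
qed

section \<open>Truncations of the Dirac operator\<close>

definition \<alpha> where "\<alpha> n = c n / \<gamma> n"

text \<open>The truncation \<open>P\<^sub>n D P\<^sub>n\<close> of the Dirac operator, acting on the algebra itself.\<close>

primrec T :: "nat \<Rightarrow> 'a \<Rightarrow> 'a" where
  "T 0 a = \<zero>"
| "T (Suc n) a = T n a \<oplus> of_real (\<alpha> (Suc n)) \<odot> (E (Suc n) a \<ominus> E n a)"

lemma T_in: "a \<in> carrier A \<Longrightarrow> T n a \<in> F n"
proof (induction n)
  case (Suc n)
  have "T n a \<in> F (Suc n)" "E n a \<in> F (Suc n)"
    using Suc E_in[of a n] by (auto intro: F_mono[of n "Suc n"])
  then show ?case using Suc by (auto intro: F_add F_smult F_minus E_in)
qed (simp add: F_zero)

lemma T_carrier [simp]: "a \<in> carrier A \<Longrightarrow> T n a \<in> carrier A" using T_in FC by blast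

lemma ip_T:
  assumes [simp]: "a \<in> carrier A" "b \<in> carrier A" shows "ip (T n a) b = ip a (T n b)"
  by (induction n) (simp_all add: ip_add_left ip_add_right ip_smult_left ip_smult_right
      ip_minus_left ip_minus_right ip_E_E)

text \<open>Linearity is read off from the symmetry \<open>ip_T\<close>: the difference of the two
  sides is orthogonal to itself.\<close>

lemma T_smult:
  assumes [simp]: "a \<in> carrier A" shows "T n (z \<odot> a) = z \<odot> T n a"
proof (rule eqI_tn)
  let ?d = "T n (z \<odot> a) \<ominus> z \<odot> T n a"
  have "ip ?d ?d = 0" by (simp add: ip_minus_left ip_smult_left ip_T)
  then show "tn ?d = 0" using ip_self[of ?d] by simp
qed auto

lemma T_E: "m \<le> n \<Longrightarrow> a \<in> carrier A \<Longrightarrow> T m (E n a) = T m a"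
  by (induction m) (simp_all add: E_E_le)

text \<open>For a in \<open>F m\<close> all increments above level m vanish, since
  \<open>E (Suc n) a\<close> and \<open>E n a\<close> are both a. Hence \<open>T n\<close> acts on
  \<open>F m\<close> as the full operator D for every \<open>n >= m\<close>.\<close>

lemma T_stable:
  assumes "m \<le> n" and a: "a \<in> F m" shows "T n a = T m a"
  using assms(1)
proof (induction n rule: dec_induct)
  case (step n)
  have "E (Suc n) a = a" "E n a = a"
    using F_mono[OF _ a] step by (auto intro!: E_id)
  then show ?case using step FC[OF a] by (simp add: a_minus_def add_minus_self)
qed simp

text \<open>Testing against v in \<open>F m\<close> moves \<open>T n\<close> onto v by symmetry,
  where it equals \<open>T m\<close>.\<close>

lemma E_T:
  assumes "m \<le> n" and [simp]: "a \<in> carrier A" shows "E m (T n a) = T m a"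
proof (rule E_unique)
  fix v assume v: "v \<in> F m"
  note [simp] = FC[OF v]
  show "ip (T n a \<ominus> T m a) v = 0" using T_stable[OF assms(1) v] by (simp add: ip_minus_left ip_T)
qed (auto simp: T_in)

lemma T_one [simp]: "T n \<one> = \<zero>"
  using T_stable[of 0 n \<one>] F_one by simp

lemma tn_T_mono: "m \<le> n \<Longrightarrow> a \<in> carrier A \<Longrightarrow> tn (T m a) \<le> tn (T n a)"
  using tn_E_le[of "T n a" m] by (simp add: E_T)

text \<open>\<open>T n a\<close> is the projection of \<open>T (Suc n) a\<close> onto
  \<open>F n\<close>, so Pythagoras applies. The squared norms of the truncations are thus the
  partial sums of the series that defines the domain of D.\<close>

lemma tn_T_Suc:
  assumes [simp]: "a \<in> carrier A"
  shows "(tn (T (Suc n) a))\<^sup>2 = (tn (T n a))\<^sup>2 + (\<alpha> (Suc n))\<^sup>2 * (tn (E (Suc n) a \<ominus> E n a))\<^sup>2"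
proof -
  have "T (Suc n) a \<ominus> T n a = of_real (\<alpha> (Suc n)) \<odot> (E (Suc n) a \<ominus> E n a)"
    by (simp add: a_minus_def add_assoc add_comm[of "T n a"] add_minus_self)
  then have "tn (T (Suc n) a \<ominus> T n a) = \<bar>\<alpha> (Suc n)\<bar> * tn (E (Suc n) a \<ominus> E n a)"
    by (simp add: tn_smult)
  then show ?thesis
    using tn_E_Pythagoras[of "T (Suc n) a" n] E_T[of n "Suc n" a]
    by (simp add: power_mult_distrib del: T.simps)
qed

lemma tn_T_sum:
  "a \<in> carrier A \<Longrightarrow> (tn (T n a))\<^sup>2 = (\<Sum>i<n. (\<alpha> (Suc i))\<^sup>2 * (tn (E (Suc i) a \<ominus> E i a))\<^sup>2)"
  by (induction n) (simp_all add: tn_T_Suc del: T.simps(2))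

lemma T_bounded: "\<exists>K\<ge>0. \<forall>a\<in>carrier A. tn (T n a) \<le> K * tn a"
proof (induction n)
  case 0
  then show ?case by (intro exI[of _ 0]) simp
next
  case (Suc n)
  then obtain K where K: "K \<ge> 0" "\<And>a. a \<in> carrier A \<Longrightarrow> tn (T n a) \<le> K * tn a" by blast
  have "tn (T (Suc n) a) \<le> (K + \<bar>\<alpha> (Suc n)\<bar> * 2) * tn a" if [simp]: "a \<in> carrier A" for a
  proof -
    have "tn (E (Suc n) a \<ominus> E n a) \<le> 2 * tn a"
      using tn_triangle_minus[of "E (Suc n) a" "E n a"] tn_E_le[of a "Suc n"] tn_E_le[of a n] by simp
    then have "\<bar>\<alpha> (Suc n)\<bar> * tn (E (Suc n) a \<ominus> E n a) \<le> \<bar>\<alpha> (Suc n)\<bar> * (2 * tn a)"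
      by (intro mult_left_mono) auto
    then show ?thesis
      using tn_triangle[of "T n a" "of_real (\<alpha> (Suc n)) \<odot> (E (Suc n) a \<ominus> E n a)"] K(2)[of a]
      by (simp add: tn_smult algebra_simps)
  qed
  then show ?case using K by (intro exI[of _ "K + \<bar>\<alpha> (Suc n)\<bar> * 2"]) auto
qed

end

text \<open>Used after testing a form on the vector d that is to be estimated:
  \<open>||d||^2 <= y ||d||\<close> gives \<open>||d|| <= y\<close>.\<close>

lemma le_of_mult_self_le:
  fixes x y :: real
  assumes "x * x \<le> y * x" "0 \<le> x" "0 \<le> y" shows "x \<le> y"
  using assms by (cases "x = 0") auto

section \<open>The commutator form and its norm\<close>

context ci_system
begin

text \<open>The form \<open>\<langle>a h, D k\<rangle> - \<langle>a D h, k\<rangle>\<close> when h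
  and k lie in \<open>F M\<close>, where \<open>T M\<close> is D; any larger M gives the same value.
  Putting D on h and k avoids asking whether \<open>a h\<close> lies in the domain.\<close>

definition comm_form where "comm_form a M h k = ip (a \<otimes> h) (T M k) - ip (a \<otimes> T M h) k"

definition core_pairs where
  "core_pairs = {(M, h, k). h \<in> F M \<and> k \<in> F M \<and> tn h \<le> 1 \<and> tn k \<le> 1}"

text \<open>The norm of the sesquilinear form \<open>(h, k) \<mapsto> \<langle>[D, a] h, k\<rangle>\<close> on the algebraic core, up to sign.\<close>

definition comm_norm :: "'a \<Rightarrow> ennreal" where
  "comm_norm a = (SUP (M, h, k) \<in> core_pairs. ennreal (cmod (comm_form a M h k)))"

lemma comm_form_smult_args:
  assumes "a \<in> carrier A" "h \<in> carrier A" "k \<in> carrier A"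
  shows "comm_form a M (y \<odot> h) (z \<odot> k) = y * cnj z * comm_form a M h k"
  using assms
  by (simp add: comm_form_def T_smult smult_mult_right ip_smult_left ip_smult_right algebra_simps)

lemma comm_norm_leI:
  assumes "0 \<le> r" "\<And>M h k. h \<in> F M \<Longrightarrow> k \<in> F M \<Longrightarrow> cmod (comm_form a M h k) \<le> r * tn h * tn k"
  shows "comm_norm a \<le> ennreal r"
  unfolding comm_norm_def
proof (rule SUP_least, clarify)
  fix M h k assume "(M, h, k) \<in> core_pairs"
  then have hk: "h \<in> F M" "k \<in> F M" "tn h \<le> 1" "tn k \<le> 1" by (auto simp: core_pairs_def)
  have "cmod (comm_form a M h k) \<le> r * tn h * tn k" using assms hk by blast
  also have "r * tn h * tn k \<le> r * 1 * 1"
    by (intro mult_mono) (use hk assms FC in auto)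
  finally show "ennreal (cmod (comm_form a M h k)) \<le> ennreal r" by (simp add: ennreal_leI)
qed

lemma comm_norm_leD:
  assumes a [simp]: "a \<in> carrier A" and le: "comm_norm a \<le> ennreal r" and r: "0 \<le> r"
    and h: "h \<in> F M" and k: "k \<in> F M"
  shows "cmod (comm_form a M h k) \<le> r * tn h * tn k"
proof -
  note [simp] = FC[OF h] FC[OF k]
  show ?thesis
  proof (cases "tn h = 0 \<or> tn k = 0")
    case True
    \<comment> \<open>Faithfulness of the trace enters: a vector that cannot be normalised is
      zero.\<close>
    then have "h = \<zero> \<or> k = \<zero>" using tn_eq_0 by auto
    then show ?thesis using T_smult[of \<one> M 0] by (auto simp: comm_form_def)
  next
    case False
    then have pos: "tn h > 0" "tn k > 0" by (auto simp: less_le)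
    let ?h = "of_real (1 / tn h) \<odot> h" and ?k = "of_real (1 / tn k) \<odot> k"
    have "(M, ?h, ?k) \<in> core_pairs"
      using h k pos by (simp add: core_pairs_def F_smult tn_smult norm_divide)
    then have "ennreal (cmod (comm_form a M ?h ?k)) \<le> comm_norm a"
      unfolding comm_norm_def by (rule SUP_upper2) simp
    then have "cmod (comm_form a M ?h ?k) \<le> r" using le r by (metis ennreal_le_iff order_trans)
    then show ?thesis using pos by (simp add: comm_form_smult_args norm_mult norm_divide field_simps)
  qed
qed

lemma comm_form_stable: "M \<le> N \<Longrightarrow> h \<in> F M \<Longrightarrow> k \<in> F M \<Longrightarrow> comm_form a N h k = comm_form a M h k"
  by (simp add: comm_form_def T_stable)

lemma comm_norm_cases:
  obtains (top) "comm_norm a = \<infinity>" | (real) r where "comm_norm a = ennreal r" "0 \<le> r"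
  by (cases "comm_norm a") auto

lemma comm_norm_add:
  assumes [simp]: "a \<in> carrier A" "b \<in> carrier A" shows "comm_norm (a \<oplus> b) \<le> comm_norm a + comm_norm b"
proof (cases a rule: comm_norm_cases)
  case (real r)
  note r = this
  show ?thesis
  proof (cases b rule: comm_norm_cases)
    case (real s)
    have "comm_norm (a \<oplus> b) \<le> ennreal (r + s)"
    proof (rule comm_norm_leI)
      fix M h k assume h: "h \<in> F M" and k: "k \<in> F M"
      note [simp] = FC[OF h] FC[OF k]
      have "comm_form (a \<oplus> b) M h k = comm_form a M h k + comm_form b M h k"
        by (simp add: comm_form_def mult_add_left ip_add_left)
      then have "cmod (comm_form (a \<oplus> b) M h k) \<le> cmod (comm_form a M h k) + cmod (comm_form b M h k)"
        by (simp add: norm_triangle_ineq)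
      then show "cmod (comm_form (a \<oplus> b) M h k) \<le> (r + s) * tn h * tn k"
        using comm_norm_leD[of a r h M k] comm_norm_leD[of b s h M k] r real h k by (simp add: algebra_simps)
    qed (use r real in simp)
    then show ?thesis using r real by simp
  qed simp
qed simp

lemma comm_norm_smult:
  assumes [simp]: "a \<in> carrier A" shows "comm_norm (z \<odot> a) = ennreal (cmod z) * comm_norm a"
proof -
  have "comm_norm (z \<odot> a) = (SUP (M, h, k) \<in> core_pairs. ennreal (cmod z) * ennreal (cmod (comm_form a M h k)))"
    unfolding comm_norm_def
  proof (rule SUP_cong[OF refl], clarify)
    fix M h k assume "(M, h, k) \<in> core_pairs"
    then have "h \<in> carrier A" "k \<in> carrier A" by (auto simp: core_pairs_def)
    then have "comm_form (z \<odot> a) M h k = z * comm_form a M h k"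
      by (simp add: comm_form_def smult_mult_left ip_smult_left algebra_simps)
    then show "ennreal (cmod (comm_form (z \<odot> a) M h k)) = ennreal (cmod z) * ennreal (cmod (comm_form a M h k))"
      by (simp add: norm_mult ennreal_mult)
  qed
  also have "\<dots> = ennreal (cmod z) * comm_norm a"
    unfolding comm_norm_def by (subst SUP_mult_left_ennreal) (simp add: case_prod_unfold)
  finally show ?thesis .
qed

text \<open>Passing to \<open>a*\<close> exchanges h and k and replaces the value of the form by
  minus its conjugate, so the bound for a is also one for \<open>a*\<close>.\<close>

lemma comm_norm_star_le:
  assumes [simp]: "a \<in> carrier A" shows "comm_norm (star A a) \<le> comm_norm a"
proof (cases a rule: comm_norm_cases)
  case (real r)
  have "comm_norm (star A a) \<le> ennreal r"
  proof (rule comm_norm_leI)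
    fix M h k assume h: "h \<in> F M" and k: "k \<in> F M"
    note [simp] = FC[OF h] FC[OF k]
    have "comm_form (star A a) M h k = - cnj (comm_form a M k h)"
      using ip_cnj[of "a \<otimes> T M k" h] ip_cnj[of "a \<otimes> k" "T M h"]
      by (simp add: comm_form_def ip_mult_left)
    then have "cmod (comm_form (star A a) M h k) = cmod (comm_form a M k h)" by simp
    then show "cmod (comm_form (star A a) M h k) \<le> r * tn h * tn k"
      using comm_norm_leD[of a r k M h] real h k by (simp add: mult.commute mult.left_commute)
  qed (use real in simp)
  then show ?thesis using real by simp
qed simp

lemma comm_norm_star: "a \<in> carrier A \<Longrightarrow> comm_norm (star A a) = comm_norm a"
  using comm_norm_star_le[of a] comm_norm_star_le[of "star A a"] by (simp add: antisym)

text \<open>A supremum of functions of a that are continuous for the norm: for a fixed triple the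
  form is Lipschitz in a with constant K. The radius is divided by \<open>K + 1\<close> to cover
  \<open>K = 0\<close>.\<close>

lemma comm_norm_lsc:
  assumes [simp]: "a \<in> carrier A" and y: "y < comm_norm a"
  obtains e where "e > 0" "\<And>b. b \<in> carrier A \<Longrightarrow> nrm A (b \<ominus> a) < e \<Longrightarrow> y < comm_norm b"
proof -
  from y obtain M h k where C: "(M, h, k) \<in> core_pairs" and yw: "y < ennreal (cmod (comm_form a M h k))"
    unfolding comm_norm_def less_SUP_iff by auto
  then have [simp]: "h \<in> carrier A" "k \<in> carrier A" by (auto simp: core_pairs_def)
  define w where "w = cmod (comm_form a M h k)"
  obtain x where x: "y = ennreal x" "0 \<le> x" using yw by (cases y) auto
  have xw: "x < w" using yw x by (simp add: w_def ennreal_less_iff)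
  define K where "K = tn h * tn (T M k) + tn (T M h) * tn k"
  have K: "K \<ge> 0" by (simp add: K_def)
  show thesis
  proof
    show "(w - x) / (K + 1) > 0" using xw K by simp
    fix b assume b [simp]: "b \<in> carrier A" and n: "nrm A (b \<ominus> a) < (w - x) / (K + 1)"
    have "comm_form b M h k - comm_form a M h k = ip ((b \<ominus> a) \<otimes> h) (T M k) - ip ((b \<ominus> a) \<otimes> T M h) k"
      by (simp add: comm_form_def minus_smult mult_add_left smult_mult_left ip_add_left ip_smult_left)
    also have "cmod \<dots> \<le> cmod (ip ((b \<ominus> a) \<otimes> h) (T M k)) + cmod (ip ((b \<ominus> a) \<otimes> T M h) k)"
      by (rule norm_triangle_ineq4)
    also have "\<dots> \<le> (nrm A (b \<ominus> a) * tn h) * tn (T M k) + (nrm A (b \<ominus> a) * tn (T M h)) * tn k"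
      by (intro add_mono order_trans[OF ip_Cauchy_Schwarz] mult_right_mono tn_mult_le) auto
    also have "\<dots> = nrm A (b \<ominus> a) * K" by (simp add: K_def algebra_simps)
    finally have "w - cmod (comm_form b M h k) \<le> nrm A (b \<ominus> a) * K"
      using norm_triangle_ineq2[of "comm_form a M h k" "comm_form b M h k"] by (simp add: w_def norm_minus_commute)
    moreover have "nrm A (b \<ominus> a) * K < w - x \<or> (nrm A (b \<ominus> a) * K = 0)"
    proof -
      have "nrm A (b \<ominus> a) * (K + 1) < w - x" using n K by (simp add: pos_less_divide_eq)
      moreover have "nrm A (b \<ominus> a) \<ge> 0" by (simp add: nrm_nonneg)
      ultimately show ?thesis by (simp add: distrib_left)
    qed
    ultimately have "x < cmod (comm_form b M h k)" using xw by linarith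
    then have "y < ennreal (cmod (comm_form b M h k))" using x by (simp add: ennreal_less_iff)
    also have "\<dots> \<le> comm_norm b" unfolding comm_norm_def by (rule SUP_upper2[OF C]) simp
    finally show "y < comm_norm b" .
  qed
qed

lemma ip_mult_E_tendsto:
  assumes [simp]: "a \<in> carrier A" "x \<in> carrier A" "y \<in> carrier A"
  shows "(\<lambda>N. ip (a \<otimes> E N x) y) \<longlonglongrightarrow> ip (a \<otimes> x) y"
proof -
  have "(\<lambda>N. ip (a \<otimes> E N x) y - ip (a \<otimes> x) y) \<longlonglongrightarrow> 0"
  proof (rule Lim_null_comparison)
    show "\<forall>\<^sub>F N in sequentially. norm (ip (a \<otimes> E N x) y - ip (a \<otimes> x) y) \<le> tn (x \<ominus> E N x) * (nrm A a * tn y)"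
    proof (rule always_eventually, rule allI)
      fix N
      have "ip (a \<otimes> x) y - ip (a \<otimes> E N x) y = ip (a \<otimes> (x \<ominus> E N x)) y"
        by (simp add: minus_smult mult_add_right smult_mult_right ip_add_left ip_smult_left)
      then have "norm (ip (a \<otimes> E N x) y - ip (a \<otimes> x) y) = cmod (ip (a \<otimes> (x \<ominus> E N x)) y)"
        by (metis norm_minus_commute)
      also have "\<dots> \<le> (nrm A a * tn (x \<ominus> E N x)) * tn y"
        by (intro order_trans[OF ip_Cauchy_Schwarz] mult_right_mono tn_mult_le) auto
      finally show "norm (ip (a \<otimes> E N x) y - ip (a \<otimes> x) y) \<le> tn (x \<ominus> E N x) * (nrm A a * tn y)"
        by (simp add: algebra_simps)
    qed
    show "(\<lambda>N. tn (x \<ominus> E N x) * (nrm A a * tn y)) \<longlonglongrightarrow> 0"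
      by (rule tendsto_mult_left_zero) (rule E_tendsto, simp)
  qed
  then show ?thesis by (simp add: LIM_zero_iff)
qed

text \<open>The difference is the compression of \<open>[D, b] h\<close> to \<open>F N\<close>.\<close>

lemma tn_T_mult_le:
  assumes b [simp]: "b \<in> carrier A" and le: "comm_norm b \<le> ennreal s" "0 \<le> s" and h: "h \<in> F M" and "M \<le> N"
  shows "tn (T N (b \<otimes> h) \<ominus> E N (b \<otimes> T M h)) \<le> s * tn h"
proof -
  note [simp] = FC[OF h]
  let ?d = "T N (b \<otimes> h) \<ominus> E N (b \<otimes> T M h)"
  have d: "?d \<in> F N" by (simp add: F_minus T_in E_in)
  have "ip ?d ?d = ip (b \<otimes> h) (T N ?d) - ip (b \<otimes> T M h) ?d"
    using ip_E(1)[OF _ d, of "b \<otimes> T M h"] by (subst ip_minus_left) (simp_all add: ip_T)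
  also have "\<dots> = comm_form b N h ?d" using T_stable[OF \<open>M \<le> N\<close> h] by (simp add: comm_form_def)
  finally have "cmod (ip ?d ?d) \<le> s * tn h * tn ?d"
    using comm_norm_leD[OF b le(1,2) F_mono[OF \<open>M \<le> N\<close> h] d] by simp
  then have "tn ?d * tn ?d \<le> s * tn h * tn ?d"
    by (simp add: ip_self power2_eq_square norm_mult)
  then show ?thesis
    by (rule le_of_mult_self_le) (use le in auto)
qed

text \<open>Formally \<open>[D, a b] = [D, a] b + a [D, b]\<close>, but \<open>b h\<close> need not
  lie in any level. It is replaced by \<open>E N (b h)\<close>, for which the identity holds up to a
  compression, and N tends to infinity with h and k fixed.\<close>

lemma comm_norm_Leibniz:
  assumes [simp]: "a \<in> carrier A" "b \<in> carrier A"
  shows "comm_norm (a \<otimes> b) \<le> ennreal (nrm A a) * comm_norm b + ennreal (nrm A b) * comm_norm a"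
proof -
  have zero: "comm_norm \<zero> = 0" using comm_norm_smult[of \<zero> 0] by simp
  \<comment> \<open>Since \<open>0 * \<infinity> = 0\<close> in \<open>ennreal\<close>, zero factors
    are separated before an infinite seminorm may be used to make the right-hand side
    infinite.\<close>
  consider "a = \<zero> \<or> b = \<zero>" | "a \<noteq> \<zero>" "b \<noteq> \<zero>" "comm_norm a = \<infinity> \<or> comm_norm b = \<infinity>"
    | r s where "comm_norm a = ennreal r" "0 \<le> r" "comm_norm b = ennreal s" "0 \<le> s"
    using comm_norm_cases[of a] comm_norm_cases[of b] by metis
  then show ?thesis
  proof cases
    case 1
    then show ?thesis using zero by auto
  next
    case 2
    then have "0 < nrm A a" "0 < nrm A b" using nrm_eq_0 nrm_nonneg by (metis assms order_le_less)+
    then show ?thesis using 2(3) by (auto simp: ennreal_mult_top)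
  next
    case 3
    have "comm_norm (a \<otimes> b) \<le> ennreal (nrm A a * s + nrm A b * r)"
    proof (rule comm_norm_leI)
      show "0 \<le> nrm A a * s + nrm A b * r" using 3 by (simp add: nrm_nonneg)
      fix M h k assume h: "h \<in> F M" and k: "k \<in> F M"
      note [simp] = FC[OF h] FC[OF k]
      have lim: "(\<lambda>N. ip (a \<otimes> E N (b \<otimes> h)) (T M k) - ip (a \<otimes> E N (b \<otimes> T M h)) k)
          \<longlonglongrightarrow> ip (a \<otimes> (b \<otimes> h)) (T M k) - ip (a \<otimes> (b \<otimes> T M h)) k"
        by (intro tendsto_diff ip_mult_E_tendsto) auto
      have bound: "cmod (ip (a \<otimes> E N (b \<otimes> h)) (T M k) - ip (a \<otimes> E N (b \<otimes> T M h)) k)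
          \<le> (nrm A a * s + nrm A b * r) * tn h * tn k" if N: "N \<ge> M" for N
      proof -
        let ?g = "E N (b \<otimes> h)" and ?d = "T N (b \<otimes> h) \<ominus> E N (b \<otimes> T M h)"
        have g: "?g \<in> F N" by (simp add: E_in)
        have kN: "k \<in> F N" using F_mono[OF N k] .
        \<comment> \<open>Inserting \<open>a \<otimes> T N ?g\<close> splits off the form of a at
          \<open>?g\<close> and k; what remains is a applied to \<open>?d\<close>, the compression
          of \<open>[D, b] h\<close>.\<close>
        have "ip (a \<otimes> ?g) (T M k) - ip (a \<otimes> E N (b \<otimes> T M h)) k = comm_form a N ?g k + ip (a \<otimes> ?d) k"
          using T_stable[OF N k] T_E[of N N "b \<otimes> h"]
          by (simp add: comm_form_def minus_smult mult_add_right smult_mult_right ip_add_left ip_smult_left)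
        moreover have "cmod (comm_form a N ?g k) \<le> r * (nrm A b * tn h) * tn k"
        proof -
          have "cmod (comm_form a N ?g k) \<le> r * tn ?g * tn k" by (rule comm_norm_leD) (use 3 g kN in auto)
          also have "\<dots> \<le> r * (nrm A b * tn h) * tn k"
            using order_trans[OF tn_E_le[of "b \<otimes> h" N] tn_mult_le[of b h]] 3
            by (intro mult_right_mono mult_left_mono) auto
          finally show ?thesis .
        qed
        moreover have "cmod (ip (a \<otimes> ?d) k) \<le> nrm A a * (s * tn h) * tn k"
        proof -
          have "cmod (ip (a \<otimes> ?d) k) \<le> (nrm A a * tn ?d) * tn k"
            by (intro order_trans[OF ip_Cauchy_Schwarz] mult_right_mono tn_mult_le) auto
          also have "\<dots> \<le> nrm A a * (s * tn h) * tn k"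
            using tn_T_mult_le[of b s h M N] 3 h N
            by (intro mult_right_mono mult_left_mono) (auto simp: nrm_nonneg)
          finally show ?thesis .
        qed
        ultimately show ?thesis
          using norm_triangle_ineq[of "comm_form a N ?g k" "ip (a \<otimes> ?d) k"] by (simp add: algebra_simps)
      qed
      have "cmod (ip (a \<otimes> (b \<otimes> h)) (T M k) - ip (a \<otimes> (b \<otimes> T M h)) k) \<le> (nrm A a * s + nrm A b * r) * tn h * tn k"
        using bound by (intro LIMSEQ_le_const2[OF tendsto_norm[OF lim]]) auto
      then show "cmod (comm_form (a \<otimes> b) M h k) \<le> (nrm A a * s + nrm A b * r) * tn h * tn k"
        by (simp add: comm_form_def mult_assoc)
    qed
    also have "\<dots> = ennreal (nrm A a) * comm_norm b + ennreal (nrm A b) * comm_norm a"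
      using 3 by (simp add: ennreal_mult nrm_nonneg)
    finally show ?thesis .
  qed
qed

text \<open>Left multiplication by a in \<open>F N\<close> commutes with every \<open>E n\<close>
  for \<open>n >= N\<close>, so the contributions of the levels above N to the two terms of the form
  cancel. The remaining operator \<open>T N\<close> sees only the projections of h and k onto
  \<open>F N\<close>.\<close>

lemma comm_form_local:
  assumes a: "a \<in> F N" and "N \<le> M" and [simp]: "h \<in> carrier A" "k \<in> carrier A"
  shows "comm_form a M h k = comm_form a N (E N h) (E N k)"
proof -
  note [simp] = FC[OF a]
  have com: "ip (a \<otimes> h) (E n k) = ip (a \<otimes> E n h) k" if "n \<ge> N" for n
    using E_mult_left[of h a n] F_mono[OF that a] ip_E_E[of "a \<otimes> h" k n] by simp
  have "comm_form a M h k = comm_form a N h k" using \<open>N \<le> M\<close>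
  proof (induction M rule: dec_induct)
    case (step n)
    then show ?case using com[of n] com[of "Suc n"]
      by (simp add: comm_form_def minus_smult mult_add_right smult_mult_right ip_add_left ip_add_right
          ip_smult_left ip_smult_right algebra_simps)
  qed simp
  also have "\<dots> = comm_form a N (E N h) (E N k)"
  proof -
    have "ip (a \<otimes> h) (T N k) = ip (a \<otimes> E N h) (T N k)"
      using ip_E(1)[of "a \<otimes> h" "T N k" N] E_mult_left[of h a N] a by (simp add: T_in)
    moreover have "ip (a \<otimes> T N h) k = ip (a \<otimes> T N h) (E N k)"
      using ip_E(2)[of k "a \<otimes> T N h" N] a by (simp add: T_in F_mult)
    ultimately show ?thesis by (simp add: comm_form_def T_E)
  qed
  finally show ?thesis .
qed

text \<open>The reduction of \<open>comm_form_local\<close> replaces h and k by their projections,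
  which are not longer in trace norm.\<close>

lemma comm_norm_leI_local:
  assumes a: "a \<in> F N" and r: "0 \<le> r"
    and le: "\<And>h k. h \<in> F N \<Longrightarrow> k \<in> F N \<Longrightarrow> cmod (comm_form a N h k) \<le> r * tn h * tn k"
  shows "comm_norm a \<le> ennreal r"
proof (rule comm_norm_leI[OF r])
  fix M h k assume h: "h \<in> F M" and k: "k \<in> F M"
  note [simp] = FC[OF h] FC[OF k]
  show "cmod (comm_form a M h k) \<le> r * tn h * tn k"
  proof (cases "N \<le> M")
    case True
    have "cmod (comm_form a M h k) \<le> r * tn (E N h) * tn (E N k)"
      using comm_form_local[OF a True, of h k] le[of "E N h" "E N k"] by (simp add: E_in)
    also have "\<dots> \<le> r * tn h * tn k" using r by (intro mult_mono) (auto simp: tn_E_le)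
    finally show ?thesis .
  next
    case False
    then show ?thesis using le[of h k] comm_form_stable[of M N h k a] h k F_mono[of M N] by simp
  qed
qed

text \<open>By the local criterion only \<open>T N\<close> matters, and it is bounded as a finite
  combination of projections. So the dense union of the levels has finite seminorm.\<close>

lemma comm_norm_finite:
  assumes a: "a \<in> F N" shows "comm_norm a < \<infinity>"
proof -
  note [simp] = FC[OF a]
  obtain K where K: "K \<ge> 0" "\<And>x. x \<in> carrier A \<Longrightarrow> tn (T N x) \<le> K * tn x" using T_bounded by blast
  have "comm_norm a \<le> ennreal (2 * nrm A a * K)"
  proof (rule comm_norm_leI_local[OF a])
    fix h k assume "h \<in> F N" "k \<in> F N"
    then have [simp]: "h \<in> carrier A" "k \<in> carrier A" by auto
    have "cmod (comm_form a N h k) \<le> cmod (ip (a \<otimes> h) (T N k)) + cmod (ip (a \<otimes> T N h) k)"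
      unfolding comm_form_def by (rule norm_triangle_ineq4)
    also have "\<dots> \<le> (nrm A a * tn h) * (K * tn k) + (nrm A a * (K * tn h)) * tn k"
      by (intro add_mono order_trans[OF ip_Cauchy_Schwarz] mult_mono tn_mult_le
          order_trans[OF tn_mult_le] mult_left_mono K(2)) (auto simp: nrm_nonneg K)
    finally show "cmod (comm_form a N h k) \<le> 2 * nrm A a * K * tn h * tn k" by (simp add: algebra_simps)
  qed (use K in \<open>simp add: nrm_nonneg\<close>)
  also have "\<dots> < \<infinity>" by simp
  finally show ?thesis .
qed

text \<open>On vectors of \<open>F N\<close> the forms of a and of \<open>E N a\<close> coincide by
  the right module property. Hence \<open>E N\<close> maps the Lipschitz ball into itself, which
  makes \<open>E N a\<close> a legitimate partner of a in the reach of a bridge.\<close>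

lemma comm_norm_E_le:
  assumes [simp]: "a \<in> carrier A" shows "comm_norm (E N a) \<le> comm_norm a"
proof (cases a rule: comm_norm_cases)
  case (real r)
  have "comm_norm (E N a) \<le> ennreal r"
  proof (rule comm_norm_leI_local)
    fix h k assume h: "h \<in> F N" and k: "k \<in> F N"
    note [simp] = FC[OF h] FC[OF k]
    have "ip (E N a \<otimes> h) (T N k) = ip (a \<otimes> h) (T N k)"
      using ip_E(1)[of "a \<otimes> h" "T N k" N] E_mult_right[of a h N] h by (simp add: T_in)
    moreover have "ip (E N a \<otimes> T N h) k = ip (a \<otimes> T N h) k"
      using ip_E(1)[of "a \<otimes> T N h" k N] E_mult_right[of a "T N h" N] k by (simp add: T_in)
    ultimately have "comm_form (E N a) N h k = comm_form a N h k" by (simp add: comm_form_def)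
    then show "cmod (comm_form (E N a) N h k) \<le> r * tn h * tn k" using comm_norm_leD[of a r h N k] real h k by simp
  qed (use real in \<open>auto simp: E_in\<close>)
  then show ?thesis using real by simp
qed simp

section \<open>Approximation by finite levels and total boundedness\<close>

lemma c_pos: "c n > 0"
proof -
  have "\<one> \<noteq> \<zero>" using tn_one tn_zero by force
  then have "0 < nrm A \<one>" using nrm_eq_0[of \<one>] nrm_nonneg[of \<one>] by simp
  then show ?thesis using nrm_le_trace_norm[OF F_one, of n] by simp
qed

text \<open>The sum starts at \<open>Suc n\<close>: the first increment absent from
  \<open>E n a\<close> is \<open>E (Suc n) a - E n a\<close>, and it is bounded by
  \<open>\<gamma> (Suc n)\<close>.\<close>

definition tail where "tail n = (\<Sum>i. \<gamma> (Suc n + i))"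

lemma tail_nonneg: "0 \<le> tail n" and tail_ge: "(\<Sum>i<k. \<gamma> (Suc n + i)) \<le> tail n"
proof -
  have s: "summable (\<lambda>i. \<gamma> (Suc n + i))"
    using summable_ignore_initial_segment[OF gamma_summable, of "Suc n"] by (simp add: add.commute)
  show "0 \<le> tail n" unfolding tail_def by (intro suminf_nonneg s) (simp add: less_imp_le gamma_pos)
  show "(\<Sum>i<k. \<gamma> (Suc n + i)) \<le> tail n"
    unfolding tail_def by (intro sum_le_suminf s) (auto simp: less_imp_le gamma_pos)
qed

lemma tail_tendsto: "tail \<longlonglongrightarrow> 0"
proof -
  have "tail = (\<lambda>n. suminf \<gamma> - (\<Sum>i<Suc n. \<gamma> i))"
    unfolding tail_def using suminf_minus_initial_segment[OF gamma_summable, of "Suc _"]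
    by (simp add: add.commute del: sum.lessThan_Suc)
  moreover have "(\<lambda>n. suminf \<gamma> - (\<Sum>i<Suc n. \<gamma> i)) \<longlonglongrightarrow> suminf \<gamma> - suminf \<gamma>"
    by (intro tendsto_diff tendsto_const LIMSEQ_Suc[OF summable_LIMSEQ] gamma_summable)
  ultimately show ?thesis by simp
qed

lemma nrm_E_diff_le:
  assumes [simp]: "a \<in> carrier A" and le: "comm_norm a \<le> ennreal y" and y: "0 \<le> y"
  shows "nrm A (E (n + k) a \<ominus> E n a) \<le> y * tail n"
proof -
  have T_le: "tn (T M a) \<le> y" for M
  proof -
    \<comment> \<open>D annihilates the unit, so the second term vanishes at \<open>h = 1\<close>;
      taking \<open>k = T M a\<close> turns the first into a square.\<close>
    have "comm_form a M \<one> (T M a) = ip (T M a) (T M a)" by (simp add: comm_form_def ip_T)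
    then have "cmod (ip (T M a) (T M a)) \<le> y * 1 * tn (T M a)"
      using comm_norm_leD[OF assms(1) le y F_one T_in[OF assms(1)], of M] by simp
    then have "tn (T M a) * tn (T M a) \<le> y * tn (T M a)"
      by (simp add: ip_self power2_eq_square norm_mult)
    then show ?thesis by (rule le_of_mult_self_le) (use y in auto)
  qed
  have Q: "nrm A (E (Suc n) a \<ominus> E n a) \<le> y * \<gamma> (Suc n)" for n
  proof -
    let ?q = "E (Suc n) a \<ominus> E n a"
    have q: "?q \<in> F (Suc n)" using E_in[of a n] E_in[of a "Suc n"] F_mono[of n "Suc n"] by (simp add: F_minus)
    have al: "\<alpha> (Suc n) > 0" by (simp add: \<alpha>_def c_pos gamma_pos)
    \<comment> \<open>The top increment is one of the orthogonal summands of
      \<open>T (Suc n) a\<close>; the others are dropped.\<close>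
    have "(\<alpha> (Suc n) * tn ?q)\<^sup>2 \<le> (tn (T (Suc n) a))\<^sup>2"
      by (simp add: tn_T_Suc power_mult_distrib del: T.simps)
    then have "\<alpha> (Suc n) * tn ?q \<le> y"
      using T_le[of "Suc n"] power2_le_imp_le[OF _ tn_nonneg[OF T_carrier[OF assms(1)]]]
      by (meson order_trans)
    \<comment> \<open>Here \<open>\<alpha> = c / \<gamma>\<close> is unfolded: the factor c is what
      \<open>nrm_le_trace_norm\<close> needs to bound the C*-norm, and
      \<open>\<gamma> (Suc n)\<close> is what remains.\<close>
    then have "c (Suc n) * tn ?q \<le> y * \<gamma> (Suc n)"
      using gamma_pos[of "Suc n"] by (simp add: \<alpha>_def field_simps)
    then show ?thesis using nrm_le_trace_norm[OF q] by simp
  qed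
  have "nrm A (E (n + k) a \<ominus> E n a) \<le> y * (\<Sum>i<k. \<gamma> (Suc n + i))"
  proof (induction k)
    case (Suc k)
    show ?case using nrm_triangle3[of "E (n + Suc k) a" "E (n + k) a" "E n a"] Q[of "n + k"] Suc
      by (simp add: distrib_left)
  qed (simp add: a_minus_def add_minus_self)
  also have "\<dots> \<le> y * tail n" using tail_ge y by (intro mult_left_mono)
  finally show ?thesis .
qed

text \<open>\<open>E M a\<close> is so far known to approach a only in trace norm, so
  \<open>nrm_E_diff_le\<close> cannot simply be passed to the limit. For a fixed vector v it can,
  because right multiplication by v is bounded in trace norm, and \<open>nrm_leI\<close> reassembles
  the norm bound.\<close>

lemma nrm_minus_E_le:
  assumes [simp]: "a \<in> carrier A" and le: "comm_norm a \<le> ennreal y" and y: "0 \<le> y"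
  shows "nrm A (a \<ominus> E n a) \<le> y * tail n"
proof (rule nrm_leI)
  fix m v assume v: "v \<in> F m"
  note [simp] = FC[OF v]
  show "tn ((a \<ominus> E n a) \<otimes> v) \<le> y * tail n * tn v"
  proof (rule LIMSEQ_le_const)
    show "(\<lambda>M. tn (a \<ominus> E M a) * nrm A v + y * tail n * tn v) \<longlonglongrightarrow> y * tail n * tn v"
      using tendsto_add[OF tendsto_mult_left_zero[OF E_tendsto[OF assms(1)]] tendsto_const] by simp
    have "tn ((a \<ominus> E n a) \<otimes> v) \<le> tn (a \<ominus> E M a) * nrm A v + y * tail n * tn v" if "M \<ge> n" for M
    proof -
      have "a \<ominus> E n a = (a \<ominus> E M a) \<oplus> (E M a \<ominus> E n a)"
        by (simp add: a_minus_def add_assoc add_uminus_cancel)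
      then have "(a \<ominus> E n a) \<otimes> v = (a \<ominus> E M a) \<otimes> v \<oplus> (E M a \<ominus> E n a) \<otimes> v"
        by (simp add: mult_add_left)
      then have "tn ((a \<ominus> E n a) \<otimes> v) \<le> tn ((a \<ominus> E M a) \<otimes> v) + tn ((E M a \<ominus> E n a) \<otimes> v)"
        by (simp add: tn_triangle)
      moreover have "tn ((E M a \<ominus> E n a) \<otimes> v) \<le> y * tail n * tn v"
        using nrm_E_diff_le[OF assms, of n "M - n"] that
        by (intro order_trans[OF tn_mult_le] mult_right_mono) auto
      ultimately show ?thesis using tn_mult_le_right[of "a \<ominus> E M a" v] by simp
    qed
    then show "\<exists>N. \<forall>M\<ge>N. tn ((a \<ominus> E n a) \<otimes> v) \<le> tn (a \<ominus> E M a) * nrm A v + y * tail n * tn v"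
      by blast
  qed
qed (use y tail_nonneg in auto)

lemma comm_norm_eq_0_iff:
  assumes [simp]: "a \<in> carrier A" shows "comm_norm a = 0 \<longleftrightarrow> a \<in> F 0"
proof
  assume "comm_norm a = 0"
  then have "nrm A (a \<ominus> E 0 a) \<le> 0" using nrm_minus_E_le[of a 0 0] by simp
  then have "a \<ominus> E 0 a = \<zero>"
    using nrm_eq_0[of "a \<ominus> E 0 a"] nrm_nonneg[of "a \<ominus> E 0 a"] by simp
  then show "a \<in> F 0" using E_in[of a 0] by simp
next
  assume a: "a \<in> F 0"
  have "comm_norm a \<le> ennreal 0" by (rule comm_norm_leI_local[OF a]) (auto simp: comm_form_def)
  then show "comm_norm a = 0" by simp
qed

text \<open>After subtraction of the scalar \<open>E 0 a\<close> the Lipschitz ball of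
  \<open>F N\<close> lies in the norm ball of radius \<open>tail 0\<close>, where finite nets
  exist.\<close>

lemma comm_norm_totally_bounded:
  assumes "e > 0"
  obtains S where "finite S" "S \<subseteq> F N"
    "\<And>a. a \<in> F N \<Longrightarrow> comm_norm a \<le> 1 \<Longrightarrow> \<exists>s\<in>S. \<exists>z. nrm A (a \<ominus> (s \<oplus> z \<odot> \<one>)) < e"
proof -
  obtain S where S: "finite S" "S \<subseteq> F N" "\<forall>a\<in>F N. nrm A a \<le> tail 0 \<longrightarrow> (\<exists>s\<in>S. nrm A (a \<ominus> s) < e)"
    using F_totally_bounded[OF assms, where n = N and r = "tail 0"] by auto
  show thesis
  proof
    fix a assume a: "a \<in> F N" and le: "comm_norm a \<le> 1"
    note [simp] = FC[OF a]
    have "E 0 a \<in> F 0" by (simp add: E_in)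
    then obtain z where z: "E 0 a = z \<odot> \<one>" unfolding F_0 by blast
    have "nrm A (a \<ominus> E 0 a) \<le> tail 0" using nrm_minus_E_le[of a 1 0] le by simp
    moreover have "a \<ominus> E 0 a \<in> F N" using a E_in[of a 0] F_mono[of 0 N] by (simp add: F_minus)
    ultimately obtain s where s: "s \<in> S" "nrm A (a \<ominus> E 0 a \<ominus> s) < e" using S by blast
    have [simp]: "s \<in> carrier A" using s S by auto
    have "a \<ominus> E 0 a \<ominus> s = a \<ominus> (s \<oplus> z \<odot> \<one>)"
      unfolding z by (simp add: a_minus_def add_assoc uminus_add add_comm[of "\<ominus> s"])
    then show "\<exists>s\<in>S. \<exists>z. nrm A (a \<ominus> (s \<oplus> z \<odot> \<one>)) < e" using s by auto
  qed (use S in auto)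
qed

text \<open>The projection to a level with \<open>tail N < e / 2\<close> moves all Lipschitz
  elements by less than \<open>e / 2\<close> at once, so a net of that level suffices.\<close>

lemma comm_norm_totally_bounded_carrier:
  assumes "e > 0"
  obtains S where "finite S" "S \<subseteq> carrier A"
    "\<And>a. a \<in> carrier A \<Longrightarrow> comm_norm a \<le> 1 \<Longrightarrow> \<exists>s\<in>S. \<exists>z. nrm A (a \<ominus> (s \<oplus> z \<odot> \<one>)) < e"
proof -
  obtain N where N: "tail N < e / 2"
    using order_tendstoD(2)[OF tail_tendsto, of "e / 2"] assms by (auto simp: eventually_sequentially)
  obtain S where S: "finite S" "S \<subseteq> F N"
    "\<And>a. a \<in> F N \<Longrightarrow> comm_norm a \<le> 1 \<Longrightarrow> \<exists>s\<in>S. \<exists>z. nrm A (a \<ominus> (s \<oplus> z \<odot> \<one>)) < e / 2"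
    using comm_norm_totally_bounded[of "e / 2" N] assms by auto
  show thesis
  proof
    show "S \<subseteq> carrier A" using S(2) F_carrier by blast
    fix a assume a [simp]: "a \<in> carrier A" and le: "comm_norm a \<le> 1"
    have "comm_norm (E N a) \<le> 1" using comm_norm_E_le[OF a] le by (rule order_trans)
    then obtain s z where s: "s \<in> S" "nrm A (E N a \<ominus> (s \<oplus> z \<odot> \<one>)) < e / 2" using S(3)[of "E N a"] by (auto simp: E_in)
    have [simp]: "s \<in> carrier A" using s S(2) by auto
    have "nrm A (a \<ominus> E N a) \<le> tail N" using nrm_minus_E_le[of a 1 N] le by simp
    then have "nrm A (a \<ominus> (s \<oplus> z \<odot> \<one>)) < e"
      using nrm_triangle3[of a "E N a" "s \<oplus> z \<odot> \<one>"] s N by simp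
    then show "\<exists>s\<in>S. \<exists>z. nrm A (a \<ominus> (s \<oplus> z \<odot> \<one>)) < e" using s by blast
  qed (use S in auto)
qed

end

lemma ennreal_half_double: "ennreal (1 / 2) * (K + K) = K"
proof -
  have "K + K = ennreal 2 * K" by (simp add: mult_2)
  moreover have "ennreal (1 / 2) * ennreal 2 = 1" by (subst ennreal_mult[symmetric]) auto
  ultimately show ?thesis by (simp only: mult.assoc[symmetric] mult_1)
qed

lemma hausdorff_distance_le:
  assumes "\<And>x. x \<in> X \<Longrightarrow> \<exists>y\<in>Y. d x y \<le> r" "\<And>y. y \<in> Y \<Longrightarrow> \<exists>x\<in>X. d x y \<le> r"
  shows "hausdorff_distance d X Y \<le> r"
  unfolding hausdorff_distance_def using assms
  by (intro max.boundedI SUP_least) (meson INF_lower2)+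

lemma mk_self [simp]: "mk T \<phi> \<phi> = 0"
proof -
  have "mk T \<phi> \<phi> \<le> 0" unfolding mk_def by (rule SUP_least) simp
  then show ?thesis by simp
qed

lemma hausdorff_distance_mk_self: "hausdorff_distance (mk T) S S = 0"
proof -
  have "hausdorff_distance (mk T) S S \<le> 0" by (rule hausdorff_distance_le) (metis mk_self order_refl)+
  then show ?thesis by simp
qed

section \<open>Membership in the two classes of quantum metric spaces\<close>

context ci_system
begin

lemma comm_norm_scale:
  assumes [simp]: "b \<in> carrier A" and fin: "comm_norm b < \<infinity>"
  obtains r where "r > 0" "comm_norm (of_real (1 / r) \<odot> b) \<le> 1" "of_real r \<odot> (of_real (1 / r) \<odot> b) = b"
proof (cases b rule: comm_norm_cases)
  case (real r)
  \<comment> \<open>Dividing by \<open>r + 1\<close> instead of r also covers elements with seminorm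
    0.\<close>
  have "comm_norm (of_real (1 / (r + 1)) \<odot> b) = ennreal (r / (r + 1))"
    unfolding comm_norm_smult[OF assms(1)] real(1)
    using real(2) by (simp flip: ennreal_mult add: norm_divide)
  also have "\<dots> \<le> ennreal 1" using real(2) by (intro ennreal_leI) simp
  finally have "comm_norm (of_real (1 / (r + 1)) \<odot> b) \<le> 1" by simp
  moreover have "of_real (r + 1) * of_real (1 / (r + 1)) = (1::complex)"
    using real(2) by (subst of_real_mult[symmetric]) simp
  ultimately show thesis using that[of "r + 1"] real(2)
    by (simp add: smult_smult del: of_real_add of_real_divide)
qed (use fin in simp)

lemma comm_norm_minus: "a \<in> carrier A \<Longrightarrow> b \<in> carrier A \<Longrightarrow> comm_norm (a \<ominus> b) \<le> comm_norm a + comm_norm b"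
  using comm_norm_add[of a "(- 1) \<odot> b"] by (simp add: minus_smult comm_norm_smult)

lemma comm_norm_dense: "a \<in> carrier A \<Longrightarrow> e > 0 \<Longrightarrow> \<exists>b\<in>carrier A. comm_norm b < \<infinity> \<and> nrm A (a \<ominus> b) < e"
  using F_dense[of a e] comm_norm_finite FC by blast

text \<open>L is an arbitrary function on the type that agrees with \<open>comm_norm\<close> on the
  carrier; this is all that holds for the Christensen-Ivan seminorm.\<close>

theorem leibniz_cqms_comm_norm:
  assumes L: "\<And>a. a \<in> carrier A \<Longrightarrow> L a = comm_norm a"
  shows "leibniz_cqms A L"
proof -
  have dom: "seminorm_dom A L = {a \<in> carrier A. comm_norm a < \<infinity>}"
    by (auto simp: seminorm_dom_def L)
  have ball: "{a \<in> carrier A. L a \<le> 1} = {a \<in> carrier A. comm_norm a \<le> 1}" by (auto simp: L)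
  have "metrizes_weak_star A (mk {a \<in> carrier A. comm_norm a \<le> 1})"
  proof (rule metrizes_weak_starI)
    fix a e assume a [simp]: "a \<in> carrier A" and "(e::real) > 0"
    then obtain b where b [simp]: "b \<in> carrier A" and "comm_norm b < \<infinity>" and n: "nrm A (a \<ominus> b) < e"
      using comm_norm_dense by blast
    then obtain r where r: "r > 0" "comm_norm (of_real (1 / r) \<odot> b) \<le> 1" "of_real r \<odot> (of_real (1 / r) \<odot> b) = b"
      using comm_norm_scale by blast
    let ?t = "of_real (1 / r) \<odot> b"
    \<comment> \<open>The ball of the whole algebra contains arbitrary, not only self-adjoint
      elements, so one of them suffices and the second coefficient is 0.\<close>
    have "of_real r \<odot> ?t \<oplus> 0 \<odot> ?t = b" using r(3) by simp
    then show "\<exists>s\<in>{a \<in> carrier A. comm_norm a \<le> 1}. \<exists>t\<in>{a \<in> carrier A. comm_norm a \<le> 1}. \<exists>c d. nrm A (a \<ominus> (c \<odot> s \<oplus> d \<odot> t)) < e"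
      using n r(2) by (intro bexI[of _ ?t] exI[of _ "of_real r"] exI[of _ 0]) auto
  next
    fix e :: real assume "e > 0"
    then show "\<exists>S. finite S \<and> S \<subseteq> carrier A \<and>
      (\<forall>t\<in>{a \<in> carrier A. comm_norm a \<le> 1}. \<exists>s\<in>S. \<exists>c. nrm A (t \<ominus> (s \<oplus> c \<odot> \<one>)) < e)"
      using comm_norm_totally_bounded_carrier[of e] by (metis (no_types, lifting) mem_Collect_eq)
  qed auto
  moreover have "comm_norm (a \<oplus> b) < \<infinity>" if "a \<in> carrier A" "b \<in> carrier A" "comm_norm a < \<infinity>" "comm_norm b < \<infinity>" for a b
    using comm_norm_add[OF that(1,2)] that(3,4) by (simp add: order_le_less_trans)
  moreover have "comm_norm (a \<otimes> b) < \<infinity>" if "a \<in> carrier A" "b \<in> carrier A" "comm_norm a < \<infinity>" "comm_norm b < \<infinity>" for a b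
  proof -
    have "ennreal (nrm A a) * comm_norm b + ennreal (nrm A b) * comm_norm a < \<infinity>"
      using that(3,4) by (simp add: ennreal_mult_less_top)
    then show ?thesis using comm_norm_Leibniz[OF that(1,2)] by (rule order_le_less_trans[rotated])
  qed
  moreover have "comm_norm (z \<odot> a) < \<infinity>" if "a \<in> carrier A" "comm_norm a < \<infinity>" for a z
    using that by (simp add: comm_norm_smult ennreal_mult_less_top)
  moreover have "{a \<in> carrier A. L a = 0} = {z \<odot> \<one> | z. True}"
    unfolding F_0[symmetric] using comm_norm_eq_0_iff FC by (auto simp: L)
  moreover have "\<exists>b\<in>{a \<in> carrier A. comm_norm a < \<infinity>}. nrm A (a \<ominus> b) < e" if "a \<in> carrier A" "e > 0" for a and e :: real
    using comm_norm_dense[OF that] by blast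
  ultimately show ?thesis
    unfolding leibniz_cqms_def dom ball
    by (intro conjI) (simp_all add: L comm_norm_add comm_norm_smult comm_norm_star comm_norm_Leibniz unital_cstar_algebra_axioms)
qed

text \<open>Formulated for a subalgebra so that both a level and the algebra itself are instances.
  The Lipschitz ball now contains only self-adjoint elements, so density passes through real and
  imaginary parts; the Jordan and Lie inequalities are averages of the Leibniz inequality.\<close>

lemma propinquity_class_subalg:
  assumes sub: "S \<subseteq> carrier A" and cstar: "unital_cstar_algebra (subalg S)"
    and S_add: "\<And>x y. x \<in> S \<Longrightarrow> y \<in> S \<Longrightarrow> x \<oplus> y \<in> S"
    and S_smult: "\<And>z x. x \<in> S \<Longrightarrow> z \<odot> x \<in> S"
    and S_mult: "\<And>x y. x \<in> S \<Longrightarrow> y \<in> S \<Longrightarrow> x \<otimes> y \<in> S"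
    and S_star: "\<And>x. x \<in> S \<Longrightarrow> star A x \<in> S"
    and S_one: "\<one> \<in> S"
    and minus: "\<And>x y. x \<in> S \<Longrightarrow> y \<in> S \<Longrightarrow> x \<ominus>\<^bsub>subalg S\<^esub> y = x \<ominus> y"
    and dense: "\<And>a e. a \<in> S \<Longrightarrow> e > 0 \<Longrightarrow> \<exists>b\<in>S. comm_norm b < \<infinity> \<and> nrm A (a \<ominus> b) < e"
    and tb: "\<And>e. e > 0 \<Longrightarrow> \<exists>U. finite U \<and> U \<subseteq> S \<and>
      (\<forall>a\<in>S. comm_norm a \<le> 1 \<longrightarrow> (\<exists>s\<in>U. \<exists>z. nrm A (a \<ominus> (s \<oplus> z \<odot> \<one>)) < e))"
    and L: "\<And>a. a \<in> S \<Longrightarrow> L a = comm_norm a"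
  shows "propinquity_class (subalg S) L"
proof -
  have SC [simp]: "x \<in> carrier A" if "x \<in> S" for x using sub that by blast
  have sa: "sa (subalg S) = {a \<in> S. star A a = a}" by (simp add: sa_def)
  have ball: "lipschitz_ball (subalg S) L = {a \<in> S. star A a = a \<and> comm_norm a \<le> 1}"
    by (auto simp: lipschitz_ball_def sa L)
  \<comment> \<open>Real part of b; since the star preserves the seminorm, taking it does not
    increase the seminorm.\<close>
  define re where "re b = (1 / 2) \<odot> (b \<oplus> star A b)" for b
  have re: "re b \<in> S" "star A (re b) = re b" "comm_norm (re b) \<le> comm_norm b" if b: "b \<in> S" for b
  proof -
    note [simp] = SC[OF b]
    show "re b \<in> S" using b by (simp add: re_def S_smult S_add S_star)
    show "star A (re b) = re b" by (simp add: re_def star_smult star_add add_comm)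
    have "comm_norm (re b) = ennreal (1 / 2) * comm_norm (b \<oplus> star A b)" by (simp add: re_def comm_norm_smult norm_divide)
    also have "\<dots> \<le> ennreal (1 / 2) * (comm_norm b + comm_norm b)"
      using comm_norm_add[of b "star A b"] by (intro mult_left_mono) (simp_all add: comm_norm_star)
    finally show "comm_norm (re b) \<le> comm_norm b" by (simp only: ennreal_half_double)
  qed
  have re_im: "b = 1 \<odot> re b \<oplus> \<i> \<odot> re ((- \<i>) \<odot> b)" if b: "b \<in> S" for b
  proof -
    note [simp] = SC[OF b]
    have "1 \<odot> re b \<oplus> \<i> \<odot> re ((- \<i>) \<odot> b) =
      ((1 / 2) \<odot> b \<oplus> (1 / 2) \<odot> star A b) \<oplus> ((1 / 2) \<odot> b \<oplus> (- (1 / 2)) \<odot> star A b)"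
      by (simp add: re_def star_smult smult_add_right smult_smult)
    also have "\<dots> = ((1 / 2) \<odot> b \<oplus> (1 / 2) \<odot> b) \<oplus> ((1 / 2) \<odot> star A b \<oplus> (- (1 / 2)) \<odot> star A b)"
      by (simp add: add_assoc add_lcomm[of "(1 / 2) \<odot> star A b"])
    also have "\<dots> = b" by (simp flip: smult_add_left)
    finally show ?thesis by simp
  qed
  \<comment> \<open>For self-adjoint a the element \<open>a - re b\<close> is the real part of
    \<open>a - b\<close>, and taking real parts is contractive.\<close>
  have re_approx: "nrm A (a \<ominus> re b) \<le> nrm A (a \<ominus> b)" if a: "a \<in> S" "star A a = a" and b: "b \<in> S" for a b
  proof -
    note [simp] = SC[OF a(1)] SC[OF b]
    have "(a \<ominus> b) \<oplus> star A (a \<ominus> b) = (a \<oplus> a) \<ominus> (b \<oplus> star A b)"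
      by (simp add: star_minus a(2)) (simp add: a_minus_def uminus_add add_assoc add_lcomm[of "\<ominus> b"])
    moreover have "a = (1 / 2) \<odot> (a \<oplus> a)" by (simp add: smult_add_right flip: smult_add_left)
    ultimately have "a \<ominus> re b = (1 / 2) \<odot> ((a \<ominus> b) \<oplus> star A (a \<ominus> b))"
      unfolding re_def by (simp add: smult_minus_right)
    then have "nrm A (a \<ominus> re b) = nrm A ((a \<ominus> b) \<oplus> star A (a \<ominus> b)) / 2"
      by (simp add: nrm_smult norm_divide)
    also have "\<dots> \<le> nrm A (a \<ominus> b)" using nrm_triangle[of "a \<ominus> b" "star A (a \<ominus> b)"] by simp
    finally show ?thesis .
  qed
  have scale: "\<exists>t\<in>lipschitz_ball (subalg S) L. \<exists>r. b = r \<odot> t"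
    if b: "b \<in> S" "star A b = b" "comm_norm b < \<infinity>" for b
  proof -
    note [simp] = SC[OF b(1)]
    obtain r where r: "comm_norm (of_real (1 / r) \<odot> b) \<le> 1" "of_real r \<odot> (of_real (1 / r) \<odot> b) = b"
      using comm_norm_scale[OF SC[OF b(1)] b(3)] by blast
    have "of_real (1 / r) \<odot> b \<in> lipschitz_ball (subalg S) L"
      using r(1) b by (simp add: ball S_smult star_smult)
    then show ?thesis using r(2) by metis
  qed
  have "metrizes_weak_star (subalg S) (mk (lipschitz_ball (subalg S) L))"
  proof (rule unital_cstar_algebra.metrizes_weak_starI[OF cstar])
    show "lipschitz_ball (subalg S) L \<subseteq> carrier (subalg S)" by (auto simp: ball)
  next
    fix a and e :: real assume "a \<in> carrier (subalg S)" and e: "e > 0"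
    then have a: "a \<in> S" by simp
    obtain b where b: "b \<in> S" "comm_norm b < \<infinity>" "nrm A (a \<ominus> b) < e" using dense[OF a e] by blast
    have ib: "(- \<i>) \<odot> b \<in> S" "comm_norm ((- \<i>) \<odot> b) < \<infinity>" using b by (simp_all add: S_smult comm_norm_smult)
    obtain s p where s: "s \<in> lipschitz_ball (subalg S) L" "re b = p \<odot> s"
      using scale[OF re(1,2)[OF b(1)] order_le_less_trans[OF re(3)[OF b(1)] b(2)]] by blast
    obtain t q where t: "t \<in> lipschitz_ball (subalg S) L" "re ((- \<i>) \<odot> b) = q \<odot> t"
      using scale[OF re(1,2)[OF ib(1)] order_le_less_trans[OF re(3)[OF ib(1)] ib(2)]] by blast
    have [simp]: "s \<in> S" "t \<in> S" using s t by (auto simp: ball)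
    have "b = p \<odot> s \<oplus> (\<i> * q) \<odot> t"
      using re_im[OF b(1)] s(2) t(2) by (simp add: smult_smult)
    then have "nrm (subalg S) (a \<ominus>\<^bsub>subalg S\<^esub> (p \<odot>\<^bsub>subalg S\<^esub> s \<oplus>\<^bsub>subalg S\<^esub> (\<i> * q) \<odot>\<^bsub>subalg S\<^esub> t)) < e"
      using b a by (simp add: minus)
    then show "\<exists>s\<in>lipschitz_ball (subalg S) L. \<exists>t\<in>lipschitz_ball (subalg S) L. \<exists>c d.
        nrm (subalg S) (a \<ominus>\<^bsub>subalg S\<^esub> (c \<odot>\<^bsub>subalg S\<^esub> s \<oplus>\<^bsub>subalg S\<^esub> d \<odot>\<^bsub>subalg S\<^esub> t)) < e"
      using s t by blast
  next
    fix e :: real assume "e > 0"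
    from tb[OF this] obtain U where U: "finite U" "U \<subseteq> S"
      "\<forall>a\<in>S. comm_norm a \<le> 1 \<longrightarrow> (\<exists>s\<in>U. \<exists>z. nrm A (a \<ominus> (s \<oplus> z \<odot> \<one>)) < e)"
      by (elim exE conjE)
    have "\<exists>s\<in>U. \<exists>z. nrm (subalg S) (t \<ominus>\<^bsub>subalg S\<^esub> (s \<oplus>\<^bsub>subalg S\<^esub> z \<odot>\<^bsub>subalg S\<^esub> \<one>\<^bsub>subalg S\<^esub>)) < e"
      if "t \<in> lipschitz_ball (subalg S) L" for t
    proof -
      have t: "t \<in> S" "comm_norm t \<le> 1" using that by (auto simp: ball)
      obtain s z where "s \<in> U" "nrm A (t \<ominus> (s \<oplus> z \<odot> \<one>)) < e" using U(3) t by blast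
      moreover have "s \<oplus> z \<odot> \<one> \<in> S" using \<open>s \<in> U\<close> U(2) by (auto intro!: S_add S_smult S_one)
      ultimately show ?thesis using t(1) by (intro bexI[of _ s] exI[of _ z]) (auto simp: minus)
    qed
    then show "\<exists>U. finite U \<and> U \<subseteq> carrier (subalg S) \<and> (\<forall>t\<in>lipschitz_ball (subalg S) L. \<exists>s\<in>U. \<exists>c.
        nrm (subalg S) (t \<ominus>\<^bsub>subalg S\<^esub> (s \<oplus>\<^bsub>subalg S\<^esub> c \<odot>\<^bsub>subalg S\<^esub> \<one>\<^bsub>subalg S\<^esub>)) < e)"
      using U(1,2) by (intro exI[of _ U]) simp
  qed
  moreover have "{a \<in> sa (subalg S). L a = 0} = {of_real r \<odot> \<one> | r::real. True}"
  proof
    show "{a \<in> sa (subalg S). L a = 0} \<subseteq> {of_real r \<odot> \<one> | r::real. True}"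
    proof
      fix a assume "a \<in> {a \<in> sa (subalg S). L a = 0}"
      then have a: "a \<in> S" "star A a = a" "comm_norm a = 0" by (auto simp: sa L)
      then obtain z where z: "a = z \<odot> \<one>" using comm_norm_eq_0_iff[of a] F_0 by auto
      \<comment> \<open>Evaluating the trace on both sides of \<open>a* = a\<close> compares the
        scalars and shows that z is real.\<close>
      have "\<tau> (cnj z \<odot> \<one>) = \<tau> (z \<odot> \<one>)" using a(2) unfolding z by (simp add: star_smult)
      then have "cnj z = z" by (simp add: tau_smult state_one[OF tau])
      then have "z = of_real (Re z)" by (simp add: complex_eq_iff)
      then have "a = of_real (Re z) \<odot> \<one>" using z by simp
      then show "a \<in> {of_real r \<odot> \<one> | r::real. True}" by blast
    qed
    have "comm_norm (of_real r \<odot> \<one>) = 0" for r :: real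
      using comm_norm_eq_0_iff[of "of_real r \<odot> \<one>"] unfolding F_0 by blast
    then show "{of_real r \<odot> \<one> | r::real. True} \<subseteq> {a \<in> sa (subalg S). L a = 0}"
      by (auto simp: sa L S_smult S_one star_smult)
  qed
  moreover have "\<exists>e>0. \<forall>b\<in>sa (subalg S). nrm A (b \<ominus>\<^bsub>subalg S\<^esub> a) < e \<longrightarrow> y < L b"
    if "a \<in> sa (subalg S)" "y < L a" for a y
  proof -
    have a: "a \<in> S" "y < comm_norm a" using that by (auto simp: sa L)
    obtain e where "e > 0" "\<And>b. b \<in> carrier A \<Longrightarrow> nrm A (b \<ominus> a) < e \<Longrightarrow> y < comm_norm b"
      using comm_norm_lsc[OF SC[OF a(1)] a(2)] by blast
    then show ?thesis using a by (intro exI[of _ e]) (auto simp: sa L minus)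
  qed
  moreover have "\<exists>b\<in>sa (subalg S). L b < \<infinity> \<and> nrm A (a \<ominus>\<^bsub>subalg S\<^esub> b) < e"
    if "a \<in> sa (subalg S)" "e > 0" for a and e :: real
  proof -
    have a: "a \<in> S" "star A a = a" using that by (auto simp: sa)
    obtain b where b: "b \<in> S" "comm_norm b < \<infinity>" "nrm A (a \<ominus> b) < e" using dense[OF a(1) \<open>e > 0\<close>] by blast
    show ?thesis using re[OF b(1)] re_approx[OF a b(1)] b a
      by (intro bexI[of _ "re b"]) (auto simp: sa L minus intro: order_le_less_trans)
  qed
  moreover have "comm_norm ((1 / 2) \<odot> (a \<otimes> b \<oplus> b \<otimes> a)) \<le> ennreal (nrm A a) * comm_norm b + ennreal (nrm A b) * comm_norm a"
      "comm_norm ((1 / (2 * \<i>)) \<odot> (a \<otimes> b \<ominus> b \<otimes> a)) \<le> ennreal (nrm A a) * comm_norm b + ennreal (nrm A b) * comm_norm a"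
    if [simp]: "a \<in> carrier A" "b \<in> carrier A" for a b
  proof -
    let ?K = "ennreal (nrm A a) * comm_norm b + ennreal (nrm A b) * comm_norm a"
    \<comment> \<open>The Leibniz bound is symmetric in a and b, so \<open>a b\<close> and
      \<open>b a\<close> together cost twice \<open>?K\<close>; the coefficient of modulus 1/2
      undoes the doubling.\<close>
    have K: "comm_norm (a \<otimes> b) + comm_norm (b \<otimes> a) \<le> ?K + ?K"
      using comm_norm_Leibniz[of b a] by (intro add_mono comm_norm_Leibniz) (simp_all add: add.commute)
    have *: "comm_norm (z \<odot> x) \<le> ?K" if "x \<in> carrier A" "cmod z = 1 / 2" "comm_norm x \<le> comm_norm (a \<otimes> b) + comm_norm (b \<otimes> a)" for x z
    proof -
      have "comm_norm (z \<odot> x) = ennreal (1 / 2) * comm_norm x" using comm_norm_smult[OF that(1), of z] unfolding that(2) .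
      also have "\<dots> \<le> ennreal (1 / 2) * (?K + ?K)"
        using order_trans[OF that(3) K] by (rule mult_left_mono) simp
      finally show ?thesis by (simp only: ennreal_half_double)
    qed
    show "comm_norm ((1 / 2) \<odot> (a \<otimes> b \<oplus> b \<otimes> a)) \<le> ?K" by (rule *) (auto simp: comm_norm_add norm_divide)
    show "comm_norm ((1 / (2 * \<i>)) \<odot> (a \<otimes> b \<ominus> b \<otimes> a)) \<le> ?K" by (rule *) (auto simp: comm_norm_minus norm_divide norm_mult)
  qed
  moreover have "(1 / (2 * \<i>)) \<odot> (a \<otimes> b \<ominus> b \<otimes> a) \<in> S" "(1 / 2) \<odot> (a \<otimes> b \<oplus> b \<otimes> a) \<in> S"
    if "a \<in> S" "b \<in> S" for a b
    using that by (simp_all add: minus_smult S_smult S_add S_mult)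
  ultimately show ?thesis
    unfolding propinquity_class_def using cstar
    by (simp add: sa L comm_norm_add comm_norm_smult S_add S_smult S_mult minus norm_divide norm_mult)
qed

text \<open>The best-approximation property bounds the trace-norm distance of l from
  \<open>E N l\<close> by the norm distance to the sequence, so l is fixed by
  \<open>E N\<close>.\<close>

lemma F_closed:
  assumes s: "\<And>n. s n \<in> F N" and l [simp]: "l \<in> carrier A" and lim: "(\<lambda>n. nrm A (s n \<ominus> l)) \<longlonglongrightarrow> 0"
  shows "l \<in> F N"
proof -
  note [simp] = FC[OF s]
  have "tn (l \<ominus> E N l) \<le> 0"
  proof (rule LIMSEQ_le_const[OF lim])
    have "tn (l \<ominus> E N l) \<le> nrm A (s n \<ominus> l)" for n
      using tn_E_best[OF l s[of n]] tn_le_nrm[of "l \<ominus> s n"] nrm_minus_commute[of "s n" l] by simp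
    then show "\<exists>m. \<forall>n\<ge>m. tn (l \<ominus> E N l) \<le> nrm A (s n \<ominus> l)" by blast
  qed
  then have "l = E N l" by (intro eqI_tn antisym) auto
  then show ?thesis using E_in[OF l, of N] by simp
qed

lemma subalg_F_cstar: "unital_cstar_algebra (subalg (F N))"
  by (rule subalg_cstar) (auto simp: F_one F_add F_mult F_smult F_star intro: F_closed)

lemma subalg_carrier: "subalg (carrier A) = A" by (simp add: subalg_def)

theorem propinquity_class_F:
  assumes "\<And>a. a \<in> F N \<Longrightarrow> L a = comm_norm a" shows "propinquity_class (subalg (F N)) L"
proof (rule propinquity_class_subalg)
  show "x \<ominus>\<^bsub>subalg (F N)\<^esub> y = x \<ominus> y" if "x \<in> F N" "y \<in> F N" for x y
    using that by (intro subalg_minus) (auto simp: F_one F_add F_mult F_smult F_star intro: F_closed)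
  show "\<exists>b\<in>F N. comm_norm b < \<infinity> \<and> nrm A (a \<ominus> b) < e" if "a \<in> F N" "e > 0" for a e
    using that comm_norm_finite[OF that(1)] by (intro bexI[of _ a]) (auto simp: a_minus_def add_minus_self)
  show "\<exists>U. finite U \<and> U \<subseteq> F N \<and>
      (\<forall>a\<in>F N. comm_norm a \<le> 1 \<longrightarrow> (\<exists>s\<in>U. \<exists>z. nrm A (a \<ominus> (s \<oplus> z \<odot> \<one>)) < e))" if "e > 0" for e
    using comm_norm_totally_bounded[OF that, of N] by metis
qed (auto simp: F_one F_add F_mult F_smult F_star subalg_F_cstar assms)

theorem propinquity_class_comm_norm:
  assumes "\<And>a. a \<in> carrier A \<Longrightarrow> L a = comm_norm a" shows "propinquity_class A L"
proof -
  have "propinquity_class (subalg (carrier A)) L"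
  proof (rule propinquity_class_subalg)
    show "\<exists>U. finite U \<and> U \<subseteq> carrier A \<and>
      (\<forall>a\<in>carrier A. comm_norm a \<le> 1 \<longrightarrow> (\<exists>s\<in>U. \<exists>z. nrm A (a \<ominus> (s \<oplus> z \<odot> \<one>)) < e))" if "e > 0" for e
      using comm_norm_totally_bounded_carrier[OF that] by metis
    show "\<exists>b\<in>carrier A. comm_norm b < \<infinity> \<and> nrm A (a \<ominus> b) < e" if "a \<in> carrier A" "e > 0" for a e
      using that by (rule comm_norm_dense)
  qed (auto simp: subalg_carrier unital_cstar_algebra_axioms assms)
  then show ?thesis by (simp add: subalg_carrier)
qed

end

section \<open>Bridges\<close>

context ci_system
begin

text \<open>Apply Cauchy-Schwarz for the positive form \<open>\<langle>x u, v\<rangle>\<close> with \<open>v = x u\<close>.\<close>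

lemma nrm_le_1_of_form:
  assumes x: "x \<in> F N" and xs: "star A x = x"
    and form: "\<And>v. v \<in> F N \<Longrightarrow> 0 \<le> Re (ip (x \<otimes> v) v) \<and> Re (ip (x \<otimes> v) v) \<le> (tn v)\<^sup>2"
  shows "nrm A x \<le> 1"
proof (rule nrm_leI_F[OF x])
  fix u assume u: "u \<in> F N"
  note [simp] = FC[OF x] FC[OF u]
  define v where "v = x \<otimes> u"
  have v: "v \<in> F N" using x u by (simp add: v_def F_mult)
  note [simp] = FC[OF v]
  have sym: "ip (x \<otimes> u) v = cnj (ip (x \<otimes> v) u)"
    using ip_mult_left[of x u v] ip_cnj[of "x \<otimes> v" u] by (simp add: xs)
  have "(cmod (ip (x \<otimes> v) u))\<^sup>2 \<le> Re (ip (x \<otimes> u) u) * Re (ip (x \<otimes> v) v)"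
  proof (rule complex_quadratic_nonneg_imp)
    fix z
    have Re_sum: "Re (p + w + cnj w + q) = Re p + 2 * Re w + Re q" for p w q :: complex by simp
    have "ip (x \<otimes> (u \<oplus> z \<odot> v)) (u \<oplus> z \<odot> v) =
      ip (x \<otimes> u) u + z * ip (x \<otimes> v) u + cnj (z * ip (x \<otimes> v) u) + (z * cnj z) * ip (x \<otimes> v) v"
      by (simp add: mult_add_right smult_mult_right ip_add_left ip_add_right ip_smult_left
          ip_smult_right sym algebra_simps)
    moreover have "Re ((z * cnj z) * ip (x \<otimes> v) v) = (cmod z)\<^sup>2 * Re (ip (x \<otimes> v) v)"
      by (simp add: complex_mult_cnj cmod_power2 del: of_real_power of_real_add)
    ultimately have "Re (ip (x \<otimes> (u \<oplus> z \<odot> v)) (u \<oplus> z \<odot> v)) =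
      Re (ip (x \<otimes> u) u) + 2 * Re (z * ip (x \<otimes> v) u) + (cmod z)\<^sup>2 * Re (ip (x \<otimes> v) v)"
      by (simp only: Re_sum)
    then show "0 \<le> Re (ip (x \<otimes> u) u) + 2 * Re (z * ip (x \<otimes> v) u) + (cmod z)\<^sup>2 * Re (ip (x \<otimes> v) v)"
      using form[of "u \<oplus> z \<odot> v"] u v by (simp add: F_add F_smult)
  qed
  also have "ip (x \<otimes> v) u = of_real ((tn v)\<^sup>2)"
    using ip_mult_left[of x v u] ip_self[of v] by (simp add: xs v_def)
  also have "Re (ip (x \<otimes> u) u) * Re (ip (x \<otimes> v) v) \<le> (tn u)\<^sup>2 * (tn v)\<^sup>2"
    using form[OF u] form[OF v] by (intro mult_mono) auto
  finally have "(tn v)\<^sup>2 * (tn v)\<^sup>2 \<le> (tn u)\<^sup>2 * (tn v)\<^sup>2"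
    by (simp add: power2_eq_square norm_mult)
  then have "(tn v)\<^sup>2 \<le> (tn u)\<^sup>2" by (rule le_of_mult_self_le) auto
  then have "tn v \<le> tn u" by (rule power2_le_imp_le) simp
  then show "tn (x \<otimes> u) \<le> 1 * tn u" by (simp add: v_def)
qed simp

text \<open>Positivity of \<open>p = E N (a* a)\<close> in a form that needs no order on A. At v the
  form of \<open>1 - p / s\<close> is \<open>(tn v)^2 - (tn (a v))^2 / s\<close>; for
  \<open>s >= ||a||^2\<close> it lies between 0 and \<open>(tn v)^2\<close>, and
  \<open>nrm_le_1_of_form\<close> bounds the norm.\<close>

lemma E_positive_nrm:
  assumes [simp]: "a \<in> carrier A"
  obtains s where "s > 0" "nrm A (\<one> \<ominus> of_real (1 / s) \<odot> E N (star A a \<otimes> a)) \<le> 1"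
proof
  \<comment> \<open>The summand 1 keeps s positive when a is zero.\<close>
  define s where "s = (nrm A a)\<^sup>2 + 1"
  show s: "s > 0" by (simp add: s_def add_nonneg_pos)
  let ?p = "E N (star A a \<otimes> a)"
  let ?x = "\<one> \<ominus> of_real (1 / s) \<odot> ?p"
  show "nrm A ?x \<le> 1"
  proof (rule nrm_le_1_of_form)
    show "?x \<in> F N" by (simp add: F_minus F_one F_smult E_in)
    show "star A ?x = ?x" by (simp add: star_minus star_smult E_star[symmetric] star_mult)
    fix v assume v: "v \<in> F N"
    note [simp] = FC[OF v]
    have "ip (?p \<otimes> v) v = ip (star A a \<otimes> a \<otimes> v) v"
      using E_mult_right[of "star A a \<otimes> a" v N] v ip_E(1)[OF _ v, of "star A a \<otimes> a \<otimes> v"] by simp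
    also have "\<dots> = of_real ((tn (a \<otimes> v))\<^sup>2)"
      using ip_mult_left[of "star A a" "a \<otimes> v" v] ip_self[of "a \<otimes> v"] by (simp add: mult_assoc)
    finally have "ip (?x \<otimes> v) v = of_real ((tn v)\<^sup>2 - (1 / s) * (tn (a \<otimes> v))\<^sup>2)"
      by (simp add: minus_smult mult_add_left smult_mult_left ip_add_left ip_smult_left ip_self)
    then have eq: "Re (ip (?x \<otimes> v) v) = (tn v)\<^sup>2 - (1 / s) * (tn (a \<otimes> v))\<^sup>2" by simp
    have "(tn (a \<otimes> v))\<^sup>2 \<le> (nrm A a * tn v)\<^sup>2" by (intro power_mono tn_mult_le) auto
    also have "\<dots> \<le> s * (tn v)\<^sup>2" by (simp add: s_def power_mult_distrib distrib_right)
    finally have "(1 / s) * (tn (a \<otimes> v))\<^sup>2 \<le> (tn v)\<^sup>2" using s by (simp add: field_simps)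
    moreover have "0 \<le> (1 / s) * (tn (a \<otimes> v))\<^sup>2" using s by simp
    ultimately show "0 \<le> Re (ip (?x \<otimes> v) v) \<and> Re (ip (?x \<otimes> v) v) \<le> (tn v)\<^sup>2" unfolding eq by linarith
  qed
qed

text \<open>B is an abstract copy of \<open>F N\<close> with an isometric embedding. In the
  application one and the same algebra is embedded into two different UHF algebras, by an inclusion
  into one and by a genuine map into the other.\<close>

context
  fixes B :: "'a cstar_algebra" and \<iota> :: "'a \<Rightarrow> 'a" and N :: nat and LA LB :: "'a \<Rightarrow> ennreal"
  assumes B: "unital_cstar_algebra B" and mono: "unital_star_mono B A \<iota>"
    and img: "\<iota> ` carrier B = F N"
    and iso: "\<And>b. b \<in> carrier B \<Longrightarrow> nrm A (\<iota> b) = nrm B b"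
    and LA: "\<And>a. a \<in> carrier A \<Longrightarrow> LA a = comm_norm a"
    and LB: "\<And>b. b \<in> carrier B \<Longrightarrow> LB b = comm_norm (\<iota> b)"
begin

interpretation B: unital_cstar_algebra B by (rule B)

lemma iota:
  "b \<in> carrier B \<Longrightarrow> \<iota> b \<in> F N"
  "b \<in> carrier B \<Longrightarrow> b' \<in> carrier B \<Longrightarrow> \<iota> (b \<oplus>\<^bsub>B\<^esub> b') = \<iota> b \<oplus> \<iota> b'"
  "b \<in> carrier B \<Longrightarrow> b' \<in> carrier B \<Longrightarrow> \<iota> (b \<otimes>\<^bsub>B\<^esub> b') = \<iota> b \<otimes> \<iota> b'"
  "\<iota> \<one>\<^bsub>B\<^esub> = \<one>"
  "b \<in> carrier B \<Longrightarrow> \<iota> (z \<odot>\<^bsub>B\<^esub> b) = z \<odot> \<iota> b"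
  "b \<in> carrier B \<Longrightarrow> \<iota> (star B b) = star A (\<iota> b)"
  "inj_on \<iota> (carrier B)"
proof -
  have hom: "\<iota> \<in> Ring.ring_hom B A"
    and sm: "\<forall>z. \<forall>b\<in>carrier B. \<iota> (z \<odot>\<^bsub>B\<^esub> b) = z \<odot> \<iota> b"
    and st: "\<forall>b\<in>carrier B. \<iota> (star B b) = star A (\<iota> b)"
    and inj: "inj_on \<iota> (carrier B)"
    using mono unfolding unital_star_mono_def by blast+
  show "\<iota> b \<in> F N" if "b \<in> carrier B" using imageI[OF that, of \<iota>] unfolding img .
  show "\<iota> (b \<oplus>\<^bsub>B\<^esub> b') = \<iota> b \<oplus> \<iota> b'" if "b \<in> carrier B" "b' \<in> carrier B"
    using ring_hom_add[OF hom that] .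
  show "\<iota> (b \<otimes>\<^bsub>B\<^esub> b') = \<iota> b \<otimes> \<iota> b'" if "b \<in> carrier B" "b' \<in> carrier B"
    using ring_hom_mult[OF hom that] .
  show "\<iota> \<one>\<^bsub>B\<^esub> = \<one>" using ring_hom_one[OF hom] .
  show "\<iota> (z \<odot>\<^bsub>B\<^esub> b) = z \<odot> \<iota> b" if "b \<in> carrier B" using sm that by blast
  show "\<iota> (star B b) = star A (\<iota> b)" if "b \<in> carrier B" using st that by blast
  show "inj_on \<iota> (carrier B)" by (rule inj)
qed

section \<open>Extension of states from a finite level\<close>

definition retr where "retr a = inv_into (carrier B) \<iota> (E N a)"

lemma retr: "a \<in> carrier A \<Longrightarrow> retr a \<in> carrier B" "a \<in> carrier A \<Longrightarrow> \<iota> (retr a) = E N a"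
proof -
  assume a: "a \<in> carrier A"
  then have "E N a \<in> \<iota> ` carrier B" unfolding img by (rule E_in)
  then show "retr a \<in> carrier B" "\<iota> (retr a) = E N a"
    unfolding retr_def by (rule inv_into_into, rule f_inv_into_f)
qed

lemma iota_eqI: "x \<in> carrier B \<Longrightarrow> y \<in> carrier B \<Longrightarrow> \<iota> x = \<iota> y \<Longrightarrow> x = y"
  using iota(7) by (rule inj_onD)

lemma retr_hom:
  assumes [simp]: "a \<in> carrier A" "b \<in> carrier A"
  shows "retr (a \<oplus> b) = retr a \<oplus>\<^bsub>B\<^esub> retr b" "retr (z \<odot> a) = z \<odot>\<^bsub>B\<^esub> retr a"
    "retr (star A a) = star B (retr a)"
  by (rule iota_eqI; simp add: retr iota(2-6) E_add E_smult E_star)+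

lemma retr_one: "retr \<one> = \<one>\<^bsub>B\<^esub>"
  by (rule iota_eqI) (simp_all add: retr iota(4))

lemma retr_iota: "b \<in> carrier B \<Longrightarrow> retr (\<iota> b) = b"
  by (rule iota_eqI) (simp_all add: retr E_id iota(1) FC[OF iota(1)])

text \<open>A state has modulus at most 1 on \<open>1 - p / s\<close>, an element of norm at most 1
  when p comes from \<open>E N (a* a)\<close>. Its value there is \<open>1 - \<psi>(p) / s\<close>
  with \<open>\<psi>(p)\<close> real, so \<open>\<psi>(p)\<close> is nonnegative.\<close>

lemma state_retr:
  assumes \<psi>: "\<psi> \<in> states B"
  shows "restrict (\<lambda>a. \<psi> (retr a)) (carrier A) \<in> states A"
proof -
  have pos: "\<psi> (retr (star A a \<otimes> a)) \<in> \<real>\<^sub>\<ge>\<^sub>0" if [simp]: "a \<in> carrier A" for a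
  proof -
    let ?p = "star A a \<otimes> a"
    obtain s where s: "s > 0" and n: "nrm A (\<one> \<ominus> of_real (1 / s) \<odot> E N ?p) \<le> 1"
      using E_positive_nrm[of a N] by auto
    let ?x = "\<one>\<^bsub>B\<^esub> \<ominus>\<^bsub>B\<^esub> of_real (1 / s) \<odot>\<^bsub>B\<^esub> retr ?p"
    have xB: "?x \<in> carrier B" by (simp add: retr)
    have "\<iota> ?x = \<one> \<ominus> of_real (1 / s) \<odot> E N ?p"
      by (simp add: B.minus_smult minus_smult iota retr)
    then have "nrm B ?x \<le> 1" using n iso[OF xB] by simp
    then have le: "cmod (\<psi> ?x) \<le> 1" using B.state_bound[OF \<psi> xB] by simp
    have eq: "\<psi> ?x = 1 - of_real (1 / s) * \<psi> (retr ?p)"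
      by (simp add: B.state_minus[OF \<psi>] B.state_smult[OF \<psi>] B.state_one[OF \<psi>] retr)
    have "\<psi> (retr ?p) = cnj (\<psi> (retr ?p))"
      using B.state_star[OF \<psi>, of "retr ?p"] retr_hom(3)[of ?p ?p] by (simp add: retr star_mult)
    then have re: "\<psi> (retr ?p) = of_real (Re (\<psi> (retr ?p)))" by (simp add: complex_eq_iff)
    define q where "q = Re (\<psi> (retr ?p))"
    have "Re (\<psi> ?x) \<le> 1" using le complex_Re_le_cmod[of "\<psi> ?x"] by linarith
    then have "0 \<le> q / s" unfolding eq q_def by simp
    then have "0 \<le> q" using s by (simp add: zero_le_divide_iff)
    then show ?thesis using re unfolding q_def by (metis nonneg_Reals_of_real_iff)
  qed
  then show ?thesis
    unfolding states_def
    by (auto simp: retr_hom retr_one retr B.state_add[OF \<psi>] B.state_smult[OF \<psi>] B.state_one[OF \<psi>])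
qed

text \<open>Restriction to the level is onto because \<open>retr\<close> is a left inverse of the
  embedding and pulls states back to states. With every state of A in the 1-level this makes the
  height zero.\<close>

lemma states_restrict_iota:
  "(\<lambda>\<phi>. restrict (\<phi> \<circ> \<iota>) (carrier B)) ` states A = states B"
proof
  show "(\<lambda>\<phi>. restrict (\<phi> \<circ> \<iota>) (carrier B)) ` states A \<subseteq> states B"
  proof clarify
    fix \<phi> assume \<phi>: "\<phi> \<in> states A"
    have [simp]: "b \<in> carrier B \<Longrightarrow> \<iota> b \<in> carrier A" for b using FC[OF iota(1)] .
    show "restrict (\<phi> \<circ> \<iota>) (carrier B) \<in> states B"
      unfolding states_def
      by (auto simp: iota(2-6) state_add[OF \<phi>] state_smult[OF \<phi>] state_one[OF \<phi>] state_pos[OF \<phi>])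
  qed
  show "states B \<subseteq> (\<lambda>\<phi>. restrict (\<phi> \<circ> \<iota>) (carrier B)) ` states A"
  proof
    fix \<psi> assume \<psi>: "\<psi> \<in> states B"
    have "\<psi> = restrict (restrict (\<lambda>a. \<psi> (retr a)) (carrier A) \<circ> \<iota>) (carrier B)"
    proof (rule extensionalityI[OF B.states_extensional[OF \<psi>] restrict_extensional])
      fix b assume "b \<in> carrier B"
      then show "\<psi> b = restrict (restrict (\<lambda>a. \<psi> (retr a)) (carrier A) \<circ> \<iota>) (carrier B) b"
        using FC[OF iota(1)] by (simp add: retr_iota)
    qed
    then show "\<psi> \<in> (\<lambda>\<phi>. restrict (\<phi> \<circ> \<iota>) (carrier B)) ` states A"
      using state_retr[OF \<psi>] by blast
  qed
qed

lemma states_restrict_id: "(\<lambda>\<phi>. restrict (\<phi> \<circ> (\<lambda>a. a)) (carrier A)) ` states A = states A"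
proof -
  have "restrict (\<phi> \<circ> (\<lambda>a. a)) (carrier A) = \<phi>" if "\<phi> \<in> states A" for \<phi>
    using states_extensional[OF that] by (simp add: comp_def extensional_restrict)
  then show ?thesis by simp
qed

lemma one_level_one: "one_level A \<one> = states A"
proof -
  show ?thesis using state_zero by (auto simp: one_level_def minus_self)
qed

lemma iota_ball: "\<iota> ` lipschitz_ball B LB = {x \<in> F N. star A x = x \<and> comm_norm x \<le> 1}"
proof
  show "\<iota> ` lipschitz_ball B LB \<subseteq> {x \<in> F N. star A x = x \<and> comm_norm x \<le> 1}"
    by (auto simp: lipschitz_ball_def sa_def iota(1) LB iota(6)[symmetric])
  show "{x \<in> F N. star A x = x \<and> comm_norm x \<le> 1} \<subseteq> \<iota> ` lipschitz_ball B LB"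
  proof
    fix x assume x: "x \<in> {x \<in> F N. star A x = x \<and> comm_norm x \<le> 1}"
    then obtain b where b: "b \<in> carrier B" "x = \<iota> b" using img by auto
    then have "\<iota> (star B b) = \<iota> b" using x iota(6)[of b] by simp
    then have "star B b = b" by (rule iota_eqI[rotated 2]) (use b in auto)
    then show "x \<in> \<iota> ` lipschitz_ball B LB" using x b by (auto simp: lipschitz_ball_def sa_def LB)
  qed
qed

text \<open>The partner of y is \<open>E N y\<close>: it stays self-adjoint and Lipschitz, and
  \<open>nrm_minus_E_le\<close> with seminorm bound 1 measures its distance from y.\<close>

lemma ball_approx:
  defines "X \<equiv> {x \<in> F N. star A x = x \<and> comm_norm x \<le> 1}" and "Y \<equiv> lipschitz_ball A LA"
  shows "\<And>x. x \<in> X \<Longrightarrow> x \<in> Y" "\<And>y. y \<in> Y \<Longrightarrow> \<exists>x\<in>X. nrm A (x \<ominus> y) \<le> tail N"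
proof -
  show "x \<in> Y" if "x \<in> X" for x using that by (auto simp: X_def Y_def lipschitz_ball_def sa_def LA)
  fix y assume "y \<in> Y"
  then have y [simp]: "y \<in> carrier A" and ys: "star A y = y" and Ly: "comm_norm y \<le> 1"
    by (auto simp: Y_def lipschitz_ball_def sa_def LA)
  have "E N y \<in> X"
    using order_trans[OF comm_norm_E_le[OF y] Ly] by (simp add: X_def E_in E_star[symmetric] ys)
  moreover have "nrm A (E N y \<ominus> y) \<le> tail N"
    using nrm_minus_E_le[of y 1 N] Ly nrm_minus_commute[of y "E N y"] by simp
  ultimately show "\<exists>x\<in>X. nrm A (x \<ominus> y) \<le> tail N" by blast
qed

section \<open>The bridges with pivot 1, in both directions\<close>

lemma id_mono: "unital_star_mono A A (\<lambda>a. a)"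
  by (auto simp: unital_star_mono_def Ring.ring_hom_def)

lemma lipschitz_ball_carrier: "x \<in> lipschitz_ball A LA \<Longrightarrow> x \<in> carrier A"
  by (simp add: lipschitz_ball_def sa_def)

text \<open>Bridges are directed, and the final trek descends from one UHF algebra to the level and
  climbs to another; hence two versions with the embeddings exchanged.\<close>

definition bridge_in where
  "bridge_in = \<lparr>bridge_algebra = A, pivot = \<one>, left_embedding = \<iota>, right_embedding = (\<lambda>a. a)\<rparr>"

definition bridge_out where
  "bridge_out = \<lparr>bridge_algebra = A, pivot = \<one>, left_embedding = (\<lambda>a. a), right_embedding = \<iota>\<rparr>"

lemma is_bridge_in_out: "is_bridge B A bridge_in" "is_bridge A B bridge_out"
proof -
  have "one_level A \<one> \<noteq> {}" using tau unfolding one_level_one by blast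
  then show "is_bridge B A bridge_in" "is_bridge A B bridge_out"
    using mono id_mono unital_cstar_algebra_axioms
    by (simp_all add: is_bridge_def bridge_in_def bridge_out_def)
qed

lemma reach_images:
  "(\<lambda>b. \<iota> b \<otimes> \<one>) ` lipschitz_ball B LB = {x \<in> F N. star A x = x \<and> comm_norm x \<le> 1}"
  "(\<lambda>b. \<one> \<otimes> \<iota> b) ` lipschitz_ball B LB = {x \<in> F N. star A x = x \<and> comm_norm x \<le> 1}"
  "(\<lambda>a. a \<otimes> \<one>) ` lipschitz_ball A LA = lipschitz_ball A LA"
  "(\<lambda>a. \<one> \<otimes> a) ` lipschitz_ball A LA = lipschitz_ball A LA"
proof -
  have "\<iota> b \<in> carrier A" if "b \<in> lipschitz_ball B LB" for b
    using that iota(1)[of b] by (auto simp: lipschitz_ball_def sa_def)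
  then show "(\<lambda>b. \<iota> b \<otimes> \<one>) ` lipschitz_ball B LB = {x \<in> F N. star A x = x \<and> comm_norm x \<le> 1}"
    "(\<lambda>b. \<one> \<otimes> \<iota> b) ` lipschitz_ball B LB = {x \<in> F N. star A x = x \<and> comm_norm x \<le> 1}"
    unfolding iota_ball[symmetric] by (auto intro!: image_cong)
  show "(\<lambda>a. a \<otimes> \<one>) ` lipschitz_ball A LA = lipschitz_ball A LA"
    "(\<lambda>a. \<one> \<otimes> a) ` lipschitz_ball A LA = lipschitz_ball A LA"
    using lipschitz_ball_carrier by (auto simp: image_iff)
qed

lemma reach_le:
  defines "X \<equiv> {x \<in> F N. star A x = x \<and> comm_norm x \<le> 1}" and "Y \<equiv> lipschitz_ball A LA"
  shows "hausdorff_distance (\<lambda>x y. ennreal (nrm A (x \<ominus> y))) X Y \<le> ennreal (tail N)"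
    "hausdorff_distance (\<lambda>x y. ennreal (nrm A (x \<ominus> y))) Y X \<le> ennreal (tail N)"
proof -
  have self: "ennreal (nrm A (x \<ominus> x)) \<le> ennreal (tail N)" if "x \<in> X" for x
    using that by (auto simp: X_def minus_self[OF FC])
  have near: "\<exists>x\<in>X. ennreal (nrm A (x \<ominus> y)) \<le> ennreal (tail N)" if "y \<in> Y" for y
    using ball_approx(2) that unfolding X_def Y_def by (meson ennreal_leI)
  show "hausdorff_distance (\<lambda>x y. ennreal (nrm A (x \<ominus> y))) X Y \<le> ennreal (tail N)"
    using self near ball_approx(1) unfolding X_def Y_def by (intro hausdorff_distance_le) blast+
  have "\<exists>x\<in>X. ennreal (nrm A (y \<ominus> x)) \<le> ennreal (tail N)" if y: "y \<in> Y" for y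
  proof -
    obtain x where "x \<in> X" "ennreal (nrm A (x \<ominus> y)) \<le> ennreal (tail N)" using near[OF y] by blast
    moreover have "nrm A (x \<ominus> y) = nrm A (y \<ominus> x)"
      using \<open>x \<in> X\<close> y lipschitz_ball_carrier by (intro nrm_minus_commute) (auto simp: X_def Y_def)
    ultimately show ?thesis by auto
  qed
  then show "hausdorff_distance (\<lambda>x y. ennreal (nrm A (x \<ominus> y))) Y X \<le> ennreal (tail N)"
    using self ball_approx(1) unfolding X_def Y_def by (intro hausdorff_distance_le) blast+
qed

lemma bridge_length_in: "bridge_length (B, LB) (A, LA) bridge_in \<le> ennreal (tail N)"
proof -
  have "bridge_reach (B, LB) (A, LA) bridge_in \<le> ennreal (tail N)"
    using reach_le(1) by (simp add: bridge_reach_def bridge_in_def reach_images(1,4))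
  moreover have "bridge_height (B, LB) (A, LA) bridge_in = 0"
    by (simp add: bridge_height_def bridge_in_def one_level_one states_restrict_iota
        states_restrict_id hausdorff_distance_mk_self)
  ultimately show ?thesis by (simp add: bridge_length_def)
qed

lemma bridge_length_out: "bridge_length (A, LA) (B, LB) bridge_out \<le> ennreal (tail N)"
proof -
  have "bridge_reach (A, LA) (B, LB) bridge_out \<le> ennreal (tail N)"
    using reach_le(2) by (simp add: bridge_reach_def bridge_out_def reach_images(2,3))
  moreover have "bridge_height (A, LA) (B, LB) bridge_out = 0"
    by (simp add: bridge_height_def bridge_out_def one_level_one states_restrict_iota
        states_restrict_id hausdorff_distance_mk_self)
  ultimately show ?thesis by (simp add: bridge_length_def)
qed

end
end

section \<open>The GNS representation\<close>

context ci_system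
begin

section \<open>The completion for the trace norm\<close>

abbreviation seqs where "seqs \<equiv> gns_seqs A \<tau>"
abbreviation cls where "cls \<equiv> gns_class A \<tau>"
abbreviation H where "H \<equiv> gns_space A \<tau>"
abbreviation nm where "nm \<equiv> vnorm H"
abbreviation emb where "emb \<equiv> gns_embed A \<tau>"

lemma seqs_carrier: "x \<in> seqs \<Longrightarrow> x n \<in> carrier A"
  by (simp add: gns_seqs_def)

lemma seqs_Cauchy: "x \<in> seqs \<Longrightarrow> e > 0 \<Longrightarrow> \<exists>N. \<forall>m\<ge>N. \<forall>n\<ge>N. tn (x m \<ominus> x n) < e"
  by (simp add: gns_seqs_def)

lemma seqsI: 
  assumes "\<And>n. x n \<in> carrier A" "\<And>e. e > 0 \<Longrightarrow> \<exists>N. \<forall>m\<ge>N. \<forall>n\<ge>N. tn (x m \<ominus> x n) < e"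
  shows "x \<in> seqs"
  using assms by (simp add: gns_seqs_def)

lemma seqs_boundI:
  assumes x: "x \<in> seqs" and y: "\<And>n. y n \<in> carrier A"
    and le: "\<And>m n. tn (y m \<ominus> y n) \<le> K * tn (x m \<ominus> x n)" and K: "K \<ge> 0"
  shows "y \<in> seqs"
proof (rule seqsI[OF y])
  note [simp] = seqs_carrier[OF x]
  fix e :: real assume "e > 0"
  then have "e / (K + 1) > 0" using K by simp
  from seqs_Cauchy[OF x this] obtain N where N: "\<And>m n. m \<ge> N \<Longrightarrow> n \<ge> N \<Longrightarrow> tn (x m \<ominus> x n) < e / (K + 1)"
    by blast
  have "tn (y m \<ominus> y n) < e" if "m \<ge> N" "n \<ge> N" for m n
  proof -
    have "(K + 1) * tn (x m \<ominus> x n) < e" using N[OF that] K by (simp add: pos_less_divide_eq mult.commute)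
    moreover have "0 \<le> tn (x m \<ominus> x n)" using x by simp
    ultimately show ?thesis using le[of m n] by (simp only: distrib_right mult_1)
  qed
  then show "\<exists>N. \<forall>m\<ge>N. \<forall>n\<ge>N. tn (y m \<ominus> y n) < e" by blast
qed

lemma const_seqs: "a \<in> carrier A \<Longrightarrow> (\<lambda>_. a) \<in> seqs"
  by (rule seqsI) (auto simp: a_minus_def add_minus_self)

lemma seqs_add:
  assumes x: "x \<in> seqs" and y: "y \<in> seqs" shows "(\<lambda>n. x n \<oplus> y n) \<in> seqs"
proof (rule seqsI)
  note [simp] = seqs_carrier[OF x] seqs_carrier[OF y]
  fix e :: real assume "e > 0"
  then have e2: "e / 2 > 0" by simp
  from seqs_Cauchy[OF x e2] obtain M where M: "\<And>m n. m \<ge> M \<Longrightarrow> n \<ge> M \<Longrightarrow> tn (x m \<ominus> x n) < e / 2"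
    by blast
  from seqs_Cauchy[OF y e2] obtain N where N: "\<And>m n. m \<ge> N \<Longrightarrow> n \<ge> N \<Longrightarrow> tn (y m \<ominus> y n) < e / 2"
    by blast
  have "tn ((x m \<oplus> y m) \<ominus> (x n \<oplus> y n)) < e" if "m \<ge> max M N" "n \<ge> max M N" for m n
    using tn_triangle[of "x m \<ominus> x n" "y m \<ominus> y n"] M[of m n] N[of m n] that x y
    by (simp add: minus_add_minus)
  then show "\<exists>N. \<forall>m\<ge>N. \<forall>n\<ge>N. tn ((x m \<oplus> y m) \<ominus> (x n \<oplus> y n)) < e" by blast
qed (simp add: seqs_carrier[OF x] seqs_carrier[OF y])

lemma seqs_smult:
  assumes x: "x \<in> seqs" shows "(\<lambda>n. z \<odot> x n) \<in> seqs"
  by (rule seqs_boundI[OF x, of _ "cmod z"])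
    (simp_all add: seqs_carrier[OF x] tn_smult smult_minus_right[symmetric])

lemma seqs_minus:
  assumes x: "x \<in> seqs" and y: "y \<in> seqs" shows "(\<lambda>n. x n \<ominus> y n) \<in> seqs"
  using seqs_add[OF x seqs_smult[OF y, of "-1"]]
  by (simp add: minus_smult seqs_carrier[OF x] seqs_carrier[OF y])

lemma seqs_mult:
  assumes a: "a \<in> carrier A" and x: "x \<in> seqs" shows "(\<lambda>n. a \<otimes> x n) \<in> seqs"
  by (rule seqs_boundI[OF x, of _ "nrm A a"])
    (simp_all add: a seqs_carrier[OF x] mult_diff_right tn_mult_le nrm_nonneg)

lemma seqs_tn_bounded:
  assumes x: "x \<in> seqs" obtains K where "\<And>n. tn (x n) \<le> K" "K \<ge> 0"
proof -
  have "Cauchy (\<lambda>n. tn (x n))"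
  proof (rule CauchyI)
    fix e :: real assume "e > 0"
    from seqs_Cauchy[OF x this] obtain N where N: "\<And>m n. m \<ge> N \<Longrightarrow> n \<ge> N \<Longrightarrow> tn (x m \<ominus> x n) < e" by blast
    have "norm (tn (x m) - tn (x n)) < e" if "m \<ge> N" "n \<ge> N" for m n
      using tn_diff_le[OF seqs_carrier[OF x] seqs_carrier[OF x], of m n] N[OF that] by simp
    then show "\<exists>N. \<forall>m\<ge>N. \<forall>n\<ge>N. norm (tn (x m) - tn (x n)) < e" by blast
  qed
  then have "Bseq (\<lambda>n. tn (x n))" by (rule Cauchy_Bseq)
  then obtain K where K: "\<And>n. \<bar>tn (x n)\<bar> \<le> K" "K > 0" unfolding Bseq_def by auto
  have "tn (x n) \<le> K" for n using K(1)[of n] by simp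
  then show thesis using that[of K] K(2) by simp
qed

lemma gns_equiv: "equiv seqs (gns_rel A \<tau>)"
proof -
  have "(x, z) \<in> gns_rel A \<tau>" if "(x, y) \<in> gns_rel A \<tau>" "(y, z) \<in> gns_rel A \<tau>" for x y z
  proof -
    from that have s: "x \<in> seqs" "y \<in> seqs" "z \<in> seqs"
      and l: "(\<lambda>n. tn (x n \<ominus> y n)) \<longlonglongrightarrow> 0" "(\<lambda>n. tn (y n \<ominus> z n)) \<longlonglongrightarrow> 0"
      by (auto simp: gns_rel_def)
    note [simp] = seqs_carrier[OF s(1)] seqs_carrier[OF s(2)] seqs_carrier[OF s(3)]
    have "(\<lambda>n. tn (x n \<ominus> z n)) \<longlonglongrightarrow> 0"
      by (rule null_le_add[OF l]) (simp_all add: tn_triangle3)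
    then show ?thesis using s by (simp add: gns_rel_def)
  qed
  moreover have "(y, x) \<in> gns_rel A \<tau>" if "(x, y) \<in> gns_rel A \<tau>" for x y
  proof -
    from that have s: "x \<in> seqs" "y \<in> seqs" by (auto simp: gns_rel_def)
    then show ?thesis using that tn_minus_commute[OF seqs_carrier[OF s(1)] seqs_carrier[OF s(2)]]
      by (simp add: gns_rel_def)
  qed
  moreover have "(x, x) \<in> gns_rel A \<tau>" if "x \<in> seqs" for x
    using that by (simp add: gns_rel_def minus_self[OF seqs_carrier[OF that]])
  moreover have "gns_rel A \<tau> \<subseteq> seqs \<times> seqs" by (auto simp: gns_rel_def)
  ultimately show ?thesis
    unfolding equiv_def refl_on_def sym_def trans_def by blast
qed

lemma cls_eq_iff: "x \<in> seqs \<Longrightarrow> y \<in> seqs \<Longrightarrow> cls x = cls y \<longleftrightarrow> (\<lambda>n. tn (x n \<ominus> y n)) \<longlonglongrightarrow> 0"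
  unfolding gns_class_def using eq_equiv_class_iff[OF gns_equiv] by (simp add: gns_rel_def)

lemma carrier_H: "carrier H = cls ` seqs"
  by (auto simp: gns_space_def quotient_def gns_class_def)

lemma cls_H [simp]: "x \<in> seqs \<Longrightarrow> cls x \<in> carrier H" by (simp add: carrier_H)

lemma H_cases: assumes "h \<in> carrier H" obtains x where "x \<in> seqs" "h = cls x"
  using assms by (auto simp: carrier_H)

lemma in_cls: "x' \<in> cls x \<longleftrightarrow> x \<in> seqs \<and> x' \<in> seqs \<and> (\<lambda>n. tn (x n \<ominus> x' n)) \<longlonglongrightarrow> 0"
  by (simp add: gns_class_def gns_rel_def)

lemma self_in_cls: "x \<in> seqs \<Longrightarrow> x \<in> cls x"
  by (simp add: in_cls minus_self[OF seqs_carrier])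

lemma H_add:
  assumes x: "x \<in> seqs" and y: "y \<in> seqs"
  shows "cls x \<oplus>\<^bsub>H\<^esub> cls y = cls (\<lambda>n. x n \<oplus> y n)"
proof -
  have "cls (\<lambda>n. x' n \<oplus> y' n) = cls (\<lambda>n. x n \<oplus> y n)" if "x' \<in> cls x" "y' \<in> cls y" for x' y'
  proof -
    from that have s: "x' \<in> seqs" "y' \<in> seqs" and l: "(\<lambda>n. tn (x n \<ominus> x' n)) \<longlonglongrightarrow> 0" "(\<lambda>n. tn (y n \<ominus> y' n)) \<longlonglongrightarrow> 0"
      by (auto simp: in_cls)
    have "(\<lambda>n. tn ((x n \<oplus> y n) \<ominus> (x' n \<oplus> y' n))) \<longlonglongrightarrow> 0"
      by (rule null_le_add[OF l]) (simp_all add: minus_add_minus tn_triangle seqs_carrier[OF x]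
          seqs_carrier[OF y] seqs_carrier[OF s(1)] seqs_carrier[OF s(2)])
    then show ?thesis using s x y by (subst eq_commute) (simp add: cls_eq_iff seqs_add)
  qed
  then have "(\<Union>x'\<in>cls x. \<Union>y'\<in>cls y. cls (\<lambda>n. x' n \<oplus> y' n)) = cls (\<lambda>n. x n \<oplus> y n)"
    using self_in_cls[OF x] self_in_cls[OF y] by (intro UN_eqI)
  then show ?thesis by (simp add: gns_space_def)
qed

lemma H_smult:
  assumes x: "x \<in> seqs" shows "z \<odot>\<^bsub>H\<^esub> cls x = cls (\<lambda>n. z \<odot> x n)"
proof -
  have "cls (\<lambda>n. z \<odot> x' n) = cls (\<lambda>n. z \<odot> x n)" if "x' \<in> cls x" for x'
  proof -
    from that have s: "x' \<in> seqs" and l: "(\<lambda>n. tn (x n \<ominus> x' n)) \<longlonglongrightarrow> 0" by (auto simp: in_cls)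
    have "(\<lambda>n. tn (z \<odot> x n \<ominus> z \<odot> x' n)) \<longlonglongrightarrow> 0"
      using tendsto_mult_right_zero[OF l, of "cmod z"]
      by (simp add: tn_smult smult_minus_right[symmetric] seqs_carrier[OF x] seqs_carrier[OF s])
    then show ?thesis using s x by (subst eq_commute) (simp add: cls_eq_iff seqs_smult)
  qed
  then have "(\<Union>x'\<in>cls x. cls (\<lambda>n. z \<odot> x' n)) = cls (\<lambda>n. z \<odot> x n)"
    using self_in_cls[OF x] by (intro UN_eqI)
  then show ?thesis by (simp add: gns_space_def)
qed

lemma gns_rep_cls:
  assumes [simp]: "a \<in> carrier A" and x: "x \<in> seqs" shows "gns_rep A \<tau> a (cls x) = cls (\<lambda>n. a \<otimes> x n)"
proof -
  have "cls (\<lambda>n. a \<otimes> x' n) = cls (\<lambda>n. a \<otimes> x n)" if "x' \<in> cls x" for x'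
  proof -
    from that have s: "x' \<in> seqs" and l: "(\<lambda>n. tn (x n \<ominus> x' n)) \<longlonglongrightarrow> 0" by (auto simp: in_cls)
    have "(\<lambda>n. tn (a \<otimes> x n \<ominus> a \<otimes> x' n)) \<longlonglongrightarrow> 0"
      by (rule null_le_add[OF tendsto_mult_right_zero[OF l, of "nrm A a"] tendsto_const])
        (simp_all add: mult_diff_right tn_mult_le seqs_carrier[OF x] seqs_carrier[OF s])
    then show ?thesis using s x by (subst eq_commute) (simp add: cls_eq_iff seqs_mult)
  qed
  then show ?thesis unfolding gns_rep_def using self_in_cls[OF x] by (intro UN_eqI)
qed

lemma ip_convergent:
  assumes x: "x \<in> seqs" and y: "y \<in> seqs" shows "convergent (\<lambda>n. ip (x n) (y n))"
proof -
  note [simp] = seqs_carrier[OF x] seqs_carrier[OF y]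
  obtain K where K: "\<And>n. tn (x n) \<le> K" "K \<ge> 0" using seqs_tn_bounded[OF x] by blast
  obtain L where L: "\<And>n. tn (y n) \<le> L" "L \<ge> 0" using seqs_tn_bounded[OF y] by blast
  have "Cauchy (\<lambda>n. ip (x n) (y n))"
  proof (rule CauchyI)
    fix e :: real assume e: "e > 0"
    define d where "d = e / (K + L + 1)"
    have d: "d > 0" using e K L by (simp add: d_def)
    obtain M N where M: "\<And>m n. m \<ge> M \<Longrightarrow> n \<ge> M \<Longrightarrow> tn (x m \<ominus> x n) < d"
      and N: "\<And>m n. m \<ge> N \<Longrightarrow> n \<ge> N \<Longrightarrow> tn (y m \<ominus> y n) < d"
      using seqs_Cauchy[OF x d] seqs_Cauchy[OF y d] by blast
    have "norm (ip (x m) (y m) - ip (x n) (y n)) < e" if "m \<ge> max M N" "n \<ge> max M N" for m n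
    proof -
      have "ip (x m) (y m) - ip (x n) (y n) = ip (x m \<ominus> x n) (y m) + ip (x n) (y m \<ominus> y n)"
        using x y by (simp add: ip_minus_left ip_minus_right)
      also have "cmod \<dots> \<le> cmod (ip (x m \<ominus> x n) (y m)) + cmod (ip (x n) (y m \<ominus> y n))" by (rule norm_triangle_ineq)
      also have "\<dots> \<le> tn (x m \<ominus> x n) * tn (y m) + tn (x n) * tn (y m \<ominus> y n)"
        using x y by (intro add_mono ip_Cauchy_Schwarz) auto
      also have "\<dots> \<le> d * L + K * d"
        using x y M[of m n] N[of m n] that K L d by (intro add_mono mult_mono) (auto simp: less_imp_le)
      also have "\<dots> < d * (K + L + 1)" using d by (simp add: algebra_simps)
      also have "\<dots> = e" using K L by (simp add: d_def)
      finally show ?thesis .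
    qed
    then show "\<exists>N. \<forall>m\<ge>N. \<forall>n\<ge>N. norm (ip (x m) (y m) - ip (x n) (y n)) < e" by blast
  qed
  then show ?thesis by (simp add: Cauchy_convergent)
qed

lemma ip_diff_null:
  assumes x: "x \<in> seqs" and y: "y \<in> seqs" and "x' \<in> cls x" "y' \<in> cls y"
  shows "(\<lambda>n. ip (x' n) (y' n) - ip (x n) (y n)) \<longlonglongrightarrow> 0"
proof -
  from assms have s: "x' \<in> seqs" "y' \<in> seqs" and l: "(\<lambda>n. tn (x n \<ominus> x' n)) \<longlonglongrightarrow> 0" "(\<lambda>n. tn (y n \<ominus> y' n)) \<longlonglongrightarrow> 0"
    by (auto simp: in_cls)
  note [simp] = seqs_carrier[OF x] seqs_carrier[OF y] seqs_carrier[OF s(1)] seqs_carrier[OF s(2)]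
  obtain K where K: "\<And>n. tn (x n) \<le> K" "K \<ge> 0" using seqs_tn_bounded[OF x] by blast
  obtain L where L: "\<And>n. tn (y' n) \<le> L" "L \<ge> 0" using seqs_tn_bounded[OF s(2)] by blast
  have "(\<lambda>n. cmod (ip (x' n) (y' n) - ip (x n) (y n))) \<longlonglongrightarrow> 0"
  proof (rule null_le_add[OF tendsto_mult_left_zero[OF l(1), of L] tendsto_mult_right_zero[OF l(2), of K]])
    fix n
    have "ip (x n) (y n) - ip (x' n) (y' n) = ip (x n \<ominus> x' n) (y' n) + ip (x n) (y n \<ominus> y' n)"
      using x y s by (simp add: ip_minus_left ip_minus_right)
    then have "cmod (ip (x' n) (y' n) - ip (x n) (y n)) = cmod (ip (x n \<ominus> x' n) (y' n) + ip (x n) (y n \<ominus> y' n))"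
      by (metis norm_minus_commute)
    also have "\<dots> \<le> cmod (ip (x n \<ominus> x' n) (y' n)) + cmod (ip (x n) (y n \<ominus> y' n))" by (rule norm_triangle_ineq)
    also have "\<dots> \<le> tn (x n \<ominus> x' n) * tn (y' n) + tn (x n) * tn (y n \<ominus> y' n)"
      using x y s by (intro add_mono ip_Cauchy_Schwarz) auto
    also have "\<dots> \<le> tn (x n \<ominus> x' n) * L + K * tn (y n \<ominus> y' n)"
      using x y s K L by (intro add_mono mult_mono) auto
    finally show "cmod (ip (x' n) (y' n) - ip (x n) (y n)) \<le> tn (x n \<ominus> x' n) * L + K * tn (y n \<ominus> y' n)" .
  qed auto
  then show ?thesis by (simp add: tendsto_norm_zero_iff)
qed

text \<open>Changing representatives alters the inner products by a null sequence, so the definite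
  description in \<open>gns_space\<close> denotes the limit along any pair of them. Facts about H
  are then limits of the corresponding facts in A.\<close>

lemma inner_tendsto:
  assumes x: "x \<in> seqs" and y: "y \<in> seqs"
  shows "(\<lambda>n. ip (x n) (y n)) \<longlonglongrightarrow> inner_prod H (cls x) (cls y)"
proof -
  obtain z where z: "(\<lambda>n. ip (x n) (y n)) \<longlonglongrightarrow> z" using ip_convergent[OF x y] by (auto simp: convergent_def)
  have all: "(\<lambda>n. ip (x' n) (y' n)) \<longlonglongrightarrow> z" if "x' \<in> cls x" "y' \<in> cls y" for x' y'
    using tendsto_add[OF ip_diff_null[OF x y that] z] by simp
  have "inner_prod H (cls x) (cls y) = (THE z. \<forall>x\<in>cls x. \<forall>y\<in>cls y. (\<lambda>n. ip (x n) (y n)) \<longlonglongrightarrow> z)"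
    by (simp add: gns_space_def ip_def)
  also have "\<dots> = z"
  proof (rule the_equality)
    fix w assume "\<forall>x\<in>cls x. \<forall>y\<in>cls y. (\<lambda>n. ip (x n) (y n)) \<longlonglongrightarrow> w"
    then show "w = z" using self_in_cls x y z LIMSEQ_unique by blast
  qed (use all in blast)
  finally show ?thesis using z by simp
qed

lemma nm_tendsto:
  assumes x: "x \<in> seqs" shows "(\<lambda>n. tn (x n)) \<longlonglongrightarrow> nm (cls x)"
proof -
  have "(\<lambda>n. sqrt (Re (ip (x n) (x n)))) \<longlonglongrightarrow> sqrt (Re (inner_prod H (cls x) (cls x)))"
    by (intro tendsto_intros inner_tendsto x)
  then show ?thesis by (simp add: vnorm_def ip_self seqs_carrier[OF x])
qed

lemma H_zero: "\<zero>\<^bsub>H\<^esub> = cls (\<lambda>_. \<zero>)" by (simp add: gns_space_def)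

lemma H_neg:
  assumes x: "x \<in> seqs" shows "cls (\<lambda>n. (- 1) \<odot> x n) \<oplus>\<^bsub>H\<^esub> cls x = \<zero>\<^bsub>H\<^esub>"
  unfolding H_add[OF seqs_smult[OF x] x] H_zero
  by (simp add: smult_minus_1 minus_add_self seqs_carrier[OF x])

lemma H_abelian_group: "abelian_group H"
proof (rule abelian_groupI)
  fix X assume "X \<in> carrier H"
  then obtain x where x: "x \<in> seqs" "X = cls x" by (rule H_cases)
  note [simp] = seqs_carrier[OF x(1)]
  show "\<exists>Y\<in>carrier H. Y \<oplus>\<^bsub>H\<^esub> X = \<zero>\<^bsub>H\<^esub>"
    using H_neg[OF x(1)] cls_H[OF seqs_smult[OF x(1)]] x(2) by metis
  show "\<zero>\<^bsub>H\<^esub> \<oplus>\<^bsub>H\<^esub> X = X" using x by (simp add: H_zero H_add const_seqs)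
next
  fix X Y assume "X \<in> carrier H" "Y \<in> carrier H"
  then obtain x y where x: "x \<in> seqs" "X = cls x" and y: "y \<in> seqs" "Y = cls y" by (metis H_cases)
  then show "X \<oplus>\<^bsub>H\<^esub> Y \<in> carrier H" "X \<oplus>\<^bsub>H\<^esub> Y = Y \<oplus>\<^bsub>H\<^esub> X"
    using add_comm[OF seqs_carrier[OF x(1)] seqs_carrier[OF y(1)]] by (simp_all add: H_add seqs_add)
next
  fix X Y Z assume "X \<in> carrier H" "Y \<in> carrier H" "Z \<in> carrier H"
  then obtain x y z where x: "x \<in> seqs" "X = cls x" and y: "y \<in> seqs" "Y = cls y"
    and z: "z \<in> seqs" "Z = cls z" by (metis H_cases)
  then show "X \<oplus>\<^bsub>H\<^esub> Y \<oplus>\<^bsub>H\<^esub> Z = X \<oplus>\<^bsub>H\<^esub> (Y \<oplus>\<^bsub>H\<^esub> Z)"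
    by (simp add: H_add seqs_add add_assoc[OF seqs_carrier[OF x(1)] seqs_carrier[OF y(1)] seqs_carrier[OF z(1)]])
qed (simp add: H_zero const_seqs)

lemma H_minus:
  assumes x: "x \<in> seqs" and y: "y \<in> seqs" shows "cls x \<ominus>\<^bsub>H\<^esub> cls y = cls (\<lambda>n. x n \<ominus> y n)"
proof -
  note [simp] = seqs_carrier[OF x] seqs_carrier[OF y]
  have "\<ominus>\<^bsub>H\<^esub> cls y = cls (\<lambda>n. (- 1) \<odot> y n)"
    by (rule abelian_group.minus_equality[OF H_abelian_group H_neg[OF y] cls_H[OF y] cls_H[OF seqs_smult[OF y]]])
  then have "cls x \<ominus>\<^bsub>H\<^esub> cls y = cls x \<oplus>\<^bsub>H\<^esub> cls (\<lambda>n. (- 1) \<odot> y n)"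
    by (simp add: a_minus_def)
  also have "\<dots> = cls (\<lambda>n. x n \<oplus> (- 1) \<odot> y n)" by (rule H_add[OF x seqs_smult[OF y]])
  finally show ?thesis by (simp add: minus_smult)
qed

lemma H_minus_closed: "h \<in> carrier H \<Longrightarrow> g \<in> carrier H \<Longrightarrow> h \<ominus>\<^bsub>H\<^esub> g \<in> carrier H"
  by (elim H_cases) (simp add: H_minus seqs_minus)

lemma inner_minus_left:
  assumes "h \<in> carrier H" "g \<in> carrier H" "k \<in> carrier H"
  shows "inner_prod H (h \<ominus>\<^bsub>H\<^esub> g) k = inner_prod H h k - inner_prod H g k"
proof -
  obtain x y z where x: "x \<in> seqs" "h = cls x" and y: "y \<in> seqs" "g = cls y" and z: "z \<in> seqs" "k = cls z"
    using assms by (metis H_cases)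
  have "(\<lambda>n. ip (x n \<ominus> y n) (z n)) \<longlonglongrightarrow> inner_prod H (h \<ominus>\<^bsub>H\<^esub> g) k"
    unfolding x y z H_minus[OF x(1) y(1)] by (intro inner_tendsto seqs_minus x y z)
  moreover have "(\<lambda>n. ip (x n \<ominus> y n) (z n)) \<longlonglongrightarrow> inner_prod H h k - inner_prod H g k"
    using tendsto_diff[OF inner_tendsto[OF x(1) z(1)] inner_tendsto[OF y(1) z(1)]]
    by (simp add: ip_minus_left x y z seqs_carrier[OF x(1)] seqs_carrier[OF y(1)] seqs_carrier[OF z(1)])
  ultimately show ?thesis by (rule LIMSEQ_unique)
qed

lemma nm_nonneg: assumes "h \<in> carrier H" shows "0 \<le> nm h"
proof -
  obtain x where x: "x \<in> seqs" "h = cls x" using assms by (rule H_cases)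
  show ?thesis unfolding x(2)
    by (rule LIMSEQ_le_const[OF nm_tendsto[OF x(1)]]) (simp add: seqs_carrier[OF x(1)])
qed

lemma inner_Cauchy_Schwarz:
  assumes "h \<in> carrier H" "g \<in> carrier H" shows "cmod (inner_prod H h g) \<le> nm h * nm g"
proof -
  obtain x y where x: "x \<in> seqs" "h = cls x" and y: "y \<in> seqs" "g = cls y" using assms by (metis H_cases)
  show ?thesis unfolding x(2) y(2)
    by (rule LIMSEQ_le[OF tendsto_norm[OF inner_tendsto[OF x(1) y(1)]] tendsto_mult[OF nm_tendsto[OF x(1)] nm_tendsto[OF y(1)]]])
      (simp add: ip_Cauchy_Schwarz seqs_carrier[OF x(1)] seqs_carrier[OF y(1)])
qed

lemma nm_triangle3:
  assumes "h \<in> carrier H" "g \<in> carrier H" "k \<in> carrier H"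
  shows "nm (h \<ominus>\<^bsub>H\<^esub> k) \<le> nm (h \<ominus>\<^bsub>H\<^esub> g) + nm (g \<ominus>\<^bsub>H\<^esub> k)"
proof -
  obtain x y z where x: "x \<in> seqs" "h = cls x" and y: "y \<in> seqs" "g = cls y" and z: "z \<in> seqs" "k = cls z"
    using assms by (metis H_cases)
  show ?thesis unfolding x(2) y(2) z(2)
    unfolding H_minus[OF x(1) z(1)] H_minus[OF x(1) y(1)] H_minus[OF y(1) z(1)]
    by (rule LIMSEQ_le[OF nm_tendsto[OF seqs_minus[OF x(1) z(1)]]
          tendsto_add[OF nm_tendsto[OF seqs_minus[OF x(1) y(1)]] nm_tendsto[OF seqs_minus[OF y(1) z(1)]]]])
      (simp add: tn_triangle3 seqs_carrier[OF x(1)] seqs_carrier[OF y(1)] seqs_carrier[OF z(1)])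
qed

lemma nm_eq_0:
  assumes "h \<in> carrier H" "g \<in> carrier H" "nm (h \<ominus>\<^bsub>H\<^esub> g) = 0" shows "h = g"
proof -
  obtain x y where x: "x \<in> seqs" "h = cls x" and y: "y \<in> seqs" "g = cls y" using assms by (metis H_cases)
  show ?thesis
    using nm_tendsto[OF seqs_minus[OF x(1) y(1)]] assms(3) x y by (simp add: H_minus cls_eq_iff)
qed

lemma nm_minus_commute:
  assumes "h \<in> carrier H" "g \<in> carrier H" shows "nm (h \<ominus>\<^bsub>H\<^esub> g) = nm (g \<ominus>\<^bsub>H\<^esub> h)"
proof -
  obtain x y where x: "x \<in> seqs" "h = cls x" and y: "y \<in> seqs" "g = cls y" using assms by (metis H_cases)
  have "(\<lambda>n. tn (x n \<ominus> y n)) \<longlonglongrightarrow> nm (h \<ominus>\<^bsub>H\<^esub> g)"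
    using nm_tendsto[OF seqs_minus[OF x(1) y(1)]] unfolding x(2) y(2) H_minus[OF x(1) y(1)] .
  moreover have "(\<lambda>n. tn (x n \<ominus> y n)) \<longlonglongrightarrow> nm (g \<ominus>\<^bsub>H\<^esub> h)"
    using nm_tendsto[OF seqs_minus[OF y(1) x(1)]] unfolding x(2) y(2) H_minus[OF y(1) x(1)]
    by (simp add: tn_minus_commute[OF seqs_carrier[OF x(1)] seqs_carrier[OF y(1)]])
  ultimately show ?thesis by (rule LIMSEQ_unique)
qed

section \<open>The algebra inside its completion, and the projections onto its levels\<close>

lemma emb_H [simp]: "a \<in> carrier A \<Longrightarrow> emb a \<in> carrier H"
  by (simp add: gns_embed_def const_seqs)

lemma emb_minus: "a \<in> carrier A \<Longrightarrow> b \<in> carrier A \<Longrightarrow> emb a \<ominus>\<^bsub>H\<^esub> emb b = emb (a \<ominus> b)"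
  by (simp add: gns_embed_def H_minus const_seqs)

lemma emb_add: "a \<in> carrier A \<Longrightarrow> b \<in> carrier A \<Longrightarrow> emb a \<oplus>\<^bsub>H\<^esub> emb b = emb (a \<oplus> b)"
  by (simp add: gns_embed_def H_add const_seqs)

lemma emb_smult: "a \<in> carrier A \<Longrightarrow> z \<odot>\<^bsub>H\<^esub> emb a = emb (z \<odot> a)"
  by (simp add: gns_embed_def H_smult const_seqs)

lemma nm_emb [simp]: "a \<in> carrier A \<Longrightarrow> nm (emb a) = tn a"
  using LIMSEQ_unique[OF nm_tendsto[OF const_seqs] tendsto_const] by (simp add: gns_embed_def)

lemma inner_emb: "a \<in> carrier A \<Longrightarrow> b \<in> carrier A \<Longrightarrow> inner_prod H (emb a) (emb b) = ip a b"
  using LIMSEQ_unique[OF inner_tendsto[OF const_seqs const_seqs] tendsto_const, of a b] by (simp add: gns_embed_def)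

lemma inner_cls_emb:
  "x \<in> seqs \<Longrightarrow> b \<in> carrier A \<Longrightarrow> (\<lambda>n. ip (x n) b) \<longlonglongrightarrow> inner_prod H (cls x) (emb b)"
  using inner_tendsto[OF _ const_seqs, of x b] by (simp add: gns_embed_def)

lemma cls_approx:
  assumes x: "x \<in> seqs" shows "(\<lambda>n. nm (cls x \<ominus>\<^bsub>H\<^esub> emb (x n))) \<longlonglongrightarrow> 0"
proof (rule LIMSEQ_I)
  note [simp] = seqs_carrier[OF x]
  fix e :: real assume "e > 0"
  then have "e / 2 > 0" by simp
  from seqs_Cauchy[OF x this] obtain N where N: "\<And>m n. m \<ge> N \<Longrightarrow> n \<ge> N \<Longrightarrow> tn (x m \<ominus> x n) < e / 2" by blast
  have "nm (cls x \<ominus>\<^bsub>H\<^esub> emb (x n)) \<le> e / 2" if "n \<ge> N" for n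
  proof -
    have "(\<lambda>m. tn (x m \<ominus> x n)) \<longlonglongrightarrow> nm (cls x \<ominus>\<^bsub>H\<^esub> emb (x n))"
      using nm_tendsto[OF seqs_minus[OF x const_seqs, of "x n"]] x by (simp add: gns_embed_def H_minus const_seqs)
    then show ?thesis
      by (rule LIMSEQ_le_const2) (use N that in \<open>auto intro!: exI[of _ N] less_imp_le\<close>)
  qed
  then have "norm (nm (cls x \<ominus>\<^bsub>H\<^esub> emb (x n)) - 0) < e" if "n \<ge> N" for n
    using that \<open>e > 0\<close> nm_nonneg[OF H_minus_closed[OF cls_H[OF x] emb_H[of "x n"]]] x by fastforce
  then show "\<exists>N. \<forall>n\<ge>N. norm (nm (cls x \<ominus>\<^bsub>H\<^esub> emb (x n)) - 0) < e" by blast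
qed

text \<open>On \<open>F n\<close> the norm is at most \<open>c n\<close> times the trace norm, so a
  Cauchy sequence for the latter converges in A, and its limit is fixed by \<open>E n\<close>. Hence
  the image of \<open>F n\<close> in H is complete and orthogonal projections onto it exist.\<close>

lemma F_limit_exists:
  assumes s: "\<And>k. s k \<in> F n" and C: "s \<in> seqs"
  obtains p where "p \<in> F n" "(\<lambda>k. tn (s k \<ominus> p)) \<longlonglongrightarrow> 0"
proof -
  note [simp] = FC[OF s]
  have "\<exists>l\<in>carrier A. (\<lambda>k. nrm A (s k \<ominus> l)) \<longlonglongrightarrow> 0"
  proof (rule complete)
    fix e :: real assume "e > 0"
    then have "e / c n > 0" by (simp add: c_pos)
    from seqs_Cauchy[OF C this] obtain N where N: "\<And>k l. k \<ge> N \<Longrightarrow> l \<ge> N \<Longrightarrow> tn (s k \<ominus> s l) < e / c n" by blast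
    have "nrm A (s k \<ominus> s l) < e" if "k \<ge> N" "l \<ge> N" for k l
    proof -
      have "nrm A (s k \<ominus> s l) \<le> c n * tn (s k \<ominus> s l)" using s by (intro nrm_le_trace_norm F_minus)
      also have "\<dots> < e" using N[OF that] c_pos[of n] by (simp add: pos_less_divide_eq mult.commute)
      finally show ?thesis .
    qed
    then show "\<exists>N. \<forall>k\<ge>N. \<forall>l\<ge>N. nrm A (s k \<ominus> s l) < e" by blast
  qed simp
  then obtain l where l [simp]: "l \<in> carrier A" and lim: "(\<lambda>k. nrm A (s k \<ominus> l)) \<longlonglongrightarrow> 0" by blast
  have tlim: "(\<lambda>k. tn (s k \<ominus> l)) \<longlonglongrightarrow> 0"
    by (rule null_le_add[OF lim tendsto_const]) (auto simp: tn_le_nrm)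
  have "tn (l \<ominus> E n l) \<le> 0"
  proof (rule LIMSEQ_le_const[OF tlim])
    have "tn (l \<ominus> E n l) \<le> tn (s k \<ominus> l)" for k
      using tn_E_best[OF l s[of k]] tn_minus_commute[of "s k" l] by simp
    then show "\<exists>m. \<forall>k\<ge>m. tn (l \<ominus> E n l) \<le> tn (s k \<ominus> l)" by blast
  qed
  then have "l = E n l" by (intro eqI_tn antisym) auto
  then have "l \<in> F n" using E_in[OF l, of n] by simp
  then show thesis using tlim that by blast
qed

text \<open>The projection of h onto level n, taken as an element of A instead of H, so that
  \<open>E\<close> and \<open>T\<close> can be applied to it. It represents the functional of h on
  \<open>F n\<close>.\<close>

definition pr where "pr n h = (SOME p. p \<in> F n \<and> (\<forall>v\<in>F n. inner_prod H h (emb v) = ip p v))"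

lemma pr:
  assumes "h \<in> carrier H"
  shows "pr n h \<in> F n" "v \<in> F n \<Longrightarrow> inner_prod H h (emb v) = ip (pr n h) v"
proof -
  obtain x where x: "x \<in> seqs" "h = cls x" using assms by (rule H_cases)
  note [simp] = seqs_carrier[OF x(1)]
  \<comment> \<open>\<open>E n\<close> is linear and contractive for the trace norm, so it preserves
    Cauchy sequences; the limit inside \<open>F n\<close> is the projection.\<close>
  have s: "(\<lambda>k. E n (x k)) \<in> seqs"
    by (rule seqs_boundI[OF x(1), of _ 1]) (simp_all add: E_minus[symmetric] tn_E_le)
  obtain p where p: "p \<in> F n" "(\<lambda>k. tn (E n (x k) \<ominus> p)) \<longlonglongrightarrow> 0"
    by (rule F_limit_exists[OF _ s]) (use x in \<open>auto simp: E_in\<close>)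
  have "inner_prod H h (emb v) = ip p v" if v: "v \<in> F n" for v
  proof -
    note [simp] = FC[OF v] FC[OF p(1)]
    have "cls (\<lambda>k. E n (x k)) = emb p"
      using s p by (simp add: gns_embed_def cls_eq_iff const_seqs)
    then have "(\<lambda>k. ip (E n (x k)) v) \<longlonglongrightarrow> ip p v" using inner_cls_emb[OF s, of v] by (simp add: inner_emb)
    then have "(\<lambda>k. ip (x k) v) \<longlonglongrightarrow> ip p v" using x v by (simp add: ip_E)
    then show ?thesis using inner_cls_emb[OF x(1), of v] x(2) LIMSEQ_unique by auto
  qed
  then have "\<exists>p. p \<in> F n \<and> (\<forall>v\<in>F n. inner_prod H h (emb v) = ip p v)" using p by blast
  from someI_ex[OF this] show "pr n h \<in> F n" "v \<in> F n \<Longrightarrow> inner_prod H h (emb v) = ip (pr n h) v"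
    unfolding pr_def by blast+
qed

lemma pr_unique:
  assumes h: "h \<in> carrier H" and p: "p \<in> F n" and eq: "\<And>v. v \<in> F n \<Longrightarrow> inner_prod H h (emb v) = ip p v"
  shows "pr n h = p"
proof -
  note [simp] = FC[OF p] FC[OF pr(1)[OF h]]
  have "E n (pr n h) = p"
    by (rule E_unique) (use p eq pr(2)[OF h] in \<open>auto simp: ip_minus_left\<close>)
  then show ?thesis using E_id[OF pr(1)[OF h]] by simp
qed

lemma pr_carrier [simp]: "h \<in> carrier H \<Longrightarrow> pr n h \<in> carrier A" using FC pr(1) by blast

lemma pr_emb: "a \<in> carrier A \<Longrightarrow> pr n (emb a) = E n a"
  by (rule pr_unique) (auto simp: E_in inner_emb ip_E)

lemma pr_minus:
  assumes h: "h \<in> carrier H" and g: "g \<in> carrier H"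
  shows "pr n (h \<ominus>\<^bsub>H\<^esub> g) = pr n h \<ominus> pr n g"
proof (rule pr_unique)
  fix v assume v: "v \<in> F n"
  show "inner_prod H (h \<ominus>\<^bsub>H\<^esub> g) (emb v) = ip (pr n h \<ominus> pr n g) v"
    using pr(2)[OF h v] pr(2)[OF g v] h g v
    by (simp add: inner_minus_left[OF h g emb_H[OF FC[OF v]]] ip_minus_left)
qed (use h g in \<open>simp_all add: H_minus_closed F_minus pr(1)\<close>)

lemma E_pr: "m \<le> n \<Longrightarrow> h \<in> carrier H \<Longrightarrow> E m (pr n h) = pr m h"
  by (rule E_unique) (use F_mono[of m n] in \<open>auto simp: pr(1) ip_minus_left pr(2)[symmetric]\<close>)

lemma tn_pr_le:
  assumes h: "h \<in> carrier H" shows "tn (pr n h) \<le> nm h"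
proof (rule le_of_mult_self_le)
  have "tn (pr n h) * tn (pr n h) = cmod (inner_prod H h (emb (pr n h)))"
    using pr(2)[OF h pr(1)[OF h]] h by (simp add: ip_self norm_mult power2_eq_square)
  also have "\<dots> \<le> nm h * tn (pr n h)" using inner_Cauchy_Schwarz[OF h, of "emb (pr n h)"] h by simp
  finally show "tn (pr n h) * tn (pr n h) \<le> nm h * tn (pr n h)" .
qed (use h nm_nonneg in auto)

text \<open>Some b in A lies within \<open>e / 4\<close> of h and its projections converge to it;
  contractivity of \<open>pr n\<close> transfers this to h.\<close>

lemma pr_tendsto:
  assumes h: "h \<in> carrier H" shows "(\<lambda>n. nm (h \<ominus>\<^bsub>H\<^esub> emb (pr n h))) \<longlonglongrightarrow> 0"
proof (rule LIMSEQ_I)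
  fix e :: real assume e: "e > 0"
  obtain x where x: "x \<in> seqs" "h = cls x" using h by (rule H_cases)
  obtain k where k: "nm (h \<ominus>\<^bsub>H\<^esub> emb (x k)) < e / 4"
    using order_tendstoD(2)[OF cls_approx[OF x(1)], of "e / 4"] e x(2) by (auto simp: eventually_sequentially)
  define b where "b = x k"
  have b [simp]: "b \<in> carrier A" using seqs_carrier[OF x(1)] by (simp add: b_def)
  obtain N where N: "\<And>n. n \<ge> N \<Longrightarrow> tn (b \<ominus> E n b) < e / 4"
    using order_tendstoD(2)[OF E_tendsto[OF b], of "e / 4"] e by (auto simp: eventually_sequentially)
  have "nm (h \<ominus>\<^bsub>H\<^esub> emb (pr n h)) < e" if "n \<ge> N" for n
  proof -
    have "nm (h \<ominus>\<^bsub>H\<^esub> emb (pr n h)) \<le> nm (h \<ominus>\<^bsub>H\<^esub> emb b) + tn (b \<ominus> pr n h)"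
      using nm_triangle3[OF h, of "emb b" "emb (pr n h)"] h by (simp add: emb_minus)
    also have "tn (b \<ominus> pr n h) \<le> tn (b \<ominus> E n b) + tn (E n b \<ominus> pr n h)"
      using h by (intro tn_triangle3) auto
    also have "tn (E n b \<ominus> pr n h) \<le> nm (emb b \<ominus>\<^bsub>H\<^esub> h)"
      using tn_pr_le[of "emb b \<ominus>\<^bsub>H\<^esub> h" n] h by (simp add: pr_minus pr_emb H_minus_closed)
    finally show ?thesis
      using k[folded b_def] N[OF that] nm_minus_commute[OF h emb_H[OF b]] e by simp
  qed
  moreover have "0 \<le> nm (h \<ominus>\<^bsub>H\<^esub> emb (pr n h))" for n using h by (intro nm_nonneg H_minus_closed) auto
  ultimately show "\<exists>N. \<forall>n\<ge>N. norm (nm (h \<ominus>\<^bsub>H\<^esub> emb (pr n h)) - 0) < e" by (intro exI[of _ N]) auto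
qed

text \<open>The sequence of projections is a canonical representative of h whose n-th entry lies in
  \<open>F n\<close>. Operators on H can be computed entrywise along it.\<close>

lemma pr_seqs:
  assumes h: "h \<in> carrier H" shows "(\<lambda>n. pr n h) \<in> seqs" "cls (\<lambda>n. pr n h) = h"
proof -
  have d: "tn (pr m h \<ominus> pr n h) \<le> nm (h \<ominus>\<^bsub>H\<^esub> emb (pr m h)) + nm (h \<ominus>\<^bsub>H\<^esub> emb (pr n h))" for m n
    using nm_triangle3[of "emb (pr m h)" h "emb (pr n h)"] nm_minus_commute[OF h, of "emb (pr m h)"] h
    by (simp add: emb_minus)
  show s: "(\<lambda>n. pr n h) \<in> seqs"
  proof (rule seqsI)
    fix e :: real assume "e > 0"
    then obtain N where N: "\<And>n. n \<ge> N \<Longrightarrow> nm (h \<ominus>\<^bsub>H\<^esub> emb (pr n h)) < e / 2"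
      using order_tendstoD(2)[OF pr_tendsto[OF h], of "e / 2"] by (auto simp: eventually_sequentially)
    have "tn (pr m h \<ominus> pr n h) < e" if "m \<ge> N" "n \<ge> N" for m n
      using d[of m n] N[OF that(1)] N[OF that(2)] by simp
    then show "\<exists>N. \<forall>m\<ge>N. \<forall>n\<ge>N. tn (pr m h \<ominus> pr n h) < e" by blast
  qed (use h in simp)
  have C: "cls (\<lambda>n. pr n h) \<in> carrier H" using s by simp
  have "nm (cls (\<lambda>n. pr n h) \<ominus>\<^bsub>H\<^esub> h) \<le> 0"
  proof (rule LIMSEQ_le_const)
    show "(\<lambda>n. nm (cls (\<lambda>n. pr n h) \<ominus>\<^bsub>H\<^esub> emb (pr n h)) + nm (h \<ominus>\<^bsub>H\<^esub> emb (pr n h))) \<longlonglongrightarrow> 0"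
      using tendsto_add[OF cls_approx[OF s] pr_tendsto[OF h]] by simp
    have "nm (cls (\<lambda>n. pr n h) \<ominus>\<^bsub>H\<^esub> h) \<le> nm (cls (\<lambda>n. pr n h) \<ominus>\<^bsub>H\<^esub> emb (pr n h)) + nm (h \<ominus>\<^bsub>H\<^esub> emb (pr n h))" for n
      using nm_triangle3[OF C _ h, of "emb (pr n h)"] nm_minus_commute[OF h, of "emb (pr n h)"] h by simp
    then show "\<exists>N. \<forall>n\<ge>N. nm (cls (\<lambda>n. pr n h) \<ominus>\<^bsub>H\<^esub> h) \<le> nm (cls (\<lambda>n. pr n h) \<ominus>\<^bsub>H\<^esub> emb (pr n h)) + nm (h \<ominus>\<^bsub>H\<^esub> emb (pr n h))"
      by blast
  qed
  then show "cls (\<lambda>n. pr n h) = h"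
    using nm_nonneg[OF H_minus_closed[OF C h]] by (intro nm_eq_0[OF C h]) simp
qed

lemma ci_P_eq:
  assumes h: "h \<in> carrier H" shows "ci_P A F \<tau> n h = emb (pr n h)"
  unfolding ci_P_def orth_proj_def
proof (rule the_equality)
  show "emb (pr n h) \<in> emb ` F n \<and> (\<forall>v\<in>emb ` F n. inner_prod H (h \<ominus>\<^bsub>H\<^esub> emb (pr n h)) v = 0)"
    using pr[OF h] h by (auto simp: inner_minus_left inner_emb)
  fix p assume p: "p \<in> emb ` F n \<and> (\<forall>v\<in>emb ` F n. inner_prod H (h \<ominus>\<^bsub>H\<^esub> p) v = 0)"
  then obtain q where q: "q \<in> F n" "p = emb q" by blast
  have "inner_prod H h (emb v) = ip q v" if "v \<in> F n" for v
    using p that q h FC by (auto simp: inner_minus_left inner_emb)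
  then show "p = emb (pr n h)" using pr_unique[OF h q(1)] q(2) by simp
qed

lemma ci_Q_eq: "h \<in> carrier H \<Longrightarrow> ci_Q A F \<tau> n h = emb (pr n h \<ominus> pr (n - 1) h)"
  by (simp add: ci_Q_def ci_P_eq emb_minus)

section \<open>The Dirac operator on its domain\<close>

abbreviation TN where "TN n h \<equiv> T n (pr n h)"

lemma tn_TN: "h \<in> carrier H \<Longrightarrow>
  (tn (TN n h))\<^sup>2 = (\<Sum>i<n. (\<alpha> (Suc i))\<^sup>2 * (tn (pr (Suc i) h \<ominus> pr i h))\<^sup>2)"
  by (simp add: tn_T_sum E_pr)

lemma E_TN: "m \<le> n \<Longrightarrow> h \<in> carrier H \<Longrightarrow> E m (TN n h) = TN m h"
  using T_E[of m m "pr n h"] by (simp add: E_T E_pr)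

text \<open>Now \<open>c n\<close> must be the optimal constant, because the coefficients of
  \<open>ci_D\<close> are defined through \<open>ci_const\<close>.\<close>

context
  assumes c_eq: "\<And>n. ci_const A F \<tau> n = c n"
begin

lemma ci_coeff_eq: "ci_coeff A F \<tau> \<gamma> n = \<alpha> n"
  by (simp add: ci_coeff_def \<alpha>_def c_eq)

abbreviation dom where "dom \<equiv> ci_dom A F \<tau> \<gamma>"

lemma dom_carrier: "h \<in> dom \<Longrightarrow> h \<in> carrier H" by (simp add: ci_dom_def)

lemma dom_summable: "h \<in> carrier H \<Longrightarrow>
  h \<in> dom \<longleftrightarrow> summable (\<lambda>n. (\<alpha> (Suc n))\<^sup>2 * (tn (pr (Suc n) h \<ominus> pr n h))\<^sup>2)"
  by (simp add: ci_dom_def ci_coeff_eq ci_Q_eq)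

text \<open>The squared norms of the truncations are partial sums of a nonnegative series, so a
  uniform bound is enough. This is the form in which closedness of D is used.\<close>

lemma domI:
  assumes h: "h \<in> carrier H" and le: "\<And>n. tn (TN n h) \<le> K" shows "h \<in> dom"
  unfolding dom_summable[OF h]
proof (rule bounded_imp_summable)
  fix n
  have "(tn (TN (Suc n) h))\<^sup>2 \<le> K\<^sup>2" using le[of "Suc n"] h by (intro power_mono) auto
  then show "(\<Sum>i\<le>n. (\<alpha> (Suc i))\<^sup>2 * (tn (pr (Suc i) h \<ominus> pr i h))\<^sup>2) \<le> K\<^sup>2"
    using tn_TN[OF h, of "Suc n"] by (simp add: lessThan_Suc_atMost)
qed simp

text \<open>\<open>TN m h\<close> is the projection of \<open>TN n h\<close> for
  \<open>m <= n\<close>, so the squared norm of the difference is the difference of the squared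
  norms, and the latter converge by summability.\<close>

lemma TN_seqs:
  assumes h: "h \<in> dom" shows "(\<lambda>n. TN n h) \<in> seqs"
proof (rule seqsI)
  have hH [simp]: "h \<in> carrier H" using dom_carrier[OF h] .
  fix e :: real assume e: "e > 0"
  have "summable (\<lambda>n. (\<alpha> (Suc n))\<^sup>2 * (tn (pr (Suc n) h \<ominus> pr n h))\<^sup>2)" using h dom_summable by simp
  then have "convergent (\<lambda>n. (tn (TN n h))\<^sup>2)" by (simp add: tn_TN summable_iff_convergent)
  then have "Cauchy (\<lambda>n. (tn (TN n h))\<^sup>2)" by (rule convergent_Cauchy)
  then obtain N where N: "\<And>m n. m \<ge> N \<Longrightarrow> n \<ge> N \<Longrightarrow> \<bar>(tn (TN m h))\<^sup>2 - (tn (TN n h))\<^sup>2\<bar> < e\<^sup>2"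
    using CauchyD[of _ "e\<^sup>2"] e by fastforce
  have 1: "tn (TN n h \<ominus> TN m h) < e" if "m \<le> n" "m \<ge> N" for m n
  proof -
    have "(tn (TN n h \<ominus> TN m h))\<^sup>2 = (tn (TN n h))\<^sup>2 - (tn (TN m h))\<^sup>2"
      using tn_E_Pythagoras[of "TN n h" m] that by (simp add: E_TN)
    also have "\<dots> < e\<^sup>2" using N[of n m] that by simp
    finally show ?thesis by (rule power2_less_imp_less) (use e in simp)
  qed
  have "tn (TN m h \<ominus> TN n h) < e" if "m \<ge> N" "n \<ge> N" for m n
    using 1[of m n] 1[of n m] that tn_minus_commute[of "TN m h" "TN n h"] by (cases "m \<le> n") auto
  then show "\<exists>N. \<forall>m\<ge>N. \<forall>n\<ge>N. tn (TN m h \<ominus> TN n h) < e" by blast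
qed (use dom_carrier[OF h] in simp)

lemma finsum_Q:
  assumes h: "h \<in> carrier H"
  shows "finsum H (\<lambda>n. of_real (ci_coeff A F \<tau> \<gamma> n) \<odot>\<^bsub>H\<^esub> ci_Q A F \<tau> n h) {1..N} = emb (TN N h)"
proof -
  interpret H: abelian_group H by (rule H_abelian_group)
  show ?thesis
  proof (induction N)
    case 0
    show ?case by (simp add: H_zero gns_embed_def)
  next
    case (Suc N)
    have "{1..Suc N} = insert (Suc N) {1..N}" by auto
    then have "finsum H (\<lambda>n. of_real (ci_coeff A F \<tau> \<gamma> n) \<odot>\<^bsub>H\<^esub> ci_Q A F \<tau> n h) {1..Suc N} =
      of_real (\<alpha> (Suc N)) \<odot>\<^bsub>H\<^esub> ci_Q A F \<tau> (Suc N) h \<oplus>\<^bsub>H\<^esub> emb (TN N h)"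
      using h Suc by (simp add: H.finsum_insert ci_Q_eq emb_smult ci_coeff_eq Pi_def)
    also have "\<dots> = emb (of_real (\<alpha> (Suc N)) \<odot> (pr (Suc N) h \<ominus> pr N h) \<oplus> TN N h)"
      using h by (simp add: ci_Q_eq emb_smult emb_add)
    also have "of_real (\<alpha> (Suc N)) \<odot> (pr (Suc N) h \<ominus> pr N h) \<oplus> TN N h = TN (Suc N) h"
      using h T_E[of N N "pr (Suc N) h"] by (simp add: E_pr add_comm)
    finally show ?case .
  qed
qed

lemma ci_D_eq:
  assumes h: "h \<in> dom" shows "ci_D A F \<tau> \<gamma> h = cls (\<lambda>n. TN n h)"
proof -
  have hH [simp]: "h \<in> carrier H" using dom_carrier[OF h] .
  have s: "(\<lambda>n. TN n h) \<in> seqs" using TN_seqs[OF h] .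
  have "ci_D A F \<tau> \<gamma> h = (THE k. k \<in> carrier H \<and> (\<lambda>N. nm (emb (TN N h) \<ominus>\<^bsub>H\<^esub> k)) \<longlonglongrightarrow> 0)"
    unfolding ci_D_def Let_def by (simp only: finsum_Q[OF hH])
  also have "\<dots> = cls (\<lambda>n. TN n h)"
  proof (rule the_equality)
    have l: "(\<lambda>N. nm (emb (TN N h) \<ominus>\<^bsub>H\<^esub> cls (\<lambda>n. TN n h))) \<longlonglongrightarrow> 0"
      using cls_approx[OF s] nm_minus_commute[OF cls_H[OF s] emb_H, of "TN _ h"] by simp
    then show "cls (\<lambda>n. TN n h) \<in> carrier H \<and> (\<lambda>N. nm (emb (TN N h) \<ominus>\<^bsub>H\<^esub> cls (\<lambda>n. TN n h))) \<longlonglongrightarrow> 0"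
      using s by simp
    fix k assume k: "k \<in> carrier H \<and> (\<lambda>N. nm (emb (TN N h) \<ominus>\<^bsub>H\<^esub> k)) \<longlonglongrightarrow> 0"
    have "nm (k \<ominus>\<^bsub>H\<^esub> cls (\<lambda>n. TN n h)) \<le> 0"
    proof (rule LIMSEQ_le_const)
      show "(\<lambda>N. nm (emb (TN N h) \<ominus>\<^bsub>H\<^esub> k) + nm (emb (TN N h) \<ominus>\<^bsub>H\<^esub> cls (\<lambda>n. TN n h))) \<longlonglongrightarrow> 0"
        using tendsto_add[OF conjunct2[OF k] l] by simp
      have "nm (k \<ominus>\<^bsub>H\<^esub> cls (\<lambda>n. TN n h)) \<le> nm (emb (TN N h) \<ominus>\<^bsub>H\<^esub> k) + nm (emb (TN N h) \<ominus>\<^bsub>H\<^esub> cls (\<lambda>n. TN n h))" for N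
        using nm_triangle3[of k "emb (TN N h)" "cls (\<lambda>n. TN n h)"] nm_minus_commute[of k "emb (TN N h)"] k s by simp
      then show "\<exists>M. \<forall>N\<ge>M. nm (k \<ominus>\<^bsub>H\<^esub> cls (\<lambda>n. TN n h)) \<le> nm (emb (TN N h) \<ominus>\<^bsub>H\<^esub> k) + nm (emb (TN N h) \<ominus>\<^bsub>H\<^esub> cls (\<lambda>n. TN n h))" by blast
    qed
    then show "k = cls (\<lambda>n. TN n h)"
      using k s nm_nonneg[OF H_minus_closed[of k "cls (\<lambda>n. TN n h)"]] by (intro nm_eq_0) auto
  qed
  finally show ?thesis .
qed

text \<open>For k in a fixed level the inner products along \<open>TN n h\<close> are constant from
  level M on, which moves D onto k without a domain question.\<close>

lemma inner_D:
  assumes h: "h \<in> dom" and k: "k \<in> F M"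
  shows "inner_prod H (ci_D A F \<tau> \<gamma> h) (emb k) = inner_prod H h (emb (T M k))"
proof -
  have hH [simp]: "h \<in> carrier H" using dom_carrier[OF h] .
  note [simp] = FC[OF k]
  have "(\<lambda>n. ip (TN n h) k) \<longlonglongrightarrow> inner_prod H (ci_D A F \<tau> \<gamma> h) (emb k)"
    unfolding ci_D_eq[OF h] by (intro inner_cls_emb TN_seqs h) simp
  moreover have "eventually (\<lambda>n. ip (TN n h) k = inner_prod H h (emb (T M k))) sequentially"
  proof (rule eventually_sequentiallyI)
    fix n assume n: "M \<le> n"
    show "ip (TN n h) k = inner_prod H h (emb (T M k))"
      using pr(2)[OF hH, of "T M k" n] T_stable[OF n k] F_mono[OF n T_in[of k M]] by (simp add: ip_T)
  qed
  from LIMSEQ_unique[OF calculation tendsto_eventually[OF this]] show ?thesis .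
qed

lemma emb_dom:
  assumes a: "a \<in> F M" shows "emb a \<in> dom" "ci_D A F \<tau> \<gamma> (emb a) = emb (T M a)"
proof -
  note [simp] = FC[OF a]
  have TN: "TN n (emb a) = T n a" for n using T_E[of n n a] by (simp add: pr_emb)
  show d: "emb a \<in> dom"
  proof (rule domI)
    fix n
    show "tn (TN n (emb a)) \<le> tn (T M a)"
      using tn_T_mono[of n "max n M" a] T_stable[of M "max n M" a] a unfolding TN by simp
  qed simp
  have "eventually (\<lambda>n. tn (T n a \<ominus> T M a) = 0) sequentially"
  proof (rule eventually_sequentiallyI)
    fix n assume "M \<le> n"
    show "tn (T n a \<ominus> T M a) = 0" unfolding T_stable[OF \<open>M \<le> n\<close> a] by (simp add: minus_self)
  qed
  then have "(\<lambda>n. tn (T n a \<ominus> T M a)) \<longlonglongrightarrow> 0" by (rule tendsto_eventually)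
  moreover have "(\<lambda>n. T n a) \<in> seqs" using TN_seqs[OF d] unfolding TN .
  ultimately have "cls (\<lambda>n. T n a) = emb (T M a)"
    unfolding gns_embed_def by (simp add: cls_eq_iff const_seqs)
  then show "ci_D A F \<tau> \<gamma> (emb a) = emb (T M a)" unfolding ci_D_eq[OF d] TN .
qed

section \<open>The norm of the form equals the Christensen-Ivan seminorm\<close>

lemma gns_rep_H: "a \<in> carrier A \<Longrightarrow> h \<in> carrier H \<Longrightarrow> gns_rep A \<tau> a h \<in> carrier H"
  by (erule H_cases) (simp add: gns_rep_cls seqs_mult)

lemma gns_rep_emb: "a \<in> carrier A \<Longrightarrow> b \<in> carrier A \<Longrightarrow> gns_rep A \<tau> a (emb b) = emb (a \<otimes> b)"
  by (simp add: gns_embed_def gns_rep_cls const_seqs)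

lemma ci_D_H: "h \<in> dom \<Longrightarrow> ci_D A F \<tau> \<gamma> h \<in> carrier H"
  by (simp add: ci_D_eq TN_seqs)

text \<open>On vectors of the levels the form is a matrix coefficient of the actual commutator, so
  Cauchy-Schwarz bounds it by the commutator norm.\<close>

lemma comm_norm_le_ci_seminorm:
  assumes a [simp]: "a \<in> carrier A" and inv: "\<And>h. h \<in> dom \<Longrightarrow> gns_rep A \<tau> a h \<in> dom"
  shows "comm_norm a \<le> (SUP h\<in>{h \<in> dom. nm h \<le> 1}.
    ennreal (nm (ci_D A F \<tau> \<gamma> (gns_rep A \<tau> a h) \<ominus>\<^bsub>H\<^esub> gns_rep A \<tau> a (ci_D A F \<tau> \<gamma> h))))"
  (is "_ \<le> (SUP h\<in>_. ennreal (nm (?C h)))")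
  unfolding comm_norm_def
proof (rule SUP_least, clarify)
  fix M h k assume "(M, h, k) \<in> core_pairs"
  then have h: "h \<in> F M" "tn h \<le> 1" and k: "k \<in> F M" "tn k \<le> 1" by (auto simp: core_pairs_def)
  note [simp] = FC[OF h(1)] FC[OF k(1)]
  have d: "emb h \<in> dom" using emb_dom[OF h(1)] by simp
  have CH: "?C (emb h) \<in> carrier H"
    using d inv[OF d] by (intro H_minus_closed ci_D_H gns_rep_H) auto
  have "comm_form a M h k = inner_prod H (?C (emb h)) (emb k)"
    using inner_D[OF inv[OF d] k(1)] emb_dom[OF h(1)] inv[OF d]
    by (subst inner_minus_left)
      (simp_all add: ci_D_H gns_rep_H gns_rep_emb inner_emb comm_form_def)
  also have "cmod \<dots> \<le> nm (?C (emb h)) * tn k" using inner_Cauchy_Schwarz[OF CH, of "emb k"] by simp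
  also have "\<dots> \<le> nm (?C (emb h))" using k nm_nonneg[OF CH] by (simp add: mult_left_le)
  finally have "ennreal (cmod (comm_form a M h k)) \<le> ennreal (nm (?C (emb h)))" by (rule ennreal_leI)
  also have "\<dots> \<le> (SUP h\<in>{h \<in> dom. nm h \<le> 1}. ennreal (nm (?C h)))"
    using d h by (intro SUP_upper) simp
  finally show "ennreal (cmod (comm_form a M h k)) \<le> (SUP h\<in>{h \<in> dom. nm h \<le> 1}. ennreal (nm (?C h)))" .
qed

text \<open>The bound on the form says that \<open>\<langle>a h, D k\<rangle>\<close> is bounded in
  k, up to the bounded term \<open>\<langle>a D h, k\<rangle>\<close>; by self-adjointness of D this
  places \<open>a h\<close> in the domain. Once there, the commutator at h has its matrix
  coefficients controlled by y and therefore its norm.\<close>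

lemma commutator_bounded:
  assumes a [simp]: "a \<in> carrier A" and le: "comm_norm a \<le> ennreal y" and y: "0 \<le> y" and h: "h \<in> dom"
  shows "gns_rep A \<tau> a h \<in> dom"
    "nm (ci_D A F \<tau> \<gamma> (gns_rep A \<tau> a h) \<ominus>\<^bsub>H\<^esub> gns_rep A \<tau> a (ci_D A F \<tau> \<gamma> h)) \<le> y * nm h"
proof -
  have hH [simp]: "h \<in> carrier H" using dom_carrier[OF h] .
  define g where "g = gns_rep A \<tau> a h"
  define w where "w = gns_rep A \<tau> a (ci_D A F \<tau> \<gamma> h)"
  have gH [simp]: "g \<in> carrier H" by (simp add: g_def gns_rep_H)
  have wH [simp]: "w \<in> carrier H" using h by (simp add: w_def gns_rep_H ci_D_H)
  have n0: "0 \<le> nm h" using nm_nonneg by simp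
  have g: "g = cls (\<lambda>n. a \<otimes> pr n h)" using gns_rep_cls[OF a pr_seqs(1)[OF hH]] pr_seqs(2)[OF hH] by (simp add: g_def)
  have w: "w = cls (\<lambda>n. a \<otimes> TN n h)" by (simp add: w_def ci_D_eq[OF h] gns_rep_cls TN_seqs[OF h])
  \<comment> \<open>The estimate on levels is carried to h along its projections
    \<open>pr n h\<close>, while k stays in a fixed level.\<close>
  have star: "cmod (inner_prod H g (emb (T M k)) - inner_prod H w (emb k)) \<le> y * nm h * tn k"
    if k: "k \<in> F M" for k M
  proof -
    note [simp] = FC[OF k]
    have lim: "(\<lambda>n. ip (a \<otimes> pr n h) (T M k) - ip (a \<otimes> TN n h) k) \<longlonglongrightarrow> inner_prod H g (emb (T M k)) - inner_prod H w (emb k)"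
      unfolding g w by (intro tendsto_diff inner_cls_emb seqs_mult pr_seqs TN_seqs h) auto
    have "cmod (ip (a \<otimes> pr n h) (T M k) - ip (a \<otimes> TN n h) k) \<le> y * nm h * tn k" if n: "n \<ge> M" for n
    proof -
      have "cmod (comm_form a n (pr n h) k) \<le> y * tn (pr n h) * tn k"
        using comm_norm_leD[OF a le y pr(1)[OF hH] F_mono[OF n k]] .
      also have "\<dots> \<le> y * nm h * tn k" using tn_pr_le[OF hH] y by (intro mult_right_mono mult_left_mono) auto
      finally show ?thesis using T_stable[OF n k] by (simp add: comm_form_def)
    qed
    then show ?thesis by (intro LIMSEQ_le_const2[OF tendsto_norm[OF lim]]) auto
  qed
  show gd: "gns_rep A \<tau> a h \<in> dom" unfolding g_def[symmetric]
  proof (rule domI[OF gH])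
    fix M
    show "tn (TN M g) \<le> nm w + y * nm h"
    proof (rule le_of_mult_self_le)
      \<comment> \<open>Testing with k equal to \<open>TN M g\<close> produces its squared norm on
        the left; the resulting bound is uniform in M, as \<open>domI\<close> requires.\<close>
      have k: "TN M g \<in> F M" by (simp add: T_in)
      have "inner_prod H g (emb (T M (TN M g))) = ip (TN M g) (TN M g)"
        using pr(2)[OF gH, of "T M (TN M g)" M] by (simp add: T_in ip_T)
      then have "tn (TN M g) * tn (TN M g) = cmod (inner_prod H g (emb (T M (TN M g))))"
        by (simp add: ip_self norm_mult power2_eq_square)
      also have "\<dots> \<le> cmod (inner_prod H w (emb (TN M g))) + y * nm h * tn (TN M g)"
        using star[OF k] norm_triangle_ineq2[of "inner_prod H g (emb (T M (TN M g)))" "inner_prod H w (emb (TN M g))"] by linarith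
      also have "\<dots> \<le> nm w * tn (TN M g) + y * nm h * tn (TN M g)"
        using inner_Cauchy_Schwarz[OF wH, of "emb (TN M g)"] by simp
      finally show "tn (TN M g) * tn (TN M g) \<le> (nm w + y * nm h) * tn (TN M g)" by (simp add: distrib_right)
    qed (use y n0 nm_nonneg[OF wH] in auto)
  qed
  have gd': "g \<in> dom" using gd by (simp add: g_def)
  define d where "d = ci_D A F \<tau> \<gamma> g \<ominus>\<^bsub>H\<^esub> w"
  have dH [simp]: "d \<in> carrier H" using ci_D_H[OF gd'] by (simp add: d_def H_minus_closed)
  have dm: "inner_prod H d (emb v) = inner_prod H (ci_D A F \<tau> \<gamma> g) (emb v) - inner_prod H w (emb v)"
    if "v \<in> carrier A" for v
    unfolding d_def using that by (intro inner_minus_left ci_D_H gd' wH emb_H)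
  \<comment> \<open>Test with the projections of d itself; their norms converge to the norm of
    d.\<close>
  have pd: "tn (pr M d) \<le> y * nm h" for M
  proof (rule le_of_mult_self_le)
    have k: "pr M d \<in> F M" by (simp add: pr)
    have "ip (pr M d) (pr M d) = inner_prod H g (emb (T M (pr M d))) - inner_prod H w (emb (pr M d))"
      using pr(2)[OF dH k] inner_D[OF gd' k] dm[OF pr_carrier[OF dH], of M] by simp
    then have "cmod (ip (pr M d) (pr M d)) \<le> y * nm h * tn (pr M d)" using star[OF k] by (simp only:)
    then show "tn (pr M d) * tn (pr M d) \<le> y * nm h * tn (pr M d)"
      by (simp add: ip_self norm_mult power2_eq_square)
  qed (use y n0 in auto)
  have "(\<lambda>M. tn (pr M d)) \<longlonglongrightarrow> nm d" using nm_tendsto[OF pr_seqs(1)[OF dH]] pr_seqs(2)[OF dH] by simp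
  then have "nm d \<le> y * nm h" by (rule LIMSEQ_le_const2) (use pd in blast)
  then show "nm (ci_D A F \<tau> \<gamma> (gns_rep A \<tau> a h) \<ominus>\<^bsub>H\<^esub> gns_rep A \<tau> a (ci_D A F \<tau> \<gamma> h)) \<le> y * nm h"
    by (simp add: d_def g_def w_def)
qed

theorem ci_seminorm_eq_comm_norm:
  assumes a: "a \<in> carrier A" shows "ci_seminorm A F \<tau> \<gamma> a = comm_norm a"
proof (cases a rule: comm_norm_cases)
  \<comment> \<open>Either the domain is not invariant and the seminorm is infinite by definition,
    or the supremum dominates the infinite \<open>comm_norm a\<close>.\<close>
  case top
  then show ?thesis using comm_norm_le_ci_seminorm[OF a] by (auto simp: ci_seminorm_def Let_def top_unique)
next
  case (real y)
  have le: "comm_norm a \<le> ennreal y" using real by simp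
  have inv: "gns_rep A \<tau> a h \<in> dom" if "h \<in> dom" for h
    using commutator_bounded(1)[OF a le real(2) that] .
  have "(SUP h\<in>{h \<in> dom. nm h \<le> 1}.
    ennreal (nm (ci_D A F \<tau> \<gamma> (gns_rep A \<tau> a h) \<ominus>\<^bsub>H\<^esub> gns_rep A \<tau> a (ci_D A F \<tau> \<gamma> h)))) \<le> ennreal y"
  proof (rule SUP_least, rule ennreal_leI)
    fix h assume "h \<in> {h \<in> dom. nm h \<le> 1}"
    then have h: "h \<in> dom" "nm h \<le> 1" by auto
    have "nm (ci_D A F \<tau> \<gamma> (gns_rep A \<tau> a h) \<ominus>\<^bsub>H\<^esub> gns_rep A \<tau> a (ci_D A F \<tau> \<gamma> h)) \<le> y * nm h"
      by (rule commutator_bounded(2)[OF a le real(2) h(1)])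
    also have "\<dots> \<le> y" using h real(2) by (simp add: mult_left_le)
    finally show "nm (ci_D A F \<tau> \<gamma> (gns_rep A \<tau> a h) \<ominus>\<^bsub>H\<^esub> gns_rep A \<tau> a (ci_D A F \<tau> \<gamma> h)) \<le> y" .
  qed
  then show ?thesis using comm_norm_le_ci_seminorm[OF a inv] inv real(1)
    by (auto simp: ci_seminorm_def Let_def intro: antisym)
qed

end
end

section \<open>Inductive limits\<close>

text \<open>The connecting maps are assumed isometric; for block diagonal maps this is verified by a
  direct computation with vectors instead of the general theory of injective homomorphisms.\<close>

locale cstar_sequence =
  fixes B :: "nat \<Rightarrow> 'a cstar_algebra" and \<mu> :: "nat \<Rightarrow> 'a \<Rightarrow> 'a"
  assumes B: "unital_cstar_algebra (B n)"
    and mu_closed: "a \<in> carrier (B n) \<Longrightarrow> \<mu> n a \<in> carrier (B (Suc n))"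
    and mu_add: "a \<in> carrier (B n) \<Longrightarrow> b \<in> carrier (B n) \<Longrightarrow> \<mu> n (a \<oplus>\<^bsub>B n\<^esub> b) = \<mu> n a \<oplus>\<^bsub>B (Suc n)\<^esub> \<mu> n b"
    and mu_mult: "a \<in> carrier (B n) \<Longrightarrow> b \<in> carrier (B n) \<Longrightarrow> \<mu> n (a \<otimes>\<^bsub>B n\<^esub> b) = \<mu> n a \<otimes>\<^bsub>B (Suc n)\<^esub> \<mu> n b"
    and mu_smult: "a \<in> carrier (B n) \<Longrightarrow> \<mu> n (z \<odot>\<^bsub>B n\<^esub> a) = z \<odot>\<^bsub>B (Suc n)\<^esub> \<mu> n a"
    and mu_star: "a \<in> carrier (B n) \<Longrightarrow> \<mu> n (star (B n) a) = star (B (Suc n)) (\<mu> n a)"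
    and mu_one: "\<mu> n \<one>\<^bsub>B n\<^esub> = \<one>\<^bsub>B (Suc n)\<^esub>"
    and mu_nrm: "a \<in> carrier (B n) \<Longrightarrow> nrm (B (Suc n)) (\<mu> n a) = nrm (B n) a"
begin

interpretation B: unital_cstar_algebra "B n" for n by (rule B)

section \<open>Connecting maps and asymptotically coherent sequences\<close>

abbreviation con where "con \<equiv> connecting \<mu>"
abbreviation L where "L \<equiv> limit_seqs B \<mu>"
abbreviation cls where "cls \<equiv> limit_class B \<mu>"
abbreviation R where "R \<equiv> inductive_limit B \<mu>"

lemma con_closed [simp]: "a \<in> carrier (B m) \<Longrightarrow> con m k a \<in> carrier (B (m + k))"
  by (induction k) (auto simp: mu_closed)

lemma con_add: "a \<in> carrier (B m) \<Longrightarrow> b \<in> carrier (B m) \<Longrightarrow>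
  con m k (a \<oplus>\<^bsub>B m\<^esub> b) = con m k a \<oplus>\<^bsub>B (m + k)\<^esub> con m k b"
  by (induction k) (auto simp: mu_add)

lemma con_mult: "a \<in> carrier (B m) \<Longrightarrow> b \<in> carrier (B m) \<Longrightarrow>
  con m k (a \<otimes>\<^bsub>B m\<^esub> b) = con m k a \<otimes>\<^bsub>B (m + k)\<^esub> con m k b"
  by (induction k) (auto simp: mu_mult)

lemma con_smult: "a \<in> carrier (B m) \<Longrightarrow> con m k (z \<odot>\<^bsub>B m\<^esub> a) = z \<odot>\<^bsub>B (m + k)\<^esub> con m k a"
  by (induction k) (auto simp: mu_smult)

lemma con_star: "a \<in> carrier (B m) \<Longrightarrow> con m k (star (B m) a) = star (B (m + k)) (con m k a)"
  by (induction k) (auto simp: mu_star)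

lemma con_one: "con m k \<one>\<^bsub>B m\<^esub> = \<one>\<^bsub>B (m + k)\<^esub>"
  by (induction k) (auto simp: mu_one)

lemma con_nrm: "a \<in> carrier (B m) \<Longrightarrow> nrm (B (m + k)) (con m k a) = nrm (B m) a"
  by (induction k) (auto simp: mu_nrm)

lemma con_minus: "a \<in> carrier (B m) \<Longrightarrow> b \<in> carrier (B m) \<Longrightarrow>
  con m k (a \<ominus>\<^bsub>B m\<^esub> b) = con m k a \<ominus>\<^bsub>B (m + k)\<^esub> con m k b"
  by (simp add: B.minus_smult con_add con_smult)

lemma con_zero: "con m k \<zero>\<^bsub>B m\<^esub> = \<zero>\<^bsub>B (m + k)\<^esub>"
  using con_smult[of "\<zero>\<^bsub>B m\<^esub>" m k 0] by simp

lemma con_con: "con (m + j) k (con m j a) = con m (j + k) a"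
  by (induction k) (auto simp: add.assoc)

lemma L_carrier: "x \<in> L \<Longrightarrow> x n \<in> carrier (B n)" by (simp add: limit_seqs_def)

lemma L_I:
  assumes "\<And>n. x n \<in> carrier (B n)"
    "\<And>e. e > 0 \<Longrightarrow> \<exists>N. \<forall>k. nrm (B (N + k)) (x (N + k) \<ominus>\<^bsub>B (N + k)\<^esub> con N k (x N)) < e"
  shows "x \<in> L"
  using assms by (simp add: limit_seqs_def)

text \<open>The definition offers one good starting level N for each error. Comparing through the
  image of \<open>x N\<close> shows, at twice the error, that every later level is good too, so that
  two sequences can be given a common one.\<close>

lemma L_Cauchy:
  assumes x: "x \<in> L" and e: "e > 0"
  obtains N where "\<And>n k. n \<ge> N \<Longrightarrow> nrm (B (n + k)) (x (n + k) \<ominus>\<^bsub>B (n + k)\<^esub> con n k (x n)) < e"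
proof -
  note [simp] = L_carrier[OF x]
  have "e / 2 > 0" using e by simp
  then obtain N where N: "\<And>k. nrm (B (N + k)) (x (N + k) \<ominus>\<^bsub>B (N + k)\<^esub> con N k (x N)) < e / 2"
    using x unfolding limit_seqs_def by blast
  have "nrm (B (n + k)) (x (n + k) \<ominus>\<^bsub>B (n + k)\<^esub> con n k (x n)) < e" if "n \<ge> N" for n k
  proof -
    from that obtain j where n: "n = N + j" by (blast dest: le_Suc_ex)
    let ?c = "con N (j + k) (x N)"
    have c: "?c = con n k (con N j (x N))" by (simp add: con_con n)
    have cc [simp]: "con N j (x N) \<in> carrier (B n)" unfolding n by simp
    have "nrm (B (n + k)) (x (n + k) \<ominus>\<^bsub>B (n + k)\<^esub> con n k (x n))
      \<le> nrm (B (n + k)) (x (n + k) \<ominus>\<^bsub>B (n + k)\<^esub> ?c) + nrm (B (n + k)) (?c \<ominus>\<^bsub>B (n + k)\<^esub> con n k (x n))"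
      unfolding c by (rule B.nrm_triangle3) auto
    also have "nrm (B (n + k)) (?c \<ominus>\<^bsub>B (n + k)\<^esub> con n k (x n)) = nrm (B n) (con N j (x N) \<ominus>\<^bsub>B n\<^esub> x n)"
      unfolding c by (simp add: con_minus[symmetric] con_nrm)
    also have "\<dots> = nrm (B n) (x n \<ominus>\<^bsub>B n\<^esub> con N j (x N))" by (rule B.nrm_minus_commute) auto
    also have "\<dots> < e / 2" using N[of j] by (simp add: n)
    also have "nrm (B (n + k)) (x (n + k) \<ominus>\<^bsub>B (n + k)\<^esub> ?c) < e / 2" using N[of "j + k"] by (simp add: n add.assoc)
    finally show ?thesis by simp
  qed
  then show thesis by (rule that)
qed

lemma nrm_convergent:
  assumes x: "x \<in> L" shows "convergent (\<lambda>n. nrm (B n) (x n))"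
proof -
  note [simp] = L_carrier[OF x]
  have "Cauchy (\<lambda>n. nrm (B n) (x n))"
  proof (rule CauchyI)
    fix e :: real assume "e > 0"
    then have "e / 2 > 0" by simp
    from L_Cauchy[OF x this] obtain N where
      N: "\<And>n k. n \<ge> N \<Longrightarrow> nrm (B (n + k)) (x (n + k) \<ominus>\<^bsub>B (n + k)\<^esub> con n k (x n)) < e / 2" by blast
    have 1: "\<bar>nrm (B n) (x n) - nrm (B N) (x N)\<bar> < e / 2" if "n \<ge> N" for n
    proof -
      from that obtain k where n: "n = N + k" by (blast dest: le_Suc_ex)
      show ?thesis using B.nrm_diff_le[of "x (N + k)" "N + k" "con N k (x N)"] N[of N k]
        by (simp add: n con_nrm)
    qed
    have "norm (nrm (B m) (x m) - nrm (B n) (x n)) < e" if "m \<ge> N" "n \<ge> N" for m n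
      using 1[OF that(1)] 1[OF that(2)] unfolding real_norm_def by linarith
    then show "\<exists>N. \<forall>m\<ge>N. \<forall>n\<ge>N. norm (nrm (B m) (x m) - nrm (B n) (x n)) < e" by blast
  qed
  then show ?thesis by (simp add: Cauchy_convergent)
qed

lemma L_bounded:
  assumes x: "x \<in> L" obtains K where "K > 0" "\<And>n. nrm (B n) (x n) \<le> K"
proof -
  from nrm_convergent[OF x] have "Bseq (\<lambda>n. nrm (B n) (x n))" by (simp add: Cauchy_Bseq convergent_Cauchy)
  then obtain K where K: "K > 0" "\<And>n. \<bar>nrm (B n) (x n)\<bar> \<le> K" unfolding Bseq_def by auto
  have "nrm (B n) (x n) \<le> K" for n using K(2)[of n] by linarith
  then show thesis using that K(1) by blast
qed

lemma L_add:
  assumes x: "x \<in> L" and y: "y \<in> L" shows "(\<lambda>n. x n \<oplus>\<^bsub>B n\<^esub> y n) \<in> L"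
proof (rule L_I)
  note [simp] = L_carrier[OF x] L_carrier[OF y]
  show "x n \<oplus>\<^bsub>B n\<^esub> y n \<in> carrier (B n)" for n by simp
  fix e :: real assume "e > 0"
  then have e2: "e / 2 > 0" by simp
  obtain M where M: "\<And>n k. n \<ge> M \<Longrightarrow> nrm (B (n + k)) (x (n + k) \<ominus>\<^bsub>B (n + k)\<^esub> con n k (x n)) < e / 2"
    using L_Cauchy[OF x e2] by blast
  obtain N where N: "\<And>n k. n \<ge> N \<Longrightarrow> nrm (B (n + k)) (y (n + k) \<ominus>\<^bsub>B (n + k)\<^esub> con n k (y n)) < e / 2"
    using L_Cauchy[OF y e2] by blast
  define n where "n = max M N"
  have "nrm (B (n + k)) ((x (n + k) \<oplus>\<^bsub>B (n + k)\<^esub> y (n + k)) \<ominus>\<^bsub>B (n + k)\<^esub> con n k (x n \<oplus>\<^bsub>B n\<^esub> y n)) < e" for k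
  proof -
    have "(x (n + k) \<oplus>\<^bsub>B (n + k)\<^esub> y (n + k)) \<ominus>\<^bsub>B (n + k)\<^esub> con n k (x n \<oplus>\<^bsub>B n\<^esub> y n) =
      (x (n + k) \<ominus>\<^bsub>B (n + k)\<^esub> con n k (x n)) \<oplus>\<^bsub>B (n + k)\<^esub> (y (n + k) \<ominus>\<^bsub>B (n + k)\<^esub> con n k (y n))"
      by (simp add: con_add B.minus_add_minus)
    then show ?thesis
      using B.nrm_triangle[of "x (n + k) \<ominus>\<^bsub>B (n + k)\<^esub> con n k (x n)" "n + k" "y (n + k) \<ominus>\<^bsub>B (n + k)\<^esub> con n k (y n)"]
        M[of n k] N[of n k] by (simp add: n_def)
  qed
  then show "\<exists>N. \<forall>k. nrm (B (N + k)) ((x (N + k) \<oplus>\<^bsub>B (N + k)\<^esub> y (N + k)) \<ominus>\<^bsub>B (N + k)\<^esub> con N k (x N \<oplus>\<^bsub>B N\<^esub> y N)) < e"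
    by blast
qed

lemma L_mult:
  assumes x: "x \<in> L" and y: "y \<in> L" shows "(\<lambda>n. x n \<otimes>\<^bsub>B n\<^esub> y n) \<in> L"
proof (rule L_I)
  note [simp] = L_carrier[OF x] L_carrier[OF y]
  show "x n \<otimes>\<^bsub>B n\<^esub> y n \<in> carrier (B n)" for n by simp
  fix e :: real assume e: "e > 0"
  obtain K where K: "K > 0" "\<And>n. nrm (B n) (x n) \<le> K" using L_bounded[OF x] by blast
  obtain K' where K': "K' > 0" "\<And>n. nrm (B n) (y n) \<le> K'" using L_bounded[OF y] by blast
  define d where "d = e / (K + K' + 1)"
  have d: "d > 0" using e K K' by (simp add: d_def)
  obtain M where M: "\<And>n k. n \<ge> M \<Longrightarrow> nrm (B (n + k)) (x (n + k) \<ominus>\<^bsub>B (n + k)\<^esub> con n k (x n)) < d"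
    using L_Cauchy[OF x d] by blast
  obtain N where N: "\<And>n k. n \<ge> N \<Longrightarrow> nrm (B (n + k)) (y (n + k) \<ominus>\<^bsub>B (n + k)\<^esub> con n k (y n)) < d"
    using L_Cauchy[OF y d] by blast
  define n where "n = max M N"
  have "nrm (B (n + k)) ((x (n + k) \<otimes>\<^bsub>B (n + k)\<^esub> y (n + k)) \<ominus>\<^bsub>B (n + k)\<^esub> con n k (x n \<otimes>\<^bsub>B n\<^esub> y n)) < e" for k
  proof -
    let ?b = "B (n + k)"
    have 1: "nrm ?b (x (n + k) \<ominus>\<^bsub>?b\<^esub> con n k (x n)) < d" and 2: "nrm ?b (y (n + k) \<ominus>\<^bsub>?b\<^esub> con n k (y n)) < d"
      using M[of n k] N[of n k] by (simp_all add: n_def)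
    have "nrm ?b ((x (n + k) \<otimes>\<^bsub>?b\<^esub> y (n + k)) \<ominus>\<^bsub>?b\<^esub> con n k (x n \<otimes>\<^bsub>B n\<^esub> y n))
      \<le> nrm ?b (x (n + k) \<ominus>\<^bsub>?b\<^esub> con n k (x n)) * nrm ?b (y (n + k))
        + nrm ?b (con n k (x n)) * nrm ?b (y (n + k) \<ominus>\<^bsub>?b\<^esub> con n k (y n))"
      by (simp add: con_mult B.nrm_mult_diff)
    also have "nrm ?b (x (n + k) \<ominus>\<^bsub>?b\<^esub> con n k (x n)) * nrm ?b (y (n + k)) \<le> d * K'"
      using 1 K' d by (intro mult_mono) (auto simp: B.nrm_nonneg less_imp_le)
    also have "nrm ?b (con n k (x n)) * nrm ?b (y (n + k) \<ominus>\<^bsub>?b\<^esub> con n k (y n)) \<le> K * d"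
      using 2 K by (intro mult_mono) (auto simp: con_nrm B.nrm_nonneg)
    also have "d * K' + K * d < d * (K + K' + 1)" using d by (simp add: algebra_simps)
    also have "\<dots> = e" using K K' by (simp add: d_def)
    finally show ?thesis by simp
  qed
  then show "\<exists>N. \<forall>k. nrm (B (N + k)) ((x (N + k) \<otimes>\<^bsub>B (N + k)\<^esub> y (N + k)) \<ominus>\<^bsub>B (N + k)\<^esub> con N k (x N \<otimes>\<^bsub>B N\<^esub> y N)) < e"
    by blast
qed

lemma L_smult:
  assumes x: "x \<in> L" shows "(\<lambda>n. z \<odot>\<^bsub>B n\<^esub> x n) \<in> L"
proof (rule L_I)
  note [simp] = L_carrier[OF x]
  show "z \<odot>\<^bsub>B n\<^esub> x n \<in> carrier (B n)" for n by simp
  fix e :: real assume "e > 0"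
  then have d: "e / (cmod z + 1) > 0" by (simp add: add_nonneg_pos)
  obtain n where N: "\<And>m k. m \<ge> n \<Longrightarrow> nrm (B (m + k)) (x (m + k) \<ominus>\<^bsub>B (m + k)\<^esub> con m k (x m)) < e / (cmod z + 1)"
    using L_Cauchy[OF x d] by blast
  have "nrm (B (n + k)) (z \<odot>\<^bsub>B (n + k)\<^esub> x (n + k) \<ominus>\<^bsub>B (n + k)\<^esub> con n k (z \<odot>\<^bsub>B n\<^esub> x n)) < e" for k
  proof -
    let ?t = "nrm (B (n + k)) (x (n + k) \<ominus>\<^bsub>B (n + k)\<^esub> con n k (x n))"
    have "(cmod z + 1) * ?t < e"
      using N[of n k] by (simp add: pos_less_divide_eq add_nonneg_pos mult.commute)
    moreover have "0 \<le> ?t" by (simp add: B.nrm_nonneg)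
    ultimately have "cmod z * ?t < e" by (simp only: distrib_right mult_1)
    then show ?thesis by (simp add: con_smult B.smult_minus_right[symmetric] B.nrm_smult)
  qed
  then show "\<exists>N. \<forall>k. nrm (B (N + k)) (z \<odot>\<^bsub>B (N + k)\<^esub> x (N + k) \<ominus>\<^bsub>B (N + k)\<^esub> con N k (z \<odot>\<^bsub>B N\<^esub> x N)) < e"
    by blast
qed

lemma L_star:
  assumes x: "x \<in> L" shows "(\<lambda>n. star (B n) (x n)) \<in> L"
proof (rule L_I)
  note [simp] = L_carrier[OF x]
  show "star (B n) (x n) \<in> carrier (B n)" for n by simp
  fix e :: real assume e: "e > 0"
  obtain n where N: "\<And>m k. m \<ge> n \<Longrightarrow> nrm (B (m + k)) (x (m + k) \<ominus>\<^bsub>B (m + k)\<^esub> con m k (x m)) < e"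
    using L_Cauchy[OF x e] by blast
  have "nrm (B (n + k)) (star (B (n + k)) (x (n + k)) \<ominus>\<^bsub>B (n + k)\<^esub> con n k (star (B n) (x n))) < e" for k
    using N[of n k] by (simp add: con_star B.star_minus[symmetric])
  then show "\<exists>N. \<forall>k. nrm (B (N + k)) (star (B (N + k)) (x (N + k)) \<ominus>\<^bsub>B (N + k)\<^esub> con N k (star (B N) (x N))) < e"
    by blast
qed

lemma L_minus:
  assumes x: "x \<in> L" and y: "y \<in> L" shows "(\<lambda>n. x n \<ominus>\<^bsub>B n\<^esub> y n) \<in> L"
  using L_add[OF x L_smult[OF y, of "-1"]] by (simp add: B.minus_smult L_carrier[OF x] L_carrier[OF y])

definition coh where "coh n a = (\<lambda>k. if k < n then \<zero>\<^bsub>B k\<^esub> else con n (k - n) a)"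

lemma con_closed_diff:
  assumes "a \<in> carrier (B n)" "n \<le> k" shows "con n (k - n) a \<in> carrier (B k)"
  using con_closed[OF assms(1), of "k - n"] unfolding le_add_diff_inverse[OF assms(2)] .

lemma coh_carrier: "a \<in> carrier (B n) \<Longrightarrow> coh n a k \<in> carrier (B k)"
  by (simp add: coh_def con_closed_diff)

lemma coh_L:
  assumes a: "a \<in> carrier (B n)" shows "coh n a \<in> L"
proof (rule L_I)
  show "coh n a k \<in> carrier (B k)" for k by (rule coh_carrier[OF a])
  fix e :: real assume "e > 0"
  then show "\<exists>N. \<forall>k. nrm (B (N + k)) (coh n a (N + k) \<ominus>\<^bsub>B (N + k)\<^esub> con N k (coh n a N)) < e"
    using a by (intro exI[of _ n]) (simp add: coh_def B.minus_self)
qed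

lemma one_L: "(\<lambda>n. \<one>\<^bsub>B n\<^esub>) \<in> L"
  by (rule L_I) (auto simp: con_one B.minus_self)

lemma zero_L: "(\<lambda>n. \<zero>\<^bsub>B n\<^esub>) \<in> L"
  by (rule L_I) (auto simp: con_zero B.minus_self)

section \<open>Operations on the quotient\<close>

lemma limit_equiv: "equiv L (limit_rel B \<mu>)"
proof -
  have "(x, z) \<in> limit_rel B \<mu>" if "(x, y) \<in> limit_rel B \<mu>" "(y, z) \<in> limit_rel B \<mu>" for x y z
  proof -
    from that have s: "x \<in> L" "y \<in> L" "z \<in> L"
      and l: "(\<lambda>n. nrm (B n) (x n \<ominus>\<^bsub>B n\<^esub> y n)) \<longlonglongrightarrow> 0" "(\<lambda>n. nrm (B n) (y n \<ominus>\<^bsub>B n\<^esub> z n)) \<longlonglongrightarrow> 0"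
      by (auto simp: limit_rel_def)
    note [simp] = L_carrier[OF s(1)] L_carrier[OF s(2)] L_carrier[OF s(3)]
    have "(\<lambda>n. nrm (B n) (x n \<ominus>\<^bsub>B n\<^esub> z n)) \<longlonglongrightarrow> 0"
      by (rule null_le_add[OF l]) (simp_all add: B.nrm_triangle3 B.nrm_nonneg)
    then show ?thesis using s by (simp add: limit_rel_def)
  qed
  moreover have "(y, x) \<in> limit_rel B \<mu>" if "(x, y) \<in> limit_rel B \<mu>" for x y
  proof -
    from that have s: "x \<in> L" "y \<in> L" by (auto simp: limit_rel_def)
    then show ?thesis using that B.nrm_minus_commute[OF L_carrier[OF s(1)] L_carrier[OF s(2)]]
      by (simp add: limit_rel_def)
  qed
  moreover have "(x, x) \<in> limit_rel B \<mu>" if "x \<in> L" for x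
    using that by (simp add: limit_rel_def B.minus_self[OF L_carrier[OF that]])
  moreover have "limit_rel B \<mu> \<subseteq> L \<times> L" by (auto simp: limit_rel_def)
  ultimately show ?thesis unfolding equiv_def refl_on_def sym_def trans_def by blast
qed

lemma cls_eq_iff: "x \<in> L \<Longrightarrow> y \<in> L \<Longrightarrow> cls x = cls y \<longleftrightarrow> (\<lambda>n. nrm (B n) (x n \<ominus>\<^bsub>B n\<^esub> y n)) \<longlonglongrightarrow> 0"
  unfolding limit_class_def using eq_equiv_class_iff[OF limit_equiv] by (simp add: limit_rel_def)

lemma carrier_R: "carrier R = cls ` L"
  by (auto simp: inductive_limit_def quotient_def limit_class_def)

lemma cls_R [simp]: "x \<in> L \<Longrightarrow> cls x \<in> carrier R" by (simp add: carrier_R)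

lemma R_cases: assumes "h \<in> carrier R" obtains x where "x \<in> L" "h = cls x"
  using assms by (auto simp: carrier_R)

lemma in_cls: "x' \<in> cls x \<longleftrightarrow> x \<in> L \<and> x' \<in> L \<and> (\<lambda>n. nrm (B n) (x n \<ominus>\<^bsub>B n\<^esub> x' n)) \<longlonglongrightarrow> 0"
  by (simp add: limit_class_def limit_rel_def)

lemma self_in_cls: "x \<in> L \<Longrightarrow> x \<in> cls x"
  by (simp add: in_cls B.minus_self[OF L_carrier])

lemma R_add:
  assumes x: "x \<in> L" and y: "y \<in> L"
  shows "cls x \<oplus>\<^bsub>R\<^esub> cls y = cls (\<lambda>n. x n \<oplus>\<^bsub>B n\<^esub> y n)"
proof -
  have "cls (\<lambda>n. x' n \<oplus>\<^bsub>B n\<^esub> y' n) = cls (\<lambda>n. x n \<oplus>\<^bsub>B n\<^esub> y n)" if "x' \<in> cls x" "y' \<in> cls y" for x' y'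
  proof -
    from that have s: "x' \<in> L" "y' \<in> L"
      and l: "(\<lambda>n. nrm (B n) (x n \<ominus>\<^bsub>B n\<^esub> x' n)) \<longlonglongrightarrow> 0" "(\<lambda>n. nrm (B n) (y n \<ominus>\<^bsub>B n\<^esub> y' n)) \<longlonglongrightarrow> 0"
      by (auto simp: in_cls)
    have "(\<lambda>n. nrm (B n) ((x n \<oplus>\<^bsub>B n\<^esub> y n) \<ominus>\<^bsub>B n\<^esub> (x' n \<oplus>\<^bsub>B n\<^esub> y' n))) \<longlonglongrightarrow> 0"
      by (rule null_le_add[OF l]) (simp_all add: B.minus_add_minus B.nrm_triangle B.nrm_nonneg
          L_carrier[OF x] L_carrier[OF y] L_carrier[OF s(1)] L_carrier[OF s(2)])
    then show ?thesis using s x y by (subst eq_commute) (simp add: cls_eq_iff L_add)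
  qed
  then have "(\<Union>x'\<in>cls x. \<Union>y'\<in>cls y. cls (\<lambda>n. x' n \<oplus>\<^bsub>B n\<^esub> y' n)) = cls (\<lambda>n. x n \<oplus>\<^bsub>B n\<^esub> y n)"
    using self_in_cls[OF x] self_in_cls[OF y] by (intro UN_eqI)
  then show ?thesis by (simp add: inductive_limit_def)
qed

lemma R_mult:
  assumes x: "x \<in> L" and y: "y \<in> L"
  shows "cls x \<otimes>\<^bsub>R\<^esub> cls y = cls (\<lambda>n. x n \<otimes>\<^bsub>B n\<^esub> y n)"
proof -
  have "cls (\<lambda>n. x' n \<otimes>\<^bsub>B n\<^esub> y' n) = cls (\<lambda>n. x n \<otimes>\<^bsub>B n\<^esub> y n)" if "x' \<in> cls x" "y' \<in> cls y" for x' y'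
  proof -
    from that have s: "x' \<in> L" "y' \<in> L"
      and l: "(\<lambda>n. nrm (B n) (x n \<ominus>\<^bsub>B n\<^esub> x' n)) \<longlonglongrightarrow> 0" "(\<lambda>n. nrm (B n) (y n \<ominus>\<^bsub>B n\<^esub> y' n)) \<longlonglongrightarrow> 0"
      by (auto simp: in_cls)
    note [simp] = L_carrier[OF x] L_carrier[OF y] L_carrier[OF s(1)] L_carrier[OF s(2)]
    obtain K where K: "K > 0" "\<And>n. nrm (B n) (x' n) \<le> K" using L_bounded[OF s(1)] by blast
    obtain K' where K': "K' > 0" "\<And>n. nrm (B n) (y n) \<le> K'" using L_bounded[OF y] by blast
    have "(\<lambda>n. nrm (B n) ((x n \<otimes>\<^bsub>B n\<^esub> y n) \<ominus>\<^bsub>B n\<^esub> (x' n \<otimes>\<^bsub>B n\<^esub> y' n))) \<longlonglongrightarrow> 0"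
    proof (rule null_le_add[OF tendsto_mult_left_zero[OF l(1), of K'] tendsto_mult_right_zero[OF l(2), of K]])
      fix n
      have "nrm (B n) ((x n \<otimes>\<^bsub>B n\<^esub> y n) \<ominus>\<^bsub>B n\<^esub> (x' n \<otimes>\<^bsub>B n\<^esub> y' n)) \<le>
        nrm (B n) (x n \<ominus>\<^bsub>B n\<^esub> x' n) * nrm (B n) (y n) + nrm (B n) (x' n) * nrm (B n) (y n \<ominus>\<^bsub>B n\<^esub> y' n)"
        by (rule B.nrm_mult_diff) auto
      also have "\<dots> \<le> nrm (B n) (x n \<ominus>\<^bsub>B n\<^esub> x' n) * K' + K * nrm (B n) (y n \<ominus>\<^bsub>B n\<^esub> y' n)"
        by (intro add_mono mult_left_mono mult_right_mono K K') (auto simp: B.nrm_nonneg)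
      finally show "nrm (B n) ((x n \<otimes>\<^bsub>B n\<^esub> y n) \<ominus>\<^bsub>B n\<^esub> (x' n \<otimes>\<^bsub>B n\<^esub> y' n)) \<le>
        nrm (B n) (x n \<ominus>\<^bsub>B n\<^esub> x' n) * K' + K * nrm (B n) (y n \<ominus>\<^bsub>B n\<^esub> y' n)" .
    qed (simp add: B.nrm_nonneg)
    then show ?thesis using s x y by (subst eq_commute) (simp add: cls_eq_iff L_mult)
  qed
  then have "(\<Union>x'\<in>cls x. \<Union>y'\<in>cls y. cls (\<lambda>n. x' n \<otimes>\<^bsub>B n\<^esub> y' n)) = cls (\<lambda>n. x n \<otimes>\<^bsub>B n\<^esub> y n)"
    using self_in_cls[OF x] self_in_cls[OF y] by (intro UN_eqI)
  then show ?thesis by (simp add: inductive_limit_def)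
qed

lemma R_smult:
  assumes x: "x \<in> L" shows "z \<odot>\<^bsub>R\<^esub> cls x = cls (\<lambda>n. z \<odot>\<^bsub>B n\<^esub> x n)"
proof -
  have "cls (\<lambda>n. z \<odot>\<^bsub>B n\<^esub> x' n) = cls (\<lambda>n. z \<odot>\<^bsub>B n\<^esub> x n)" if "x' \<in> cls x" for x'
  proof -
    from that have s: "x' \<in> L" and l: "(\<lambda>n. nrm (B n) (x n \<ominus>\<^bsub>B n\<^esub> x' n)) \<longlonglongrightarrow> 0" by (auto simp: in_cls)
    have "(\<lambda>n. nrm (B n) (z \<odot>\<^bsub>B n\<^esub> x n \<ominus>\<^bsub>B n\<^esub> z \<odot>\<^bsub>B n\<^esub> x' n)) \<longlonglongrightarrow> 0"
      using tendsto_mult_right_zero[OF l, of "cmod z"]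
      by (simp add: B.nrm_smult B.smult_minus_right[symmetric] L_carrier[OF x] L_carrier[OF s])
    then show ?thesis using s x by (subst eq_commute) (simp add: cls_eq_iff L_smult)
  qed
  then have "(\<Union>x'\<in>cls x. cls (\<lambda>n. z \<odot>\<^bsub>B n\<^esub> x' n)) = cls (\<lambda>n. z \<odot>\<^bsub>B n\<^esub> x n)"
    using self_in_cls[OF x] by (intro UN_eqI)
  then show ?thesis by (simp add: inductive_limit_def)
qed

lemma R_star:
  assumes x: "x \<in> L" shows "star R (cls x) = cls (\<lambda>n. star (B n) (x n))"
proof -
  have "cls (\<lambda>n. star (B n) (x' n)) = cls (\<lambda>n. star (B n) (x n))" if "x' \<in> cls x" for x'
  proof -
    from that have s: "x' \<in> L" and l: "(\<lambda>n. nrm (B n) (x n \<ominus>\<^bsub>B n\<^esub> x' n)) \<longlonglongrightarrow> 0" by (auto simp: in_cls)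
    have "(\<lambda>n. nrm (B n) (star (B n) (x n) \<ominus>\<^bsub>B n\<^esub> star (B n) (x' n))) \<longlonglongrightarrow> 0"
      using l by (simp add: B.star_minus[symmetric] L_carrier[OF x] L_carrier[OF s])
    then show ?thesis using s x by (subst eq_commute) (simp add: cls_eq_iff L_star)
  qed
  then have "(\<Union>x'\<in>cls x. cls (\<lambda>n. star (B n) (x' n))) = cls (\<lambda>n. star (B n) (x n))"
    using self_in_cls[OF x] by (intro UN_eqI)
  then show ?thesis by (simp add: inductive_limit_def)
qed

text \<open>Equivalent sequences have norms differing by a null sequence, so the definite
  description denotes the common limit. The C*-axioms of the limit algebra are obtained by passing
  to this limit.\<close>

lemma R_nrm:
  assumes x: "x \<in> L" shows "(\<lambda>n. nrm (B n) (x n)) \<longlonglongrightarrow> nrm R (cls x)"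
proof -
  obtain r where r: "(\<lambda>n. nrm (B n) (x n)) \<longlonglongrightarrow> r" using nrm_convergent[OF x] by (auto simp: convergent_def)
  have all: "(\<lambda>n. nrm (B n) (x' n)) \<longlonglongrightarrow> r" if "x' \<in> cls x" for x'
  proof -
    from that have s: "x' \<in> L" and l: "(\<lambda>n. nrm (B n) (x n \<ominus>\<^bsub>B n\<^esub> x' n)) \<longlonglongrightarrow> 0" by (auto simp: in_cls)
    have "(\<lambda>n. nrm (B n) (x n) - nrm (B n) (x' n)) \<longlonglongrightarrow> 0"
      by (rule Lim_null_comparison[OF _ l]) (simp add: B.nrm_diff_le L_carrier[OF x] L_carrier[OF s])
    from tendsto_diff[OF r this] show ?thesis by simp
  qed
  have "nrm R (cls x) = (THE r. \<forall>x\<in>cls x. (\<lambda>n. nrm (B n) (x n)) \<longlonglongrightarrow> r)"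
    by (simp add: inductive_limit_def)
  also have "\<dots> = r"
  proof (rule the_equality)
    fix s assume "\<forall>x\<in>cls x. (\<lambda>n. nrm (B n) (x n)) \<longlonglongrightarrow> s"
    then show "s = r" using self_in_cls[OF x] r LIMSEQ_unique by blast
  qed (use all in blast)
  finally show ?thesis using r by simp
qed

lemma R_zero: "\<zero>\<^bsub>R\<^esub> = cls (\<lambda>n. \<zero>\<^bsub>B n\<^esub>)" by (simp add: inductive_limit_def)
lemma R_one: "\<one>\<^bsub>R\<^esub> = cls (\<lambda>n. \<one>\<^bsub>B n\<^esub>)" by (simp add: inductive_limit_def)

lemma R_neg:
  assumes x: "x \<in> L" shows "cls (\<lambda>n. (- 1) \<odot>\<^bsub>B n\<^esub> x n) \<oplus>\<^bsub>R\<^esub> cls x = \<zero>\<^bsub>R\<^esub>"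
  unfolding R_add[OF L_smult[OF x] x] R_zero
  by (simp add: B.smult_minus_1 B.minus_add_self L_carrier[OF x])

lemma R_abelian_group: "abelian_group R"
proof (rule abelian_groupI)
  fix X assume "X \<in> carrier R"
  then obtain x where x: "x \<in> L" "X = cls x" by (rule R_cases)
  show "\<exists>Y\<in>carrier R. Y \<oplus>\<^bsub>R\<^esub> X = \<zero>\<^bsub>R\<^esub>"
    using R_neg[OF x(1)] cls_R[OF L_smult[OF x(1)]] x(2) by metis
  show "\<zero>\<^bsub>R\<^esub> \<oplus>\<^bsub>R\<^esub> X = X" unfolding x(2) R_zero R_add[OF zero_L x(1)] by (simp add: L_carrier[OF x(1)])
next
  fix X Y assume "X \<in> carrier R" "Y \<in> carrier R"
  then obtain x y where x: "x \<in> L" "X = cls x" and y: "y \<in> L" "Y = cls y" by (elim R_cases)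
  then show "X \<oplus>\<^bsub>R\<^esub> Y \<in> carrier R" "X \<oplus>\<^bsub>R\<^esub> Y = Y \<oplus>\<^bsub>R\<^esub> X"
    using B.add_comm[OF L_carrier[OF x(1)] L_carrier[OF y(1)]] by (simp_all add: R_add L_add)
next
  fix X Y Z assume "X \<in> carrier R" "Y \<in> carrier R" "Z \<in> carrier R"
  then obtain x y z where x: "x \<in> L" "X = cls x" and y: "y \<in> L" "Y = cls y" and z: "z \<in> L" "Z = cls z"
    by (elim R_cases)
  then show "X \<oplus>\<^bsub>R\<^esub> Y \<oplus>\<^bsub>R\<^esub> Z = X \<oplus>\<^bsub>R\<^esub> (Y \<oplus>\<^bsub>R\<^esub> Z)"
    by (simp add: R_add L_add B.add_assoc[OF L_carrier[OF x(1)] L_carrier[OF y(1)] L_carrier[OF z(1)]])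
qed (simp add: R_zero zero_L)

lemma R_minus:
  assumes x: "x \<in> L" and y: "y \<in> L" shows "cls x \<ominus>\<^bsub>R\<^esub> cls y = cls (\<lambda>n. x n \<ominus>\<^bsub>B n\<^esub> y n)"
proof -
  note [simp] = L_carrier[OF x] L_carrier[OF y]
  have "\<ominus>\<^bsub>R\<^esub> cls y = cls (\<lambda>n. (- 1) \<odot>\<^bsub>B n\<^esub> y n)"
    by (rule abelian_group.minus_equality[OF R_abelian_group R_neg[OF y] cls_R[OF y] cls_R[OF L_smult[OF y]]])
  then have "cls x \<ominus>\<^bsub>R\<^esub> cls y = cls x \<oplus>\<^bsub>R\<^esub> cls (\<lambda>n. (- 1) \<odot>\<^bsub>B n\<^esub> y n)"
    by (simp add: a_minus_def)
  also have "\<dots> = cls (\<lambda>n. x n \<oplus>\<^bsub>B n\<^esub> (- 1) \<odot>\<^bsub>B n\<^esub> y n)" by (rule R_add[OF x L_smult[OF y]])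
  finally show ?thesis by (simp add: B.minus_smult)
qed

lemma R_ring: "ring R"
proof (rule ringI[OF R_abelian_group])
  show "Group.monoid R"
  proof (rule monoidI)
    fix X Y assume "X \<in> carrier R" "Y \<in> carrier R"
    then obtain x y where "x \<in> L" "X = cls x" "y \<in> L" "Y = cls y" by (elim R_cases)
    then show "X \<otimes>\<^bsub>R\<^esub> Y \<in> carrier R" by (simp add: R_mult L_mult)
  next
    fix X Y Z assume "X \<in> carrier R" "Y \<in> carrier R" "Z \<in> carrier R"
    then obtain x y z where x: "x \<in> L" "X = cls x" and y: "y \<in> L" "Y = cls y" and z: "z \<in> L" "Z = cls z"
      by (elim R_cases)
    then show "X \<otimes>\<^bsub>R\<^esub> Y \<otimes>\<^bsub>R\<^esub> Z = X \<otimes>\<^bsub>R\<^esub> (Y \<otimes>\<^bsub>R\<^esub> Z)"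
      by (simp add: R_mult L_mult B.mult_assoc[OF L_carrier[OF x(1)] L_carrier[OF y(1)] L_carrier[OF z(1)]])
  next
    fix X assume "X \<in> carrier R"
    then obtain x where x: "x \<in> L" "X = cls x" by (rule R_cases)
    then show "\<one>\<^bsub>R\<^esub> \<otimes>\<^bsub>R\<^esub> X = X" "X \<otimes>\<^bsub>R\<^esub> \<one>\<^bsub>R\<^esub> = X"
      by (simp_all add: R_one R_mult one_L L_carrier[OF x(1)])
  qed (simp add: R_one one_L)
next
  fix X Y Z assume "X \<in> carrier R" "Y \<in> carrier R" "Z \<in> carrier R"
  then obtain x y z where x: "x \<in> L" "X = cls x" and y: "y \<in> L" "Y = cls y" and z: "z \<in> L" "Z = cls z"
    by (elim R_cases)
  note [simp] = L_carrier[OF x(1)] L_carrier[OF y(1)] L_carrier[OF z(1)]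
  show "(X \<oplus>\<^bsub>R\<^esub> Y) \<otimes>\<^bsub>R\<^esub> Z = X \<otimes>\<^bsub>R\<^esub> Z \<oplus>\<^bsub>R\<^esub> Y \<otimes>\<^bsub>R\<^esub> Z"
    "Z \<otimes>\<^bsub>R\<^esub> (X \<oplus>\<^bsub>R\<^esub> Y) = Z \<otimes>\<^bsub>R\<^esub> X \<oplus>\<^bsub>R\<^esub> Z \<otimes>\<^bsub>R\<^esub> Y"
    using x y z by (simp_all add: R_mult R_add L_mult L_add B.mult_add_left B.mult_add_right)
qed

lemma R_module: "Module.module (class_ring :: complex ring) R"
proof (rule moduleI)
  fix a b :: complex and X assume "X \<in> carrier R"
  then obtain x where x: "x \<in> L" "X = cls x" by (rule R_cases)
  note [simp] = L_carrier[OF x(1)]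
  show "(a \<oplus>\<^bsub>class_ring\<^esub> b) \<odot>\<^bsub>R\<^esub> X = a \<odot>\<^bsub>R\<^esub> X \<oplus>\<^bsub>R\<^esub> b \<odot>\<^bsub>R\<^esub> X"
    "(a \<otimes>\<^bsub>class_ring\<^esub> b) \<odot>\<^bsub>R\<^esub> X = a \<odot>\<^bsub>R\<^esub> (b \<odot>\<^bsub>R\<^esub> X)"
    "a \<odot>\<^bsub>R\<^esub> X \<in> carrier R" "\<one>\<^bsub>class_ring\<^esub> \<odot>\<^bsub>R\<^esub> X = X"
    using x by (simp_all add: R_smult R_add L_smult B.smult_add_left B.smult_smult)
next
  fix a :: complex and X Y assume "X \<in> carrier R" "Y \<in> carrier R"
  then obtain x y where x: "x \<in> L" "X = cls x" and y: "y \<in> L" "Y = cls y" by (elim R_cases)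
  note [simp] = L_carrier[OF x(1)] L_carrier[OF y(1)]
  show "a \<odot>\<^bsub>R\<^esub> (X \<oplus>\<^bsub>R\<^esub> Y) = a \<odot>\<^bsub>R\<^esub> X \<oplus>\<^bsub>R\<^esub> a \<odot>\<^bsub>R\<^esub> Y"
    using x y by (simp add: R_smult R_add L_smult L_add B.smult_add_right)
qed (auto simp: R_abelian_group class_cring.cring_axioms)

section \<open>Canonical maps into the limit, density and completeness\<close>

abbreviation phi where "phi \<equiv> limit_map B \<mu>"

lemma phi_eq: "phi n a = cls (coh n a)" by (simp add: limit_map_def coh_def)

lemma phi_carrier [simp]: "a \<in> carrier (B n) \<Longrightarrow> phi n a \<in> carrier R"
  by (simp add: phi_eq coh_L)

lemma cls_eqI_eventually:
  assumes x: "x \<in> L" and y: "y \<in> L" and eq: "\<And>k. k \<ge> n \<Longrightarrow> x k = y k" shows "cls x = cls y"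
proof -
  have "eventually (\<lambda>k. nrm (B k) (x k \<ominus>\<^bsub>B k\<^esub> y k) = 0) sequentially"
  proof (rule eventually_sequentiallyI)
    fix k assume "n \<le> k"
    show "nrm (B k) (x k \<ominus>\<^bsub>B k\<^esub> y k) = 0"
      unfolding eq[OF \<open>n \<le> k\<close>] by (simp add: B.minus_self L_carrier[OF y])
  qed
  then show ?thesis unfolding cls_eq_iff[OF x y] by (rule tendsto_eventually)
qed

lemma coh_ge: "coh n a (n + k) = con n k a" by (simp add: coh_def)

lemma phi_con: "a \<in> carrier (B n) \<Longrightarrow> phi (n + k) (con n k a) = phi n a"
  unfolding phi_eq
proof (rule cls_eqI_eventually[of _ _ "n + k"])
  fix j assume "n + k \<le> j"
  then obtain i where j: "j = n + k + i" by (blast dest: le_Suc_ex)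
  show "coh (n + k) (con n k a) j = coh n a j"
  proof -
    have "coh (n + k) (con n k a) (n + k + i) = con n (k + i) a" by (simp only: coh_ge con_con)
    moreover have "coh n a (n + k + i) = con n (k + i) a" using coh_ge[of n a "k + i"] by (simp only: add.assoc)
    ultimately show ?thesis using j by simp
  qed
qed (auto intro: coh_L)

lemma phi_hom:
  assumes a: "a \<in> carrier (B n)" and b: "b \<in> carrier (B n)"
  shows "phi n (a \<oplus>\<^bsub>B n\<^esub> b) = phi n a \<oplus>\<^bsub>R\<^esub> phi n b"
    "phi n (a \<otimes>\<^bsub>B n\<^esub> b) = phi n a \<otimes>\<^bsub>R\<^esub> phi n b"
    "phi n (z \<odot>\<^bsub>B n\<^esub> a) = z \<odot>\<^bsub>R\<^esub> phi n a"
    "phi n (star (B n) a) = star R (phi n a)"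
    "phi n (a \<ominus>\<^bsub>B n\<^esub> b) = phi n a \<ominus>\<^bsub>R\<^esub> phi n b"
proof -
  note [simp] = a b
  have ge: "\<exists>i. k = n + i" if "n \<le> k" for k using that by (simp add: le_iff_add)
  show "phi n (a \<oplus>\<^bsub>B n\<^esub> b) = phi n a \<oplus>\<^bsub>R\<^esub> phi n b"
    unfolding phi_eq R_add[OF coh_L[OF a] coh_L[OF b]]
    by (rule cls_eqI_eventually[of _ _ n]) (auto simp: coh_L L_add coh_ge con_add dest: ge)
  show "phi n (a \<otimes>\<^bsub>B n\<^esub> b) = phi n a \<otimes>\<^bsub>R\<^esub> phi n b"
    unfolding phi_eq R_mult[OF coh_L[OF a] coh_L[OF b]]
    by (rule cls_eqI_eventually[of _ _ n]) (auto simp: coh_L L_mult coh_ge con_mult dest: ge)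
  show "phi n (z \<odot>\<^bsub>B n\<^esub> a) = z \<odot>\<^bsub>R\<^esub> phi n a"
    unfolding phi_eq R_smult[OF coh_L[OF a]]
    by (rule cls_eqI_eventually[of _ _ n]) (auto simp: coh_L L_smult coh_ge con_smult dest: ge)
  show "phi n (star (B n) a) = star R (phi n a)"
    unfolding phi_eq R_star[OF coh_L[OF a]]
    by (rule cls_eqI_eventually[of _ _ n]) (auto simp: coh_L L_star coh_ge con_star dest: ge)
  show "phi n (a \<ominus>\<^bsub>B n\<^esub> b) = phi n a \<ominus>\<^bsub>R\<^esub> phi n b"
    unfolding phi_eq R_minus[OF coh_L[OF a] coh_L[OF b]]
    by (rule cls_eqI_eventually[of _ _ n]) (auto simp: coh_L L_minus coh_ge con_minus dest: ge)
qed

lemma phi_one: "phi n \<one>\<^bsub>B n\<^esub> = \<one>\<^bsub>R\<^esub>"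
  unfolding phi_eq R_one
proof (rule cls_eqI_eventually[of _ _ n])
  fix k assume "n \<le> k"
  then obtain i where "k = n + i" by (blast dest: le_Suc_ex)
  then show "coh n \<one>\<^bsub>B n\<^esub> k = \<one>\<^bsub>B k\<^esub>" by (simp add: coh_ge con_one)
qed (auto intro: coh_L one_L)

lemma phi_nrm:
  assumes a: "a \<in> carrier (B n)" shows "nrm R (phi n a) = nrm (B n) a"
proof -
  have "eventually (\<lambda>k. nrm (B k) (coh n a k) = nrm (B n) a) sequentially"
  proof (rule eventually_sequentiallyI)
    fix k assume "n \<le> k"
    then obtain i where "k = n + i" by (blast dest: le_Suc_ex)
    then show "nrm (B k) (coh n a k) = nrm (B n) a" using a by (simp add: coh_ge con_nrm)
  qed
  from LIMSEQ_unique[OF R_nrm[OF coh_L[OF a]] tendsto_eventually[OF this]] show ?thesis by (simp add: phi_eq)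
qed

lemma R_triangle3:
  assumes "X \<in> carrier R" "Y \<in> carrier R" "Z \<in> carrier R"
  shows "nrm R (X \<ominus>\<^bsub>R\<^esub> Z) \<le> nrm R (X \<ominus>\<^bsub>R\<^esub> Y) + nrm R (Y \<ominus>\<^bsub>R\<^esub> Z)"
proof -
  obtain x y z where x: "x \<in> L" "X = cls x" and y: "y \<in> L" "Y = cls y" and z: "z \<in> L" "Z = cls z"
    using assms by (elim R_cases)
  show ?thesis unfolding x(2) y(2) z(2) R_minus[OF x(1) z(1)] R_minus[OF x(1) y(1)] R_minus[OF y(1) z(1)]
    by (rule LIMSEQ_le[OF R_nrm[OF L_minus[OF x(1) z(1)]]
          tendsto_add[OF R_nrm[OF L_minus[OF x(1) y(1)]] R_nrm[OF L_minus[OF y(1) z(1)]]]])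
      (simp add: B.nrm_triangle3 L_carrier[OF x(1)] L_carrier[OF y(1)] L_carrier[OF z(1)])
qed

lemma R_minus_commute:
  assumes "X \<in> carrier R" "Y \<in> carrier R" shows "nrm R (X \<ominus>\<^bsub>R\<^esub> Y) = nrm R (Y \<ominus>\<^bsub>R\<^esub> X)"
proof -
  obtain x y where x: "x \<in> L" "X = cls x" and y: "y \<in> L" "Y = cls y" using assms by (elim R_cases)
  have "(\<lambda>n. nrm (B n) (x n \<ominus>\<^bsub>B n\<^esub> y n)) \<longlonglongrightarrow> nrm R (X \<ominus>\<^bsub>R\<^esub> Y)"
    using R_nrm[OF L_minus[OF x(1) y(1)]] unfolding x(2) y(2) R_minus[OF x(1) y(1)] .
  moreover have "(\<lambda>n. nrm (B n) (x n \<ominus>\<^bsub>B n\<^esub> y n)) \<longlonglongrightarrow> nrm R (Y \<ominus>\<^bsub>R\<^esub> X)"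
    using R_nrm[OF L_minus[OF y(1) x(1)]] unfolding x(2) y(2) R_minus[OF y(1) x(1)]
    by (simp add: B.nrm_minus_commute[OF L_carrier[OF x(1)] L_carrier[OF y(1)]])
  ultimately show ?thesis by (rule LIMSEQ_unique)
qed

lemma R_nrm_nonneg: "X \<in> carrier R \<Longrightarrow> 0 \<le> nrm R X"
proof -
  assume "X \<in> carrier R"
  then obtain x where x: "x \<in> L" "X = cls x" by (rule R_cases)
  show ?thesis unfolding x(2)
    by (rule LIMSEQ_le_const[OF R_nrm[OF x(1)]]) (simp add: B.nrm_nonneg L_carrier[OF x(1)])
qed

text \<open>By asymptotic coherence the entry \<open>x n\<close>, pushed forward from level n,
  eventually follows x up to a small error. Density of the union of the levels is a
  consequence.\<close>

lemma cls_approx: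
  assumes x: "x \<in> L" shows "(\<lambda>n. nrm R (cls x \<ominus>\<^bsub>R\<^esub> phi n (x n))) \<longlonglongrightarrow> 0"
proof (rule LIMSEQ_I)
  note [simp] = L_carrier[OF x]
  fix e :: real assume "e > 0"
  then have e2: "e / 2 > 0" by simp
  obtain N where N: "\<And>n k. n \<ge> N \<Longrightarrow> nrm (B (n + k)) (x (n + k) \<ominus>\<^bsub>B (n + k)\<^esub> con n k (x n)) < e / 2"
    using L_Cauchy[OF x e2] by blast
  have "norm (nrm R (cls x \<ominus>\<^bsub>R\<^esub> phi n (x n)) - 0) < e" if n: "n \<ge> N" for n
  proof -
    have c: "coh n (x n) \<in> L" by (rule coh_L) simp
    have "nrm R (cls x \<ominus>\<^bsub>R\<^esub> phi n (x n)) \<le> e / 2"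
      unfolding phi_eq R_minus[OF x c]
    proof (rule LIMSEQ_le_const2[OF R_nrm[OF L_minus[OF x c]]], intro exI allI impI)
      fix j assume "n \<le> j"
      then obtain k where j: "j = n + k" by (blast dest: le_Suc_ex)
      show "nrm (B j) (x j \<ominus>\<^bsub>B j\<^esub> coh n (x n) j) \<le> e / 2" using N[OF n, of k] by (simp add: j coh_ge)
    qed
    moreover have "cls x \<ominus>\<^bsub>R\<^esub> phi n (x n) \<in> carrier R"
      unfolding phi_eq R_minus[OF x c] by (rule cls_R[OF L_minus[OF x c]])
    ultimately show ?thesis using R_nrm_nonneg[of "cls x \<ominus>\<^bsub>R\<^esub> phi n (x n)"] \<open>e > 0\<close> by simp
  qed
  then show "\<exists>N. \<forall>n\<ge>N. norm (nrm R (cls x \<ominus>\<^bsub>R\<^esub> phi n (x n)) - 0) < e" by blast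
qed

lemma phi_dense:
  assumes X: "X \<in> carrier R" and e: "e > 0"
  shows "\<exists>n. \<exists>a\<in>carrier (B n). nrm R (X \<ominus>\<^bsub>R\<^esub> phi n a) < e"
proof -
  obtain x where x: "x \<in> L" "X = cls x" using X by (rule R_cases)
  obtain N where "\<And>n. n \<ge> N \<Longrightarrow> nrm R (X \<ominus>\<^bsub>R\<^esub> phi n (x n)) < e"
    using order_tendstoD(2)[OF cls_approx[OF x(1)] e] x(2) by (auto simp: eventually_sequentially)
  then show ?thesis using L_carrier[OF x(1)] by blast
qed

text \<open>A Cauchy sequence is approximated by elements \<open>a m\<close> of finite levels \<open>N m\<close>; its limit is
  represented by the diagonal sequence that uses at position \<open>n\<close> the latest \<open>a m\<close> whose level
  is at most \<open>n\<close>.\<close>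

lemma R_complete:
  assumes S: "\<And>n. S n \<in> carrier R"
    and C: "\<And>e. e > 0 \<Longrightarrow> \<exists>N. \<forall>m\<ge>N. \<forall>n\<ge>N. nrm R (S m \<ominus>\<^bsub>R\<^esub> S n) < e"
  shows "\<exists>l\<in>carrier R. (\<lambda>n. nrm R (S n \<ominus>\<^bsub>R\<^esub> l)) \<longlonglongrightarrow> 0"
proof -
  have "\<exists>p. snd p \<in> carrier (B (fst p)) \<and> nrm R (S m \<ominus>\<^bsub>R\<^esub> phi (fst p) (snd p)) < inverse (Suc m)" for m
    using phi_dense[OF S[of m], of "inverse (Suc m)"] by auto
  then obtain p where p: "\<And>m. snd (p m) \<in> carrier (B (fst (p m)))"
    "\<And>m. nrm R (S m \<ominus>\<^bsub>R\<^esub> phi (fst (p m)) (snd (p m))) < inverse (Suc m)"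
    by metis
  define N where "N m = fst (p m)" for m
  define a where "a m = snd (p m)" for m
  define t where "t m = phi (N m) (a m)" for m
  have a [simp]: "a m \<in> carrier (B (N m))" for m using p(1) by (simp add: N_def a_def)
  have t [simp]: "t m \<in> carrier R" for m by (simp add: t_def)
  have St: "nrm R (S m \<ominus>\<^bsub>R\<^esub> t m) < inverse (Suc m)" for m using p(2) by (simp add: N_def a_def t_def)
  have tC: "\<exists>M. \<forall>m\<ge>M. \<forall>n\<ge>M. nrm R (t m \<ominus>\<^bsub>R\<^esub> t n) < e" if "e > 0" for e
  proof -
    have e3: "e / 3 > 0" using that by simp
    obtain M where M: "\<And>m n. m \<ge> M \<Longrightarrow> n \<ge> M \<Longrightarrow> nrm R (S m \<ominus>\<^bsub>R\<^esub> S n) < e / 3" using C[OF e3] by blast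
    obtain M' where M': "inverse (real (Suc M')) < e / 3" using reals_Archimedean[OF e3] by blast
    have small: "nrm R (S m \<ominus>\<^bsub>R\<^esub> t m) < e / 3" if "m \<ge> M'" for m
    proof -
      have "inverse (real (Suc m)) \<le> inverse (real (Suc M'))" using that by (intro le_imp_inverse_le) auto
      then show ?thesis using St[of m] M' by linarith
    qed
    have "nrm R (t m \<ominus>\<^bsub>R\<^esub> t n) < e" if "m \<ge> max M M'" "n \<ge> max M M'" for m n
      using R_triangle3[OF t[of m] S[of m] t[of n]] R_triangle3[OF S[of m] S[of n] t[of n]]
        R_minus_commute[OF t[of m] S[of m]] small[of m] small[of n] M[of m n] that by simp
    then show ?thesis by blast
  qed
  \<comment> \<open>The condition \<open>m <= n\<close> makes the set finite, so that the maximum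
    exists; it is nonempty as soon as \<open>N 0 <= n\<close>, and below that index y is set to
    zero.\<close>
  define j where "j n = Max {m. m \<le> n \<and> N m \<le> n}" for n
  have fin: "finite {m. m \<le> n \<and> N m \<le> n}" for n by (rule finite_subset[of _ "{..n}"]) auto
  have j_ge: "m \<le> j n" if "m \<le> n" "N m \<le> n" for m n unfolding j_def using fin that by (intro Max_ge) auto
  have j_N: "N (j n) \<le> n" if "N 0 \<le> n" for n
  proof -
    have "j n \<in> {m. m \<le> n \<and> N m \<le> n}" unfolding j_def using fin that by (intro Max_in) auto
    then show ?thesis by simp
  qed
  define y where "y n = (if N 0 \<le> n then con (N (j n)) (n - N (j n)) (a (j n)) else \<zero>\<^bsub>B n\<^esub>)" for n
  have y [simp]: "y n \<in> carrier (B n)" for n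
    using con_closed_diff[OF a j_N] by (simp add: y_def)
  have phi_y: "phi n (y n) = t (j n)" if "N 0 \<le> n" for n
    using phi_con[OF a, of "j n" "n - N (j n)"] j_N[OF that] that by (simp add: y_def t_def)
  \<comment> \<open>Once n exceeds both M and \<open>N M\<close>, the index \<open>j n\<close> is at
    least M, so \<open>t (j n)\<close> belongs to the tail where the approximants are close to each
    other.\<close>
  have tail: "\<exists>M. \<forall>n\<ge>M. \<forall>m\<ge>M. N 0 \<le> n \<and> nrm R (t m \<ominus>\<^bsub>R\<^esub> t (j n)) < e" if e: "e > 0" for e
  proof -
    obtain M where M: "\<And>m n. m \<ge> M \<Longrightarrow> n \<ge> M \<Longrightarrow> nrm R (t m \<ominus>\<^bsub>R\<^esub> t n) < e" using tC[OF e] by blast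
    have "N 0 \<le> n \<and> nrm R (t m \<ominus>\<^bsub>R\<^esub> t (j n)) < e"
      if "n \<ge> max (N 0) (max M (N M))" "m \<ge> max (N 0) (max M (N M))" for n m
      using that M[of m "j n"] j_ge[of M n] by simp
    then show ?thesis by blast
  qed
  have yL: "y \<in> L"
  proof (rule L_I)
    fix e :: real assume e: "e > 0"
    then have e2: "e / 2 > 0" by simp
    obtain M where M: "\<And>n m. n \<ge> M \<Longrightarrow> m \<ge> M \<Longrightarrow> N 0 \<le> n \<and> nrm R (t m \<ominus>\<^bsub>R\<^esub> t (j n)) < e / 2"
      using tail[OF e2] by blast
    have "nrm (B (M + k)) (y (M + k) \<ominus>\<^bsub>B (M + k)\<^esub> con M k (y M)) < e" for k
    proof -
      have "nrm (B (M + k)) (y (M + k) \<ominus>\<^bsub>B (M + k)\<^esub> con M k (y M)) =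
        nrm R (phi (M + k) (y (M + k)) \<ominus>\<^bsub>R\<^esub> phi (M + k) (con M k (y M)))"
        by (simp add: phi_hom[symmetric] phi_nrm)
      also have "\<dots> = nrm R (t (j (M + k)) \<ominus>\<^bsub>R\<^esub> t (j M))"
        using M[of M M] M[of "M + k" M] by (simp add: phi_con phi_y)
      also have "\<dots> < e"
        using R_triangle3[OF t[of "j (M + k)"] t[of M] t[of "j M"]] R_minus_commute[OF t[of "j (M + k)"] t[of M]]
          M[of M M] M[of "M + k" M] by simp
      finally show ?thesis .
    qed
    then show "\<exists>N. \<forall>k. nrm (B (N + k)) (y (N + k) \<ominus>\<^bsub>B (N + k)\<^esub> con N k (y N)) < e" by blast
  qed simp
  have l: "cls y \<in> carrier R" using yL by simp
  have "(\<lambda>n. nrm R (S n \<ominus>\<^bsub>R\<^esub> cls y)) \<longlonglongrightarrow> 0"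
  proof (rule LIMSEQ_I)
    fix e :: real assume e: "e > 0"
    then have e3: "e / 3 > 0" by simp
    obtain M where M: "\<And>n m. n \<ge> M \<Longrightarrow> m \<ge> M \<Longrightarrow> N 0 \<le> n \<and> nrm R (t m \<ominus>\<^bsub>R\<^esub> t (j n)) < e / 3"
      using tail[OF e3] by blast
    obtain M1 where M1: "\<And>n. n \<ge> M1 \<Longrightarrow> nrm R (cls y \<ominus>\<^bsub>R\<^esub> phi n (y n)) < e / 3"
      using order_tendstoD(2)[OF cls_approx[OF yL] e3] by (auto simp: eventually_sequentially)
    obtain M2 where M2: "inverse (real (Suc M2)) < e / 3" using reals_Archimedean[OF e3] by blast
    have "norm (nrm R (S n \<ominus>\<^bsub>R\<^esub> cls y) - 0) < e" if n: "n \<ge> max M (max M1 M2)" for n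
    proof -
      have "inverse (real (Suc n)) \<le> inverse (real (Suc M2))" using n by (intro le_imp_inverse_le) auto
      then have 1: "nrm R (S n \<ominus>\<^bsub>R\<^esub> t n) < e / 3" using St[of n] M2 by linarith
      have 2: "nrm R (t n \<ominus>\<^bsub>R\<^esub> t (j n)) < e / 3" using M[of n n] n by simp
      have 3: "nrm R (t (j n) \<ominus>\<^bsub>R\<^esub> cls y) < e / 3"
        using M1[of n] M[of n n] n R_minus_commute[OF l t[of "j n"]] by (simp add: phi_y)
      obtain s where s: "s \<in> L" "S n = cls s" using S[of n] by (rule R_cases)
      have "0 \<le> nrm R (S n \<ominus>\<^bsub>R\<^esub> cls y)"
        unfolding s(2) R_minus[OF s(1) yL] by (intro R_nrm_nonneg cls_R L_minus s(1) yL)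
      then show ?thesis
        using 1 2 3 R_triangle3[OF S[of n] t[of n] l] R_triangle3[OF t[of n] t[of "j n"] l] by simp
    qed
    then show "\<exists>M. \<forall>n\<ge>M. norm (nrm R (S n \<ominus>\<^bsub>R\<^esub> cls y) - 0) < e" by blast
  qed
  then show ?thesis using l by blast
qed

theorem R_cstar: "unital_cstar_algebra R"
proof -
  have "unital_cstar_algebra_axioms R"
  proof
    fix S :: "nat \<Rightarrow> _"
    assume "\<And>n. S n \<in> carrier R" "\<And>e. e > 0 \<Longrightarrow> \<exists>N. \<forall>m\<ge>N. \<forall>n\<ge>N. nrm R (S m \<ominus>\<^bsub>R\<^esub> S n) < e"
    then show "\<exists>l\<in>carrier R. (\<lambda>n. nrm R (S n \<ominus>\<^bsub>R\<^esub> l)) \<longlonglongrightarrow> 0" by (rule R_complete)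
  next
    fix X Y and z :: complex assume "X \<in> carrier R" "Y \<in> carrier R"
    then obtain x y where x: "x \<in> L" "X = cls x" and y: "y \<in> L" "Y = cls y" by (elim R_cases)
    note [simp] = L_carrier[OF x(1)] L_carrier[OF y(1)]
    show "(z \<odot>\<^bsub>R\<^esub> X) \<otimes>\<^bsub>R\<^esub> Y = z \<odot>\<^bsub>R\<^esub> (X \<otimes>\<^bsub>R\<^esub> Y)" "X \<otimes>\<^bsub>R\<^esub> (z \<odot>\<^bsub>R\<^esub> Y) = z \<odot>\<^bsub>R\<^esub> (X \<otimes>\<^bsub>R\<^esub> Y)"
      using x y by (simp_all add: R_smult R_mult L_smult L_mult B.smult_mult_left B.smult_mult_right)
    show "star R (X \<oplus>\<^bsub>R\<^esub> Y) = star R X \<oplus>\<^bsub>R\<^esub> star R Y"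
      using x y by (simp add: R_star R_add L_add L_star B.star_add)
    show "star R (X \<otimes>\<^bsub>R\<^esub> Y) = star R Y \<otimes>\<^bsub>R\<^esub> star R X"
      using x y by (simp add: R_star R_mult L_mult L_star B.star_mult)
    show "nrm R (X \<oplus>\<^bsub>R\<^esub> Y) \<le> nrm R X + nrm R Y" unfolding x(2) y(2) R_add[OF x(1) y(1)]
      by (rule LIMSEQ_le[OF R_nrm[OF L_add[OF x(1) y(1)]] tendsto_add[OF R_nrm[OF x(1)] R_nrm[OF y(1)]]])
        (simp add: B.nrm_triangle)
    show "nrm R (X \<otimes>\<^bsub>R\<^esub> Y) \<le> nrm R X * nrm R Y" unfolding x(2) y(2) R_mult[OF x(1) y(1)]
      by (rule LIMSEQ_le[OF R_nrm[OF L_mult[OF x(1) y(1)]] tendsto_mult[OF R_nrm[OF x(1)] R_nrm[OF y(1)]]])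
        (simp add: B.nrm_mult)
  next
    fix X and z :: complex assume XR: "X \<in> carrier R"
    then obtain x where x: "x \<in> L" "X = cls x" by (rule R_cases)
    note [simp] = L_carrier[OF x(1)]
    show "star R X \<in> carrier R" "star R (star R X) = X" "star R (z \<odot>\<^bsub>R\<^esub> X) = cnj z \<odot>\<^bsub>R\<^esub> star R X"
      using x by (simp_all add: R_star R_smult L_star L_smult B.star_smult)
    show "0 \<le> nrm R X" by (rule R_nrm_nonneg[OF XR])
    show "nrm R X = 0 \<longleftrightarrow> X = \<zero>\<^bsub>R\<^esub>"
    proof -
      have "X = \<zero>\<^bsub>R\<^esub> \<longleftrightarrow> (\<lambda>n. nrm (B n) (x n)) \<longlonglongrightarrow> 0"
        unfolding x(2) R_zero cls_eq_iff[OF x(1) zero_L] by (simp add: B.minus_smult)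
      also have "\<dots> \<longleftrightarrow> nrm R X = 0"
      proof
        assume "(\<lambda>n. nrm (B n) (x n)) \<longlonglongrightarrow> 0"
        from LIMSEQ_unique[OF R_nrm[OF x(1)] this] show "nrm R X = 0" by (simp add: x(2))
      next
        assume "nrm R X = 0"
        then show "(\<lambda>n. nrm (B n) (x n)) \<longlonglongrightarrow> 0" using R_nrm[OF x(1)] by (simp add: x(2))
      qed
      finally show ?thesis by simp
    qed
    have "(\<lambda>n. nrm (B n) (z \<odot>\<^bsub>B n\<^esub> x n)) \<longlonglongrightarrow> cmod z * nrm R X"
      using tendsto_mult[OF tendsto_const R_nrm[OF x(1)], of "cmod z"] x(2) by (simp add: B.nrm_smult)
    from LIMSEQ_unique[OF R_nrm[OF L_smult[OF x(1)]] this]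
    show "nrm R (z \<odot>\<^bsub>R\<^esub> X) = cmod z * nrm R X" using x by (simp add: R_smult)
    have "(\<lambda>n. nrm (B n) (star (B n) (x n) \<otimes>\<^bsub>B n\<^esub> x n)) \<longlonglongrightarrow> (nrm R X)\<^sup>2"
      using tendsto_power[OF R_nrm[OF x(1)], of 2] x(2) by (simp add: B.cstar_identity)
    from LIMSEQ_unique[OF R_nrm[OF L_mult[OF L_star[OF x(1)] x(1)]] this]
    show "nrm R (star R X \<otimes>\<^bsub>R\<^esub> X) = (nrm R X)\<^sup>2" using x by (simp add: R_star R_mult L_star)
  qed
  then show ?thesis using R_ring R_module by (simp add: unital_cstar_algebra_def)
qed

end

section \<open>Matrix algebras\<close>

definition vec_nrm :: "complex vec \<Rightarrow> real" where "vec_nrm v = sqrt (Re (v \<bullet>c v))"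

lemma cscalar_sum: "v \<bullet>c w = (\<Sum>i<dim_vec w. vec_index v i * cnj (vec_index w i))"
  by (auto simp: scalar_prod_def atLeast0LessThan conjugate_complex_def intro!: sum.cong)

lemma vec_nrm_L2: "vec_nrm v = L2_set (\<lambda>i. cmod (vec_index v i)) {..<dim_vec v}"
proof -
  have "v \<bullet>c v = of_real (\<Sum>i<dim_vec v. (cmod (vec_index v i))\<^sup>2)"
    by (simp add: cscalar_sum complex_norm_square[symmetric])
  then show ?thesis by (simp add: vec_nrm_def L2_set_def)
qed

lemma vec_nrm_nonneg [simp]: "0 \<le> vec_nrm v" by (simp add: vec_nrm_L2)

lemma vec_nrm_power2: "(vec_nrm v)\<^sup>2 = (\<Sum>i<dim_vec v. (cmod (vec_index v i))\<^sup>2)"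
  by (simp add: vec_nrm_L2 L2_set_def sum_nonneg)

lemma cscalar_self: "v \<bullet>c v = of_real ((vec_nrm v)\<^sup>2)"
  unfolding vec_nrm_power2 by (simp add: cscalar_sum complex_norm_square[symmetric])

lemma vec_nrm_add: "v \<in> carrier_vec n \<Longrightarrow> w \<in> carrier_vec n \<Longrightarrow> vec_nrm (v + w) \<le> vec_nrm v + vec_nrm w"
proof -
  assume v: "v \<in> carrier_vec n" and w: "w \<in> carrier_vec n"
  have "L2_set (\<lambda>i. cmod (vec_index v i + vec_index w i)) {..<n}
    \<le> L2_set (\<lambda>i. cmod (vec_index v i) + cmod (vec_index w i)) {..<n}"
    by (intro L2_set_mono norm_triangle_ineq) auto
  also have "\<dots> \<le> L2_set (\<lambda>i. cmod (vec_index v i)) {..<n} + L2_set (\<lambda>i. cmod (vec_index w i)) {..<n}"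
    by (rule L2_set_triangle_ineq)
  also have "L2_set (\<lambda>i. cmod (vec_index v i + vec_index w i)) {..<n} = vec_nrm (v + w)"
    using v w by (auto simp: vec_nrm_L2 intro!: L2_set_cong)
  finally show ?thesis using v w by (simp add: vec_nrm_L2)
qed

lemma vec_nrm_smult: "vec_nrm (z \<cdot>\<^sub>v v) = cmod z * vec_nrm v"
proof -
  have "vec_nrm (z \<cdot>\<^sub>v v) = L2_set (\<lambda>i. cmod z * cmod (vec_index v i)) {..<dim_vec v}"
    by (auto simp: vec_nrm_L2 norm_mult intro!: L2_set_cong)
  then show ?thesis by (simp add: vec_nrm_L2 L2_set_right_distrib)
qed

lemma vec_nrm_Cauchy_Schwarz:
  assumes "dim_vec v = dim_vec w" shows "cmod (v \<bullet>c w) \<le> vec_nrm v * vec_nrm w"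
proof -
  have "cmod (v \<bullet>c w) \<le> (\<Sum>i<dim_vec w. \<bar>cmod (vec_index v i)\<bar> * \<bar>cmod (vec_index w i)\<bar>)"
    unfolding cscalar_sum by (rule order_trans[OF norm_sum]) (simp add: norm_mult)
  also have "\<dots> \<le> vec_nrm v * vec_nrm w" unfolding vec_nrm_L2 assms by (rule L2_set_mult_ineq)
  finally show ?thesis .
qed

lemma vec_nrm_zero [simp]: "vec_nrm (0\<^sub>v n) = 0" by (simp add: vec_nrm_L2 L2_set_def)

lemma vec_nrm_eq_0: "vec_nrm v = 0 \<Longrightarrow> v \<in> carrier_vec n \<Longrightarrow> v = 0\<^sub>v n"
  by (auto simp: vec_nrm_L2 L2_set_eq_0_iff)

lemma component_le_vec_nrm: "i < dim_vec v \<Longrightarrow> cmod (vec_index v i) \<le> vec_nrm v"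
  unfolding vec_nrm_L2 by (intro member_le_L2_set) auto

lemma vec_nrm_unit_vec: "j < n \<Longrightarrow> vec_nrm (unit_vec n j) = 1"
proof -
  assume j: "j < n"
  have "(vec_nrm (unit_vec n j))\<^sup>2 = (\<Sum>i<n. if i = j then 1 else 0)"
    unfolding vec_nrm_power2 by (rule sum.cong) (auto simp: unit_vec_def)
  then have "(vec_nrm (unit_vec n j))\<^sup>2 = 1" using j by simp
  then show ?thesis by (simp add: power2_eq_1_iff) (use vec_nrm_nonneg[of "unit_vec n j"] in linarith)
qed

text \<open>Cauchy-Schwarz in each row. The Hilbert-Schmidt bound also shows that the supremum
  defining the operator norm is finite, and later makes entrywise convergence imply norm
  convergence.\<close>

lemma mult_vec_le_entries:
  assumes a: "a \<in> carrier_mat m d" and v: "v \<in> carrier_vec d"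
  shows "vec_nrm (a *\<^sub>v v) \<le> sqrt (\<Sum>i<m. \<Sum>j<d. (cmod (a $$ (i, j)))\<^sup>2) * vec_nrm v"
proof -
  have row: "(cmod (vec_index (a *\<^sub>v v) i))\<^sup>2 \<le> (\<Sum>j<d. (cmod (a $$ (i, j)))\<^sup>2) * (vec_nrm v)\<^sup>2" if i: "i < m" for i
  proof -
    have "vec_index (a *\<^sub>v v) i = (\<Sum>j<d. a $$ (i, j) * vec_index v j)"
      using a v i by (auto simp: scalar_prod_def atLeast0LessThan intro!: sum.cong)
    then have "cmod (vec_index (a *\<^sub>v v) i) \<le> (\<Sum>j<d. \<bar>cmod (a $$ (i, j))\<bar> * \<bar>cmod (vec_index v j)\<bar>)"
      by (simp add: norm_mult[symmetric] norm_sum)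
    also have "\<dots> \<le> L2_set (\<lambda>j. cmod (a $$ (i, j))) {..<d} * vec_nrm v"
      unfolding vec_nrm_L2 carrier_vecD[OF v] by (rule L2_set_mult_ineq)
    finally have "(cmod (vec_index (a *\<^sub>v v) i))\<^sup>2 \<le> (L2_set (\<lambda>j. cmod (a $$ (i, j))) {..<d} * vec_nrm v)\<^sup>2"
      by (rule power_mono) simp
    then show ?thesis by (simp add: power_mult_distrib L2_set_def sum_nonneg)
  qed
  have "(vec_nrm (a *\<^sub>v v))\<^sup>2 = (\<Sum>i<m. (cmod (vec_index (a *\<^sub>v v) i))\<^sup>2)"
    using a by (simp add: vec_nrm_power2 del: index_mult_mat_vec)
  also have "\<dots> \<le> (\<Sum>i<m. (\<Sum>j<d. (cmod (a $$ (i, j)))\<^sup>2) * (vec_nrm v)\<^sup>2)"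
    by (intro sum_mono row) simp
  also have "\<dots> = (sqrt (\<Sum>i<m. \<Sum>j<d. (cmod (a $$ (i, j)))\<^sup>2) * vec_nrm v)\<^sup>2"
    by (simp add: power_mult_distrib sum_distrib_right sum_nonneg)
  finally show ?thesis by (rule power2_le_imp_le) (simp add: sum_nonneg)
qed

section \<open>The operator norm and the C*-identity\<close>

lemma mat_op_norm_vec_nrm: "mat_op_norm a = (SUP v\<in>{v \<in> carrier_vec (dim_col a). (vec_nrm v)\<^sup>2 \<le> 1}. vec_nrm (a *\<^sub>v v))"
proof -
  have "Re (v \<bullet>c v) = (vec_nrm v)\<^sup>2" for v :: "complex vec" by (simp add: cscalar_self del: of_real_power)
  then show ?thesis unfolding mat_op_norm_def vec_nrm_def[symmetric] by simp
qed

lemma op_norm_bdd: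
  assumes a: "a \<in> carrier_mat m d"
  shows "bdd_above ((\<lambda>v. vec_nrm (a *\<^sub>v v)) ` {v \<in> carrier_vec d. (vec_nrm v)\<^sup>2 \<le> 1})"
proof (rule bdd_aboveI2)
  fix v assume "v \<in> {v \<in> carrier_vec d. (vec_nrm v)\<^sup>2 \<le> 1}"
  then have v: "v \<in> carrier_vec d" "vec_nrm v \<le> 1" by (auto simp: power2_le_imp_le abs_square_le_1 abs_le_iff)
  have "vec_nrm (a *\<^sub>v v) \<le> sqrt (\<Sum>i<m. \<Sum>j<d. (cmod (a $$ (i, j)))\<^sup>2) * vec_nrm v" by (rule mult_vec_le_entries[OF a v(1)])
  also have "\<dots> \<le> sqrt (\<Sum>i<m. \<Sum>j<d. (cmod (a $$ (i, j)))\<^sup>2) * 1"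
    using v by (intro mult_left_mono) (auto simp: sum_nonneg)
  finally show "vec_nrm (a *\<^sub>v v) \<le> sqrt (\<Sum>i<m. \<Sum>j<d. (cmod (a $$ (i, j)))\<^sup>2) * 1" .
qed

lemma op_norm_ge:
  assumes a: "a \<in> carrier_mat m d" and v: "v \<in> carrier_vec d"
  shows "vec_nrm (a *\<^sub>v v) \<le> mat_op_norm a * vec_nrm v"
proof (cases "vec_nrm v = 0")
  case True
  then have "v = 0\<^sub>v d" using v by (rule vec_nrm_eq_0)
  then have "a *\<^sub>v v = 0\<^sub>v m" using a by (intro eq_vecI) (auto simp: scalar_prod_def)
  then show ?thesis using True by simp
next
  case False
  let ?w = "of_real (1 / vec_nrm v) \<cdot>\<^sub>v v"
  have w: "?w \<in> carrier_vec d" "vec_nrm ?w = 1" using v False by (simp_all add: vec_nrm_smult norm_divide)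
  have "vec_nrm (a *\<^sub>v ?w) \<le> mat_op_norm a"
    unfolding mat_op_norm_vec_nrm using a w op_norm_bdd[OF a] by (intro cSUP_upper) auto
  moreover have "a *\<^sub>v ?w = of_real (1 / vec_nrm v) \<cdot>\<^sub>v (a *\<^sub>v v)" using a v by (rule mult_mat_vec)
  ultimately have "\<bar>1 / vec_nrm v\<bar> * vec_nrm (a *\<^sub>v v) \<le> mat_op_norm a" by (simp add: vec_nrm_smult del: of_real_divide)
  then show ?thesis using False vec_nrm_nonneg[of v] by (simp add: field_simps)
qed

lemma op_norm_le:
  assumes a: "a \<in> carrier_mat m d" and C: "0 \<le> C"
    and le: "\<And>v. v \<in> carrier_vec d \<Longrightarrow> vec_nrm (a *\<^sub>v v) \<le> C * vec_nrm v"
  shows "mat_op_norm a \<le> C"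
  unfolding mat_op_norm_vec_nrm
proof (rule cSUP_least)
  have "0\<^sub>v (dim_col a) \<in> {v \<in> carrier_vec (dim_col a). (vec_nrm v)\<^sup>2 \<le> 1}" by simp
  then show "{v \<in> carrier_vec (dim_col a). (vec_nrm v)\<^sup>2 \<le> 1} \<noteq> {}" by blast
  fix v assume "v \<in> {v \<in> carrier_vec (dim_col a). (vec_nrm v)\<^sup>2 \<le> 1}"
  then have v: "v \<in> carrier_vec d" "vec_nrm v \<le> 1" using a by (auto simp: power2_le_imp_le abs_square_le_1 abs_le_iff)
  have "vec_nrm (a *\<^sub>v v) \<le> C * vec_nrm v" by (rule le[OF v(1)])
  also have "\<dots> \<le> C" using v C by (simp add: mult_left_le)
  finally show "vec_nrm (a *\<^sub>v v) \<le> C" .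
qed

lemma op_norm_nonneg:
  assumes a: "a \<in> carrier_mat m d" shows "0 \<le> mat_op_norm a"
proof -
  have "vec_nrm (a *\<^sub>v 0\<^sub>v d) \<le> mat_op_norm a"
    unfolding mat_op_norm_vec_nrm using a op_norm_bdd[OF a] by (intro cSUP_upper) auto
  then show ?thesis using vec_nrm_nonneg[of "a *\<^sub>v 0\<^sub>v d"] by linarith
qed

lemma op_norm_le_entries:
  assumes a: "a \<in> carrier_mat m d"
  shows "mat_op_norm a \<le> sqrt (\<Sum>i<m. \<Sum>j<d. (cmod (a $$ (i, j)))\<^sup>2)"
  by (rule op_norm_le[OF a _ mult_vec_le_entries[OF a]]) (auto simp: sum_nonneg)

lemma entry_le_op_norm:
  assumes a: "a \<in> carrier_mat m d" and ij: "i < m" "j < d"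
  shows "cmod (a $$ (i, j)) \<le> mat_op_norm a"
proof -
  have "vec_index (a *\<^sub>v unit_vec d j) i = a $$ (i, j)" using a ij by simp
  then have "cmod (a $$ (i, j)) \<le> vec_nrm (a *\<^sub>v unit_vec d j)"
    using component_le_vec_nrm[of i "a *\<^sub>v unit_vec d j"] a ij by simp
  also have "\<dots> \<le> mat_op_norm a" using op_norm_ge[OF a, of "unit_vec d j"] ij by (simp add: vec_nrm_unit_vec)
  finally show ?thesis .
qed

lemma adjoint_carrier [simp]: "a \<in> carrier_mat m d \<Longrightarrow> mat_adjoint a \<in> carrier_mat d m"
  by (auto simp: mat_adjoint_def)

lemma adjoint_dim [simp]: "dim_row (mat_adjoint a) = dim_col a" "dim_col (mat_adjoint a) = dim_row a"
  by (simp_all add: mat_adjoint_def)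

lemma adjoint_index:
  "a \<in> carrier_mat m d \<Longrightarrow> i < d \<Longrightarrow> j < m \<Longrightarrow> mat_adjoint (a :: complex mat) $$ (i, j) = cnj (a $$ (j, i))"
  by (simp add: mat_adjoint_def mat_of_rows_def conjugate_complex_def)

lemma adjoint_cscalar:
  fixes a :: "complex mat"
  assumes a: "a \<in> carrier_mat m d" and v: "v \<in> carrier_vec d" and w: "w \<in> carrier_vec m"
  shows "(a *\<^sub>v v) \<bullet>c w = v \<bullet>c (mat_adjoint a *\<^sub>v w)"
proof -
  have "(a *\<^sub>v v) \<bullet>c w = (\<Sum>i<m. \<Sum>j<d. a $$ (i, j) * vec_index v j * cnj (vec_index w i))"
    using a v w by (auto simp: cscalar_sum scalar_prod_def atLeast0LessThan sum_distrib_right intro!: sum.cong)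
  also have "\<dots> = (\<Sum>j<d. \<Sum>i<m. a $$ (i, j) * vec_index v j * cnj (vec_index w i))" by (rule sum.swap)
  also have "\<dots> = v \<bullet>c (mat_adjoint a *\<^sub>v w)"
    using a v w adjoint_carrier[OF a]
    by (auto simp: cscalar_sum scalar_prod_def atLeast0LessThan sum_distrib_left adjoint_index[OF a] cnj_sum
        mult.commute mult.left_commute intro!: sum.cong)
  finally show ?thesis .
qed

lemma adjoint_adjoint: "a \<in> carrier_mat m d \<Longrightarrow> mat_adjoint (mat_adjoint a) = (a :: complex mat)"
  by (rule eq_matI) (auto simp: adjoint_index[of _ d m] adjoint_index[of _ m d])

lemma op_norm_mult:
  assumes a: "a \<in> carrier_mat d d" and b: "b \<in> carrier_mat d d"
  shows "mat_op_norm (a * b) \<le> mat_op_norm a * mat_op_norm b"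
proof (rule op_norm_le)
  show "0 \<le> mat_op_norm a * mat_op_norm b" using op_norm_nonneg[OF a] op_norm_nonneg[OF b] by simp
  fix v :: "complex vec" assume v: "v \<in> carrier_vec d"
  have bv: "b *\<^sub>v v \<in> carrier_vec d" using b v by simp
  have "vec_nrm (a * b *\<^sub>v v) = vec_nrm (a *\<^sub>v (b *\<^sub>v v))" using a b v by simp
  also have "\<dots> \<le> mat_op_norm a * vec_nrm (b *\<^sub>v v)" by (rule op_norm_ge[OF a bv])
  also have "\<dots> \<le> mat_op_norm a * (mat_op_norm b * vec_nrm v)"
    using op_norm_nonneg[OF a] by (intro mult_left_mono op_norm_ge[OF b v])
  finally show "vec_nrm (a * b *\<^sub>v v) \<le> mat_op_norm a * mat_op_norm b * vec_nrm v" by (simp add: mult.assoc)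
qed (use a b in auto)

text \<open>For \<open>w = a* v\<close> one has
  \<open>||w||^2 = \<langle>a w, v\<rangle> <= ||a|| ||w|| ||v||\<close>, and a factor
  \<open>||w||\<close> cancels.\<close>

lemma op_norm_adjoint_le:
  assumes a: "a \<in> carrier_mat d d" shows "mat_op_norm (mat_adjoint a) \<le> mat_op_norm a"
proof (rule op_norm_le[OF adjoint_carrier[OF a] op_norm_nonneg[OF a]])
  fix v :: "complex vec" assume v: "v \<in> carrier_vec d"
  let ?w = "mat_adjoint a *\<^sub>v v"
  have w: "?w \<in> carrier_vec d" by (rule mult_mat_vec_carrier[OF adjoint_carrier[OF a] v])
  have aw: "a *\<^sub>v ?w \<in> carrier_vec d" using a w by simp
  have "(of_real ((vec_nrm ?w)\<^sup>2) :: complex) = (a *\<^sub>v ?w) \<bullet>c v"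
    unfolding adjoint_cscalar[OF a w v] by (rule cscalar_self[symmetric])
  then have "(vec_nrm ?w)\<^sup>2 = cmod ((a *\<^sub>v ?w) \<bullet>c v)" by (metis abs_power2 norm_of_real)
  also have "\<dots> \<le> vec_nrm (a *\<^sub>v ?w) * vec_nrm v" by (rule vec_nrm_Cauchy_Schwarz) (simp only: carrier_vecD[OF aw] carrier_vecD[OF v])
  also have "\<dots> \<le> mat_op_norm a * vec_nrm ?w * vec_nrm v" by (intro mult_right_mono op_norm_ge[OF a w]) simp
  finally have "vec_nrm ?w * vec_nrm ?w \<le> (mat_op_norm a * vec_nrm v) * vec_nrm ?w" by (simp add: power2_eq_square mult.commute mult.left_commute)
  then show "vec_nrm ?w \<le> mat_op_norm a * vec_nrm v"
    using op_norm_nonneg[OF a] by (cases "vec_nrm ?w = 0") (auto simp: mult_le_cancel_right less_le)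
qed

text \<open>One direction is submultiplicativity with the previous bound; the other is
  \<open>||a v||^2 = \<langle>v, a* a v\<rangle> <= ||a* a|| ||v||^2\<close>.\<close>

lemma op_norm_cstar:
  assumes a: "a \<in> carrier_mat d d" shows "mat_op_norm (mat_adjoint a * a) = (mat_op_norm a)\<^sup>2"
proof (rule antisym)
  have "mat_op_norm (mat_adjoint a * a) \<le> mat_op_norm (mat_adjoint a) * mat_op_norm a"
    by (rule op_norm_mult[OF adjoint_carrier[OF a] a])
  also have "\<dots> \<le> mat_op_norm a * mat_op_norm a"
    by (intro mult_right_mono op_norm_adjoint_le[OF a] op_norm_nonneg[OF a])
  finally show "mat_op_norm (mat_adjoint a * a) \<le> (mat_op_norm a)\<^sup>2" by (simp add: power2_eq_square)
  have c: "mat_adjoint a * a \<in> carrier_mat d d" by (rule mult_carrier_mat[OF adjoint_carrier[OF a] a])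
  have "mat_op_norm a \<le> sqrt (mat_op_norm (mat_adjoint a * a))"
  proof (rule op_norm_le[OF a])
    fix v :: "complex vec" assume v: "v \<in> carrier_vec d"
    have av: "a *\<^sub>v v \<in> carrier_vec d" using a v by simp
    have "(of_real ((vec_nrm (a *\<^sub>v v))\<^sup>2) :: complex) = v \<bullet>c (mat_adjoint a *\<^sub>v (a *\<^sub>v v))"
      unfolding adjoint_cscalar[OF a v av, symmetric] by (rule cscalar_self[symmetric])
    also have "mat_adjoint a *\<^sub>v (a *\<^sub>v v) = mat_adjoint a * a *\<^sub>v v"
      by (rule assoc_mult_mat_vec[OF adjoint_carrier[OF a] a v, symmetric])
    finally have "(vec_nrm (a *\<^sub>v v))\<^sup>2 = cmod (v \<bullet>c (mat_adjoint a * a *\<^sub>v v))" by (metis abs_power2 norm_of_real)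
    also have "\<dots> \<le> vec_nrm v * vec_nrm (mat_adjoint a * a *\<^sub>v v)" by (rule vec_nrm_Cauchy_Schwarz) (simp only: carrier_vecD[OF v] carrier_vecD[OF mult_mat_vec_carrier[OF c v]])
    also have "\<dots> \<le> vec_nrm v * (mat_op_norm (mat_adjoint a * a) * vec_nrm v)" by (intro mult_left_mono op_norm_ge[OF c v]) simp
    also have "\<dots> = (sqrt (mat_op_norm (mat_adjoint a * a)) * vec_nrm v)\<^sup>2"
      using op_norm_nonneg[OF c] by (simp add: power_mult_distrib) (simp add: power2_eq_square)
    finally show "vec_nrm (a *\<^sub>v v) \<le> sqrt (mat_op_norm (mat_adjoint a * a)) * vec_nrm v"
      by (rule power2_le_imp_le) (simp add: op_norm_nonneg[OF c])
  qed (simp add: op_norm_nonneg[OF c])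
  then have "(mat_op_norm a)\<^sup>2 \<le> (sqrt (mat_op_norm (mat_adjoint a * a)))\<^sup>2"
    by (rule power_mono) (rule op_norm_nonneg[OF a])
  then show "(mat_op_norm a)\<^sup>2 \<le> mat_op_norm (mat_adjoint a * a)" using op_norm_nonneg[OF c] by simp
qed

section \<open>Matrices as a C*-algebra\<close>

abbreviation M :: "nat \<Rightarrow> complex mat cstar_algebra" where "M \<equiv> mat_algebra"

lemma M_sel [simp]:
  "carrier (M d) = carrier_mat d d" "mult (M d) = (*)" "one (M d) = 1\<^sub>m d" "zero (M d) = 0\<^sub>m d d"
  "add (M d) = (+)" "smult (M d) = (\<cdot>\<^sub>m)" "star (M d) = mat_adjoint" "nrm (M d) = mat_op_norm"
  by (simp_all add: mat_algebra_def ring_mat_def)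

lemma M_ring: "ring (M d)" unfolding mat_algebra_def by (rule ring_mat)

lemma M_minus:
  assumes x: "x \<in> carrier_mat d d" and y: "y \<in> carrier_mat d d" shows "x \<ominus>\<^bsub>M d\<^esub> y = x - y"
proof -
  have "\<ominus>\<^bsub>M d\<^esub> y = - y"
    by (rule abelian_group.minus_equality[OF ring.is_abelian_group[OF M_ring]]) (use y in auto)
  then show ?thesis using x y by (simp add: a_minus_def) (rule eq_matI, auto)
qed

lemma M_module: "Module.module (class_ring :: complex ring) (M d)"
  by (rule moduleI) (auto simp: ring.is_abelian_group[OF M_ring] class_cring.cring_axioms
      add_smult_distrib_left_mat add_smult_distrib_right_mat add_smult_distrib_left_mat[of _ d d] smult_smult_assoc
      intro!: eq_matI simp: algebra_simps)

text \<open>Entries are dominated by the operator norm, so they converge; the operator norm of the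
  error is dominated by its Hilbert-Schmidt norm, a finite expression in the entries.\<close>

lemma M_complete:
  assumes s: "\<And>n. s n \<in> carrier_mat d d"
    and C: "\<And>e. e > 0 \<Longrightarrow> \<exists>N. \<forall>m\<ge>N. \<forall>n\<ge>N. mat_op_norm (s m - s n) < e"
  shows "\<exists>l\<in>carrier_mat d d. (\<lambda>n. mat_op_norm (s n - l)) \<longlonglongrightarrow> 0"
proof -
  have conv: "convergent (\<lambda>n. s n $$ (i, j))" if ij: "i < d" "j < d" for i j
  proof -
    have "Cauchy (\<lambda>n. s n $$ (i, j))"
    proof (rule CauchyI)
      fix e :: real assume "e > 0"
      from C[OF this] obtain N where N: "\<And>m n. m \<ge> N \<Longrightarrow> n \<ge> N \<Longrightarrow> mat_op_norm (s m - s n) < e" by blast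
      have "norm (s m $$ (i, j) - s n $$ (i, j)) < e" if "m \<ge> N" "n \<ge> N" for m n
        using entry_le_op_norm[OF minus_carrier_mat[OF s[of n], of "s m"] ij] N[OF that] ij s[of m] s[of n] by simp
      then show "\<exists>N. \<forall>m\<ge>N. \<forall>n\<ge>N. norm (s m $$ (i, j) - s n $$ (i, j)) < e" by blast
    qed
    then show ?thesis by (simp add: Cauchy_convergent)
  qed
  define l where "l = mat d d (\<lambda>(i, j). lim (\<lambda>n. s n $$ (i, j)))"
  have l: "l \<in> carrier_mat d d" by (simp add: l_def)
  have lij: "(\<lambda>n. s n $$ (i, j)) \<longlonglongrightarrow> l $$ (i, j)" if "i < d" "j < d" for i j
    using conv[OF that] that by (simp add: l_def convergent_LIMSEQ_iff)
  have "(\<lambda>n. sqrt (\<Sum>i<d. \<Sum>j<d. (cmod (s n $$ (i, j) - l $$ (i, j)))\<^sup>2)) \<longlonglongrightarrow>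
      sqrt (\<Sum>i<d. \<Sum>j<d. (cmod (l $$ (i, j) - l $$ (i, j)))\<^sup>2)"
    by (intro tendsto_real_sqrt tendsto_sum tendsto_power tendsto_norm tendsto_diff lij tendsto_const) auto
  then have lim: "(\<lambda>n. sqrt (\<Sum>i<d. \<Sum>j<d. (cmod (s n $$ (i, j) - l $$ (i, j)))\<^sup>2)) \<longlonglongrightarrow> 0" by simp
  have "(\<lambda>n. mat_op_norm (s n - l)) \<longlonglongrightarrow> 0"
  proof (rule Lim_null_comparison[OF always_eventually lim], rule allI)
    fix n
    have sl: "s n - l \<in> carrier_mat d d" using l by (rule minus_carrier_mat)
    have "mat_op_norm (s n - l) \<le> sqrt (\<Sum>i<d. \<Sum>j<d. (cmod ((s n - l) $$ (i, j)))\<^sup>2)"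
      by (rule op_norm_le_entries[OF sl])
    also have "\<dots> = sqrt (\<Sum>i<d. \<Sum>j<d. (cmod (s n $$ (i, j) - l $$ (i, j)))\<^sup>2)" using s[of n] l by simp
    finally show "norm (mat_op_norm (s n - l)) \<le> sqrt (\<Sum>i<d. \<Sum>j<d. (cmod (s n $$ (i, j) - l $$ (i, j)))\<^sup>2)"
      using op_norm_nonneg[OF sl] by simp
  qed
  then show ?thesis using l by blast
qed

lemma adjoint_mult:
  assumes a: "a \<in> carrier_mat d d" and b: "b \<in> carrier_mat d d"
  shows "mat_adjoint (a * b) = mat_adjoint b * mat_adjoint (a :: complex mat)"
proof (rule eq_matI)
  have ab: "a * b \<in> carrier_mat d d" using a b by simp
  note c = adjoint_carrier[OF a] adjoint_carrier[OF b] adjoint_carrier[OF ab]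
  show "dim_row (mat_adjoint (a * b)) = dim_row (mat_adjoint b * mat_adjoint a)"
    "dim_col (mat_adjoint (a * b)) = dim_col (mat_adjoint b * mat_adjoint a)" using c by auto
  fix i j assume "i < dim_row (mat_adjoint b * mat_adjoint a)" "j < dim_col (mat_adjoint b * mat_adjoint a)"
  then have ij: "i < d" "j < d" using c by auto
  show "mat_adjoint (a * b) $$ (i, j) = (mat_adjoint b * mat_adjoint a) $$ (i, j)"
    using a b c ij
    by (auto simp: adjoint_index[OF ab] scalar_prod_def adjoint_index[OF a] adjoint_index[OF b] cnj_sum mult.commute intro!: sum.cong)
qed

lemma M_cstar: "unital_cstar_algebra (M d)"
proof -
  have "unital_cstar_algebra_axioms (M d)"
  proof
    fix s :: "nat \<Rightarrow> complex mat"
    assume "\<And>n. s n \<in> carrier (M d)" "\<And>e. e > 0 \<Longrightarrow> \<exists>N. \<forall>m\<ge>N. \<forall>n\<ge>N. nrm (M d) (s m \<ominus>\<^bsub>M d\<^esub> s n) < e"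
    then show "\<exists>l\<in>carrier (M d). (\<lambda>n. nrm (M d) (s n \<ominus>\<^bsub>M d\<^esub> l)) \<longlonglongrightarrow> 0"
      using M_complete[of s d] by (simp add: M_minus cong: bex_cong)
  next
    fix x y and z :: complex assume "x \<in> carrier (M d)" "y \<in> carrier (M d)"
    then have x: "x \<in> carrier_mat d d" and y: "y \<in> carrier_mat d d" by simp_all
    note ax = adjoint_carrier[OF x] and ay = adjoint_carrier[OF y]
    show "(z \<odot>\<^bsub>M d\<^esub> x) \<otimes>\<^bsub>M d\<^esub> y = z \<odot>\<^bsub>M d\<^esub> (x \<otimes>\<^bsub>M d\<^esub> y)" "x \<otimes>\<^bsub>M d\<^esub> (z \<odot>\<^bsub>M d\<^esub> y) = z \<odot>\<^bsub>M d\<^esub> (x \<otimes>\<^bsub>M d\<^esub> y)"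
      using x y by (simp_all add: mult_smult_assoc_mat[of _ d d _ d] mult_smult_distrib[of _ d d _ d])
    have xy: "x + y \<in> carrier_mat d d" using x y by simp
    show "star (M d) (x \<oplus>\<^bsub>M d\<^esub> y) = star (M d) x \<oplus>\<^bsub>M d\<^esub> star (M d) y"
      by (simp, rule eq_matI) (use x y ax ay adjoint_carrier[OF xy] in
        \<open>auto simp: adjoint_index[OF xy] adjoint_index[OF x] adjoint_index[OF y]\<close>)
    show "star (M d) (x \<otimes>\<^bsub>M d\<^esub> y) = star (M d) y \<otimes>\<^bsub>M d\<^esub> star (M d) x"
      using adjoint_mult[OF x y] by simp
    show "nrm (M d) (x \<oplus>\<^bsub>M d\<^esub> y) \<le> nrm (M d) x + nrm (M d) y"
    proof (simp, rule op_norm_le[OF xy])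
      show "0 \<le> mat_op_norm x + mat_op_norm y" using op_norm_nonneg[OF x] op_norm_nonneg[OF y] by simp
      fix v :: "complex vec" assume v: "v \<in> carrier_vec d"
      have "vec_nrm ((x + y) *\<^sub>v v) = vec_nrm (x *\<^sub>v v + y *\<^sub>v v)" using x y v by (simp add: add_mult_distrib_mat_vec)
      also have "\<dots> \<le> vec_nrm (x *\<^sub>v v) + vec_nrm (y *\<^sub>v v)" using x y v by (intro vec_nrm_add[of _ d]) auto
      also have "\<dots> \<le> mat_op_norm x * vec_nrm v + mat_op_norm y * vec_nrm v"
        by (intro add_mono op_norm_ge[OF x v] op_norm_ge[OF y v])
      finally show "vec_nrm ((x + y) *\<^sub>v v) \<le> (mat_op_norm x + mat_op_norm y) * vec_nrm v" by (simp add: distrib_right)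
    qed
    show "nrm (M d) (x \<otimes>\<^bsub>M d\<^esub> y) \<le> nrm (M d) x * nrm (M d) y" using op_norm_mult[OF x y] by simp
  next
    fix x and z :: complex assume "x \<in> carrier (M d)"
    then have x: "x \<in> carrier_mat d d" by simp
    note ax = adjoint_carrier[OF x]
    show "star (M d) x \<in> carrier (M d)" "star (M d) (star (M d) x) = x" using ax adjoint_adjoint[OF x] by simp_all
    have zx: "z \<cdot>\<^sub>m x \<in> carrier_mat d d" using x by simp
    show "star (M d) (z \<odot>\<^bsub>M d\<^esub> x) = cnj z \<odot>\<^bsub>M d\<^esub> star (M d) x"
      by (simp, rule eq_matI) (use x ax adjoint_carrier[OF zx] in \<open>auto simp: adjoint_index[OF zx] adjoint_index[OF x]\<close>)
    show "0 \<le> nrm (M d) x" using op_norm_nonneg[OF x] by simp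
    show "nrm (M d) x = 0 \<longleftrightarrow> x = \<zero>\<^bsub>M d\<^esub>"
    proof
      assume "nrm (M d) x = 0"
      then have "x $$ (i, j) = 0" if "i < d" "j < d" for i j using entry_le_op_norm[OF x that] by simp
      then show "x = \<zero>\<^bsub>M d\<^esub>" using x by (auto intro!: eq_matI)
    next
      assume "x = \<zero>\<^bsub>M d\<^esub>"
      then have "mat_op_norm x \<le> 0" using op_norm_le_entries[OF x] by simp
      then show "nrm (M d) x = 0" using op_norm_nonneg[OF x] by simp
    qed
    have le: "mat_op_norm (z \<cdot>\<^sub>m x) \<le> cmod z * mat_op_norm x" if x: "x \<in> carrier_mat d d" for z x
    proof (rule op_norm_le[of _ d d])
      fix v :: "complex vec" assume v: "v \<in> carrier_vec d"
      have "z \<cdot>\<^sub>m x *\<^sub>v v = z \<cdot>\<^sub>v (x *\<^sub>v v)" using x v by (intro eq_vecI) (auto simp: scalar_prod_def sum_distrib_left mult.assoc)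
      then show "vec_nrm (z \<cdot>\<^sub>m x *\<^sub>v v) \<le> cmod z * mat_op_norm x * vec_nrm v"
        using op_norm_ge[OF x v] by (simp add: vec_nrm_smult mult.assoc mult_left_mono)
    qed (use x op_norm_nonneg[OF x] in auto)
    show "nrm (M d) (z \<odot>\<^bsub>M d\<^esub> x) = cmod z * nrm (M d) x"
    proof (cases "z = 0")
      case True
      then show ?thesis using le[OF x, of 0] op_norm_nonneg[OF zx] by simp
    next
      case False
      \<comment> \<open>The reverse inequality is the one already proved, applied to the scalar
        \<open>1 / z\<close>.\<close>
      have "(1 / z) \<cdot>\<^sub>m (z \<cdot>\<^sub>m x) = x" using x False by (intro eq_matI) auto
      then have "mat_op_norm x \<le> mat_op_norm (z \<cdot>\<^sub>m x) / cmod z" using le[OF zx, of "1 / z"] by (simp add: norm_divide)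
      then show ?thesis using le[OF x, of z] False by (simp add: field_simps)
    qed
    show "nrm (M d) (star (M d) x \<otimes>\<^bsub>M d\<^esub> x) = (nrm (M d) x)\<^sup>2" using op_norm_cstar[OF x] by simp
  qed
  then show ?thesis using M_ring M_module by (simp add: unital_cstar_algebra_def)
qed

section \<open>Hilbert-Schmidt norm, normalised trace and matrix units\<close>

definition frob_sq :: "nat \<Rightarrow> complex mat \<Rightarrow> real" where
  "frob_sq d a = (\<Sum>i<d. \<Sum>j<d. (cmod (a $$ (i, j)))\<^sup>2)"

definition mat_tr :: "nat \<Rightarrow> complex mat \<Rightarrow> complex" where
  "mat_tr d a = (\<Sum>i<d. a $$ (i, i)) / of_nat d"

lemma frob_sq_nonneg [simp]: "0 \<le> frob_sq d a" by (simp add: frob_sq_def sum_nonneg)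

lemma mat_mult_index:
  "a \<in> carrier_mat d d \<Longrightarrow> b \<in> carrier_mat d d \<Longrightarrow> i < d \<Longrightarrow> j < d \<Longrightarrow>
    (a * b) $$ (i, j) = (\<Sum>k<d. a $$ (i, k) * b $$ (k, j))"
  by (auto simp: scalar_prod_def atLeast0LessThan intro!: sum.cong)

lemma mat_tr_add: "a \<in> carrier_mat d d \<Longrightarrow> b \<in> carrier_mat d d \<Longrightarrow> mat_tr d (a + b) = mat_tr d a + mat_tr d b"
  by (simp add: mat_tr_def sum.distrib add_divide_distrib)

lemma mat_tr_smult: "a \<in> carrier_mat d d \<Longrightarrow> mat_tr d (z \<cdot>\<^sub>m a) = z * mat_tr d a"
  by (simp add: mat_tr_def sum_distrib_left)

lemma mat_tr_minus: "a \<in> carrier_mat d d \<Longrightarrow> b \<in> carrier_mat d d \<Longrightarrow> mat_tr d (a - b) = mat_tr d a - mat_tr d b"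
  by (simp add: mat_tr_def sum_subtractf diff_divide_distrib)

lemma mat_tr_one: "d > 0 \<Longrightarrow> mat_tr d (1\<^sub>m d) = 1"
  by (simp add: mat_tr_def)

lemma mat_tr_mult: "a \<in> carrier_mat d d \<Longrightarrow> b \<in> carrier_mat d d \<Longrightarrow>
  mat_tr d (a * b) = (\<Sum>i<d. \<Sum>k<d. a $$ (i, k) * b $$ (k, i)) / of_nat d"
  by (simp add: mat_tr_def mat_mult_index del: index_mult_mat)

lemma mat_tr_comm:
  assumes "a \<in> carrier_mat d d" "b \<in> carrier_mat d d" shows "mat_tr d (a * b) = mat_tr d (b * a)"
  unfolding mat_tr_mult[OF assms] mat_tr_mult[OF assms(2,1)]
  by (subst sum.swap) (simp add: mult.commute)

lemma mat_tr_adjoint_mult: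
  assumes a: "a \<in> carrier_mat d d"
  shows "mat_tr d (mat_adjoint a * a) = of_real (frob_sq d a / real d)"
proof -
  have "(\<Sum>i<d. \<Sum>k<d. mat_adjoint a $$ (i, k) * a $$ (k, i)) = (\<Sum>i<d. \<Sum>k<d. of_real ((cmod (a $$ (k, i)))\<^sup>2))"
    using a by (intro sum.cong refl)
      (simp add: adjoint_index[OF a] complex_norm_square mult.commute del: of_real_power)
  also have "\<dots> = of_real (frob_sq d a)" unfolding frob_sq_def by (subst sum.swap) simp
  finally show ?thesis unfolding mat_tr_mult[OF adjoint_carrier[OF a] a] by simp
qed

lemma mat_tr_le_op_norm:
  assumes a: "a \<in> carrier_mat d d" shows "cmod (mat_tr d a) \<le> mat_op_norm a"
proof (cases "d = 0")
  case False
  have "(\<Sum>i<d. cmod (a $$ (i, i))) \<le> (\<Sum>i<d. mat_op_norm a)"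
    by (rule sum_mono) (rule entry_le_op_norm[OF a], auto)
  then have "cmod (\<Sum>i<d. a $$ (i, i)) \<le> (\<Sum>i<d. mat_op_norm a)"
    by (rule order_trans[OF norm_sum])
  then show ?thesis using False by (simp add: mat_tr_def norm_divide field_simps)
qed (use op_norm_nonneg[OF a] in \<open>simp add: mat_tr_def\<close>)

definition mat_unit :: "nat \<Rightarrow> nat \<Rightarrow> nat \<Rightarrow> complex mat" where
  "mat_unit d i j = mat d d (\<lambda>p. if p = (i, j) then 1 else 0)"

lemma mat_unit_carrier [simp]: "mat_unit d i j \<in> carrier_mat d d" by (simp add: mat_unit_def)

lemma mat_unit_index: "k < d \<Longrightarrow> l < d \<Longrightarrow> mat_unit d i j $$ (k, l) = (if k = i \<and> l = j then 1 else 0)"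
  by (auto simp: mat_unit_def)

lemma mat_unit_mult:
  assumes "k < d" "k' < d"
  shows "mat_unit d i k * mat_unit d k' j = (if k = k' then mat_unit d i j else 0\<^sub>m d d)"
proof (rule eq_matI)
  fix r s assume "r < dim_row (if k = k' then mat_unit d i j else 0\<^sub>m d d)" "s < dim_col (if k = k' then mat_unit d i j else 0\<^sub>m d d)"
  then have rs: "r < d" "s < d" by (auto simp: mat_unit_def split: if_splits)
  have "(mat_unit d i k * mat_unit d k' j) $$ (r, s) = (\<Sum>m<d. if m = k then (if r = i \<and> k = k' \<and> s = j then 1 else 0) else 0)"
    unfolding mat_mult_index[OF mat_unit_carrier mat_unit_carrier rs]
    by (rule sum.cong[OF refl]) (use rs assms in \<open>simp add: mat_unit_index\<close>)
  also have "\<dots> = (if k = k' then mat_unit d i j else 0\<^sub>m d d) $$ (r, s)"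
    using rs assms by (auto simp: mat_unit_index)
  finally show "(mat_unit d i k * mat_unit d k' j) $$ (r, s) = (if k = k' then mat_unit d i j else 0\<^sub>m d d) $$ (r, s)" .
qed (auto simp: mat_unit_def)

lemma mat_unit_adjoint: "mat_adjoint (mat_unit d i j) = mat_unit d j i"
proof (rule eq_matI)
  fix k l assume "k < dim_row (mat_unit d j i)" "l < dim_col (mat_unit d j i)"
  then have "k < d" "l < d" by (auto simp: mat_unit_def)
  then show "mat_adjoint (mat_unit d i j) $$ (k, l) = mat_unit d j i $$ (k, l)"
    by (simp add: adjoint_index[OF mat_unit_carrier] mat_unit_index conj_commute)
qed (auto simp: mat_unit_def mat_adjoint_def)

lemma mat_tr_mat_unit_mult:
  assumes a: "a \<in> carrier_mat d d" and ij: "i < d" "j < d"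
  shows "mat_tr d (mat_unit d i j * a) = a $$ (j, i) / of_nat d"
proof -
  have "(\<Sum>r<d. \<Sum>k<d. mat_unit d i j $$ (r, k) * a $$ (k, r)) = (\<Sum>r<d. \<Sum>k<d. if k = j then (if r = i then a $$ (k, r) else 0) else 0)"
    by (intro sum.cong refl) (auto simp: mat_unit_index)
  also have "\<dots> = a $$ (j, i)" using ij by simp
  finally show ?thesis by (simp add: mat_tr_mult[OF mat_unit_carrier a])
qed

lemma mat_functional_expand:
  fixes f :: "complex mat \<Rightarrow> complex"
  assumes add: "\<And>a b. a \<in> carrier_mat d d \<Longrightarrow> b \<in> carrier_mat d d \<Longrightarrow> f (a + b) = f a + f b"
    and smult: "\<And>z a. a \<in> carrier_mat d d \<Longrightarrow> f (z \<cdot>\<^sub>m a) = z * f a"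
    and a: "a \<in> carrier_mat d d"
  shows "f a = (\<Sum>i<d. \<Sum>j<d. a $$ (i, j) * f (mat_unit d i j))"
proof -
  \<comment> \<open>Keeps the entries with index in S and erases the others; the induction on S
    restores one matrix unit at a time.\<close>
  let ?r = "\<lambda>S. mat d d (\<lambda>p. if p \<in> S then a $$ p else 0)"
  have part: "f (?r S) = (\<Sum>p\<in>S. a $$ p * f (mat_unit d (fst p) (snd p)))" if "finite S" "S \<subseteq> {..<d} \<times> {..<d}" for S
    using that
  proof (induction S)
    case empty
    have "?r {} = 0 \<cdot>\<^sub>m 0\<^sub>m d d" by (rule eq_matI) auto
    then show ?case using smult[of "0\<^sub>m d d" 0] by simp
  next
    case (insert p S)
    have "?r (insert p S) = ?r S + a $$ p \<cdot>\<^sub>m mat_unit d (fst p) (snd p)"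
      using insert by (intro eq_matI) (auto simp: mat_unit_def)
    then show ?case using insert by (simp add: add smult add.commute)
  qed
  have "?r ({..<d} \<times> {..<d}) = a" using a by (intro eq_matI) auto
  then show ?thesis using part[of "{..<d} \<times> {..<d}"] by (simp add: sum.cartesian_product case_prod_unfold)
qed

text \<open>Writing a matrix unit as \<open>e_i0 e_0j\<close> and exchanging the factors kills the
  off-diagonal units and gives all diagonal ones the value at \<open>e_00\<close>. The value at the
  identity then fixes this number as \<open>1 / d\<close>.\<close>

lemma mat_tr_unique:
  fixes f :: "complex mat \<Rightarrow> complex"
  assumes d: "d > 0"
    and add: "\<And>a b. a \<in> carrier_mat d d \<Longrightarrow> b \<in> carrier_mat d d \<Longrightarrow> f (a + b) = f a + f b"
    and smult: "\<And>z a. a \<in> carrier_mat d d \<Longrightarrow> f (z \<cdot>\<^sub>m a) = z * f a"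
    and comm: "\<And>a b. a \<in> carrier_mat d d \<Longrightarrow> b \<in> carrier_mat d d \<Longrightarrow> f (a * b) = f (b * a)"
    and one: "f (1\<^sub>m d) = 1" and a: "a \<in> carrier_mat d d"
  shows "f a = mat_tr d a"
proof -
  define t where "t = f (mat_unit d 0 0)"
  have zero: "f (0\<^sub>m d d) = 0" using smult[of "0\<^sub>m d d" 0] by simp
  have unit: "f (mat_unit d i j) = (if i = j then t else 0)" if "i < d" "j < d" for i j
  proof -
    have "f (mat_unit d i j) = f (mat_unit d i 0 * mat_unit d 0 j)" using d by (simp add: mat_unit_mult)
    also have "\<dots> = f (mat_unit d 0 j * mat_unit d i 0)" by (rule comm) auto
    also have "\<dots> = (if i = j then t else 0)" using that zero by (simp add: mat_unit_mult t_def)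
    finally show ?thesis .
  qed
  have expand: "f b = (\<Sum>i<d. b $$ (i, i)) * t" if b: "b \<in> carrier_mat d d" for b
  proof -
    have "f b = (\<Sum>i<d. \<Sum>j<d. b $$ (i, j) * f (mat_unit d i j))" by (rule mat_functional_expand[OF add smult b])
    also have "\<dots> = (\<Sum>i<d. \<Sum>j<d. if j = i then b $$ (i, i) * t else 0)"
      by (intro sum.cong refl) (auto simp: unit)
    also have "\<dots> = (\<Sum>i<d. b $$ (i, i)) * t" by (simp add: sum_distrib_right)
    finally show ?thesis .
  qed
  have "of_nat d * t = 1" using expand[of "1\<^sub>m d"] one by simp
  then have "t = 1 / of_nat d" using d by (simp add: field_simps)
  then show ?thesis using expand[OF a] by (simp add: mat_tr_def)
qed

section \<open>The block diagonal embeddings\<close>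

abbreviation block_diag :: "nat \<Rightarrow> complex mat \<Rightarrow> complex mat" where "block_diag k a \<equiv> diag_block_mat (replicate k a)"

lemma block_diag_carrier: "a \<in> carrier_mat d d \<Longrightarrow> block_diag k a \<in> carrier_mat (k * d) (k * d)"
  by (rule carrier_matI) (simp_all add: dim_diag_block_mat sum_list_replicate)

lemma block_diag_Suc:
  assumes a: "a \<in> carrier_mat d d"
  shows "block_diag (Suc k) a = four_block_mat a (0\<^sub>m d (k * d)) (0\<^sub>m (k * d) d) (block_diag k a)"
  using a block_diag_carrier[OF a, of k] by (simp add: Let_def)

text \<open>Division by d gives the block, the remainder the position inside it. Linearity,
  adjoints, units and traces are checked through this formula; products and norms go through the
  recursive block form instead.\<close>

lemma block_diag_index:
  assumes a: "a \<in> carrier_mat d d" and "d > 0"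
  shows "i < k * d \<Longrightarrow> j < k * d \<Longrightarrow> block_diag k a $$ (i, j) = (if i div d = j div d then a $$ (i mod d, j mod d) else 0)"
proof (induction k arbitrary: i j)
  case (Suc k)
  have "block_diag (Suc k) a $$ (i, j) = (if i < d then if j < d then a $$ (i, j) else 0
      else if j < d then 0 else block_diag k a $$ (i - d, j - d))"
    unfolding block_diag_Suc[OF a] using a block_diag_carrier[OF a, of k] Suc.prems by auto
  then show ?case
    using Suc.IH[of "i - d" "j - d"] Suc.prems \<open>d > 0\<close> by (auto simp: le_div_geq le_mod_geq not_less)
qed simp

lemma block_diag_eqI:
  assumes a: "a \<in> carrier_mat d d" and "d > 0" and x: "x \<in> carrier_mat (k * d) (k * d)"
    and eq: "\<And>i j. i < k * d \<Longrightarrow> j < k * d \<Longrightarrow> x $$ (i, j) = (if i div d = j div d then a $$ (i mod d, j mod d) else 0)"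
  shows "block_diag k a = x"
  by (rule eq_matI) (use x block_diag_carrier[OF a, of k] eq block_diag_index[OF a \<open>d > 0\<close>, of _ k] in auto)

lemma block_diag_add:
  assumes a: "a \<in> carrier_mat d d" and b: "b \<in> carrier_mat d d" and d: "d > 0"
  shows "block_diag k (a + b) = block_diag k a + block_diag k b"
  by (rule block_diag_eqI[OF _ d]) (use a b d block_diag_carrier[OF a, of k] block_diag_carrier[OF b, of k] in
    \<open>auto simp: block_diag_index[OF a d] block_diag_index[OF b d]\<close>)

lemma block_diag_smult:
  assumes a: "a \<in> carrier_mat d d" and d: "d > 0" shows "block_diag k (z \<cdot>\<^sub>m a) = z \<cdot>\<^sub>m block_diag k a"
  by (rule block_diag_eqI[OF _ d]) (use a d block_diag_carrier[OF a, of k] in \<open>auto simp: block_diag_index[OF a d]\<close>)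

lemma block_diag_adjoint:
  assumes a: "a \<in> carrier_mat d d" and d: "d > 0" shows "block_diag k (mat_adjoint a) = mat_adjoint (block_diag k a)"
  by (rule block_diag_eqI[OF adjoint_carrier[OF a] d adjoint_carrier[OF block_diag_carrier[OF a]]])
    (use d in \<open>auto simp: adjoint_index[OF block_diag_carrier[OF a]] adjoint_index[OF a] block_diag_index[OF a d]\<close>)

lemma block_diag_one:
  assumes d: "d > 0" shows "block_diag k (1\<^sub>m d) = 1\<^sub>m (k * d)"
proof (rule block_diag_eqI[OF one_carrier_mat d one_carrier_mat])
  fix i j assume "i < k * d" "j < k * d"
  moreover have "i = j \<longleftrightarrow> i div d = j div d \<and> i mod d = j mod d" by (metis div_mult_mod_eq)
  ultimately show "1\<^sub>m (k * d) $$ (i, j) = (if i div d = j div d then 1\<^sub>m d $$ (i mod d, j mod d) else (0::complex))"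
    using d by auto
qed

lemma block_diag_mult:
  assumes a: "a \<in> carrier_mat d d" and b: "b \<in> carrier_mat d d"
  shows "block_diag k (a * b) = block_diag k a * block_diag k b"
proof (induction k)
  case 0
  show ?case by (rule eq_matI) auto
next
  case (Suc k)
  have ab: "a * b \<in> carrier_mat d d" using a b by simp
  note c = block_diag_carrier[OF a, of k] block_diag_carrier[OF b, of k]
  show ?case unfolding block_diag_Suc[OF ab] block_diag_Suc[OF a] block_diag_Suc[OF b] Suc
    by (subst mult_four_block_mat[OF a _ _ c(1) b _ _ c(2)])
      (use a b c ab mult_carrier_mat[OF c] in \<open>auto simp: right_add_zero_mat left_add_zero_mat\<close>)
qed

lemma sum_lessThan_add: "(\<Sum>i<m + n. f i) = (\<Sum>i<m. f i) + (\<Sum>i<n. f (m + i :: nat))"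
  for f :: "nat \<Rightarrow> 'a :: comm_monoid_add"
  by (induction n) (auto simp: add.assoc)

lemma vec_nrm_append: "(vec_nrm (v @\<^sub>v w))\<^sup>2 = (vec_nrm v)\<^sup>2 + (vec_nrm w)\<^sup>2"
  unfolding vec_nrm_power2 by (simp add: sum_lessThan_add)

lemma block_diag_vec:
  assumes a: "a \<in> carrier_mat d d" and v: "v \<in> carrier_vec d" and w: "w \<in> carrier_vec (k * d)"
  shows "block_diag (Suc k) a *\<^sub>v (v @\<^sub>v w) = (a *\<^sub>v v) @\<^sub>v (block_diag k a *\<^sub>v w)"
proof -
  have z: "0\<^sub>m m n *\<^sub>v u = 0\<^sub>v m" if "u \<in> carrier_vec n" for m n and u :: "complex vec"
    using that by (intro eq_vecI) auto
  have "block_diag k a *\<^sub>v w \<in> carrier_vec (k * d)" by (rule mult_mat_vec_carrier[OF block_diag_carrier[OF a] w])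
  moreover have "a *\<^sub>v v \<in> carrier_vec d" by (rule mult_mat_vec_carrier[OF a v])
  ultimately show ?thesis unfolding block_diag_Suc[OF a]
    by (subst four_block_mat_mult_vec[OF a zero_carrier_mat zero_carrier_mat block_diag_carrier[OF a] v w])
      (simp add: z[OF v] z[OF w])
qed

text \<open>Blocks act on separate parts of the vector and squared norms add up, so splitting off
  the first block gives an induction.\<close>

lemma block_diag_vec_le:
  assumes a: "a \<in> carrier_mat d d"
  shows "u \<in> carrier_vec (k * d) \<Longrightarrow> vec_nrm (block_diag k a *\<^sub>v u) \<le> mat_op_norm a * vec_nrm u"
proof (induction k arbitrary: u)
  case 0
  then have "block_diag 0 a *\<^sub>v u = 0\<^sub>v 0" by (intro eq_vecI) auto
  moreover have "vec_nrm (0\<^sub>v 0 :: complex vec) = 0" by (simp add: vec_nrm_def)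
  moreover have "0 \<le> mat_op_norm a * vec_nrm u" using op_norm_nonneg[OF a] by simp
  ultimately show ?case by simp
next
  case (Suc k)
  let ?v = "vec_first u d" and ?w = "vec_last u (k * d)"
  have u: "u = ?v @\<^sub>v ?w" using Suc.prems vec_first_last_append[of u d "k * d"] by simp
  have vw: "?v \<in> carrier_vec d" "?w \<in> carrier_vec (k * d)" by auto
  have "(vec_nrm (block_diag (Suc k) a *\<^sub>v (?v @\<^sub>v ?w)))\<^sup>2 = (vec_nrm (a *\<^sub>v ?v))\<^sup>2 + (vec_nrm (block_diag k a *\<^sub>v ?w))\<^sup>2"
    unfolding block_diag_vec[OF a vw] vec_nrm_append ..
  also have "\<dots> \<le> (mat_op_norm a * vec_nrm ?v)\<^sup>2 + (mat_op_norm a * vec_nrm ?w)\<^sup>2"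
    by (intro add_mono power_mono op_norm_ge[OF a vw(1)] Suc.IH vw) auto
  also have "\<dots> = (mat_op_norm a * vec_nrm (?v @\<^sub>v ?w))\<^sup>2"
    by (simp add: power_mult_distrib vec_nrm_append distrib_left)
  finally have "(vec_nrm (block_diag (Suc k) a *\<^sub>v u))\<^sup>2 \<le> (mat_op_norm a * vec_nrm u)\<^sup>2" unfolding u[symmetric] .
  then show ?case by (rule power2_le_imp_le) (simp add: op_norm_nonneg[OF a])
qed

text \<open>\<open>Suc k\<close> copies guarantee at least one block; a vector padded with zeros
  sees that block alone, which gives the lower bound.\<close>

lemma block_diag_op_norm:
  assumes a: "a \<in> carrier_mat d d" shows "mat_op_norm (block_diag (Suc k) a) = mat_op_norm a"
proof (rule antisym)
  show "mat_op_norm (block_diag (Suc k) a) \<le> mat_op_norm a"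
    by (rule op_norm_le[OF block_diag_carrier[OF a] op_norm_nonneg[OF a] block_diag_vec_le[OF a]])
  show "mat_op_norm a \<le> mat_op_norm (block_diag (Suc k) a)"
  proof (rule op_norm_le[OF a op_norm_nonneg[OF block_diag_carrier[OF a]]])
    fix v :: "complex vec" assume v: "v \<in> carrier_vec d"
    let ?u = "v @\<^sub>v 0\<^sub>v (k * d)"
    have u: "?u \<in> carrier_vec (Suc k * d)" using v by simp
    have "(vec_nrm ?u)\<^sup>2 = (vec_nrm v)\<^sup>2" by (simp add: vec_nrm_append)
    then have vu: "vec_nrm ?u = vec_nrm v" by (simp add: power2_eq_iff_nonneg)
    have "(vec_nrm (a *\<^sub>v v))\<^sup>2 \<le> (vec_nrm (block_diag (Suc k) a *\<^sub>v ?u))\<^sup>2"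
      unfolding block_diag_vec[OF a v zero_carrier_vec] vec_nrm_append by simp
    then have "vec_nrm (a *\<^sub>v v) \<le> vec_nrm (block_diag (Suc k) a *\<^sub>v ?u)" by (rule power2_le_imp_le) simp
    also have "\<dots> \<le> mat_op_norm (block_diag (Suc k) a) * vec_nrm v"
      using op_norm_ge[OF block_diag_carrier[OF a] u] unfolding vu .
    finally show "vec_nrm (a *\<^sub>v v) \<le> mat_op_norm (block_diag (Suc k) a) * vec_nrm v" .
  qed
qed

text \<open>The k equal blocks multiply the sum of the diagonal by k, which the normalisation by
  \<open>k * d\<close> cancels. This makes the matrix traces compatible along the inductive
  system.\<close>

lemma block_diag_mat_tr:
  assumes a: "a \<in> carrier_mat d d" and d: "d > 0" and k: "k > 0" shows "mat_tr (k * d) (block_diag k a) = mat_tr d a"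
proof -
  have "(\<Sum>i<n * d. block_diag k a $$ (i, i)) = of_nat n * (\<Sum>i<d. a $$ (i, i))" if "n \<le> k" for n
    using that
  proof (induction n)
    case (Suc n)
    have lt: "n * d + i < k * d" if "i < d" for i
    proof -
      have "n * d + i < Suc n * d" using that by simp
      also have "\<dots> \<le> k * d" using Suc.prems by (rule mult_le_mono1)
      finally show ?thesis .
    qed
    have "(\<Sum>i<Suc n * d. block_diag k a $$ (i, i)) = (\<Sum>i<n * d + d. block_diag k a $$ (i, i))" by (simp add: add.commute)
    also have "\<dots> = of_nat n * (\<Sum>i<d. a $$ (i, i)) + (\<Sum>i<d. block_diag k a $$ (n * d + i, n * d + i))"
      using Suc by (simp add: sum_lessThan_add)
    also have "(\<Sum>i<d. block_diag k a $$ (n * d + i, n * d + i)) = (\<Sum>i<d. a $$ (i, i))"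
      using lt by (intro sum.cong refl) (simp add: block_diag_index[OF a d])
    finally show ?case by (simp add: distrib_right)
  qed simp
  from this[of k] show ?thesis using k by (simp add: mat_tr_def)
qed

section \<open>Operator norm against Hilbert-Schmidt norm, and nets of norm balls\<close>

lemma op_norm_le_frob_sq: "a \<in> carrier_mat d d \<Longrightarrow> mat_op_norm a \<le> sqrt (frob_sq d a)"
  unfolding frob_sq_def by (rule op_norm_le_entries)

text \<open>A vector w placed in the first column of an otherwise zero matrix v has the
  Hilbert-Schmidt norm of w, and \<open>x v\<close> carries \<open>x w\<close> in the same way. So
  left multiplication on matrices detects the operator norm, as the axiom \<open>nrm_leI_F\<close>
  demands.\<close>

lemma op_norm_leI_frob_sq:
  assumes x: "x \<in> carrier_mat d d" and d: "d > 0" and r: "0 \<le> r"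
    and le: "\<And>v. v \<in> carrier_mat d d \<Longrightarrow> sqrt (frob_sq d (x * v)) \<le> r * sqrt (frob_sq d v)"
  shows "mat_op_norm x \<le> r"
proof (rule op_norm_le[OF x r])
  fix w :: "complex vec" assume w: "w \<in> carrier_vec d"
  define v where "v = mat d d (\<lambda>(i, j). if j = 0 then vec_index w i else 0)"
  have v: "v \<in> carrier_mat d d" by (simp add: v_def)
  have col: "frob_sq d y = (vec_nrm u)\<^sup>2" if "u \<in> carrier_vec d"
    "\<And>i j. i < d \<Longrightarrow> j < d \<Longrightarrow> y $$ (i, j) = (if j = 0 then vec_index u i else 0)" for y u
  proof -
    have "frob_sq d y = (\<Sum>i<d. \<Sum>j<d. if j = 0 then (cmod (vec_index u i))\<^sup>2 else 0)"
      unfolding frob_sq_def using that(2) by (intro sum.cong refl) auto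
    then show ?thesis using d that(1) by (simp add: vec_nrm_power2)
  qed
  have "frob_sq d v = (vec_nrm w)\<^sup>2" by (rule col[OF w]) (simp add: v_def)
  moreover have "frob_sq d (x * v) = (vec_nrm (x *\<^sub>v w))\<^sup>2"
  proof (rule col)
    show "x *\<^sub>v w \<in> carrier_vec d" by (rule mult_mat_vec_carrier[OF x w])
    fix i j assume ij: "i < d" "j < d"
    have "vec_index (x *\<^sub>v w) i = (\<Sum>k<d. x $$ (i, k) * vec_index w k)"
      using x w ij by (auto simp: scalar_prod_def atLeast0LessThan intro!: sum.cong)
    then show "(x * v) $$ (i, j) = (if j = 0 then vec_index (x *\<^sub>v w) i else 0)"
      using ij by (simp add: mat_mult_index[OF x v] del: index_mult_mat index_mult_mat_vec) (simp add: v_def)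
  qed
  ultimately show "vec_nrm (x *\<^sub>v w) \<le> r * vec_nrm w" using le[OF v] by simp
qed

text \<open>The entries of a matrix in the ball lie in a compact disc, and a finite net of the disc,
  chosen entry by entry, yields finitely many matrices.\<close>

lemma op_norm_ball_net:
  assumes e: "e > 0"
  shows "\<exists>S. finite S \<and> S \<subseteq> carrier_mat d d \<and>
    (\<forall>a\<in>carrier_mat d d. mat_op_norm a \<le> r \<longrightarrow> (\<exists>s\<in>S. mat_op_norm (a - s) < e))"
proof -
  \<comment> \<open>An error \<delta> in each entry amounts to at most \<open>d * \<delta>\<close>
    in Hilbert-Schmidt norm, which has to stay below e; the \<open>+ 1\<close> makes this strict and
    covers \<open>d = 0\<close>.\<close>
  define \<delta> where "\<delta> = e / (real d + 1)"
  have \<delta>: "\<delta> > 0" using e by (simp add: \<delta>_def)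
  obtain K where K: "finite K" "cball (0::complex) r \<subseteq> (\<Union>x\<in>K. ball x \<delta>)"
    using seq_compact_imp_totally_bounded[of "cball (0::complex) r"] \<delta>
      compact_imp_seq_compact[OF compact_cball] by meson
  define S where "S = (\<lambda>f. mat d d f) ` (PiE ({..<d} \<times> {..<d}) (\<lambda>_. K))"
  have "\<exists>s\<in>S. mat_op_norm (a - s) < e" if a: "a \<in> carrier_mat d d" and le: "mat_op_norm a \<le> r" for a
  proof -
    have "\<exists>x\<in>K. cmod (a $$ p - x) < \<delta>" if "p \<in> {..<d} \<times> {..<d}" for p
    proof -
      have "cmod (a $$ (fst p, snd p)) \<le> r"
        using that by (intro order_trans[OF entry_le_op_norm[OF a] le]) auto
      then have "a $$ p \<in> cball 0 r" by simp
      then have "a $$ p \<in> (\<Union>x\<in>K. ball x \<delta>)" using K(2) by blast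
      then obtain x where "x \<in> K" "dist x (a $$ p) < \<delta>" by auto
      then show ?thesis by (intro bexI[of _ x]) (simp_all add: dist_norm norm_minus_commute)
    qed
    then obtain f where f: "\<And>p. p \<in> {..<d} \<times> {..<d} \<Longrightarrow> f p \<in> K \<and> cmod (a $$ p - f p) < \<delta>" by metis
    define s where "s = mat d d f"
    have sc: "s \<in> carrier_mat d d" by (simp add: s_def)
    \<comment> \<open>The finite set consists of extensional functions, so f is cut down to the
      index square; the matrix reads only those values.\<close>
    have "s = mat d d (restrict f ({..<d} \<times> {..<d}))" unfolding s_def by (rule eq_matI) auto
    moreover have "restrict f ({..<d} \<times> {..<d}) \<in> PiE ({..<d} \<times> {..<d}) (\<lambda>_. K)" using f by auto
    ultimately have sS: "s \<in> S" unfolding S_def by blast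
    have "mat_op_norm (a - s) \<le> sqrt (\<Sum>i<d. \<Sum>j<d. (cmod ((a - s) $$ (i, j)))\<^sup>2)"
      by (rule op_norm_le_entries[OF minus_carrier_mat[OF sc]])
    also have "\<dots> \<le> sqrt (\<Sum>i<d. \<Sum>j<d. \<delta>\<^sup>2)"
    proof (intro real_sqrt_le_mono sum_mono power_mono)
      fix i j assume "i \<in> {..<d}" "j \<in> {..<d}"
      then show "cmod ((a - s) $$ (i, j)) \<le> \<delta>" using f[of "(i, j)"] a by (simp add: s_def)
    qed simp
    also have "\<dots> = sqrt ((real d * \<delta>)\<^sup>2)" by (simp add: power_mult_distrib power2_eq_square mult.assoc)
    also have "\<dots> = real d * \<delta>" using \<delta> by simp
    also have "\<dots> < e" using e by (simp add: \<delta>_def field_simps)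
    finally show ?thesis using sS by blast
  qed
  moreover have "finite S" unfolding S_def using K(1) by (intro finite_imageI finite_PiE) auto
  moreover have "S \<subseteq> carrier_mat d d" by (auto simp: S_def)
  ultimately show ?thesis by blast
qed

section \<open>UHF algebras\<close>

lemma uhf_dim_0: "uhf_dim \<beta> 0 = 1" by (simp add: uhf_dim_def)

lemma uhf_dim_Suc: "uhf_dim \<beta> (Suc n) = Suc (\<beta> n) * uhf_dim \<beta> n" by (simp add: uhf_dim_def)

lemma uhf_dim_pos: "uhf_dim \<beta> n > 0" by (simp add: uhf_dim_def prod_pos)

lemma uhf_mu_block_diag: "uhf_mu \<beta> n a = block_diag (Suc (\<beta> n)) a" by (simp only: uhf_mu_def Suc_eq_plus1)

lemma frob_sq_mat_unit: "i < d \<Longrightarrow> j < d \<Longrightarrow> frob_sq d (mat_unit d i j) = 1"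
proof -
  assume ij: "i < d" "j < d"
  have "frob_sq d (mat_unit d i j) = (\<Sum>k<d. \<Sum>l<d. if l = j then (if k = i then 1 else 0) else 0)"
    unfolding frob_sq_def by (intro sum.cong refl) (auto simp: mat_unit_index)
  then show ?thesis using ij by simp
qed

text \<open>Points of Baire space have no zero entries, so each factor \<open>\<beta> n + 1\<close>
  is at least 2 and the matrix size at least doubles. Squaring the size gives the ratio 1/4, hence
  summability and the rate in the final estimate.\<close>

lemma uhf_gamma_le:
  assumes "\<beta> \<in> baire_space" shows "uhf_gamma \<beta> n \<le> (1 / 4) ^ n"
proof -
  have "(2::real) ^ n \<le> real (uhf_dim \<beta> n)"
  proof (induction n)
    case (Suc n)
    have "\<beta> n \<noteq> 0" using assms by (simp add: baire_space_def)
    then have "(2::real) \<le> real (Suc (\<beta> n))" by simp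
    from mult_mono[OF this Suc] show ?case unfolding uhf_dim_Suc by (simp add: distrib_right)
  qed (simp add: uhf_dim_0)
  then have "((2::real) ^ n)\<^sup>2 \<le> (real (uhf_dim \<beta> n))\<^sup>2" by (rule power_mono) simp
  also have "((2::real) ^ n)\<^sup>2 = (2\<^sup>2) ^ n" by (simp only: power_mult[symmetric] mult.commute[of n])
  finally show ?thesis using uhf_dim_pos[of \<beta> n]
    by (simp add: uhf_gamma_def power_one_over frac_le del: power_mult_distrib)
qed

locale uhf_system = fixes \<beta> :: "nat \<Rightarrow> nat" assumes beta: "\<beta> \<in> baire_space"
begin

abbreviation d where "d \<equiv> uhf_dim \<beta>"

lemmas d_pos [simp] = uhf_dim_pos[of \<beta>]

sublocale cstar_sequence "\<lambda>n. mat_algebra (d n)" "uhf_mu \<beta>"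
proof (rule cstar_sequence.intro)
  fix n :: nat and a b :: "complex mat" and z :: complex
  show "unital_cstar_algebra (M (d n))" by (rule M_cstar)
  show "uhf_mu \<beta> n \<one>\<^bsub>M (d n)\<^esub> = \<one>\<^bsub>M (d (Suc n))\<^esub>"
    unfolding M_sel uhf_mu_block_diag uhf_dim_Suc by (rule block_diag_one) simp
  assume "a \<in> carrier (M (d n))"
  then have a: "a \<in> carrier_mat (d n) (d n)" by simp
  show "uhf_mu \<beta> n a \<in> carrier (M (d (Suc n)))"
    unfolding M_sel uhf_mu_block_diag uhf_dim_Suc by (rule block_diag_carrier[OF a])
  show "uhf_mu \<beta> n (z \<odot>\<^bsub>M (d n)\<^esub> a) = z \<odot>\<^bsub>M (d (Suc n))\<^esub> uhf_mu \<beta> n a"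
    unfolding M_sel uhf_mu_block_diag by (rule block_diag_smult[OF a]) simp
  show "uhf_mu \<beta> n (star (M (d n)) a) = star (M (d (Suc n))) (uhf_mu \<beta> n a)"
    unfolding M_sel uhf_mu_block_diag by (rule block_diag_adjoint[OF a]) simp
  show "nrm (M (d (Suc n))) (uhf_mu \<beta> n a) = nrm (M (d n)) a"
    unfolding M_sel uhf_mu_block_diag by (rule block_diag_op_norm[OF a])
  assume "b \<in> carrier (M (d n))"
  then have b: "b \<in> carrier_mat (d n) (d n)" by simp
  show "uhf_mu \<beta> n (a \<oplus>\<^bsub>M (d n)\<^esub> b) = uhf_mu \<beta> n a \<oplus>\<^bsub>M (d (Suc n))\<^esub> uhf_mu \<beta> n b"
    unfolding M_sel uhf_mu_block_diag by (rule block_diag_add[OF a b]) simp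
  show "uhf_mu \<beta> n (a \<otimes>\<^bsub>M (d n)\<^esub> b) = uhf_mu \<beta> n a \<otimes>\<^bsub>M (d (Suc n))\<^esub> uhf_mu \<beta> n b"
    unfolding M_sel uhf_mu_block_diag by (rule block_diag_mult[OF a b])
qed

sublocale R: unital_cstar_algebra R by (rule R_cstar)

section \<open>The trace as a limit of matrix traces\<close>

lemma L_mat: "x \<in> L \<Longrightarrow> x n \<in> carrier_mat (d n) (d n)" using L_carrier[of x n] by simp

lemma con_mat: "a \<in> carrier_mat (d m) (d m) \<Longrightarrow> con m k a \<in> carrier_mat (d (m + k)) (d (m + k))"
  using con_closed[of a m k] by simp

lemma mat_tr_con:
  assumes a: "a \<in> carrier_mat (d m) (d m)" shows "mat_tr (d (m + k)) (con m k a) = mat_tr (d m) a"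
proof (induction k)
  case (Suc k)
  have "mat_tr (d (m + Suc k)) (con m (Suc k) a) = mat_tr (d (m + k)) (con m k a)"
    unfolding connecting.simps(2) uhf_mu_block_diag[of \<beta> "m + k"] add_Suc_right uhf_dim_Suc by (rule block_diag_mat_tr[OF con_mat[OF a]]) simp_all
  then show ?case using Suc by simp
qed simp

lemma mat_tr_convergent:
  assumes x: "x \<in> L" shows "convergent (\<lambda>n. mat_tr (d n) (x n))"
proof -
  note [simp] = L_mat[OF x]
  have "Cauchy (\<lambda>n. mat_tr (d n) (x n))"
  proof (rule metric_CauchyI)
    fix e :: real assume "e > 0"
    then have "e / 2 > 0" by simp
    from L_Cauchy[OF x this] obtain N where
      N: "\<And>n k. n \<ge> N \<Longrightarrow> nrm (M (d (n + k))) (x (n + k) \<ominus>\<^bsub>M (d (n + k))\<^esub> con n k (x n)) < e / 2" by blast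
    have close: "dist (mat_tr (d n) (x n)) (mat_tr (d N) (x N)) < e / 2" if "n \<ge> N" for n
    proof -
      from that obtain k where n: "n = N + k" by (blast dest: le_Suc_ex)
      have c: "con N k (x N) \<in> carrier_mat (d n) (d n)" unfolding n by (rule con_mat) simp
      have "mat_tr (d n) (x n) - mat_tr (d N) (x N) = mat_tr (d n) (x n - con N k (x N))"
        using mat_tr_con[of "x N" N k] c unfolding n by (simp add: mat_tr_minus)
      also have "cmod \<dots> \<le> mat_op_norm (x n - con N k (x N))"
        by (rule mat_tr_le_op_norm[OF minus_carrier_mat[OF c]])
      also have "\<dots> < e / 2" using N[of N k] c by (simp add: M_minus n)
      finally show ?thesis by (simp add: dist_norm)
    qed
    have "dist (mat_tr (d m) (x m)) (mat_tr (d n) (x n)) < e" if "m \<ge> N" "n \<ge> N" for m n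
      using close[OF that(1)] close[OF that(2)] by (rule dist_triangle_half_l)
    then show "\<exists>N. \<forall>m\<ge>N. \<forall>n\<ge>N. dist (mat_tr (d m) (x m)) (mat_tr (d n) (x n)) < e" by blast
  qed
  then show ?thesis by (rule Cauchy_convergent)
qed

text \<open>The limit does not depend on the representative chosen by \<open>SOME\<close>, see \<open>tr_cls\<close>.\<close>

definition tr where "tr = restrict (\<lambda>X. lim (\<lambda>n. mat_tr (d n) ((SOME x. x \<in> X) n))) (carrier R)"

lemma tr_cls:
  assumes x: "x \<in> L" shows "(\<lambda>n. mat_tr (d n) (x n)) \<longlonglongrightarrow> tr (cls x)"
proof -
  define y where "y = (SOME y. y \<in> cls x)"
  have "y \<in> cls x" unfolding y_def by (rule someI[of _ x]) (rule self_in_cls[OF x])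
  then have y: "y \<in> L" and xy: "(\<lambda>n. nrm (M (d n)) (x n \<ominus>\<^bsub>M (d n)\<^esub> y n)) \<longlonglongrightarrow> 0"
    by (auto simp: in_cls)
  note [simp] = L_mat[OF x] L_mat[OF y]
  have "(\<lambda>n. mat_tr (d n) (x n - y n)) \<longlonglongrightarrow> 0"
  proof (rule Lim_null_comparison)
    show "(\<lambda>n. mat_op_norm (x n - y n)) \<longlonglongrightarrow> 0" using xy by (simp add: M_minus)
    show "\<forall>\<^sub>F n in sequentially. norm (mat_tr (d n) (x n - y n)) \<le> mat_op_norm (x n - y n)"
      by (rule always_eventually) (auto intro!: mat_tr_le_op_norm[OF minus_carrier_mat])
  qed
  moreover have "(\<lambda>n. mat_tr (d n) (y n)) \<longlonglongrightarrow> tr (cls x)"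
    using mat_tr_convergent[OF y] x by (simp add: tr_def y_def convergent_LIMSEQ_iff)
  ultimately have "(\<lambda>n. mat_tr (d n) (x n - y n) + mat_tr (d n) (y n)) \<longlonglongrightarrow> 0 + tr (cls x)" by (rule tendsto_add)
  then show ?thesis by (simp add: mat_tr_minus)
qed

lemma tr_eqI: "x \<in> L \<Longrightarrow> (\<lambda>n. mat_tr (d n) (x n)) \<longlonglongrightarrow> z \<Longrightarrow> tr (cls x) = z"
  using tr_cls LIMSEQ_unique by blast

lemma phi_in [simp]: "a \<in> carrier_mat (d n) (d n) \<Longrightarrow> phi n a \<in> carrier R"
  by (rule phi_carrier) simp

lemma tr_phi:
  assumes a: "a \<in> carrier_mat (d n) (d n)" shows "tr (phi n a) = mat_tr (d n) a"
proof -
  have "(\<lambda>k. mat_tr (d (k + n)) (coh n a (k + n))) \<longlonglongrightarrow> mat_tr (d n) a"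
    using mat_tr_con[OF a] by (simp add: coh_ge add.commute[of _ n])
  then have "(\<lambda>k. mat_tr (d k) (coh n a k)) \<longlonglongrightarrow> mat_tr (d n) a" by (rule LIMSEQ_offset)
  then show ?thesis unfolding phi_eq using a by (intro tr_eqI coh_L) auto
qed

lemma tr_add:
  assumes "X \<in> carrier R" "Y \<in> carrier R" shows "tr (X \<oplus>\<^bsub>R\<^esub> Y) = tr X + tr Y"
proof -
  obtain x y where x: "x \<in> L" "X = cls x" and y: "y \<in> L" "Y = cls y" using assms by (elim R_cases)
  show ?thesis unfolding x y R_add[OF x(1) y(1)]
    by (rule tr_eqI[OF L_add[OF x(1) y(1)]])
      (use tendsto_add[OF tr_cls[OF x(1)] tr_cls[OF y(1)]] L_mat[OF x(1)] L_mat[OF y(1)] in \<open>simp add: mat_tr_add\<close>)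
qed

lemma tr_smult:
  assumes "X \<in> carrier R" shows "tr (z \<odot>\<^bsub>R\<^esub> X) = z * tr X"
proof -
  obtain x where x: "x \<in> L" "X = cls x" using assms by (elim R_cases)
  show ?thesis unfolding x R_smult[OF x(1)]
    by (rule tr_eqI[OF L_smult[OF x(1)]])
      (use tendsto_mult_left[OF tr_cls[OF x(1)], of z] L_mat[OF x(1)] in \<open>simp add: mat_tr_smult\<close>)
qed

lemma tr_comm:
  assumes "X \<in> carrier R" "Y \<in> carrier R" shows "tr (X \<otimes>\<^bsub>R\<^esub> Y) = tr (Y \<otimes>\<^bsub>R\<^esub> X)"
proof -
  obtain x y where x: "x \<in> L" "X = cls x" and y: "y \<in> L" "Y = cls y" using assms by (elim R_cases)
  show ?thesis unfolding x y R_mult[OF x(1) y(1)] R_mult[OF y(1) x(1)]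
    by (rule tr_eqI[OF L_mult[OF x(1) y(1)]])
      (use tr_cls[OF L_mult[OF y(1) x(1)]] mat_tr_comm[OF L_mat[OF x(1)] L_mat[OF y(1)]] in simp)
qed

lemma tr_pos:
  assumes "X \<in> carrier R" shows "tr (star R X \<otimes>\<^bsub>R\<^esub> X) \<in> \<real>\<^sub>\<ge>\<^sub>0"
proof -
  obtain x where x: "x \<in> L" "X = cls x" using assms by (elim R_cases)
  have "(\<lambda>n. mat_tr (d n) (mat_adjoint (x n) * x n)) \<longlonglongrightarrow> tr (star R X \<otimes>\<^bsub>R\<^esub> X)"
    using tr_cls[OF L_mult[OF L_star[OF x(1)] x(1)]]
    unfolding x R_star[OF x(1)] R_mult[OF L_star[OF x(1)] x(1)] by simp
  moreover have "mat_tr (d n) (mat_adjoint (x n) * x n) \<in> \<real>\<^sub>\<ge>\<^sub>0" for n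
    by (simp only: mat_tr_adjoint_mult[OF L_mat[OF x(1)]]) simp
  ultimately show ?thesis
    by (intro Lim_in_closed_set[OF closed_nonneg_Reals_complex always_eventually sequentially_bot]) auto
qed

lemma tr_state: "tr \<in> states R"
proof -
  have "tr \<one>\<^bsub>R\<^esub> = 1" using tr_phi[of "1\<^sub>m (d 0)" 0] phi_one[of 0] by (simp add: mat_tr_one)
  then show ?thesis
    by (simp add: states_def tr_add tr_smult tr_pos) (simp add: tr_def)
qed

text \<open>The coefficients are those of the expansion in the orthogonal basis of matrix units, whose
  squared trace norm is \<open>1 / d n\<close>.\<close>

definition Ex where "Ex n X = phi n (mat (d n) (d n) (\<lambda>(i, j). of_nat (d n) * tr (star R (phi n (mat_unit (d n) i j)) \<otimes>\<^bsub>R\<^esub> X)))"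

lemma level_eq: "uhf_level \<beta> n = phi n ` carrier_mat (d n) (d n)" by (simp add: uhf_level_def)

lemma phi_mat:
  assumes a: "a \<in> carrier_mat (d n) (d n)" and b: "b \<in> carrier_mat (d n) (d n)"
  shows "phi n (a + b) = phi n a \<oplus>\<^bsub>R\<^esub> phi n b" "phi n (a * b) = phi n a \<otimes>\<^bsub>R\<^esub> phi n b"
    "phi n (z \<cdot>\<^sub>m a) = z \<odot>\<^bsub>R\<^esub> phi n a" "phi n (mat_adjoint a) = star R (phi n a)"
    "phi n (a - b) = phi n a \<ominus>\<^bsub>R\<^esub> phi n b"
  using phi_hom[of a n b] a b by (simp_all add: M_minus)

lemma phi_op_norm: "a \<in> carrier_mat (d n) (d n) \<Longrightarrow> nrm R (phi n a) = mat_op_norm a"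
  using phi_nrm[of a n] by simp

text \<open>By linearity it is enough to test with matrix units, and
  \<open>mat_tr_mat_unit_mult\<close> picks out one coefficient of \<open>Ex n X\<close> divided by
  \<open>d n\<close>. The factor \<open>of_nat (d n)\<close> in its definition is there to cancel
  this.\<close>

lemma Ex_orth:
  assumes X: "X \<in> carrier R" and w: "w \<in> carrier_mat (d n) (d n)"
  shows "tr (phi n w \<otimes>\<^bsub>R\<^esub> (X \<ominus>\<^bsub>R\<^esub> Ex n X)) = 0"
proof -
  define y where "y = mat (d n) (d n) (\<lambda>(i, j). of_nat (d n) * tr (star R (phi n (mat_unit (d n) i j)) \<otimes>\<^bsub>R\<^esub> X))"
  have y: "y \<in> carrier_mat (d n) (d n)" by (simp add: y_def)
  have E: "Ex n X = phi n y" by (simp add: Ex_def y_def)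
  let ?Z = "X \<ominus>\<^bsub>R\<^esub> phi n y"
  have Z [simp]: "?Z \<in> carrier R" using X y by simp
  have "tr (phi n w \<otimes>\<^bsub>R\<^esub> ?Z) = (\<Sum>i<d n. \<Sum>j<d n. w $$ (i, j) * tr (phi n (mat_unit (d n) i j) \<otimes>\<^bsub>R\<^esub> ?Z))"
    by (rule mat_functional_expand[OF _ _ w])
      (simp_all add: phi_mat R.mult_add_left R.smult_mult_left tr_add tr_smult)
  also have "\<dots> = (\<Sum>i<d n. \<Sum>j<d n. 0)"
  proof (intro sum.cong refl)
    fix i j assume "i \<in> {..<d n}" "j \<in> {..<d n}"
    then have ij: "i < d n" "j < d n" by auto
    have "tr (phi n (mat_unit (d n) i j) \<otimes>\<^bsub>R\<^esub> ?Z) = tr (phi n (mat_unit (d n) i j) \<otimes>\<^bsub>R\<^esub> X) - tr (phi n (mat_unit (d n) i j) \<otimes>\<^bsub>R\<^esub> phi n y)"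
      using X y by (simp add: R.mult_diff_right[symmetric] R.state_minus[OF tr_state])
    also have "tr (phi n (mat_unit (d n) i j) \<otimes>\<^bsub>R\<^esub> phi n y) = y $$ (j, i) / of_nat (d n)"
      using y ij tr_phi[OF mult_carrier_mat[OF mat_unit_carrier y]] by (simp add: phi_mat[symmetric] mat_tr_mat_unit_mult)
    \<comment> \<open>The transposed index is undone by the star, as the adjoint of
      \<open>e_ji\<close> is \<open>e_ij\<close>; the two terms of the difference therefore
      agree.\<close>
    also have "y $$ (j, i) / of_nat (d n) = tr (star R (phi n (mat_unit (d n) j i)) \<otimes>\<^bsub>R\<^esub> X)"
      using ij d_pos[of n] by (simp add: y_def del: d_pos)
    also have "star R (phi n (mat_unit (d n) j i)) = phi n (mat_unit (d n) i j)"
      using phi_mat(4)[OF mat_unit_carrier mat_unit_carrier, of n j i] by (simp add: mat_unit_adjoint)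
    finally show "w $$ (i, j) * tr (phi n (mat_unit (d n) i j) \<otimes>\<^bsub>R\<^esub> ?Z) = 0" by simp
  qed
  finally show ?thesis by (simp add: E)
qed

lemma trace_norm_phi:
  assumes a: "a \<in> carrier_mat (d n) (d n)" shows "trace_norm R tr (phi n a) = sqrt (frob_sq (d n) a / real (d n))"
  using phi_mat(2)[OF adjoint_carrier[OF a] a] phi_mat(4)[OF a a] tr_phi[OF mult_carrier_mat[OF adjoint_carrier[OF a] a]]
  by (simp add: trace_norm_def mat_tr_adjoint_mult[OF a])

text \<open>The constant \<open>sqrt d\<close> appears because the operator norm is at most the
  Hilbert-Schmidt norm, which is \<open>sqrt d\<close> times the normalised trace norm.\<close>

sublocale C: ci_system R tr "uhf_level \<beta>" Ex "\<lambda>n. sqrt (real (d n))" "uhf_gamma \<beta>"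
proof
  fix n :: nat
  show "tr \<in> states R" by (rule tr_state)
  show "tr (a \<otimes>\<^bsub>R\<^esub> b) = tr (b \<otimes>\<^bsub>R\<^esub> a)" if "a \<in> carrier R" "b \<in> carrier R" for a b
    by (rule tr_comm[OF that])
  show "uhf_level \<beta> n \<subseteq> carrier R" by (auto simp: level_eq)
  show "uhf_level \<beta> 0 = {z \<odot>\<^bsub>R\<^esub> \<one>\<^bsub>R\<^esub> |z. True}"
  proof -
    have one: "phi 0 (1\<^sub>m 1) = \<one>\<^bsub>R\<^esub>" using phi_one[of 0] by (simp add: uhf_dim_0)
    have "a = a $$ (0, 0) \<cdot>\<^sub>m 1\<^sub>m 1" if "a \<in> carrier_mat 1 1" for a :: "complex mat"
      using that by (intro eq_matI) auto
    then have sc: "phi 0 a = a $$ (0, 0) \<odot>\<^bsub>R\<^esub> \<one>\<^bsub>R\<^esub>" if "a \<in> carrier_mat 1 1" for a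
      using phi_mat(3)[of "1\<^sub>m 1" 0 "1\<^sub>m 1" "a $$ (0, 0)"] that one by (simp add: uhf_dim_0)
    have cs: "z \<odot>\<^bsub>R\<^esub> \<one>\<^bsub>R\<^esub> = phi 0 (z \<cdot>\<^sub>m 1\<^sub>m 1)" for z
      using phi_mat(3)[of "1\<^sub>m 1" 0 "1\<^sub>m 1" z] one by (simp add: uhf_dim_0)
    show ?thesis unfolding level_eq uhf_dim_0
    proof (intro equalityI subsetI)
      fix X assume "X \<in> phi 0 ` carrier_mat 1 1"
      then show "X \<in> {z \<odot>\<^bsub>R\<^esub> \<one>\<^bsub>R\<^esub> |z. True}" using sc by blast
    next
      fix X assume "X \<in> {z \<odot>\<^bsub>R\<^esub> \<one>\<^bsub>R\<^esub> |z. True}"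
      then obtain z where "X = phi 0 (z \<cdot>\<^sub>m 1\<^sub>m 1)" using cs by blast
      then show "X \<in> phi 0 ` carrier_mat 1 1" by simp
    qed
  qed
  show "uhf_level \<beta> n \<subseteq> uhf_level \<beta> (Suc n)"
  proof
    fix X assume "X \<in> uhf_level \<beta> n"
    then obtain a where a: "a \<in> carrier_mat (d n) (d n)" "X = phi n a" by (auto simp: level_eq)
    show "X \<in> uhf_level \<beta> (Suc n)"
      using phi_con[of a n 1] con_mat[OF a(1), of 1] a by (auto simp: level_eq)
  qed
  show "a \<oplus>\<^bsub>R\<^esub> b \<in> uhf_level \<beta> n" "a \<otimes>\<^bsub>R\<^esub> b \<in> uhf_level \<beta> n"
    if "a \<in> uhf_level \<beta> n" "b \<in> uhf_level \<beta> n" for a b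
    using that by (auto simp: level_eq phi_mat[symmetric])
  show "z \<odot>\<^bsub>R\<^esub> a \<in> uhf_level \<beta> n" "star R a \<in> uhf_level \<beta> n" if "a \<in> uhf_level \<beta> n" for a z
    using that by (auto simp: level_eq phi_mat(3,4)[symmetric])
  show "\<exists>n. \<exists>b\<in>uhf_level \<beta> n. nrm R (a \<ominus>\<^bsub>R\<^esub> b) < e" if "a \<in> carrier R" "e > 0" for a e
    using phi_dense[OF that] by (auto simp: level_eq)
  show "Ex n a \<in> uhf_level \<beta> n" for a by (simp add: level_eq Ex_def)
  show "tr (star R v \<otimes>\<^bsub>R\<^esub> (a \<ominus>\<^bsub>R\<^esub> Ex n a)) = 0" if "a \<in> carrier R" "v \<in> uhf_level \<beta> n" for a v
    using that Ex_orth[OF that(1) adjoint_carrier] by (auto simp: level_eq phi_mat(4)[symmetric])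
  show "nrm R a \<le> sqrt (real (d n)) * trace_norm R tr a" if a: "a \<in> uhf_level \<beta> n" for a
  proof -
    obtain x where x: "x \<in> carrier_mat (d n) (d n)" "a = phi n x" using a by (auto simp: level_eq)
    have "sqrt (real (d n)) * sqrt (frob_sq (d n) x / real (d n)) = sqrt (frob_sq (d n) x)"
      unfolding real_sqrt_mult[symmetric] using d_pos[of n] by (simp del: d_pos)
    then show ?thesis using op_norm_le_frob_sq[OF x(1)] x by (simp add: phi_op_norm trace_norm_phi)
  qed
  show "nrm R a \<le> r" if a: "a \<in> uhf_level \<beta> n" and r: "0 \<le> r"
    and le: "\<And>v. v \<in> uhf_level \<beta> n \<Longrightarrow> trace_norm R tr (a \<otimes>\<^bsub>R\<^esub> v) \<le> r * trace_norm R tr v" for a r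
  proof -
    obtain x where x: "x \<in> carrier_mat (d n) (d n)" "a = phi n x" using a by (auto simp: level_eq)
    have "mat_op_norm x \<le> r"
    proof (rule op_norm_leI_frob_sq[OF x(1) _ r])
      fix v :: "complex mat" assume v: "v \<in> carrier_mat (d n) (d n)"
      have "sqrt (frob_sq (d n) (x * v) / real (d n)) \<le> r * sqrt (frob_sq (d n) v / real (d n))"
        using le[of "phi n v"] v x trace_norm_phi[OF mult_carrier_mat[OF x(1) v]]
        by (simp add: level_eq phi_mat trace_norm_phi)
      then show "sqrt (frob_sq (d n) (x * v)) \<le> r * sqrt (frob_sq (d n) v)"
        using d_pos[of n] by (simp add: real_sqrt_divide divide_le_cancel del: d_pos)
    qed simp
    then show ?thesis using x by (simp add: phi_op_norm)
  qed
  show "\<exists>S. finite S \<and> S \<subseteq> uhf_level \<beta> n \<and> (\<forall>a\<in>uhf_level \<beta> n. nrm R a \<le> r \<longrightarrow> (\<exists>s\<in>S. nrm R (a \<ominus>\<^bsub>R\<^esub> s) < e))"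
    if "e > 0" for e r
  proof -
    from op_norm_ball_net[OF that, of "d n" r] obtain S where S: "finite S" "S \<subseteq> carrier_mat (d n) (d n)"
      and net: "\<And>a. a \<in> carrier_mat (d n) (d n) \<Longrightarrow> mat_op_norm a \<le> r \<Longrightarrow> \<exists>s\<in>S. mat_op_norm (a - s) < e" by blast
    have "\<exists>s\<in>phi n ` S. nrm R (a \<ominus>\<^bsub>R\<^esub> s) < e" if a: "a \<in> uhf_level \<beta> n" "nrm R a \<le> r" for a
    proof -
      obtain x where x: "x \<in> carrier_mat (d n) (d n)" "a = phi n x" using a by (auto simp: level_eq)
      with a net[of x] obtain s where s: "s \<in> S" "mat_op_norm (x - s) < e" by (auto simp: phi_op_norm)
      then have sc: "s \<in> carrier_mat (d n) (d n)" using S by blast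
      have "nrm R (phi n x \<ominus>\<^bsub>R\<^esub> phi n s) < e"
        using s(2) phi_op_norm[OF minus_carrier_mat[OF sc, of x]] by (simp add: phi_mat(5)[OF x(1) sc])
      then show ?thesis using s(1) x(2) by blast
    qed
    moreover have "finite (phi n ` S)" "phi n ` S \<subseteq> uhf_level \<beta> n" using S by (auto simp: level_eq)
    ultimately show ?thesis by blast
  qed
  show "uhf_gamma \<beta> n > 0" by (simp add: uhf_gamma_def)
  show "summable (uhf_gamma \<beta>)"
    by (rule summable_comparison_test'[OF summable_geometric[of "1 / 4 :: real"], of 0])
      (use uhf_gamma_le[OF beta] in \<open>simp_all add: uhf_gamma_def\<close>)
qed

section \<open>Identification of the trace, the constants and the seminorm\<close>

lemma tr_faithful: "faithful_tracial_state R tr"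
proof -
  have "X = \<zero>\<^bsub>R\<^esub>" if "X \<in> carrier R" "tr (star R X \<otimes>\<^bsub>R\<^esub> X) = 0" for X
    by (rule C.tn_eq_0[OF that(1)]) (simp add: trace_norm_def that(2))
  then show ?thesis by (auto simp: faithful_tracial_state_def tr_state intro: tr_comm)
qed

text \<open>On each level traciality leaves only the normalised matrix trace; since states are
  bounded by the norm and the levels are dense, the two functionals agree everywhere. This justifies
  the definite description in \<open>uhf_trace\<close>.\<close>

lemma tr_unique:
  assumes f: "faithful_tracial_state R f" shows "f = tr"
proof (rule extensionalityI[of _ "carrier R"])
  have fs: "f \<in> states R" and fc: "\<And>X Y. X \<in> carrier R \<Longrightarrow> Y \<in> carrier R \<Longrightarrow> f (X \<otimes>\<^bsub>R\<^esub> Y) = f (Y \<otimes>\<^bsub>R\<^esub> X)"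
    using f by (auto simp: faithful_tracial_state_def)
  show "f \<in> extensional (carrier R)" "tr \<in> extensional (carrier R)" using fs tr_state by (auto simp: states_def)
  have eq: "f (phi n a) = tr (phi n a)" if a: "a \<in> carrier_mat (d n) (d n)" for n a
  proof -
    have "f (phi n a) = mat_tr (d n) a"
    proof (rule mat_tr_unique[OF d_pos _ _ _ _ a])
      show "f (phi n (1\<^sub>m (d n))) = 1" using phi_one[of n] R.state_one[OF fs] by simp
      show "f (phi n (a * b)) = f (phi n (b * a))"
        if "a \<in> carrier_mat (d n) (d n)" "b \<in> carrier_mat (d n) (d n)" for a b
        using that by (simp add: phi_mat fc[of "phi n a"])
    qed (simp_all add: phi_mat R.state_add[OF fs] R.state_smult[OF fs])
    then show ?thesis using tr_phi[OF a] by simp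
  qed
  fix X assume X: "X \<in> carrier R"
  have "cmod (f X - tr X) \<le> 0 + e" if "e > 0" for e
  proof -
    have "e / 2 > 0" using that by simp
    from phi_dense[OF X this] obtain n a where a: "a \<in> carrier_mat (d n) (d n)"
      and le: "nrm R (X \<ominus>\<^bsub>R\<^esub> phi n a) < e / 2" by auto
    have D: "X \<ominus>\<^bsub>R\<^esub> phi n a \<in> carrier R" using X a by simp
    have eqD: "f X - tr X = f (X \<ominus>\<^bsub>R\<^esub> phi n a) - tr (X \<ominus>\<^bsub>R\<^esub> phi n a)"
      using X a eq[OF a] by (simp add: R.state_minus[OF fs] R.state_minus[OF tr_state])
    show ?thesis unfolding eqD
      using norm_triangle_ineq4[of "f (X \<ominus>\<^bsub>R\<^esub> phi n a)" "tr (X \<ominus>\<^bsub>R\<^esub> phi n a)"]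
        R.state_bound[OF fs D] R.state_bound[OF tr_state D] le by linarith
  qed
  then have "cmod (f X - tr X) \<le> 0" by (rule field_le_epsilon)
  then show "f X = tr X" by simp
qed

lemma uhf_trace_eq: "uhf_trace \<beta> = tr"
  unfolding uhf_trace_def uhf_def using tr_faithful tr_unique by (rule the_equality)

text \<open>The matrix unit \<open>e_00\<close> shows optimality: its operator norm is at least 1
  while its trace norm is \<open>1 / sqrt d\<close>.\<close>

lemma ci_const_eq: "ci_const R (uhf_level \<beta>) tr n = sqrt (real (d n))"
  unfolding ci_const_def
proof (rule Least_equality)
  show "\<forall>a\<in>uhf_level \<beta> n. nrm R a \<le> sqrt (real (d n)) * trace_norm R tr a"
    using C.nrm_le_trace_norm by blast
  fix r assume r: "\<forall>a\<in>uhf_level \<beta> n. nrm R a \<le> r * trace_norm R tr a"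
  let ?e = "mat_unit (d n) 0 0"
  have "1 \<le> mat_op_norm ?e"
    using entry_le_op_norm[OF mat_unit_carrier, of 0 "d n" 0 0 0] by (simp add: mat_unit_index)
  also have "\<dots> \<le> r * sqrt (1 / real (d n))"
    using bspec[OF r, of "phi n ?e"] by (simp add: level_eq phi_op_norm trace_norm_phi frob_sq_mat_unit)
  finally show "sqrt (real (d n)) \<le> r" using d_pos[of n] by (simp add: real_sqrt_divide field_simps del: d_pos)
qed

lemma uhf_seminorm_eq: "X \<in> carrier R \<Longrightarrow> uhf_seminorm \<beta> X = C.comm_norm X"
  unfolding uhf_seminorm_def uhf_trace_eq uhf_def by (rule C.ci_seminorm_eq_comm_norm[OF ci_const_eq])

lemma leibniz_cqms_uhf: "leibniz_cqms (uhf \<beta>) (uhf_seminorm \<beta>)"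
  unfolding uhf_def by (rule C.leibniz_cqms_comm_norm) (rule uhf_seminorm_eq)

end

section \<open>Continuity\<close>

text \<open>Matrix forms, at level \<open>N\<close>, of the projections \<open>E\<^sub>n\<close>, of \<open>P\<^sub>n D P\<^sub>n\<close> and of the commutator form
  for \<open>n \<le> N\<close>: they involve only the entries \<open>\<beta> j\<close> with \<open>j < N\<close>.\<close>

definition level_proj :: "(nat \<Rightarrow> nat) \<Rightarrow> nat \<Rightarrow> nat \<Rightarrow> complex mat \<Rightarrow> complex mat" where
  "level_proj \<beta> N n x = connecting (uhf_mu \<beta>) n (N - n) (mat (uhf_dim \<beta> n) (uhf_dim \<beta> n) (\<lambda>(i, j). of_nat (uhf_dim \<beta> n) *
     mat_tr (uhf_dim \<beta> N) (mat_adjoint (connecting (uhf_mu \<beta>) n (N - n) (mat_unit (uhf_dim \<beta> n) i j)) * x)))"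

primrec level_dirac :: "(nat \<Rightarrow> nat) \<Rightarrow> nat \<Rightarrow> nat \<Rightarrow> complex mat \<Rightarrow> complex mat" where
  "level_dirac \<beta> N 0 x = 0\<^sub>m (uhf_dim \<beta> N) (uhf_dim \<beta> N)"
| "level_dirac \<beta> N (Suc n) x = level_dirac \<beta> N n x +
    of_real (sqrt (real (uhf_dim \<beta> (Suc n))) / uhf_gamma \<beta> (Suc n)) \<cdot>\<^sub>m (level_proj \<beta> N (Suc n) x - level_proj \<beta> N n x)"

definition level_form :: "(nat \<Rightarrow> nat) \<Rightarrow> nat \<Rightarrow> complex mat \<Rightarrow> complex mat \<Rightarrow> complex mat \<Rightarrow> complex" where
  "level_form \<beta> N a x y = mat_tr (uhf_dim \<beta> N) (mat_adjoint (level_dirac \<beta> N N y) * (a * x))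
    - mat_tr (uhf_dim \<beta> N) (mat_adjoint y * (a * level_dirac \<beta> N N x))"

section \<open>Dependence on the first N entries only\<close>

context
  fixes \<beta> \<beta>' :: "nat \<Rightarrow> nat" and N :: nat
  assumes agree: "\<And>j. j < N \<Longrightarrow> \<beta> j = \<beta>' j"
begin

lemma uhf_dim_cong: "n \<le> N \<Longrightarrow> uhf_dim \<beta> n = uhf_dim \<beta>' n"
  unfolding uhf_dim_def by (rule prod.cong) (simp_all add: agree)

text \<open>The composition from level n to level \<open>n + k\<close> uses the entries with index
  from n to \<open>n + k - 1\<close>, all below N.\<close>

lemma connecting_cong: "n + k \<le> N \<Longrightarrow> connecting (uhf_mu \<beta>) n k a = connecting (uhf_mu \<beta>') n k a"
proof (induction k)
  case (Suc k)
  then have "uhf_mu \<beta> (n + k) = uhf_mu \<beta>' (n + k)" by (intro ext) (simp add: uhf_mu_def agree del: replicate.simps)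
  then show ?case using Suc by (simp only: connecting.simps)
qed simp

lemma level_proj_cong: "n \<le> N \<Longrightarrow> level_proj \<beta> N n x = level_proj \<beta>' N n x"
  unfolding level_proj_def by (simp only: uhf_dim_cong uhf_dim_cong[OF order_refl] connecting_cong le_add_diff_inverse order_refl)

lemma level_dirac_cong: "n \<le> N \<Longrightarrow> level_dirac \<beta> N n x = level_dirac \<beta>' N n x"
  by (induction n) (simp_all add: level_proj_cong uhf_dim_cong uhf_gamma_def)

lemma level_form_cong: "level_form \<beta> N a x y = level_form \<beta>' N a x y"
  unfolding level_form_def by (simp only: level_dirac_cong[OF order_refl] uhf_dim_cong[OF order_refl])

end

context uhf_system
begin

lemma phi_con_diff: "a \<in> carrier_mat (d n) (d n) \<Longrightarrow> n \<le> N \<Longrightarrow> phi N (con n (N - n) a) = phi n a"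
  using phi_con[of a n "N - n"] by simp

lemma con_diff: "a \<in> carrier_mat (d n) (d n) \<Longrightarrow> n \<le> N \<Longrightarrow> con n (N - n) a \<in> carrier_mat (d N) (d N)"
  using con_mat[of a n "N - n"] by simp

lemma level_proj_carrier [simp]: "n \<le> N \<Longrightarrow> level_proj \<beta> N n x \<in> carrier_mat (d N) (d N)"
  unfolding level_proj_def by (rule con_diff) auto

lemma Ex_phi:
  assumes n: "n \<le> N" and x: "x \<in> carrier_mat (d N) (d N)"
  shows "Ex n (phi N x) = phi N (level_proj \<beta> N n x)"
proof -
  have "tr (star R (phi n (mat_unit (d n) i j)) \<otimes>\<^bsub>R\<^esub> phi N x) =
      mat_tr (d N) (mat_adjoint (con n (N - n) (mat_unit (d n) i j)) * x)" for i j
  proof -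
    have c: "con n (N - n) (mat_unit (d n) i j) \<in> carrier_mat (d N) (d N)" by (rule con_diff[OF mat_unit_carrier n])
    show ?thesis using tr_phi[OF mult_carrier_mat[OF adjoint_carrier[OF c] x]] x c
      by (simp add: phi_con_diff[OF mat_unit_carrier n, symmetric] phi_mat)
  qed
  then show ?thesis unfolding Ex_def level_proj_def by (subst phi_con_diff[OF _ n]) auto
qed

lemma level_dirac_carrier [simp]: "n \<le> N \<Longrightarrow> level_dirac \<beta> N n x \<in> carrier_mat (d N) (d N)"
  by (induction n) (simp_all add: add_carrier_mat minus_carrier_mat)

lemma T_phi: "n \<le> N \<Longrightarrow> x \<in> carrier_mat (d N) (d N) \<Longrightarrow> C.T n (phi N x) = phi N (level_dirac \<beta> N n x)"
proof (induction n)
  case 0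
  have "phi N (0 \<cdot>\<^sub>m 0\<^sub>m (d N) (d N)) = 0 \<odot>\<^bsub>R\<^esub> phi N (0\<^sub>m (d N) (d N))" by (rule phi_mat(3)) auto
  then show ?case by simp
next
  case (Suc n)
  note c = level_proj_carrier[OF Suc.prems(1), of x] level_proj_carrier[of n N x] level_dirac_carrier[of n N x]
  show ?case using Suc c
    by (simp add: Ex_phi phi_mat(1)[OF _ smult_carrier_mat[OF minus_carrier_mat]] phi_mat(5)
        phi_mat(3)[OF minus_carrier_mat minus_carrier_mat] C.\<alpha>_def)
qed

lemma ip_phi:
  assumes x: "x \<in> carrier_mat (d N) (d N)" and y: "y \<in> carrier_mat (d N) (d N)"
  shows "C.ip (phi N x) (phi N y) = mat_tr (d N) (mat_adjoint y * x)"
  using tr_phi[OF mult_carrier_mat[OF adjoint_carrier[OF y] x]] x y by (simp add: C.ip_def phi_mat)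

lemma comm_form_phi:
  assumes a: "a \<in> carrier_mat (d N) (d N)" and x: "x \<in> carrier_mat (d N) (d N)" and y: "y \<in> carrier_mat (d N) (d N)"
  shows "C.comm_form (phi N a) N (phi N x) (phi N y) = level_form \<beta> N a x y"
  using assms by (simp add: C.comm_form_def level_form_def T_phi ip_phi phi_mat(2)[symmetric])

text \<open>The right-hand side mentions only matrices of size \<open>d N\<close> and the form
  \<open>level_form\<close>, both unchanged if the sequence is altered from index N on. Upper bounds
  determine the seminorm, so it can be compared across two different UHF algebras.\<close>

lemma seminorm_phi_le_iff:
  assumes a: "a \<in> carrier_mat (d N) (d N)" and r: "0 \<le> r"
  shows "uhf_seminorm \<beta> (phi N a) \<le> ennreal r \<longleftrightarrow>
    (\<forall>x\<in>carrier_mat (d N) (d N). \<forall>y\<in>carrier_mat (d N) (d N).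
      cmod (level_form \<beta> N a x y) \<le> r * sqrt (frob_sq (d N) x / real (d N)) * sqrt (frob_sq (d N) y / real (d N)))"
proof (intro iffI ballI)
  fix x y :: "complex mat" assume le: "uhf_seminorm \<beta> (phi N a) \<le> ennreal r"
    and x: "x \<in> carrier_mat (d N) (d N)" and y: "y \<in> carrier_mat (d N) (d N)"
  have "phi N x \<in> uhf_level \<beta> N" "phi N y \<in> uhf_level \<beta> N" using x y by (auto simp: level_eq)
  with C.comm_norm_leD[of "phi N a" r "phi N x" N "phi N y"] le r a
  show "cmod (level_form \<beta> N a x y) \<le> r * sqrt (frob_sq (d N) x / real (d N)) * sqrt (frob_sq (d N) y / real (d N))"
    by (simp add: uhf_seminorm_eq comm_form_phi[OF a x y] trace_norm_phi x y)
next
  assume le: "\<forall>x\<in>carrier_mat (d N) (d N). \<forall>y\<in>carrier_mat (d N) (d N).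
      cmod (level_form \<beta> N a x y) \<le> r * sqrt (frob_sq (d N) x / real (d N)) * sqrt (frob_sq (d N) y / real (d N))"
  have "C.comm_norm (phi N a) \<le> ennreal r"
  proof (rule C.comm_norm_leI_local[OF _ r])
    show "phi N a \<in> uhf_level \<beta> N" using a by (auto simp: level_eq)
    fix h k assume "h \<in> uhf_level \<beta> N" "k \<in> uhf_level \<beta> N"
    then obtain x y where x: "x \<in> carrier_mat (d N) (d N)" "h = phi N x"
      and y: "y \<in> carrier_mat (d N) (d N)" "k = phi N y" by (auto simp: level_eq)
    show "cmod (C.comm_form (phi N a) N h k) \<le> r * trace_norm R tr h * trace_norm R tr k"
      using le x(1) y(1) unfolding x(2) y(2) comm_form_phi[OF a x(1) y(1)] trace_norm_phi[OF x(1)] trace_norm_phi[OF y(1)]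
      by blast
  qed
  then show "uhf_seminorm \<beta> (phi N a) \<le> ennreal r" using a by (simp add: uhf_seminorm_eq)
qed

text \<open>The geometric series from exponent \<open>N + 1\<close> sums to \<open>4^-N / 3\<close>,
  which is rounded up.\<close>

lemma tail_le: "C.tail N \<le> (1 / 4) ^ N"
proof -
  have s: "summable (\<lambda>i. (1 / 4 :: real) ^ (Suc N + i))"
    unfolding power_add by (intro summable_mult summable_geometric) simp
  have g: "summable (\<lambda>i. uhf_gamma \<beta> (Suc N + i))"
    using summable_ignore_initial_segment[OF C.gamma_summable, of "Suc N"] by (simp add: add.commute)
  have "C.tail N \<le> (\<Sum>i. (1 / 4) ^ (Suc N + i))"
    unfolding C.tail_def by (rule suminf_le[OF uhf_gamma_le[OF beta] g s])
  also have "\<dots> = (1 / 4) ^ Suc N * (\<Sum>i. (1 / 4) ^ i)"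
    unfolding power_add by (rule suminf_mult) (rule summable_geometric, simp)
  also have "\<dots> \<le> (1 / 4) ^ N" by (simp add: suminf_geometric)
  finally show ?thesis .
qed

lemma ex_bridge:
  assumes B: "unital_cstar_algebra B" and mono: "unital_star_mono B (uhf \<beta>) \<iota>"
    and img: "\<iota> ` carrier B = uhf_level \<beta> N"
    and iso: "\<And>b. b \<in> carrier B \<Longrightarrow> nrm (uhf \<beta>) (\<iota> b) = nrm B b"
    and LB: "\<And>b. b \<in> carrier B \<Longrightarrow> LB b = uhf_seminorm \<beta> (\<iota> b)"
  shows "\<exists>g. is_bridge B (uhf \<beta>) g \<and> bridge_length (B, LB) (uhf \<beta>, uhf_seminorm \<beta>) g \<le> ennreal ((1 / 4) ^ N)" (is ?th1)
    and "\<exists>g. is_bridge (uhf \<beta>) B g \<and> bridge_length (uhf \<beta>, uhf_seminorm \<beta>) (B, LB) g \<le> ennreal ((1 / 4) ^ N)" (is ?th2)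
proof -
  have "\<iota> b \<in> uhf_level \<beta> N" if "b \<in> carrier B" for b using img that by blast
  then have comm_norm: "LB b = C.comm_norm (\<iota> b)" if "b \<in> carrier B" for b
    unfolding LB[OF that] using \<open>\<And>b. b \<in> carrier B \<Longrightarrow> \<iota> b \<in> uhf_level \<beta> N\<close>[OF that]
    by (intro uhf_seminorm_eq) (rule C.FC)
  note hyps = B mono[unfolded uhf_def] img iso[unfolded uhf_def] uhf_seminorm_eq comm_norm
  have tl: "ennreal (C.tail N) \<le> ennreal ((1 / 4) ^ N)" by (rule ennreal_leI[OF tail_le])
  show ?th1 unfolding uhf_def
    using C.is_bridge_in_out(1)[OF hyps] order_trans[OF C.bridge_length_in[OF hyps] tl] by blast
  show ?th2 unfolding uhf_def
    using C.is_bridge_in_out(2)[OF hyps] order_trans[OF C.bridge_length_out[OF hyps] tl] by blast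
qed

lemma propinquity_class_uhf: "propinquity_class (uhf \<beta>) (uhf_seminorm \<beta>)"
  unfolding uhf_def by (rule C.propinquity_class_comm_norm) (rule uhf_seminorm_eq)

abbreviation level_alg where "level_alg N \<equiv> R.subalg (uhf_level \<beta> N)"

lemma propinquity_class_level: "propinquity_class (level_alg N) (uhf_seminorm \<beta>)"
  by (rule C.propinquity_class_F) (simp add: uhf_seminorm_eq)

lemma ex_bridge_level:
  "\<exists>g. is_bridge (level_alg N) (uhf \<beta>) g \<and>
    bridge_length (level_alg N, uhf_seminorm \<beta>) (uhf \<beta>, uhf_seminorm \<beta>) g \<le> ennreal ((1 / 4) ^ N)"
proof (rule ex_bridge(1))
  show "unital_cstar_algebra (level_alg N)" by (rule C.subalg_F_cstar)
  show "unital_star_mono (level_alg N) (uhf \<beta>) (\<lambda>a. a)"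
    by (auto simp: unital_star_mono_def Ring.ring_hom_def uhf_def)
qed (auto simp: uhf_def)

lemma phi_inj:
  assumes "a \<in> carrier_mat (d n) (d n)" "b \<in> carrier_mat (d n) (d n)" "phi n a = phi n b" shows "a = b"
proof -
  interpret M: unital_cstar_algebra "M (d n)" by (rule M_cstar)
  have "mat_op_norm (a - b) = nrm R (phi n a \<ominus>\<^bsub>R\<^esub> phi n b)"
    using phi_op_norm[OF minus_carrier_mat[OF assms(2), of a]] by (simp add: phi_mat(5)[OF assms(1,2)])
  also have "\<dots> = 0" using assms R.nrm_eq_0[of "phi n b \<ominus>\<^bsub>R\<^esub> phi n b"] by (simp add: R.minus_self)
  finally show ?thesis using M.eqI_nrm[of a b] assms by (simp add: M_minus)
qed

end

text \<open>The common level is taken inside the algebra of \<beta>, into which it is included by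
  the identity; a map through matrix coordinates embeds it into the algebra of
  \<open>\<beta>'\<close>. The two bridges contribute \<open>4^-N\<close> each.\<close>

lemma propinquity_uhf_le:
  assumes \<beta>: "\<beta> \<in> baire_space" and \<beta>': "\<beta>' \<in> baire_space" and agree: "\<And>j. j < N \<Longrightarrow> \<beta> j = \<beta>' j"
  shows "propinquity (uhf \<beta>', uhf_seminorm \<beta>') (uhf \<beta>, uhf_seminorm \<beta>) \<le> ennreal (2 * (1 / 4) ^ N)"
proof -
  interpret U: uhf_system \<beta> by standard (rule \<beta>)
  interpret V: uhf_system \<beta>' by standard (rule \<beta>')
  let ?S = "U.level_alg N" and ?C = "carrier_mat (U.d N) (U.d N)"
  have d: "V.d N = U.d N" using uhf_dim_cong[of N \<beta> \<beta>' N] agree by simp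
  have Vc: "V.phi N a \<in> carrier V.R" if "a \<in> ?C" for a using that V.phi_in[of a N] by (simp add: d)
  have S: "carrier ?S = U.phi N ` ?C" using U.level_eq by simp
  \<comment> \<open>Reads off the matrix of X at level N, which has the same size for both
    sequences, and embeds it again on the other side.\<close>
  define \<iota> where "\<iota> X = V.phi N (inv_into ?C (U.phi N) X)" for X
  have inj: "inj_on (U.phi N) ?C" by (rule inj_onI) (rule U.phi_inj)
  have \<iota>: "\<iota> (U.phi N a) = V.phi N a" if "a \<in> ?C" for a
    using inv_into_f_f[OF inj that] by (simp add: \<iota>_def)
  have semi: "uhf_seminorm \<beta> (U.phi N a) = uhf_seminorm \<beta>' (V.phi N a)" if a: "a \<in> ?C" for a
  proof -
    have iff: "uhf_seminorm \<beta> (U.phi N a) \<le> ennreal r \<longleftrightarrow> uhf_seminorm \<beta>' (V.phi N a) \<le> ennreal r" if "0 \<le> r" for r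
      using U.seminorm_phi_le_iff[OF a that] V.seminorm_phi_le_iff[of a N r] that a
      by (simp add: d level_form_cong[of N \<beta> \<beta>', OF agree])
    \<comment> \<open>An extended nonnegative number is determined by its finite upper bounds, so
      the equivalence of bounds gives equality of the seminorms, infinite values included.\<close>
    have *: "x \<le> y" if "\<And>r. 0 \<le> r \<Longrightarrow> y \<le> ennreal r \<Longrightarrow> x \<le> ennreal r" for x y
      using that by (cases y) auto
    show ?thesis by (rule antisym; rule *; simp add: iff)
  qed
  have cstar: "unital_cstar_algebra ?S" by (rule U.C.subalg_F_cstar)
  have hom: "\<iota> \<in> Ring.ring_hom ?S (uhf \<beta>')"
  proof (rule ring_hom_memI)
    fix X assume "X \<in> carrier ?S"
    then obtain a where a: "a \<in> ?C" "X = U.phi N a" unfolding S by blast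
    show "\<iota> X \<in> carrier (uhf \<beta>')" using a Vc by (simp add: \<iota> uhf_def)
    fix Y assume "Y \<in> carrier ?S"
    then obtain b where b: "b \<in> ?C" "Y = U.phi N b" unfolding S by blast
    show "\<iota> (X \<otimes>\<^bsub>?S\<^esub> Y) = \<iota> X \<otimes>\<^bsub>uhf \<beta>'\<^esub> \<iota> Y"
      using a b V.phi_mat(2)[of a N b] by (simp add: \<iota> uhf_def U.phi_mat(2)[OF a(1) b(1), symmetric] d)
    show "\<iota> (X \<oplus>\<^bsub>?S\<^esub> Y) = \<iota> X \<oplus>\<^bsub>uhf \<beta>'\<^esub> \<iota> Y"
      using a b V.phi_mat(1)[of a N b] by (simp add: \<iota> uhf_def U.phi_mat(1)[OF a(1) b(1), symmetric] d)
  next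
    have "\<one>\<^bsub>?S\<^esub> = U.phi N (1\<^sub>m (U.d N))" using U.phi_one[of N] by simp
    then show "\<iota> \<one>\<^bsub>?S\<^esub> = \<one>\<^bsub>uhf \<beta>'\<^esub>" using V.phi_one[of N] by (simp add: \<iota> uhf_def d)
  qed
  have smult_star: "\<iota> (z \<odot>\<^bsub>?S\<^esub> X) = z \<odot>\<^bsub>uhf \<beta>'\<^esub> \<iota> X" "\<iota> (star ?S X) = star (uhf \<beta>') (\<iota> X)"
    if "X \<in> carrier ?S" for X z
  proof -
    from that obtain a where a: "a \<in> ?C" "X = U.phi N a" unfolding S by blast
    show "\<iota> (z \<odot>\<^bsub>?S\<^esub> X) = z \<odot>\<^bsub>uhf \<beta>'\<^esub> \<iota> X"
      using a V.phi_mat(3)[of a N a z] by (simp add: \<iota> uhf_def U.phi_mat(3)[OF a(1) a(1), symmetric] d)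
    show "\<iota> (star ?S X) = star (uhf \<beta>') (\<iota> X)"
      using a V.phi_mat(4)[of a N a] by (simp add: \<iota> uhf_def U.phi_mat(4)[OF a(1) a(1), symmetric] d)
  qed
  have "inj_on \<iota> (carrier ?S)"
    unfolding S
  proof (rule inj_onI, elim imageE)
    fix X Y a b assume ab: "\<iota> X = \<iota> Y" "X = U.phi N a" "a \<in> ?C" "Y = U.phi N b" "b \<in> ?C"
    then have "a = b" using V.phi_inj[of a N b] by (simp add: \<iota> d)
    then show "X = Y" using ab by simp
  qed
  with hom smult_star have mono: "unital_star_mono ?S (uhf \<beta>') \<iota>"
    unfolding unital_star_mono_def by blast
  have img: "\<iota> ` carrier ?S = uhf_level \<beta>' N"
    unfolding S V.level_eq image_image d by (rule image_cong) (simp_all add: \<iota>)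
  have iso: "nrm (uhf \<beta>') (\<iota> X) = nrm ?S X" if X: "X \<in> carrier ?S" for X
  proof -
    from X obtain a where a: "a \<in> ?C" "X = U.phi N a" unfolding S by blast
    then show ?thesis using V.phi_op_norm[of a N] U.phi_op_norm[of a N] by (simp add: \<iota> uhf_def d)
  qed
  have LB: "uhf_seminorm \<beta> X = uhf_seminorm \<beta>' (\<iota> X)" if "X \<in> carrier ?S" for X
    using that semi unfolding S by (auto simp: \<iota>)
  let ?X = "(uhf \<beta>', uhf_seminorm \<beta>')" and ?Y = "(uhf \<beta>, uhf_seminorm \<beta>)" and ?Z = "(?S, uhf_seminorm \<beta>)"
  from V.ex_bridge(2)[OF cstar mono img iso LB] obtain g where
    g: "is_bridge (uhf \<beta>') ?S g" "bridge_length ?X ?Z g \<le> ennreal ((1 / 4) ^ N)" by blast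
  from U.ex_bridge_level obtain h where
    h: "is_bridge ?S (uhf \<beta>) h" "bridge_length ?Z ?Y h \<le> ennreal ((1 / 4) ^ N)" by blast
  define Z where "Z = (\<lambda>i::nat. if i = 0 then ?X else if i = 1 then ?Z else ?Y)"
  define G where "G = (\<lambda>i::nat. if i = 0 then g else h)"
  have "is_trek ?X ?Y 2 Z G"
    using g(1) h(1) U.propinquity_class_uhf V.propinquity_class_uhf U.propinquity_class_level
    by (auto simp: is_trek_def Z_def G_def less_2_cases_iff)
  then have "propinquity ?X ?Y \<le> (\<Sum>i<2. bridge_length (Z i) (Z (Suc i)) (G i))"
    unfolding propinquity_def by (intro Inf_lower) blast
  also have "\<dots> = bridge_length ?X ?Z g + bridge_length ?Z ?Y h"
    by (simp add: numeral_2_eq_2 Z_def G_def)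
  also have "\<dots> \<le> ennreal ((1 / 4) ^ N) + ennreal ((1 / 4) ^ N)" by (rule add_mono[OF g(2) h(2)])
  also have "\<dots> = ennreal (2 * (1 / 4) ^ N)" by (simp add: ennreal_plus[symmetric] del: ennreal_plus)
  finally show ?thesis .
qed

text \<open>Distance below \<open>2^-N\<close> puts the first disagreement strictly after index
  N.\<close>

lemma baire_dist_less_agree:
  assumes lt: "baire_dist x y < 1 / 2 ^ N" and j: "j < N" shows "x j = y j"
proof (cases "x = y")
  case False
  let ?m = "LEAST n. x n \<noteq> y n"
  have "(1 / 2 :: real) ^ ?m < (1 / 2) ^ N" using lt False by (simp add: baire_dist_def power_one_over)
  then have "N < ?m" by (subst (asm) power_strict_decreasing_iff) auto
  then show ?thesis using not_less_Least[of j "\<lambda>n. x n \<noteq> y n"] j by simp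
qed simp

theorem theorem3p3:
  shows "(\<forall>\<beta>\<in>baire_space. leibniz_cqms (uhf \<beta>) (uhf_seminorm \<beta>)) \<and>
    (\<forall>(\<beta>s :: nat \<Rightarrow> nat \<Rightarrow> nat) \<beta>.
       (\<forall>k. \<beta>s k \<in> baire_space) \<longrightarrow> \<beta> \<in> baire_space \<longrightarrow>
       (\<lambda>k. baire_dist (\<beta>s k) \<beta>) \<longlonglongrightarrow> 0 \<longrightarrow>
       (\<lambda>k. propinquity (uhf (\<beta>s k), uhf_seminorm (\<beta>s k)) (uhf \<beta>, uhf_seminorm \<beta>)) \<longlonglongrightarrow> 0)"
proof (intro conjI ballI allI impI)
  show "leibniz_cqms (uhf \<beta>) (uhf_seminorm \<beta>)" if "\<beta> \<in> baire_space" for \<beta>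
    using that by (intro uhf_system.leibniz_cqms_uhf uhf_system.intro)
next
  fix \<beta>s :: "nat \<Rightarrow> nat \<Rightarrow> nat" and \<beta>
  assume \<beta>s: "\<forall>k. \<beta>s k \<in> baire_space" and \<beta>: "\<beta> \<in> baire_space"
    and lim: "(\<lambda>k. baire_dist (\<beta>s k) \<beta>) \<longlonglongrightarrow> 0"
  let ?p = "\<lambda>k. propinquity (uhf (\<beta>s k), uhf_seminorm (\<beta>s k)) (uhf \<beta>, uhf_seminorm \<beta>)"
  show "?p \<longlonglongrightarrow> 0"
  proof (rule order_tendstoI)
    \<comment> \<open>Only upper bounds need work, since no value of \<open>ennreal\<close> lies
      below 0. An N with \<open>2 * 4^-N < e\<close> is fixed first, and convergence in Baire space
      then forces agreement before N.\<close>
    fix e :: ennreal assume e: "0 < e"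
    have "(\<lambda>N. ennreal (2 * (1 / 4) ^ N)) \<longlonglongrightarrow> ennreal (2 * 0)"
      by (intro tendsto_ennrealI tendsto_mult tendsto_const LIMSEQ_realpow_zero) auto
    then have "\<forall>\<^sub>F N in sequentially. ennreal (2 * (1 / 4) ^ N) < e" by (rule order_tendstoD(2)) (simp add: e)
    then obtain N where N: "ennreal (2 * (1 / 4) ^ N) < e" by (auto simp: eventually_sequentially)
    have "\<forall>\<^sub>F k in sequentially. baire_dist (\<beta>s k) \<beta> < 1 / 2 ^ N" by (rule order_tendstoD(2)[OF lim]) simp
    then show "\<forall>\<^sub>F k in sequentially. ?p k < e"
    proof (rule eventually_mono)
      fix k assume "baire_dist (\<beta>s k) \<beta> < 1 / 2 ^ N"
      then have "\<beta> j = \<beta>s k j" if "j < N" for j using baire_dist_less_agree[OF _ that] by metis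
      then have "?p k \<le> ennreal (2 * (1 / 4) ^ N)" using \<beta> \<beta>s by (intro propinquity_uhf_le) auto
      then show "?p k < e" using N by (rule le_less_trans)
    qed
  qed simp
qed

end
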